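(* Let $\Gamma=N+S$. For any positive integer $n$ and all $\tau\in\mathbb H$, $$J_{\Gamma,n}(\tau)=J_{\Gamma,1}|T(n)(\tau).$$
   Context: Groups. $\mathbb H$ is the complex upper half-plane, $\tau\in\mathbb H$, $q=e^{2\pi i\tau}$. For a positive integer $N$, an exact divisor of $N$ is $Q\mid N$ with $\gcd(Q,N/Q)=1$; $W_{Q,N}$ denotes any matrix $\begin{pmatrix}Qx&y\\ Nz&Qw\end{pmatrix}$ with $x,y,z,w\in\mathbb Z$ and determinant $Q$. For a set $S$ of exact divisors of $N$, $\Gamma=N+S$ is the subgroup of $\mathrm{PSL}_2(\mathbb R)$ generated by $\Gamma_0(N)$ and all $W_{Q,N}$, $Q\in S$. Among the sets of exact divisors $>1$ generating the same group, $S$ is taken to be the largest one, so $\Gamma$ is the disjoint union of $\Gamma_0(N)$ and the cosets $\Gamma_0(N)W_{Q,N}$, $Q\in S$. Groups $\Gamma^{(m)}$. For a prime $p$, $\Gamma^{(p)}=N^{(p)}+S^{(p)}$ where $N^{(p)}=N/\gcd(p,N)$ and $S^{(p)}$ is the set of $Q\in S$ dividing $N^{(p)}$. For $m=p_1p_2\cdots p_r$ (primes, repetitions allowed), $\Gamma^{(m)}=\Gamma^{(p_1)(p_2)\cdots(p_r)}$ is obtained by iterating; $\Gamma^{(1)}=\Gamma$. The functions $J_{\Gamma,n}$. Let $\Gamma_\infty=\{\pm\begin{pmatrix}1&t\\0&1\end{pmatrix}:t\in\mathbb Z\}$, $e(x)=e^{2\pi i x}$, and for $n\in\mathbb N$,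 $\mathrm{Re}(s)>1$ put $$G_{\Gamma,-n}(\tau,s)=2\pi\sum_{\gamma\in\Gamma_\infty\backslash\Gamma}f_n(\gamma\tau),\qquad f_n(\tau)=e(-n\,\mathrm{Re}\,\tau)\,(n\,\mathrm{Im}\,\tau)^{1/2}I_{s-\frac12}(2\pi n\,\mathrm{Im}\,\tau),$$ with $I$ the $I$-Bessel function. It continues analytically to $\mathrm{Re}(s)>1/2$; set $j_{\Gamma,n}(\tau)=G_{\Gamma,-n}(\tau,1)$, a $\Gamma$-invariant harmonic function with expansion $j_{\Gamma,n}=q^{-n}-\bar q^n+c_\Gamma(n,0)+\sum_{\ell\ge1}(c_\Gamma(n,\ell)q^\ell+c_\Gamma(n,-\ell)\bar q^\ell)$. Define $J_{\Gamma,n}=j_{\Gamma,n}-c_\Gamma(n,0)$ for $n\ge1$, $J_{\Gamma,0}=1$, and $J_{\Gamma,x}=0$ if $x$ is not an integer. The $m$-plicate is $J_{\Gamma,n}^{(m)}=J_{\Gamma^{(m)},n}$. Operators. $(f|U^*_m)(\tau)=\sum_{i=0}^{m-1}f\left(\frac{\tau+i}{m}\right)$. For a prime $p$ and $r\ge1$, $J_{\Gamma,n}|T(p^r)(\tau)=\sum_{i=0}^{r}\bigl(J^{(p^i)}_{\Gamma,n}|U^*_{p^{r-i}}\bigr)(p^i\tau)$. For $m=p_1^{k_1}\cdots p_r^{k_r}$ with distinct primes $p_i$, $T(m)=T(p_1^{k_1})\circ\cdots\circ T(p_r^{k_r})$ and $T(1)$ is the identity. In a composition, $J_{\Gamma,n}|T(p^k)$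 is written as the finite combination $\sum_{p^j\mid\gcd(n,p^k)}p^jJ^{(p^j)}_{\Gamma,p^kn/p^{2j}}$ of functions $J_{\Gamma',n'}$ (to which it is equal), and the next operator acts on it term by term, linearly; the factors for distinct primes commute. *)

theory Defs
  imports
    "HOL-Complex_Analysis.Complex_Analysis"
    "HOL-Algebra.Generated_Groups"
    "HOL-Computational_Algebra.Computational_Algebra"
    "HOL-Library.Multiset"
begin

section \<open>The groups \<open>N+S\<close>\<close>

definition mat2 :: "real \<Rightarrow> real \<Rightarrow> real \<Rightarrow> real \<Rightarrow> real ^ 2 ^ 2" where
  "mat2 a b c d = vector [vector [a, b], vector [c, d]]"

definition SL2R :: "(real ^ 2 ^ 2) monoid" where
  "SL2R = \<lparr>carrier = {A. det A = 1}, mult = (**), one = mat 1\<rparr>"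

definition moebius :: "real ^ 2 ^ 2 \<Rightarrow> complex \<Rightarrow> complex" where
  "moebius A \<tau> = (of_real (A $ 1 $ 1) * \<tau> + of_real (A $ 1 $ 2)) /
                 (of_real (A $ 2 $ 1) * \<tau> + of_real (A $ 2 $ 2))"

text \<open>A subgroup of \<open>PSL(2,\<real>)\<close> is represented throughout by its full preimage in \<open>SL(2,\<real>)\<close>.
  All groups below contain the negative of the identity, so passing to the preimage changes
  neither the action on the upper half-plane nor the cosets of the stabiliser of infinity.\<close>

definition Gamma0 :: "nat \<Rightarrow> (real ^ 2 ^ 2) set" where
  "Gamma0 N = {mat2 (of_int a) (of_int b) (of_int c) (of_int d) | a b c d :: int.
                 a * d - b * c = 1 \<and> int N dvd c}"

definition exact_divisor :: "nat \<Rightarrow> nat \<Rightarrow> bool" where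
  "exact_divisor Q N \<longleftrightarrow> Q dvd N \<and> coprime Q (N div Q)"

text \<open>The matrices \<open>W\<^bsub>Q,N\<^esub>\<close> have determinant \<open>Q\<close>; dividing by \<open>sqrt Q\<close>
  gives the representative in \<open>SL(2,\<real>)\<close> of the same element of \<open>PSL(2,\<real>)\<close>.\<close>

definition atkin_lehner :: "nat \<Rightarrow> nat \<Rightarrow> (real ^ 2 ^ 2) set" where
  "atkin_lehner Q N =
     {mat2 (of_int (int Q * x) / sqrt Q) (of_int y / sqrt Q)
           (of_int (int N * z) / sqrt Q) (of_int (int Q * w) / sqrt Q) | x y z w :: int.
        (int Q * x) * (int Q * w) - y * (int N * z) = int Q}"

text \<open>The symbol \<open>N+S\<close> is the pair \<open>(N, S)\<close>.\<close>

type_synonym al_symbol = "nat \<times> nat set"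

fun al_group :: "al_symbol \<Rightarrow> (real ^ 2 ^ 2) set" where
  "al_group (N, S) = generate SL2R (Gamma0 N \<union> (\<Union>Q\<in>S. atkin_lehner Q N))"

text \<open>\<open>S\<close> is the largest among the sets of exact divisors \<open>> 1\<close> of \<open>N\<close> that generate
  the same group.\<close>

fun al_admissible :: "al_symbol \<Rightarrow> bool" where
  "al_admissible (N, S) \<longleftrightarrow>
     N > 0 \<and> (\<forall>Q\<in>S. Q > 1 \<and> exact_divisor Q N) \<and>
     (\<forall>S'. (\<forall>Q\<in>S'. Q > 1 \<and> exact_divisor Q N) \<and> al_group (N, S') = al_group (N, S)
            \<longrightarrow> S' \<subseteq> S)"

fun plicate_prime :: "nat \<Rightarrow> al_symbol \<Rightarrow> al_symbol" where
  "plicate_prime p (N, S) = (N div gcd p N, {Q \<in> S. Q dvd N div gcd p N})"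

definition plicate :: "nat \<Rightarrow> al_symbol \<Rightarrow> al_symbol" where
  "plicate m G = fold plicate_prime (sorted_list_of_multiset (prime_factorization m)) G"

section \<open>The Niebur--Poincare series and the functions \<open>J\<close>\<close>

definition bessel_I :: "complex \<Rightarrow> complex \<Rightarrow> complex" where
  "bessel_I \<nu> z =
     (\<Sum>k. rGamma (\<nu> + of_nat k + 1) / fact k * (z / 2) powr (\<nu> + 2 * of_nat k))"

definition unit_exp :: "complex \<Rightarrow> complex" where
  "unit_exp x = exp (2 * of_real pi * \<i> * x)"

definition niebur_seed :: "nat \<Rightarrow> complex \<Rightarrow> complex \<Rightarrow> complex" where
  "niebur_seed n s \<tau> =
     unit_exp (- of_nat n * of_real (Re \<tau>)) * of_real (sqrt (real n * Im \<tau>)) *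
     bessel_I (s - 1 / 2) (of_real (2 * pi * real n * Im \<tau>))"

definition Gamma_inf :: "(real ^ 2 ^ 2) set" where
  "Gamma_inf = {mat2 \<epsilon> (\<epsilon> * of_int t) 0 \<epsilon> | \<epsilon> (t :: int). \<epsilon> = 1 \<or> \<epsilon> = -1}"

text \<open>For an integer \<open>n\<close> the seed has period 1, so the chosen coset representatives
  do not matter.\<close>

definition niebur_series :: "al_symbol \<Rightarrow> nat \<Rightarrow> complex \<Rightarrow> complex \<Rightarrow> complex" where
  "niebur_series G n \<tau> s =
     2 * of_real pi *
     (\<Sum>\<^sub>\<infinity>C \<in> rcosets\<^bsub>SL2R\<lparr>carrier := al_group G\<rparr>\<^esub> Gamma_inf.
        niebur_seed n s (moebius (SOME \<gamma>. \<gamma> \<in> C) \<tau>))"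

text \<open>The value at \<open>s = 1\<close> of the analytic continuation in \<open>s\<close> of the series from
  \<open>Re s > 1\<close> to the left. By the identity theorem the value is the same for every half-plane
  \<open>Re s > \<sigma>\<close> with \<open>\<sigma> < 1\<close> to which the series continues, so \<open>\<sigma>\<close> is not fixed. (For
  \<open>\<sigma> = 1/2\<close> small eigenvalues of the Laplacian could produce poles with \<open>1/2 < s < 1\<close>,
  which do not affect the value at \<open>1\<close>.)\<close>

definition niebur_j :: "al_symbol \<Rightarrow> nat \<Rightarrow> complex \<Rightarrow> complex" where
  "niebur_j G n \<tau> =
     (THE v. \<exists>\<sigma><1. \<exists>F. F holomorphic_on {s. Re s > \<sigma>} \<and>
               (\<forall>s. Re s > 1 \<longrightarrow> F s = niebur_series G n \<tau> s) \<and> v = F 1)"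

text \<open>The expansion of \<open>j\<close> determines all its coefficients: for fixed \<open>Re \<tau>\<close> it is a power
  series in \<open>exp (- 2 * pi * Im \<tau>)\<close>.\<close>

definition niebur_coeff :: "al_symbol \<Rightarrow> nat \<Rightarrow> int \<Rightarrow> complex" where
  "niebur_coeff G n =
     (THE c. \<forall>\<tau>. Im \<tau> > 0 \<longrightarrow>
        (let q = unit_exp \<tau> in
         (\<lambda>l. c (int (Suc l)) * q ^ Suc l + c (- int (Suc l)) * cnj q ^ Suc l) sums
           (niebur_j G n \<tau> - (q powi (- int n) - cnj q ^ n + c 0))))"

definition niebur_J :: "al_symbol \<Rightarrow> nat \<Rightarrow> complex \<Rightarrow> complex" where
  "niebur_J G n \<tau> = (if n = 0 then 1 else niebur_j G n \<tau> - niebur_coeff G n 0)"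

section \<open>The operators\<close>

definition Ustar :: "nat \<Rightarrow> (complex \<Rightarrow> complex) \<Rightarrow> complex \<Rightarrow> complex" where
  "Ustar m f \<tau> = (\<Sum>i<m. f ((\<tau> + of_nat i) / of_nat m))"

definition hecke_prime_power :: "nat \<Rightarrow> nat \<Rightarrow> al_symbol \<Rightarrow> nat \<Rightarrow> complex \<Rightarrow> complex" where
  "hecke_prime_power p r G n \<tau> =
     (\<Sum>i\<le>r. Ustar (p ^ (r - i)) (niebur_J (plicate (p ^ i) G) n) (of_nat (p ^ i) * \<tau>))"

text \<open>\<open>hecke_comp [(p1, k1), \<dots>, (pr, kr)] G n\<close> is the image of \<open>J\<^bsub>G,n\<^esub>\<close> under the
  composition of the \<open>T(pi^ki)\<close>, the first entry acting first. As long as another operator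
  follows, the result of an operator is written as a finite combination of functions
  \<open>J\<^bsub>G',n'\<^esub>\<close>, on which the remaining operators act term by term; the operator acting last
  is given by its definition through \<open>Ustar\<close>. The division below is exact.\<close>

fun hecke_comp :: "(nat \<times> nat) list \<Rightarrow> al_symbol \<Rightarrow> nat \<Rightarrow> complex \<Rightarrow> complex" where
  "hecke_comp [] G n \<tau> = niebur_J G n \<tau>"
| "hecke_comp [(p, k)] G n \<tau> = hecke_prime_power p k G n \<tau>"
| "hecke_comp ((p, k) # x # xs) G n \<tau> =
     (\<Sum>j | p ^ j dvd gcd n (p ^ k).
        of_nat (p ^ j) *
        hecke_comp (x # xs) (plicate (p ^ j) G) (p ^ k * n div p ^ (2 * j)) \<tau>)"

definition hecke_T :: "nat \<Rightarrow> al_symbol \<Rightarrow> nat \<Rightarrow> complex \<Rightarrow> complex" where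
  "hecke_T m =
     hecke_comp (map (\<lambda>p. (p, multiplicity p m)) (sorted_list_of_set (prime_factors m)))"

end

theory Submission
  imports Defs "HOL-Number_Theory.Modular_Inverse" "HOL-Real_Asymp.Real_Asymp"
begin

text \<open>
  Since all operators but the last act on \<open>J\<^bsub>G,m\<^esub>\<close> with \<open>m\<close> prime to \<open>p\<close>, it suffices to show
  \<open>J\<^bsub>G,n p^k\<^esub> = J\<^bsub>G,n\<^esub> | T(p\<^sup>k)\<close> for \<open>p\<close> not dividing \<open>n\<close>. For \<open>Re s > 1\<close> both sides are sums over
  lower rows \<open>(C, D)\<close> of Atkin-Lehner matrices. On the right, the terms with given \<open>(C, D)\<close> differ only
  by the phases \<open>e(-n A / C)\<close>, where \<open>A\<close> runs over the residues modulo \<open>C\<close> with \<open>Q A D = p\<^sup>k\<close>; their sum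
  vanishes unless \<open>C\<close> and \<open>D\<close> are coprime, and is then the phase of the term on the left.

  The identity passes to \<open>s = 1\<close> by analytic continuation: up to an absolutely convergent error, the
  series over \<open>(c, d)\<close> is a Kloosterman zeta function, and a fourth moment bound
  \<open>O(c\<^bsup>3/4 + \<epsilon>\<^esup>)\<close> for Kloosterman sums suffices to continue it to the left of \<open>1\<close>. Hence the two sides of the
  claim differ by a constant. The Lipschitz formula gives the Fourier expansions at \<open>s = 1\<close>, and by
  these the difference tends to \<open>0\<close> as \<open>Im \<tau>\<close> grows, so the constant is \<open>0\<close>.
\<close>

section \<open>Kloosterman sums\<close>

text \<open>At \<open>s = 1\<close> the double series over \<open>(c, d)\<close> just fails to
  converge absolutely. Expanding the phases of a row in additive characters modulo \<open>c\<close>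
  brings out Kloosterman sums as coefficients, and any fixed power saving over their trivial bound
  makes the row sums summable over \<open>c\<close> somewhat to the left of \<open>Re s = 1\<close>.
  The exponent 3/4 reaches every abscissa above 7/8, of which 9/10 is a convenient one. This is
  Kloosterman's own exponent: it comes from counting solutions of two congruences in four units.

  The price is that the value at \<open>s = 1\<close> is an iterated sum, over \<open>d\<close>
  first and then over \<open>c\<close>, so the Fourier expansion has to be derived row by row in
  this order.

  The expansion serves twice. \<open>niebur_j\<close> and \<open>niebur_coeff\<close> are definite
  descriptions, so existence and uniqueness of the continuation and of the coefficients must be
  proved before \<open>J\<close> has its intended meaning. Later the constant between the two sides
  of the claim is found without computing any constant term: the singular parts satisfy the Hecke
  identity by themselves, and everything else decays at infinity.\<close>

lemma unit_exp_add: "unit_exp (x + y) = unit_exp x * unit_exp y"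
  by (simp add: unit_exp_def exp_add distrib_left)

lemma unit_exp_of_int [simp]: "unit_exp (of_int k) = 1"
proof -
  have "2 * complex_of_real pi * \<i> * of_int k = \<i> * (of_int (2 * k) * of_real pi)" by simp
  then show ?thesis
    unfolding unit_exp_def exp_eq_1 by (auto intro!: exI[of _ k])
qed

lemma unit_exp_0 [simp]: "unit_exp 0 = 1"
  by (simp add: unit_exp_def)

lemma unit_exp_minus: "unit_exp (- x) = inverse (unit_exp x)"
  by (simp add: unit_exp_def exp_minus)

lemma unit_exp_of_nat_mult: "unit_exp (of_nat l * x) = unit_exp x ^ l"
  by (simp add: unit_exp_def exp_of_nat_mult[symmetric] algebra_simps)

lemma norm_unit_exp: "norm (unit_exp x) = exp (- 2 * pi * Im x)"
  by (simp add: unit_exp_def)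

lemma cnj_unit_exp: "cnj (unit_exp x) = unit_exp (- cnj x)"
  by (simp add: unit_exp_def exp_cnj)

lemma unit_exp_eq_1_iff: "unit_exp (of_real x) = 1 \<longleftrightarrow> x \<in> \<int>"
proof
  assume "unit_exp (of_real x) = 1"
  then obtain n :: int where "2 * pi * x = of_int (2 * n) * pi"
    unfolding unit_exp_def exp_eq_1 by auto
  then have "x = of_int n" by simp
  then show "x \<in> \<int>" by simp
next
  assume "x \<in> \<int>"
  then obtain n where "x = of_int n" by (auto elim: Ints_cases)
  then show "unit_exp (of_real x) = 1" by (metis of_real_of_int_eq unit_exp_of_int)
qed

text \<open>The additive character modulo \<open>c\<close>.\<close>

definition ek :: "int \<Rightarrow> int \<Rightarrow> complex" where
  "ek c r = unit_exp (of_int r / of_int c)"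

lemma ek_add: "ek c (a + b) = ek c a * ek c b"
  by (simp add: ek_def unit_exp_add add_divide_distrib)

lemma ek_0 [simp]: "ek c 0 = 1"
  by (simp add: ek_def)

lemma ek_minus: "ek c (- a) = cnj (ek c a)"
  by (simp add: ek_def cnj_unit_exp)

lemma norm_ek [simp]: "norm (ek c a) = 1"
  by (simp add: ek_def norm_unit_exp)

lemma ek_multiple: "c \<noteq> 0 \<Longrightarrow> ek c (c * a) = 1"
  by (simp add: ek_def)

lemma ek_cong: assumes "[a = b] (mod c)" "c \<noteq> 0" shows "ek c a = ek c b"
proof -
  obtain k where "a = b + c * k"
    using assms(1) by (metis cong_iff_lin cong_sym)
  then show ?thesis by (simp add: ek_add ek_multiple assms)
qed

lemma ek_eq_1_iff: assumes "c \<noteq> 0" shows "ek c a = 1 \<longleftrightarrow> c dvd a"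
proof -
  have "ek c a = 1 \<longleftrightarrow> (of_int a / of_int c :: real) \<in> \<int>"
    using unit_exp_eq_1_iff[of "of_int a / of_int c"] by (simp add: ek_def)
  also have "\<dots> \<longleftrightarrow> c dvd a" using assms by (simp add: of_int_div_of_int_in_Ints_iff)
  finally show ?thesis .
qed

lemma ek_power: "ek c (int j * a) = ek c a ^ j"
  by (induction j) (auto simp: ek_add distrib_right)

lemma sum_int_eq_sum_nat: "(\<Sum>a\<in>{0..<int n}. f a) = (\<Sum>j<n. f (int j))"
  by (rule sum.reindex_bij_witness[of _ int nat]) auto

text \<open>Orthogonality of characters: a geometric sum whose ratio is a \<open>c\<close>-th root
  of unity.\<close>

lemma sum_ek:
  assumes "c > 0"
  shows "(\<Sum>a\<in>{0..<c}. ek c (a * k)) = (if c dvd k then of_int c else 0)"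
proof -
  have c: "c = int (nat c)" using assms by simp
  have "(\<Sum>a\<in>{0..<c}. ek c (a * k)) = (\<Sum>j<nat c. ek c k ^ j)"
    by (subst c, subst sum_int_eq_sum_nat) (use assms in \<open>simp add: ek_power\<close>)
  also have "\<dots> = (if c dvd k then of_int c else 0)"
  proof (cases "c dvd k")
    case True
    then have "ek c k = 1" using assms ek_eq_1_iff by simp
    then show ?thesis using True assms by simp
  next
    case False
    then have "ek c k \<noteq> 1" using assms ek_eq_1_iff by simp
    moreover have "ek c k ^ nat c = 1"
      using assms by (simp add: ek_power[symmetric] ek_multiple)
    ultimately show ?thesis using False by (simp add: geometric_sum)
  qed
  finally show ?thesis .
qed

section \<open>Units and inverses modulo \<open>c\<close>\<close>

definition units_mod :: "int \<Rightarrow> int set" where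
  "units_mod c = {r \<in> {0..<c}. coprime r c}"

lemma finite_units_mod [simp]: "finite (units_mod c)"
  by (rule finite_subset[of _ "{0..<c}"]) (auto simp: units_mod_def)

lemma card_units_mod_pos: "c > 0 \<Longrightarrow> card (units_mod c) > 0"
proof -
  assume "c > 0"
  \<comment> \<open>For \<open>c = 1\<close> the only unit is \<open>0\<close>, hence
    \<open>1 mod c\<close> instead of \<open>1\<close>.\<close>
  then have "1 mod c \<in> units_mod c" by (simp add: units_mod_def)
  then show ?thesis using card_gt_0_iff finite_units_mod by blast
qed

abbreviation "minv \<equiv> modular_inverse :: int \<Rightarrow> int \<Rightarrow> int"

lemma minv_cong: "coprime n c \<Longrightarrow> [n * minv c n = 1] (mod c)"
  by (rule cong_modular_inverse1)

lemma cong_minv_unique: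
  assumes "[n * x = 1] (mod c)"
  shows "[minv c n = x] (mod c)"
proof -
  have "coprime n c" using assms coprime_iff_invertible_int by auto
  have "[minv c n * (n * x) = minv c n * 1] (mod c)" by (intro cong_mult assms cong_refl)
  moreover have "minv c n * (n * x) = (n * minv c n) * x" by simp
  moreover have "[(n * minv c n) * x = 1 * x] (mod c)"
    by (intro cong_mult minv_cong \<open>coprime n c\<close> cong_refl)
  ultimately show ?thesis by (metis cong_sym cong_trans mult_1 mult.right_neutral)
qed

lemma minv_mult_cong:
  assumes "coprime a c" "coprime b c"
  shows "[minv c (a * b) = minv c a * minv c b] (mod c)"
proof (rule cong_minv_unique)
  have "[(a * minv c a) * (b * minv c b) = 1 * 1] (mod c)"
    by (intro cong_mult minv_cong assms)
  then show "[a * b * (minv c a * minv c b) = 1] (mod c)" by (simp add: algebra_simps)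
qed

lemma minv_cong_arg:
  assumes "[a = b] (mod c)" "coprime a c"
  shows "[minv c a = minv c b] (mod c)"
proof (rule cong_minv_unique)
  have b: "coprime b c" using assms by (metis cong_imp_coprime)
  have "[a * minv c b = b * minv c b] (mod c)" by (intro cong_mult assms cong_refl)
  then show "[a * minv c b = 1] (mod c)" using minv_cong[OF b] cong_trans by blast
qed

lemma bij_betw_units_mult:
  assumes "u \<in> units_mod c"
  shows "bij_betw (\<lambda>r. (u * r) mod c) (units_mod c) (units_mod c)"
proof -
  have c: "c > 0" and u: "coprime u c" using assms by (auto simp: units_mod_def)
  have "inj_on (\<lambda>r. (u * r) mod c) (units_mod c)"
  proof (rule inj_onI)
    fix x y assume xy: "x \<in> units_mod c" "y \<in> units_mod c" "(u * x) mod c = (u * y) mod c"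
    then have "[u * x = u * y] (mod c)" by (simp add: cong_def)
    then have "[x = y] (mod c)" using u cong_mult_lcancel by blast
    then show "x = y" using xy by (auto simp: units_mod_def cong_def)
  qed
  moreover have "(\<lambda>r. (u * r) mod c) ` units_mod c \<subseteq> units_mod c"
    using c u by (auto simp: units_mod_def)
  ultimately show ?thesis by (simp add: bij_betw_def endo_inj_surj)
qed

text \<open>The classical Kloosterman sum, with the inverse attached to the first parameter.\<close>

definition kloosterman :: "int \<Rightarrow> int \<Rightarrow> int \<Rightarrow> complex" where
  "kloosterman c m l = (\<Sum>r\<in>units_mod c. ek c (m * minv c r + l * r))"

lemma kloosterman_cong:
  assumes "[m = m'] (mod c)" "[l = l'] (mod c)" "c > 0"
  shows "kloosterman c m l = kloosterman c m' l'"
  unfolding kloosterman_def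
  by (intro sum.cong refl ek_cong cong_add cong_mult assms cong_refl) (use assms in auto)

text \<open>Reindexing the sum by \<open>u * r\<close> produces the inverse
  \<open>minv c u * minv c r\<close>, so the twisting factors cancel against \<open>u\<close> and
  its inverse.\<close>

lemma kloosterman_twist:
  assumes "u \<in> units_mod c"
  shows "kloosterman c (m * u) (l * minv c u) = kloosterman c m l"
proof -
  have c: "c > 0" and u: "coprime u c" using assms by (auto simp: units_mod_def)
  have "kloosterman c (m * u) (l * minv c u) =
    (\<Sum>r\<in>units_mod c. ek c (m * u * minv c ((u * r) mod c) + l * minv c u * ((u * r) mod c)))"
    unfolding kloosterman_def
    by (rule sum.reindex_bij_betw[OF bij_betw_units_mult[OF assms], symmetric])
  also have "\<dots> = kloosterman c m l"
    unfolding kloosterman_def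
  proof (intro sum.cong refl ek_cong)
    fix r assume r: "r \<in> units_mod c"
    then have r': "coprime r c" by (simp add: units_mod_def)
    have inv: "[minv c ((u * r) mod c) = minv c u * minv c r] (mod c)"
    proof -
      have "[minv c ((u * r) mod c) = minv c (u * r)] (mod c)"
        by (rule minv_cong_arg) (use u r' c in auto)
      then show ?thesis using minv_mult_cong[OF u r'] cong_trans by blast
    qed
    have "[m * u * minv c ((u * r) mod c) = m * u * (minv c u * minv c r)] (mod c)"
      by (intro cong_mult inv cong_refl)
    moreover have "m * u * (minv c u * minv c r) = m * minv c r * (u * minv c u)" by simp
    moreover have "[m * minv c r * (u * minv c u) = m * minv c r * 1] (mod c)"
      by (intro cong_mult minv_cong u cong_refl)
    ultimately have 1: "[m * u * minv c ((u * r) mod c) = m * minv c r] (mod c)"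
      by (metis cong_trans mult.right_neutral)
    have "[l * minv c u * ((u * r) mod c) = l * minv c u * (u * r)] (mod c)"
      by (intro cong_mult cong_refl) auto
    moreover have "l * minv c u * (u * r) = l * r * (u * minv c u)" by simp
    moreover have "[l * r * (u * minv c u) = l * r * 1] (mod c)"
      by (intro cong_mult minv_cong u cong_refl)
    ultimately have 2: "[l * minv c u * ((u * r) mod c) = l * r] (mod c)"
      by (metis cong_trans mult.right_neutral)
    from 1 2 show "[m * u * minv c ((u * r) mod c) + l * minv c u * ((u * r) mod c) =
       m * minv c r + l * r] (mod c)" by (rule cong_add)
  qed (use c in simp)
  finally show ?thesis .
qed

section \<open>Counting solutions of a product congruence\<close>

text \<open>Two solutions differ by a multiple of the lcm, which divides \<open>c\<close>. Distinct
  solutions therefore have distinct quotients by the lcm, and only \<open>c div lcm a b\<close>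
  quotients occur.\<close>

lemma card_two_congruences:
  fixes a b c \<alpha> \<beta> :: int
  assumes "c > 0" "a > 0" "b > 0" "a dvd c" "b dvd c"
  shows "int (card {v \<in> {0..<c}. a dvd v - \<alpha> \<and> b dvd v - \<beta>}) * lcm a b \<le> c"
proof (cases "{v \<in> {0..<c}. a dvd v - \<alpha> \<and> b dvd v - \<beta>} = {}")
  case False
  then obtain v0 where v0: "a dvd v0 - \<alpha>" "b dvd v0 - \<beta>" by auto
  define L where "L = lcm a b"
  have L: "L > 0" "L dvd c" using assms by (auto simp: L_def lcm_pos_int)
  let ?V = "{v \<in> {0..<c}. a dvd v - \<alpha> \<and> b dvd v - \<beta>}"
  have cg: "L dvd v - v0" if "v \<in> ?V" for v
  proof -
    have "a dvd (v - \<alpha>) - (v0 - \<alpha>)" "b dvd (v - \<beta>) - (v0 - \<beta>)"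
      using that by (blast intro: dvd_diff v0)+
    then show ?thesis by (simp add: L_def lcm_least)
  qed
  have "inj_on (\<lambda>v. v div L) ?V"
  proof (rule inj_onI)
    fix v w assume vw: "v \<in> ?V" "w \<in> ?V" "v div L = w div L"
    have "v mod L = w mod L" using cg vw by (metis mod_eq_dvd_iff)
    then show "v = w" using vw(3) by (metis div_mult_mod_eq)
  qed
  moreover have "(\<lambda>v. v div L) ` ?V \<subseteq> {0..<c div L}"
  proof safe
    fix v assume v: "v \<in> {0..<c}"
    obtain k where k: "c = L * k" using L by auto
    have "L * (v div L) \<le> v" using L by (metis add.commute le_add_same_cancel1 mult_div_mod_eq pos_mod_sign)
    also have "v < L * k" using v k by simp
    finally have "v div L < k" using L by simp
    then show "v div L \<in> {0..<c div L}"
      using L v k by (auto simp: pos_imp_zdiv_nonneg_iff)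
  qed
  ultimately have "card ?V \<le> card {0..<c div L}" by (intro card_inj_on_le) auto
  then have "card ?V \<le> nat (c div L)" by simp
  moreover have "c div L \<ge> 0" using assms L by (simp add: pos_imp_zdiv_nonneg_iff)
  ultimately have "int (card ?V) \<le> c div L" by (simp only: le_nat_iff)
  then have "int (card ?V) * L \<le> (c div L) * L" using L by (intro mult_right_mono) auto
  then show ?thesis using L by (simp add: L_def)
next
  case True
  show ?thesis unfolding True using assms by simp
qed

text \<open>For \<open>c > 0\<close> its cardinality is the divisor function.\<close>

definition divs :: "int \<Rightarrow> int set" where
  "divs c = {e. e > 0 \<and> e dvd c}"

lemma finite_divs: "c > 0 \<Longrightarrow> finite (divs c)"
  by (rule finite_subset[of _ "{0..c}"]) (auto simp: divs_def zdvd_imp_le)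

text \<open>With \<open>g = gcd e2 e3\<close>, a partner \<open>v\<close> exists only if
  \<open>u\<close> is \<open>- 2 x\<close> modulo \<open>g\<close>; then \<open>v\<close> is fixed
  modulo \<open>lcm e2 e3\<close>. As \<open>u\<close> is also divisible by \<open>e1\<close>, it is
  fixed modulo \<open>lcm e1 g\<close>, where \<open>gcd e1 g\<close> divides \<open>2 x\<close>, is
  coprime to \<open>x\<close> and hence is at most 2. Altogether there are at most
  \<open>2 c^2 / (e1 e2 e3)\<close> pairs, and the product of the \<open>e\<close>'s is at least
  \<open>c\<close>.\<close>

lemma card_triple_product:
  fixes c x e1 e2 e3 :: int
  assumes "c > 0" "coprime x c" "e1 \<in> divs c" "e2 \<in> divs c" "e3 \<in> divs c" "c dvd e1 * e2 * e3"
  shows "int (card {(u, v). u \<in> {0..<c} \<and> v \<in> {0..<c} \<and> e1 dvd u \<and> e2 dvd v \<and> e3 dvd u + v + 2 * x}) \<le> 2 * c"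
proof -
  define g where "g = gcd e2 e3"
  have e: "e1 > 0" "e2 > 0" "e3 > 0" "e1 dvd c" "e2 dvd c" "e3 dvd c"
    using assms by (auto simp: divs_def)
  have g: "g > 0" "g dvd c" "g dvd e2" "g dvd e3" using e by (auto simp: g_def dest: dvd_trans)
  define A where "A = {u \<in> {0..<c}. e1 dvd u - 0 \<and> g dvd u - (- 2 * x)}"
  define B where "B u = {v \<in> {0..<c}. e2 dvd v - 0 \<and> e3 dvd v - (- u - 2 * x)}" for u
  let ?E = "{(u, v). u \<in> {0..<c} \<and> v \<in> {0..<c} \<and> e1 dvd u \<and> e2 dvd v \<and> e3 dvd u + v + 2 * x}"
  have fin: "finite A" "\<And>u. finite (B u)"
    unfolding A_def B_def by (rule finite_subset[of _ "{0..<c}"]; auto)+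
  have "?E \<subseteq> Sigma A B"
  proof (safe, goal_cases)
    case (1 u v)
    have "g dvd (u + v + 2 * x) - v" using 1 g by (intro dvd_diff) (auto dest: dvd_trans)
    then have "g dvd u - (- 2 * x)" by (simp add: algebra_simps)
    then show ?case using 1 by (simp add: A_def)
  next
    case (2 u v)
    then show ?case by (simp add: B_def algebra_simps)
  qed
  then have "card ?E \<le> card (Sigma A B)" using fin by (intro card_mono) auto
  also have "\<dots> = (\<Sum>u\<in>A. card (B u))" using fin by simp
  finally have "int (card ?E) * lcm e2 e3 \<le> (\<Sum>u\<in>A. int (card (B u)) * lcm e2 e3)"
    by (simp add: sum_distrib_right[symmetric] mult_right_mono flip: of_nat_sum)
  also have "\<dots> \<le> (\<Sum>u\<in>A. c)"
    unfolding B_def by (intro sum_mono card_two_congruences) (use assms e in auto)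
  also have "\<dots> = int (card A) * c" by simp
  finally have 1: "int (card ?E) * lcm e2 e3 \<le> int (card A) * c" .
  have 2: "int (card A) * (e1 * g) \<le> 2 * c"
  proof (cases "A = {}")
    case False
    then obtain u where u: "e1 dvd u" "g dvd u + 2 * x" by (auto simp: A_def)
    have "gcd e1 g dvd (u + 2 * x) - u" using u by (intro dvd_diff) (auto dest: dvd_trans)
    then have "gcd e1 g dvd 2 * x" by simp
    moreover have "coprime (gcd e1 g) x"
      using assms(2) e(4) by (metis coprime_commute coprime_divisors dvd_refl dvd_trans gcd_dvd1)
    ultimately have "gcd e1 g dvd 2" by (simp add: coprime_dvd_mult_left_iff)
    then have "gcd e1 g \<le> 2" by (intro zdvd_imp_le) auto
    have "e1 * g = lcm e1 g * gcd e1 g"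
      using e g by (metis abs_of_pos mult.commute prod_gcd_lcm_int)
    then have "int (card A) * (e1 * g) = (int (card A) * lcm e1 g) * gcd e1 g" by simp
    also have "\<dots> \<le> c * 2"
    proof (intro mult_mono)
      show "int (card A) * lcm e1 g \<le> c"
        unfolding A_def by (rule card_two_congruences) (use assms e g in auto)
    qed (use \<open>gcd e1 g \<le> 2\<close> assms in auto)
    finally show ?thesis by simp
  qed (use assms in simp)
  have "e2 * e3 = lcm e2 e3 * g"
    using e by (metis abs_of_pos g_def mult.commute prod_gcd_lcm_int)
  then have "int (card ?E) * (e1 * e2 * e3) = (int (card ?E) * lcm e2 e3) * (e1 * g)" by simp
  also have "\<dots> \<le> (int (card A) * c) * (e1 * g)" by (intro mult_right_mono 1) (use e g in auto)
  also have "\<dots> = (int (card A) * (e1 * g)) * c" by simp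
  also have "\<dots> \<le> 2 * c * c" by (intro mult_right_mono 2) (use assms in auto)
  finally have 3: "int (card ?E) * (e1 * e2 * e3) \<le> 2 * c * c" .
  have "c \<le> e1 * e2 * e3" using assms(6) e by (intro zdvd_imp_le) auto
  then have "int (card ?E) * c \<le> int (card ?E) * (e1 * e2 * e3)" by (intro mult_left_mono) auto
  with 3 have "int (card ?E) * c \<le> 2 * c * c" by simp
  then show ?thesis using assms(1) mult_le_cancel_right_pos by blast
qed

text \<open>The factors may be replaced by their gcds with \<open>c\<close> one after the other.
  This sorts the solutions of the product congruence by divisors of \<open>c\<close>.\<close>

lemma dvd_gcd_triple:
  fixes c u v w :: int
  assumes "c dvd u * v * w" 
  shows "c dvd gcd u c * gcd v c * gcd w c"
proof -
  have *: "c dvd gcd a c * b" if "c dvd a * b" for a b :: int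
  proof -
    have "c dvd gcd (a * b) (c * b)" using that by simp
    then show ?thesis by (simp add: gcd_mult_right gcd.commute)
  qed
  have "c dvd gcd u c * (v * w)" using assms by (intro *) (simp add: mult.assoc)
  then have "c dvd gcd v c * (gcd u c * w)" by (intro *) (simp add: algebra_simps)
  then have "c dvd gcd w c * (gcd u c * gcd v c)" by (intro *) (simp add: algebra_simps)
  then show ?thesis by (simp add: algebra_simps)
qed

text \<open>Union bound over the triples of gcds of the three factors with \<open>c\<close>; each
  triple contributes at most \<open>2 c\<close> pairs by \<open>card_triple_product\<close>.\<close>

lemma card_product_zero:
  fixes c x :: int
  assumes "c > 0" "coprime x c"
  shows "int (card {(u, v). u \<in> {0..<c} \<and> v \<in> {0..<c} \<and> c dvd u * v * (u + v + 2 * x)})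
           \<le> 2 * c * int (card (divs c)) ^ 3"
proof -
  define I where "I = {(e1, e2, e3). e1 \<in> divs c \<and> e2 \<in> divs c \<and> e3 \<in> divs c \<and> c dvd e1 * e2 * e3}"
  define E where "E = (\<lambda>(e1, e2, e3). {(u, v). u \<in> {0..<c} \<and> v \<in> {0..<c} \<and> e1 dvd u \<and> e2 dvd v \<and> e3 dvd u + v + 2 * x})"
  let ?Z = "{(u, v). u \<in> {0..<c} \<and> v \<in> {0..<c} \<and> c dvd u * v * (u + v + 2 * x)}"
  have sub: "I \<subseteq> divs c \<times> divs c \<times> divs c" by (auto simp: I_def)
  have finI: "finite I" using sub finite_divs[OF assms(1)] by (auto intro: finite_subset)
  have "?Z \<subseteq> (\<Union>i\<in>I. E i)"
  proof safe
    fix u v assume uv: "u \<in> {0..<c}" "v \<in> {0..<c}" "c dvd u * v * (u + v + 2 * x)"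
    have "(gcd u c, gcd v c, gcd (u + v + 2 * x) c) \<in> I"
      using dvd_gcd_triple[OF uv(3)] assms by (auto simp: I_def divs_def)
    moreover have "(u, v) \<in> E (gcd u c, gcd v c, gcd (u + v + 2 * x) c)"
      using uv by (simp add: E_def)
    ultimately show "(u, v) \<in> (\<Union>i\<in>I. E i)" by blast
  qed
  moreover have finE: "finite (E i)" for i
    by (rule finite_subset[of _ "{0..<c} \<times> {0..<c}"]) (auto simp: E_def split: prod.splits)
  ultimately have "card ?Z \<le> card (\<Union>i\<in>I. E i)" using finI by (intro card_mono) auto
  also have "\<dots> \<le> (\<Sum>i\<in>I. card (E i))" by (rule card_UN_le[OF finI])
  finally have "int (card ?Z) \<le> (\<Sum>i\<in>I. int (card (E i)))" by (simp flip: of_nat_sum)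
  also have "\<dots> \<le> (\<Sum>i\<in>I. 2 * c)"
  proof (intro sum_mono, clarify)
    fix e1 e2 e3 assume "(e1, e2, e3) \<in> I"
    then show "int (card (E (e1, e2, e3))) \<le> 2 * c"
      using card_triple_product[OF assms, of e1 e2 e3] by (simp add: I_def E_def)
  qed
  also have "\<dots> = 2 * c * int (card I)" by simp
  also have "\<dots> \<le> 2 * c * int (card (divs c) ^ 3)"
  proof (intro mult_left_mono of_nat_mono)
    have "card I \<le> card (divs c \<times> divs c \<times> divs c)"
      using sub finite_divs[OF assms(1)] by (intro card_mono) auto
    then show "card I \<le> card (divs c) ^ 3" by (simp add: card_cartesian_product power3_eq_cube)
  qed (use assms in auto)
  finally show ?thesis by simp
qed

section \<open>The fourth moment of Kloosterman sums\<close>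

definition quads :: "int \<Rightarrow> (int \<times> int \<times> int \<times> int) set" where
  "quads c = units_mod c \<times> units_mod c \<times> units_mod c \<times> units_mod c"

text \<open>The quadruples that survive orthogonality when the fourth power is summed over both
  parameters.\<close>

definition quad_solutions :: "int \<Rightarrow> (int \<times> int \<times> int \<times> int) set" where
  "quad_solutions c = {(x1, x2, x3, x4) \<in> quads c. c dvd x1 + x2 - x3 - x4 \<and>
     c dvd minv c x1 + minv c x2 - minv c x3 - minv c x4}"

text \<open>Putting the reciprocals over a common denominator turns the two linear congruences into a
  single product congruence.\<close>

lemma quad_solution_product:
  assumes "(x1, x2, x3, x4) \<in> quad_solutions c"
  shows "c dvd (x1 - x3) * (x2 - x3) * (x1 + x2)"
proof -
  have cop: "coprime x1 c" "coprime x2 c" "coprime x3 c" "coprime x4 c"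
    and 1: "c dvd x1 + x2 - x3 - x4"
    and 2: "c dvd minv c x1 + minv c x2 - minv c x3 - minv c x4"
    using assms by (auto simp: quad_solutions_def quads_def units_mod_def)
  define i where "i = minv c"
  have inv: "c dvd x1 * i x1 - 1" "c dvd x2 * i x2 - 1" "c dvd x3 * i x3 - 1" "c dvd x4 * i x4 - 1"
    using cop by (auto simp: i_def minv_cong cong_iff_dvd_diff[symmetric])
  have 2: "c dvd i x1 + i x2 - i x3 - i x4" using 2 by (simp add: i_def)
  \<comment> \<open>Every summand on the right contains a quantity that vanishes modulo
    \<open>c\<close>: one of the four relations \<open>x * i x - 1\<close>, or one of the two linear
    congruences.\<close>
  have "(x1 - x3) * (x2 - x3) * (x1 + x2) =
      (x1 * i x1 - 1) * (x2 * x3 * x4) + (x2 * i x2 - 1) * (x1 * x3 * x4)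
    - (x3 * i x3 - 1) * (x1 * x2 * x4) - (x4 * i x4 - 1) * (x1 * x2 * x3)
    - x1 * x2 * x3 * x4 * (i x1 + i x2 - i x3 - i x4)
    + (x1 + x2 - x3 - x4) * (x1 * x2 - (x1 + x2) * x3)"
    by algebra
  moreover have "c dvd \<dots>"
    using inv 1 2 by (intro dvd_add dvd_diff) auto
  ultimately show ?thesis by simp
qed

text \<open>A solution is recovered from \<open>x3\<close>, \<open>u = x1 - x3\<close> and
  \<open>v = x2 - x3\<close>, because the first congruence determines \<open>x4\<close>. In these
  variables \<open>x1 + x2 = u + v + 2 x3\<close>, so \<open>quad_solution_product\<close> becomes
  the congruence counted by \<open>card_product_zero\<close>.\<close>

lemma card_quad_solutions:
  assumes "c > 0"
  shows "int (card (quad_solutions c)) \<le> int (card (units_mod c)) * (2 * c * int (card (divs c)) ^ 3)"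
proof -
  define h where "h = (\<lambda>(x1, x2, x3, x4 :: int). (x3, (x1 - x3) mod c, (x2 - x3) mod c))"
  define Z where "Z x = {(u, v). u \<in> {0..<c} \<and> v \<in> {0..<c} \<and> c dvd u * v * (u + v + 2 * x)}" for x
  have finZ: "finite (Z x)" for x
    by (rule finite_subset[of _ "{0..<c} \<times> {0..<c}"]) (auto simp: Z_def)
  have "inj_on h (quad_solutions c)"
  proof (rule inj_onI)
    fix p q assume pq: "p \<in> quad_solutions c" "q \<in> quad_solutions c" "h p = h q"
    obtain x1 x2 x3 x4 where p: "p = (x1, x2, x3, x4)" by (cases p) auto
    obtain y1 y2 y3 y4 where q: "q = (y1, y2, y3, y4)" by (cases q) auto
    have r: "x1 \<in> {0..<c}" "x2 \<in> {0..<c}" "x4 \<in> {0..<c}" "y1 \<in> {0..<c}" "y2 \<in> {0..<c}" "y4 \<in> {0..<c}"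
      using pq p q by (auto simp: quad_solutions_def quads_def units_mod_def)
    have e: "x3 = y3" "(x1 - x3) mod c = (y1 - x3) mod c" "(x2 - x3) mod c = (y2 - x3) mod c"
      using pq(3) by (auto simp: h_def p q)
    have "c dvd (x1 - x3) - (y1 - x3)" "c dvd (x2 - x3) - (y2 - x3)" using e(2,3) by (metis mod_eq_dvd_iff)+
    then have "c dvd x1 - y1" "c dvd x2 - y2" by auto
    then have "x1 mod c = y1 mod c" "x2 mod c = y2 mod c" by (auto simp: mod_eq_dvd_iff)
    then have e12: "x1 = y1" "x2 = y2" using r by auto
    have "c dvd x1 + x2 - x3 - x4" "c dvd y1 + y2 - y3 - y4"
      using pq p q by (auto simp: quad_solutions_def)
    then have "c dvd (x1 + x2 - x3 - x4) - (y1 + y2 - y3 - y4)" by (rule dvd_diff)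
    then have "c dvd y4 - x4" using e12 e by simp
    then have "y4 mod c = x4 mod c" by (simp add: mod_eq_dvd_iff)
    then show "p = q" using r e e12 p q by simp
  qed
  moreover have "h ` quad_solutions c \<subseteq> Sigma (units_mod c) Z"
  proof (rule image_subsetI, clarify)
    fix x1 x2 x3 x4 assume s: "(x1, x2, x3, x4) \<in> quad_solutions c"
    have "[(x1 - x3) mod c * ((x2 - x3) mod c) * ((x1 - x3) mod c + (x2 - x3) mod c + 2 * x3) =
          (x1 - x3) * (x2 - x3) * ((x1 - x3) + (x2 - x3) + 2 * x3)] (mod c)"
      by (intro cong_mult cong_add cong_refl) auto
    moreover have "(x1 - x3) * (x2 - x3) * ((x1 - x3) + (x2 - x3) + 2 * x3) = (x1 - x3) * (x2 - x3) * (x1 + x2)"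
      by simp
    ultimately have "c dvd (x1 - x3) mod c * ((x2 - x3) mod c) * ((x1 - x3) mod c + (x2 - x3) mod c + 2 * x3)"
      using quad_solution_product[OF s] by (metis cong_dvd_iff)
    then show "h (x1, x2, x3, x4) \<in> Sigma (units_mod c) Z"
      using s assms by (auto simp: h_def Z_def quad_solutions_def quads_def)
  qed
  ultimately have "card (quad_solutions c) \<le> card (Sigma (units_mod c) Z)"
    using finZ by (intro card_inj_on_le) auto
  also have "\<dots> = (\<Sum>x\<in>units_mod c. card (Z x))" using finZ by simp
  finally have "int (card (quad_solutions c)) \<le> (\<Sum>x\<in>units_mod c. int (card (Z x)))"
    by (simp flip: of_nat_sum)
  also have "\<dots> \<le> (\<Sum>x\<in>units_mod c. 2 * c * int (card (divs c)) ^ 3)"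
    unfolding Z_def by (intro sum_mono card_product_zero assms) (auto simp: units_mod_def)
  finally show ?thesis by simp
qed

lemma kloosterman_pow4:
  "kloosterman c a b ^ 2 * cnj (kloosterman c a b) ^ 2 =
   (\<Sum>(x1, x2, x3, x4)\<in>quads c. ek c (a * (minv c x1 + minv c x2 - minv c x3 - minv c x4)) *
      ek c (b * (x1 + x2 - x3 - x4)))"
proof -
  have 1: "cnj (kloosterman c a b) = (\<Sum>r\<in>units_mod c. ek c (- (a * minv c r + b * r)))"
    by (simp add: kloosterman_def ek_minus del: minus_add_distrib)
  have "kloosterman c a b ^ 2 * cnj (kloosterman c a b) ^ 2 =
    kloosterman c a b * (kloosterman c a b * (cnj (kloosterman c a b) * cnj (kloosterman c a b)))"
    by (simp add: power2_eq_square)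
  also have "\<dots> = (\<Sum>x1\<in>units_mod c. \<Sum>x2\<in>units_mod c. \<Sum>x3\<in>units_mod c. \<Sum>x4\<in>units_mod c. 
     ek c (a * minv c x1 + b * x1) * (ek c (a * minv c x2 + b * x2) * 
      (ek c (- (a * minv c x3 + b * x3)) * ek c (- (a * minv c x4 + b * x4)))))"
    unfolding 1 unfolding kloosterman_def unfolding sum_distrib_right unfolding sum_distrib_left ..
  also have "\<dots> = (\<Sum>(x1, x2, x3, x4)\<in>quads c. 
     ek c (a * minv c x1 + b * x1) * (ek c (a * minv c x2 + b * x2) * 
      (ek c (- (a * minv c x3 + b * x3)) * ek c (- (a * minv c x4 + b * x4)))))"
    unfolding quads_def by (simp add: sum.cartesian_product)
  also have "\<dots> = (\<Sum>(x1, x2, x3, x4)\<in>quads c. ek c (a * (minv c x1 + minv c x2 - minv c x3 - minv c x4)) *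
      ek c (b * (x1 + x2 - x3 - x4)))"
    by (intro sum.cong refl) (auto simp: ek_add[symmetric] algebra_simps)
  finally show ?thesis .
qed

text \<open>After expanding the fourth power, each of the sums over \<open>a\<close> and
  \<open>b\<close> is a complete character sum: it gives \<open>c\<close> for a quadruple in
  \<open>quad_solutions c\<close>, and one of the two vanishes otherwise.\<close>

lemma kloosterman_fourth_moment:
  assumes "c > 0"
  shows "(\<Sum>a\<in>{0..<c}. \<Sum>b\<in>{0..<c}. norm (kloosterman c a b) ^ 4) =
    of_int (c ^ 2 * int (card (quad_solutions c)))"
proof -
  have eq: "complex_of_real (norm z ^ 4) = z ^ 2 * cnj z ^ 2" for z
    using complex_norm_square[of z] by (simp add: power_mult_distrib flip: power_mult) 
      (metis complex_norm_square numeral_Bit0_eq_double power_even_eq power_mult_distrib)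
  have fin: "finite (quads c)" by (simp add: quads_def)
  have "complex_of_real (\<Sum>a\<in>{0..<c}. \<Sum>b\<in>{0..<c}. norm (kloosterman c a b) ^ 4) =
    (\<Sum>a\<in>{0..<c}. \<Sum>b\<in>{0..<c}. \<Sum>(x1, x2, x3, x4)\<in>quads c. 
      ek c (a * (minv c x1 + minv c x2 - minv c x3 - minv c x4)) * ek c (b * (x1 + x2 - x3 - x4)))"
    by (simp only: of_real_sum eq kloosterman_pow4)
  also have "\<dots> = (\<Sum>a\<in>{0..<c}. \<Sum>p\<in>quads c. \<Sum>b\<in>{0..<c}. case p of (x1, x2, x3, x4) \<Rightarrow> 
      ek c (a * (minv c x1 + minv c x2 - minv c x3 - minv c x4)) * ek c (b * (x1 + x2 - x3 - x4)))"
    by (intro sum.cong refl sum.swap)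
  also have "\<dots> = (\<Sum>p\<in>quads c. \<Sum>a\<in>{0..<c}. \<Sum>b\<in>{0..<c}. case p of (x1, x2, x3, x4) \<Rightarrow> 
      ek c (a * (minv c x1 + minv c x2 - minv c x3 - minv c x4)) * ek c (b * (x1 + x2 - x3 - x4)))"
    by (rule sum.swap)
  also have "\<dots> = (\<Sum>p\<in>quads c. if p \<in> quad_solutions c then (of_int c)^2 else 0)"
  proof (intro sum.cong refl, clarify, goal_cases)
    case (1 x1 x2 x3 x4)
    then have "(\<Sum>a\<in>{0..<c}. \<Sum>b\<in>{0..<c}. 
      ek c (a * (minv c x1 + minv c x2 - minv c x3 - minv c x4)) * ek c (b * (x1 + x2 - x3 - x4)))
      = (\<Sum>a\<in>{0..<c}. ek c (a * (minv c x1 + minv c x2 - minv c x3 - minv c x4))) * 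
        (\<Sum>b\<in>{0..<c}. ek c (b * (x1 + x2 - x3 - x4)))"
      by (simp add: sum_product)
    then show ?case using assms 1
      by (auto simp: sum_ek quad_solutions_def power2_eq_square)
  qed
  also have "\<dots> = (\<Sum>p\<in>quad_solutions c. (of_int c)^2)"
  proof -
    have "quad_solutions c \<subseteq> quads c" by (auto simp: quad_solutions_def)
    then show ?thesis by (simp only: sum.inter_restrict[OF fin, symmetric] Int_absorb1)
  qed
  also have "\<dots> = complex_of_real (of_int (c ^ 2 * int (card (quad_solutions c))))"
    by simp
  finally show ?thesis by (simp only: of_real_eq_iff)
qed

text \<open>The twists \<open>(m u, l u\<^sup>*)\<close> by units \<open>u\<close> all give the same Kloosterman sum, so one of them is
  bounded by the fourth moment divided by the number of distinct twists.\<close>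

lemma kloosterman_bound4:
  assumes "c > 0"
  shows "norm (kloosterman c m l) ^ 4 \<le> of_int (2 * gcd m c * c ^ 3 * int (card (divs c)) ^ 3)"
proof -
  define U where "U = units_mod c"
  define g where "g = gcd m c"
  have g: "g > 0" "g dvd c" "g dvd m" using assms by (auto simp: g_def)
  define h where "h u = ((m * u) mod c, (l * minv c u) mod c)" for u
  define F where "F = (\<lambda>(a, b). norm (kloosterman c a b) ^ 4)"
  have hU: "h ` U \<subseteq> {0..<c} \<times> {0..<c}" using assms by (auto simp: h_def)
  \<comment> \<open>Already the first component limits the fibres: if \<open>m u = m u0\<close>
    modulo \<open>c\<close>, then \<open>u = u0\<close> modulo \<open>c div g\<close>.\<close>
  have fib: "int (card {u \<in> U. h u = y}) \<le> g" for y
  proof (cases "\<exists>u0\<in>U. h u0 = y")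
    case True
    then obtain u0 where u0: "h u0 = y" by auto
    have cg: "c = g * (c div g)" using g by simp
    \<comment> \<open>The congruence modulo \<open>1\<close> is vacuous and only brings the set into
      the shape of \<open>card_two_congruences\<close>.\<close>
    have "{u \<in> U. h u = y} \<subseteq> {u \<in> {0..<c}. c div g dvd u - u0 \<and> 1 dvd u - 0}"
    proof safe
      fix u assume u: "u \<in> U" "y = h u"
      then have "(m * u) mod c = (m * u0) mod c" using u0 by (simp add: h_def)
      then have "c dvd m * (u - u0)" by (simp add: mod_eq_dvd_iff algebra_simps)
      then have "g * (c div g) dvd g * ((m div g) * (u - u0))" using g cg by (metis dvd_mult_div_cancel mult.assoc)
      then have "c div g dvd (m div g) * (u - u0)" using g(1) by (simp only: dvd_mult_cancel_left) simp
      moreover have "coprime (c div g) (m div g)"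
        using div_gcd_coprime[of c m] assms by (simp add: g_def gcd.commute)
      ultimately show "c div g dvd u - u0" by (simp add: coprime_dvd_mult_right_iff)
    qed (auto simp: U_def units_mod_def)
    then have "card {u \<in> U. h u = y} \<le> card {u \<in> {0..<c}. c div g dvd u - u0 \<and> 1 dvd u - 0}"
      by (intro card_mono finite_subset[of "{u \<in> {0..<c}. c div g dvd u - u0 \<and> 1 dvd u - 0}" "{0..<c}"]) auto
    then have "int (card {u \<in> U. h u = y}) * lcm (c div g) 1 \<le> int (card {u \<in> {0..<c}. c div g dvd u - u0 \<and> 1 dvd u - 0}) * lcm (c div g) 1"
      by (intro mult_right_mono) auto
    also have "\<dots> \<le> c" 
    proof (rule card_two_congruences)
      show "c div g > 0" using assms g by (simp add: pos_imp_zdiv_pos_iff zdvd_imp_le)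
      show "c div g dvd c" using g by (metis dvd_div_mult_self dvd_triv_left)
    qed (use assms in auto)
    finally have "int (card {u \<in> U. h u = y}) * (c div g) \<le> g * (c div g)" using assms g by (simp add: pos_imp_zdiv_nonneg_iff)
    moreover have "c div g > 0" using assms g by (simp add: pos_imp_zdiv_pos_iff zdvd_imp_le)
    ultimately show ?thesis using mult_le_cancel_right_pos by blast
  next
    case False
    then have e: "{u \<in> U. h u = y} = {}" by auto
    show ?thesis unfolding e using g by simp
  qed
  have "real (card U) * norm (kloosterman c m l) ^ 4 = (\<Sum>u\<in>U. F (h u))"
  proof -
    have "F (h u) = norm (kloosterman c m l) ^ 4" if "u \<in> U" for u
    proof -
      have "kloosterman c ((m * u) mod c) ((l * minv c u) mod c) = kloosterman c (m * u) (l * minv c u)"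
        by (rule kloosterman_cong) (use assms in auto)
      then show ?thesis using kloosterman_twist[of u c m l] that by (simp add: F_def h_def U_def)
    qed
    then show ?thesis by simp
  qed
  also have "\<dots> = (\<Sum>y\<in>h ` U. \<Sum>u\<in>{u \<in> U. h u = y}. F (h u))"
    by (rule sum.image_gen) (simp add: U_def)
  also have "\<dots> = (\<Sum>y\<in>h ` U. real (card {u \<in> U. h u = y}) * F y)"
    by (intro sum.cong refl) simp
  also have "\<dots> \<le> (\<Sum>y\<in>h ` U. of_int g * F y)"
  proof (intro sum_mono mult_right_mono)
    fix y show "real (card {u \<in> U. h u = y}) \<le> of_int g" using fib[of y] by (metis of_int_le_iff of_int_of_nat_eq)
    show "F y \<ge> 0" by (simp add: F_def split: prod.splits)
  qed
  \<comment> \<open>By positivity the orbit of twists may be enlarged to all pairs of residues,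
    which gives the full fourth moment.\<close>
  also have "\<dots> \<le> (\<Sum>y\<in>{0..<c} \<times> {0..<c}. of_int g * F y)"
    by (intro sum_mono2 hU) (use g in \<open>auto simp: F_def\<close>)
  also have "\<dots> = of_int g * (\<Sum>a\<in>{0..<c}. \<Sum>b\<in>{0..<c}. norm (kloosterman c a b) ^ 4)"
    by (simp add: sum_distrib_left F_def sum.cartesian_product)
  also have "\<dots> = of_int (g * (c ^ 2 * int (card (quad_solutions c))))"
    using kloosterman_fourth_moment[OF assms] by simp
  \<comment> \<open>Here \<open>card U\<close> is the free choice of \<open>x3\<close> in
    \<open>card_quad_solutions\<close>; it cancels the number of twists on the left.\<close>
  also have "\<dots> \<le> of_int (g * (c ^ 2 * (int (card U) * (2 * c * int (card (divs c)) ^ 3))))"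
    unfolding of_int_le_iff U_def
    by (intro mult_left_mono card_quad_solutions) (use g assms in auto)
  also have "\<dots> = real (card U) * of_int (2 * g * c ^ 3 * int (card (divs c)) ^ 3)"
    by (simp add: power2_eq_square power3_eq_cube)
  finally show ?thesis
    using card_units_mod_pos[OF assms] by (simp add: U_def g_def)
qed

section \<open>Summability over integers and lattice points\<close>

lemma summable_on_int_powr:
  fixes a :: real
  assumes "a > 1"
  shows "(\<lambda>d::int. (1 + \<bar>real_of_int d\<bar>) powr - a) summable_on UNIV"
proof -
  let ?f = "\<lambda>d::int. (1 + \<bar>real_of_int d\<bar>) powr - a"
  have "summable (\<lambda>n. real n powr - a)"
    using assms by (simp add: summable_real_powr_iff)
  then have s1: "summable (\<lambda>n. real (Suc n) powr - a)"
    by (subst summable_Suc_iff)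
  then have s2: "summable (\<lambda>n. real (Suc (Suc n)) powr - a)"
    by (subst summable_Suc_iff)
  have "(\<lambda>n. ?f (int n)) summable_on UNIV"
    using s1 by (intro norm_summable_imp_summable_on) (simp add: add.commute)
  then have 1: "?f summable_on range int"
    by (subst summable_on_reindex) (auto simp: o_def)
  have "(\<lambda>n. ?f (- int (Suc n))) summable_on UNIV"
    using s2 by (intro norm_summable_imp_summable_on) (simp add: algebra_simps)
  then have 2: "?f summable_on range (\<lambda>n. - int (Suc n))"
    by (subst summable_on_reindex) (auto simp: o_def inj_on_def)
  have "range int \<union> range (\<lambda>n. - int (Suc n)) = UNIV"
  proof (rule UNIV_eq_I[symmetric])
    fix d :: int
    show "d \<in> range int \<union> range (\<lambda>n. - int (Suc n))"
    proof (cases "d \<ge> 0")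
      case True
      then have "d = int (nat d)" by simp
      then show ?thesis by blast
    next
      case False
      then have "d = - int (Suc (nat (- d - 1)))" by simp
      then show ?thesis by blast
    qed
  qed
  moreover have "?f summable_on (range int \<union> range (\<lambda>n. - int (Suc n)))"
    by (rule summable_on_Un_disjoint[OF 1 2]) auto
  ultimately show ?thesis by simp
qed

lemma summable_on_pos_int_powr:
  fixes a :: real
  assumes "a > 1"
  shows "(\<lambda>c::int. real_of_int c powr - a) summable_on {c. c > 0}"
proof (rule summable_on_comparison_test)
  show "(\<lambda>c::int. 2 powr a * (1 + \<bar>real_of_int c\<bar>) powr - a) summable_on {c. c > 0}"
    by (intro summable_on_cmult_right summable_on_subset_banach[OF summable_on_int_powr[OF assms]]) auto
  fix c :: int assume "c \<in> {c. c > 0}"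
  then have c: "real_of_int c \<ge> 1" by simp
  have "real_of_int c powr - a \<le> ((1 + \<bar>real_of_int c\<bar>) / 2) powr - a"
    using c assms by (intro powr_mono2') auto
  also have "\<dots> = 2 powr a * (1 + \<bar>real_of_int c\<bar>) powr - a"
    using c by (simp add: powr_divide powr_minus field_simps)
  finally show "real_of_int c powr - a \<le> 2 powr a * (1 + \<bar>real_of_int c\<bar>) powr - a" .
qed auto

lemma summable_on_product:
  fixes f :: "'a \<Rightarrow> real" and g :: "'b \<Rightarrow> real"
  assumes "f summable_on A" "g summable_on B" "\<And>x. x \<in> A \<Longrightarrow> f x \<ge> 0" "\<And>y. y \<in> B \<Longrightarrow> g y \<ge> 0"
  shows "(\<lambda>(x, y). f x * g y) summable_on A \<times> B"
proof (rule summable_on_SigmaI)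
  fix x
  show "((\<lambda>y. case (x, y) of (x, y) \<Rightarrow> f x * g y) has_sum f x * infsum g B) B"
    using assms(2) by (simp add: has_sum_cmult_right)
qed (use assms in \<open>auto intro: summable_on_cmult_left\<close>)

text \<open>The Dirichlet series of the divisor function is the square of the zeta function: pairs
  \<open>(c, e)\<close> with \<open>e\<close> dividing \<open>c\<close> correspond to pairs
  \<open>(e, c div e)\<close>, and the summand factors.\<close>

lemma summable_on_divs_powr:
  fixes a :: real
  assumes "a > 1"
  shows "(\<lambda>c::int. real (card (divs c)) * real_of_int c powr - a) summable_on {c. c > 0}"
proof -
  let ?P = "{c::int. c > 0}"
  have "(\<lambda>(e, f). real_of_int e powr - a * real_of_int f powr - a) summable_on ?P \<times> ?P"
    by (rule summable_on_product) (use summable_on_pos_int_powr[OF assms] in auto)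
  then have "((\<lambda>(e, f). real_of_int e powr - a * real_of_int f powr - a) \<circ> (\<lambda>(c, e). (e, c div e))) summable_on (Sigma ?P divs)"
  proof (subst summable_on_reindex[symmetric])
    show "inj_on (\<lambda>(c, e). (e, c div e)) (Sigma ?P divs)"
      by (rule inj_onI) (auto simp: divs_def elim!: dvdE)
    have "(\<lambda>(c, e). (e, c div e)) ` (Sigma ?P divs) \<subseteq> ?P \<times> ?P"
      by (auto simp: divs_def pos_imp_zdiv_pos_iff zdvd_imp_le)
    then show "(\<lambda>(e, f). real_of_int e powr - a * real_of_int f powr - a) summable_on
       (\<lambda>(c, e). (e, c div e)) ` (Sigma ?P divs)" if "(\<lambda>(e, f). real_of_int e powr - a * real_of_int f powr - a) summable_on ?P \<times> ?P"
      using that by (rule summable_on_subset_banach[rotated])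
  qed
  also have "?this \<longleftrightarrow> (\<lambda>(c, e). real_of_int c powr - a) summable_on (Sigma ?P divs)"
    by (intro summable_on_cong) (auto simp: divs_def powr_mult[symmetric] elim!: dvdE simp flip: of_int_mult)
  finally have "(\<lambda>c. \<Sum>\<^sub>\<infinity>e\<in>divs c. real_of_int c powr - a) summable_on ?P"
    using summable_on_Sigma_banach[of "\<lambda>c e. real_of_int c powr - a" ?P divs] by simp
  then show ?thesis
    by (rule summable_on_cong[THEN iffD1, rotated]) (auto simp: finite_divs)
qed

text \<open>Weierstrass: majorants on small closed discs give locally uniform convergence of the
  finite partial sums, and locally uniform limits of holomorphic functions are holomorphic.\<close>

lemma holomorphic_infsum:
  fixes f :: "'a \<Rightarrow> complex \<Rightarrow> complex"
  assumes "open S" "\<And>x. x \<in> X \<Longrightarrow> f x holomorphic_on S"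
    and "\<And>z. z \<in> S \<Longrightarrow> \<exists>r>0. \<exists>M. cball z r \<subseteq> S \<and> M summable_on X \<and> (\<forall>x\<in>X. \<forall>w\<in>cball z r. norm (f x w) \<le> M x)"
  shows "(\<lambda>z. \<Sum>\<^sub>\<infinity>x\<in>X. f x z) holomorphic_on S"
proof -
  have "\<exists>r>0. (\<lambda>z. \<Sum>\<^sub>\<infinity>x\<in>X. f x z) holomorphic_on ball z r" if z: "z \<in> S" for z
  proof -
    obtain r M where r: "r > 0" "cball z r \<subseteq> S" "M summable_on X" "\<forall>x\<in>X. \<forall>w\<in>cball z r. norm (f x w) \<le> M x"
      using assms(3)[OF z] by blast
    have ul: "uniform_limit (cball z r) (\<lambda>X y. \<Sum>x\<in>X. f x y) (\<lambda>y. \<Sum>\<^sub>\<infinity>x\<in>X. f x y) (finite_subsets_at_top X)"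
      by (rule Weierstrass_m_test_general) (use r in auto)
    have hol: "(\<lambda>y. \<Sum>x\<in>A. f x y) holomorphic_on cball z r" if "A \<subseteq> X" for A
      using that r assms(2) by (intro holomorphic_on_sum) (blast intro: holomorphic_on_subset)
    have "\<forall>\<^sub>F A in finite_subsets_at_top X. continuous_on (cball z r) (\<lambda>y. \<Sum>x\<in>A. f x y) \<and>
        (\<lambda>y. \<Sum>x\<in>A. f x y) holomorphic_on ball z r"
    proof (rule eventually_finite_subsets_at_top_weakI, intro conjI)
      fix A assume "finite A" "A \<subseteq> X"
      then show "continuous_on (cball z r) (\<lambda>y. \<Sum>x\<in>A. f x y)"
        using hol holomorphic_on_imp_continuous_on by blast
      show "(\<lambda>y. \<Sum>x\<in>A. f x y) holomorphic_on ball z r"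
        using hol[OF \<open>A \<subseteq> X\<close>] ball_subset_cball holomorphic_on_subset by blast
    qed
    then have "(\<lambda>y. \<Sum>\<^sub>\<infinity>x\<in>X. f x y) holomorphic_on ball z r"
      by (rule holomorphic_uniform_limit[OF _ ul]) auto
    then show ?thesis using r by blast
  qed
  then show ?thesis
    using assms(1) by (meson analytic_imp_holomorphic analytic_on_def)
qed

text \<open>The imaginary part of \<open>c \<tau> + d\<close> controls \<open>c\<close>, and
  \<open>d\<close> is the difference of \<open>c \<tau> + d\<close> and \<open>c \<tau>\<close>.
  That \<open>\<kappa> \<le> 1\<close> is recorded because negative powers of
  \<open>\<kappa>\<close> are later bounded uniformly in the exponent.\<close>

lemma lattice_lower_bound:
  assumes "Im \<tau> > 0"
  obtains \<kappa> where "\<kappa> > 0" "\<kappa> \<le> 1" "\<And>c d :: int. c > 0 \<Longrightarrow> \<kappa> * real_of_int (c + \<bar>d\<bar>) \<le> norm (of_int c * \<tau> + of_int d)"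
proof -
  define K where "K = 1 / Im \<tau> + 1 + norm \<tau> / Im \<tau>"
  have K: "K > 0" using assms by (simp add: K_def add_pos_nonneg)
  have "real_of_int (c + \<bar>d\<bar>) \<le> K * norm (of_int c * \<tau> + of_int d)" if "c > 0" for c d :: int
  proof -
    let ?z = "of_int c * \<tau> + of_int d"
    have "c * Im \<tau> = Im ?z" by simp
    also have "\<dots> \<le> norm ?z" using abs_Im_le_cmod[of ?z] by linarith
    finally have 1: "c \<le> norm ?z / Im \<tau>" using assms by (simp add: pos_le_divide_eq)
    have "real_of_int \<bar>d\<bar> = norm (?z - of_int c * \<tau>)" by simp
    also have "\<dots> \<le> norm ?z + norm (of_int c * \<tau>)" by (rule norm_triangle_ineq4)
    also have "norm (of_int c * \<tau>) = c * norm \<tau>" using that by (simp add: norm_mult)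
    also have "c * norm \<tau> \<le> norm ?z / Im \<tau> * norm \<tau>" using 1 by (intro mult_right_mono) auto
    finally show ?thesis using 1 by (simp add: K_def algebra_simps)
  qed
  then have "(1 / K) * real_of_int (c + \<bar>d\<bar>) \<le> norm (of_int c * \<tau> + of_int d)" if "c > 0" for c d :: int
    using that K by (simp add: field_simps)
  moreover have "1 / K \<le> 1" using assms K by (simp add: K_def)
  ultimately show ?thesis using that[of "1 / K"] K by simp
qed

text \<open>Both \<open>c\<close> and \<open>1 + \<bar>d\<bar>\<close> are at most
  \<open>c + \<bar>d\<bar>\<close>. Dividing the exponent between them dominates a lattice sum by a
  product of one-dimensional sums.\<close>

lemma split_powr_bound:
  fixes c d :: int and a b :: real
  assumes "c > 0" "a \<ge> 0" "b \<ge> 0"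
  shows "(real_of_int (c + \<bar>d\<bar>)) powr - (a + b) \<le> real_of_int c powr - a * (1 + \<bar>real_of_int d\<bar>) powr - b"
proof -
  have "(real_of_int (c + \<bar>d\<bar>)) powr - (a + b) = real_of_int (c + \<bar>d\<bar>) powr - a * real_of_int (c + \<bar>d\<bar>) powr - b"
    by (simp add: powr_add[symmetric])
  also have "\<dots> \<le> real_of_int c powr - a * (1 + \<bar>real_of_int d\<bar>) powr - b"
    using assms by (intro mult_mono powr_mono2') auto
  finally show ?thesis .
qed

lemma has_sum_sum:
  fixes f :: "'b \<Rightarrow> 'a \<Rightarrow> 'c::{comm_monoid_add, topological_comm_monoid_add}"
  assumes "finite I" "\<And>i. i \<in> I \<Longrightarrow> (f i has_sum S i) A"
  shows "((\<lambda>x. \<Sum>i\<in>I. f i x) has_sum (\<Sum>i\<in>I. S i)) A"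
  using assms by (induction I rule: finite_induct) (auto intro!: has_sum_add)

lemma has_sum_diff:
  fixes f g :: "'a \<Rightarrow> 'b::real_normed_vector"
  assumes "(f has_sum a) A" "(g has_sum b) A"
  shows "((\<lambda>x. f x - g x) has_sum (a - b)) A"
  using has_sum_add[OF assms(1), of "\<lambda>x. - g x" "- b"] assms(2) by (simp add: has_sum_uminus)

section \<open>Incomplete Kloosterman sums and the Kloosterman zeta function\<close>

text \<open>The sine is concave on \<open>{0..pi}\<close>, so it lies above its chord from
  \<open>0\<close> to \<open>pi / 2\<close>.\<close>

lemma jordan_sin_lower:
  fixes x :: real
  assumes "0 \<le> x" "x \<le> pi / 2"
  shows "2 / pi * x \<le> sin x"
proof -
  have "convex_on {0..pi} (\<lambda>x. - sin x)"
  proof (rule convex_on_realI[where f' = "\<lambda>x. - cos x"])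
    show "((\<lambda>x. - sin x) has_real_derivative - cos x) (at x)" for x :: real
      by (auto intro!: derivative_eq_intros)
    show "- cos x \<le> - cos y" if "x \<in> {0..pi}" "y \<in> {0..pi}" "x \<le> y" for x y :: real
      using that by (simp add: cos_monotone_0_pi_le)
  qed auto
  from convex_onD[OF this, of "2 / pi * x" 0 "pi / 2"] show ?thesis
    using assms by (simp add: field_simps)
qed

text \<open>With \<open>x = l / c\<close> the norm equals \<open>2 sin (pi x)\<close>, which by
  Jordan's inequality is at least \<open>4 x (1 - x)\<close>; the right-hand side is the partial
  fraction decomposition of the reciprocal.\<close>

lemma inverse_one_minus_ek_bound:
  assumes "0 < l" "l < c"
  shows "1 / norm (1 - ek c (- l)) \<le> c / 4 * (1 / l + 1 / real_of_int (c - l))"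
proof -
  define x where "x = real_of_int l / c"
  have x: "0 < x" "x < 1" using assms by (auto simp: x_def)
  have "norm (1 - ek c (- l)) = norm (exp (\<i> * of_real (- 2 * pi * x)) - 1)"
    by (simp add: ek_def unit_exp_def x_def norm_minus_commute mult_ac)
  also have "\<dots> = 2 * \<bar>sin (- pi * x)\<bar>" by (subst dist_exp_i_1) simp
  also have "\<dots> = 2 * sin (pi * x)" using x by (simp add: sin_ge_zero abs_of_nonneg)
  finally have n: "norm (1 - ek c (- l)) = 2 * sin (pi * x)" .
  have "2 * (x * (1 - x)) \<le> sin (pi * x)"
  proof (cases "x \<le> 1 / 2")
    case True
    have "2 * (x * (1 - x)) \<le> 2 / pi * (pi * x)" using x by simp
    also have "\<dots> \<le> sin (pi * x)" using True x by (intro jordan_sin_lower) auto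
    finally show ?thesis .
  next
    case False
    have "x * (1 - x) \<le> 1 * (1 - x)" using x by (intro mult_right_mono) auto
    then have "2 * (x * (1 - x)) \<le> 2 / pi * (pi * (1 - x))" by simp
    also have "\<dots> \<le> sin (pi * (1 - x))" using False x by (intro jordan_sin_lower) auto
    also have "sin (pi * (1 - x)) = sin (pi * x)" by (simp add: algebra_simps sin_diff)
    finally show ?thesis .
  qed
  then have "4 * (x * (1 - x)) \<le> norm (1 - ek c (- l))" using n by simp
  then have "1 / norm (1 - ek c (- l)) \<le> 1 / (4 * (x * (1 - x)))"
  proof (rule divide_left_mono)
    have "0 < x * (1 - x)" using x by simp
    then show "0 < norm (1 - ek c (- l)) * (4 * (x * (1 - x)))"
      using \<open>4 * (x * (1 - x)) \<le> norm (1 - ek c (- l))\<close> by (intro mult_pos_pos[of "norm (1 - ek c (- l))"]) linarith+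
  qed auto
  also have "\<dots> = 1 / 4 * (1 / x + 1 / (1 - x))" using x by (simp add: field_simps)
  also have "\<dots> = c / 4 * (1 / l + 1 / real_of_int (c - l))"
    using assms by (simp add: x_def field_simps)
  finally show ?thesis .
qed

text \<open>The two halves agree under \<open>c - l\<close> for \<open>l\<close>, leaving a harmonic
  sum. Its logarithmic growth is absorbed into \<open>c powr e\<close> times a convergent
  series.\<close>

lemma sum_inverse_one_minus_ek_bound:
  fixes c :: int and e :: real
  assumes "c > 0" "e > 0"
  shows "(\<Sum>l\<in>{0<..<c}. 1 / norm (1 - ek c (- l))) \<le>
    c / 2 * (c powr e * (\<Sum>\<^sub>\<infinity>l\<in>{l::int. l > 0}. real_of_int l powr - (1 + e)))"
proof -
  have "(\<Sum>l\<in>{0<..<c}. 1 / norm (1 - ek c (- l))) \<le> (\<Sum>l\<in>{0<..<c}. c / 4 * (1 / l + 1 / real_of_int (c - l)))"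
  proof (rule sum_mono)
    fix l assume l: "l \<in> {0<..<c}"
    show "1 / norm (1 - ek c (- l)) \<le> c / 4 * (1 / l + 1 / real_of_int (c - l))"
      by (rule inverse_one_minus_ek_bound) (use l in auto)
  qed
  also have "\<dots> = c / 4 * ((\<Sum>l\<in>{0<..<c}. 1 / l) + (\<Sum>l\<in>{0<..<c}. 1 / real_of_int (c - l)))"
    by (simp only: sum.distrib[symmetric] sum_distrib_left)
  also have "(\<Sum>l\<in>{0<..<c}. 1 / real_of_int (c - l)) = (\<Sum>l\<in>{0<..<c}. 1 / real_of_int l)"
    by (rule sum.reindex_bij_witness[of _ "\<lambda>l. c - l" "\<lambda>l. c - l"]) auto
  also have "c / 4 * ((\<Sum>l\<in>{0<..<c}. 1 / real_of_int l) + (\<Sum>l\<in>{0<..<c}. 1 / l)) = c / 2 * (\<Sum>l\<in>{0<..<c}. 1 / l)"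
    by simp
  also have "(\<Sum>l\<in>{0<..<c}. 1 / real_of_int l) \<le> (\<Sum>l\<in>{0<..<c}. c powr e * real_of_int l powr - (1 + e))"
  proof (rule sum_mono)
    fix l assume l: "l \<in> {0<..<c}"
    then have "1 / real_of_int l = l powr e * real_of_int l powr - (1 + e)"
      by (simp add: powr_add[symmetric] powr_minus field_simps)
    also have "\<dots> \<le> c powr e * real_of_int l powr - (1 + e)"
      using l assms by (intro mult_right_mono powr_mono2) auto
    finally show "1 / real_of_int l \<le> c powr e * real_of_int l powr - (1 + e)" .
  qed
  also have "\<dots> = c powr e * (\<Sum>l\<in>{0<..<c}. real_of_int l powr - (1 + e))"
    by (simp add: sum_distrib_left)
  also have "(\<Sum>l\<in>{0<..<c}. real_of_int l powr - (1 + e)) \<le> (\<Sum>\<^sub>\<infinity>l\<in>{l::int. l > 0}. real_of_int l powr - (1 + e))"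
    using assms by (intro finite_sum_le_infsum summable_on_pos_int_powr) auto
  finally show ?thesis using assms by (simp add: mult_left_mono)
qed

text \<open>For \<open>\<gamma>\<close> with lower row \<open>sqrt Q * (c, d)\<close> one has \<open>\<gamma>\<tau> = x / c + row_point Q \<tau> c d\<close>, where
  \<open>Q d x = 1\<close> modulo \<open>c\<close>; \<open>phase\<close> is the contribution of \<open>x / c\<close> to the seed at \<open>\<gamma>\<tau>\<close>.\<close>

definition phase :: "int \<Rightarrow> nat \<Rightarrow> int \<Rightarrow> int \<Rightarrow> complex" where
  "phase Q n c d = ek c (- (int n * minv c (Q * d)))"

lemma norm_phase [simp]: "norm (phase Q n c d) = 1"
  by (simp add: phase_def)

text \<open>Finite Fourier expansion of the phase, extended by zero to the residues that are not
  units; its Fourier coefficients are Kloosterman sums.\<close>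

lemma phase_fourier:
  assumes "c > 0" "coprime c Q"
  shows "(if coprime c d then phase Q n c d else 0) =
    (\<Sum>l\<in>{0..<c}. kloosterman c (- (int n * minv c Q)) l * ek c (- l * d)) / of_int c"
proof -
  let ?m = "- (int n * minv c Q)"
  have "(\<Sum>l\<in>{0..<c}. kloosterman c ?m l * ek c (- l * d)) =
    (\<Sum>l\<in>{0..<c}. \<Sum>r\<in>units_mod c. ek c (?m * minv c r) * ek c (l * (r - d)))"
    unfolding kloosterman_def sum_distrib_right
    by (intro sum.cong refl) (simp add: ek_add[symmetric] algebra_simps)
  also have "\<dots> = (\<Sum>r\<in>units_mod c. \<Sum>l\<in>{0..<c}. ek c (?m * minv c r) * ek c (l * (r - d)))"
    by (rule sum.swap)
  also have "\<dots> = (\<Sum>r\<in>units_mod c. if c dvd r - d then ek c (?m * minv c r) * of_int c else 0)"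
    by (intro sum.cong refl) (simp add: sum_distrib_left[symmetric] sum_ek assms)
  also have "\<dots> = (\<Sum>r\<in>units_mod c. if r = d mod c then ek c (?m * minv c r) * of_int c else 0)"
  proof (intro sum.cong refl)
    fix r assume "r \<in> units_mod c"
    then have "c dvd r - d \<longleftrightarrow> r = d mod c"
      by (auto simp: units_mod_def mod_eq_dvd_iff[symmetric])
    then show "(if c dvd r - d then ek c (?m * minv c r) * of_int c else 0) =
      (if r = d mod c then ek c (?m * minv c r) * of_int c else 0)" by simp
  qed
  also have "\<dots> = (if d mod c \<in> units_mod c then ek c (?m * minv c (d mod c)) * of_int c else 0)"
    by (subst sum.delta) auto
  also have "d mod c \<in> units_mod c \<longleftrightarrow> coprime c d"
    using assms by (simp add: units_mod_def coprime_commute)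
  also have "(if coprime c d then ek c (?m * minv c (d mod c)) * of_int c else 0) =
    (if coprime c d then phase Q n c d else 0) * of_int c"
  proof (cases "coprime c d")
    case True
    have "[minv c (d mod c) = minv c d] (mod c)"
      by (rule minv_cong_arg) (use assms True in \<open>auto simp: coprime_commute\<close>)
    moreover have "[minv c (Q * d) = minv c Q * minv c d] (mod c)"
      using assms True by (intro minv_mult_cong) (auto simp: coprime_commute)
    ultimately have "[minv c (Q * d) = minv c Q * minv c (d mod c)] (mod c)"
      by (meson cong_mult cong_refl cong_sym cong_trans)
    then have "[- (int n * minv c (Q * d)) = - (int n * (minv c Q * minv c (d mod c)))] (mod c)"
      by (simp add: cong_minus_minus_iff cong_mult)
    then have "phase Q n c d = ek c (?m * minv c (d mod c))"
      unfolding phase_def using assms by (subst ek_cong) (auto simp: algebra_simps)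
    then show ?thesis using True by simp
  qed simp
  finally show ?thesis using assms by simp
qed

text \<open>The inverse of \<open>Q\<close> is a unit modulo \<open>c\<close>, so the gcd in
  \<open>kloosterman_bound4\<close> is \<open>gcd n c\<close>, which is at most \<open>n\<close>.
  The bound is thus uniform in \<open>l\<close> and explicit in \<open>c\<close>.\<close>

lemma kloosterman_phase_bound:
  assumes "c > 0" "coprime c Q" "n > 0"
  shows "norm (kloosterman c (- (int n * minv c Q)) l) \<le> 2 * real n * (c powr (3/4) * card (divs c))"
proof -
  have "coprime (minv c Q) c"
    using coprime_modular_inverse[of Q c] assms by (simp add: coprime_commute)
  then have "gcd (- (int n * minv c Q)) c = gcd (int n) c"
    by (simp add: gcd_mult_left_right_cancel coprime_commute)
  also have "\<dots> \<le> int n" using assms by (intro zdvd_imp_le) auto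
  finally have g: "gcd (- (int n * minv c Q)) c \<le> int n" .
  have D: "real (card (divs c)) \<ge> 1"
  proof -
    have "1 \<in> divs c" by (simp add: divs_def)
    then show ?thesis using finite_divs[OF assms(1)] by (simp add: Suc_le_eq card_gt_0_iff) auto
  qed
  have "norm (kloosterman c (- (int n * minv c Q)) l) ^ 4 \<le> of_int (2 * gcd (- (int n * minv c Q)) c * c ^ 3 * int (card (divs c)) ^ 3)"
    by (rule kloosterman_bound4[OF assms(1)])
  also have "\<dots> \<le> of_int (2 * int n * c ^ 3 * int (card (divs c)) ^ 3)"
    unfolding of_int_le_iff using assms g by (intro mult_right_mono mult_left_mono) auto
  also have "\<dots> = real (2 * n) * c ^ 3 * real (card (divs c)) ^ 3" by simp
  \<comment> \<open>Generous fourth powers of \<open>2 n\<close> and of the divisor count, both at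
    least 1, make the fourth root elementary.\<close>
  also have "\<dots> \<le> real (2 * n) ^ 4 * c ^ 3 * real (card (divs c)) ^ 4"
  proof (intro mult_mono)
    show "real (2 * n) \<le> real (2 * n) ^ 4" using assms by (intro self_le_power) auto
    show "real (card (divs c)) ^ 3 \<le> real (card (divs c)) ^ 4" using D by (intro power_increasing) auto
  qed (use assms in auto)
  also have "\<dots> = (2 * real n * (c powr (3/4) * card (divs c))) ^ 4"
  proof -
    have "(real_of_int c powr (3/4)) ^ 4 = real_of_int c ^ 3"
      using assms by (simp add: powr_power)
    then show ?thesis by (simp add: power_mult_distrib)
  qed
  finally show ?thesis by (subst (asm) power_mono_iff) auto
qed

text \<open>By \<open>phase_fourier\<close> the sum is a combination of the character sums
  \<open>T l\<close> of \<open>g\<close>. The frequency \<open>l = 0\<close> is bounded by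
  \<open>G\<close>. For the others, summation by parts gives \<open>(1 - ek c (- l)) * T l\<close>
  as a character sum of the differences of \<open>g\<close>, hence the bound by the variation
  \<open>V\<close>. Only the Kloosterman bound and the harmonic sum depend on the arithmetic of
  \<open>c\<close>.\<close>

lemma incomplete_phase_sum_bound:
  fixes g :: "int \<Rightarrow> complex" and G V :: real
  assumes c: "c > 0" "coprime c Q" and n: "n > 0" and e: "e > 0"
    and G: "((\<lambda>d. norm (g d)) has_sum G) UNIV"
    and V: "(\<lambda>d. norm (g d - g (d - 1))) summable_on UNIV" "(\<Sum>\<^sub>\<infinity>d. norm (g d - g (d - 1))) \<le> V"
  shows "norm (\<Sum>\<^sub>\<infinity>d\<in>{d. coprime c d}. phase Q n c d * g d) \<le>
    2 * real n * (c powr (3/4) * card (divs c)) * (G / c +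
      V / 2 * c powr e * (\<Sum>\<^sub>\<infinity>l\<in>{l::int. l > 0}. real_of_int l powr - (1 + e)))"
proof -
  define B where "B = 2 * real n * (c powr (3/4) * card (divs c))"
  define K where "K = kloosterman c (- (int n * minv c Q))"
  define T where "T l = (\<Sum>\<^sub>\<infinity>d. ek c (- l * d) * g d)" for l
  have sg: "(\<lambda>d. norm (g d)) summable_on UNIV" using G by (rule has_sum_imp_summable)
  have sT: "(\<lambda>d. ek c (- l * d) * g d) summable_on UNIV" for l
    by (rule abs_summable_summable) (use sg in \<open>simp add: norm_mult\<close>)
  have "(\<Sum>\<^sub>\<infinity>d\<in>{d. coprime c d}. phase Q n c d * g d) =
    (\<Sum>\<^sub>\<infinity>d. (if coprime c d then phase Q n c d else 0) * g d)"
    by (rule infsum_cong_neutral) auto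
  also have "\<dots> = (\<Sum>\<^sub>\<infinity>d. \<Sum>l\<in>{0..<c}. K l / of_int c * (ek c (- l * d) * g d))"
    unfolding phase_fourier[OF c] K_def sum_divide_distrib sum_distrib_right by (simp add: mult_ac)
  also have "\<dots> = (\<Sum>l\<in>{0..<c}. K l / of_int c * T l)"
    unfolding T_def by (intro infsumI has_sum_sum has_sum_cmult_right has_sum_infsum sT) simp
  finally have eq: "(\<Sum>\<^sub>\<infinity>d\<in>{d. coprime c d}. phase Q n c d * g d) = (\<Sum>l\<in>{0..<c}. K l / of_int c * T l)" .
  have T0: "norm (T 0) \<le> G"
  proof -
    have "norm (T 0) \<le> (\<Sum>\<^sub>\<infinity>d. norm (g d))" unfolding T_def using sg by (simp add: norm_infsum_bound)
    then show ?thesis using G by (simp add: infsumI)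
  qed
  have Tl: "norm (T l) \<le> V * (1 / norm (1 - ek c (- l)))" if l: "l \<in> {0<..<c}" for l
  proof -
    have ne: "ek c (- l) \<noteq> 1" using l by (auto simp: ek_eq_1_iff zdvd_not_zless)
    have "((\<lambda>d. ek c (- l * d) * g d) has_sum T l) UNIV" unfolding T_def using sT by simp
    then have s1: "((\<lambda>d. ek c (- l) * (ek c (- l * d) * g d)) has_sum ek c (- l) * T l) UNIV"
      by (rule has_sum_cmult_right)
    \<comment> \<open>Multiplication by the character value at \<open>1\<close> is a shift of
      \<open>d\<close> by one; subtracting the shifted sum is the summation by parts.\<close>
    have "((\<lambda>d. ek c (- l * d) * g (d - 1)) has_sum ek c (- l) * T l) UNIV"
    proof (rule has_sum_reindex_bij_witness[of UNIV "\<lambda>d. d + 1" "\<lambda>d. d - 1", THEN iffD2, OF _ _ _ _ _ _ s1])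
      fix d :: int
      show "ek c (- l) * (ek c (- l * (d - 1)) * g (d - 1)) = ek c (- l * d) * g (d - 1)"
        by (simp add: ek_add[symmetric] algebra_simps)
    qed auto
    from has_sum_diff[OF has_sum_infsum[OF sT[of l]] this]
    have "((\<lambda>d. ek c (- l * d) * (g d - g (d - 1))) has_sum (T l - ek c (- l) * T l)) UNIV"
      by (simp add: T_def algebra_simps)
    then have "norm (T l - ek c (- l) * T l) \<le> (\<Sum>\<^sub>\<infinity>d. norm (g d - g (d - 1)))"
      by (rule norm_infsum_le[OF _ has_sum_infsum[OF V(1)]]) (simp add: norm_mult)
    also have "\<dots> \<le> V" by (rule V(2))
    also have "T l - ek c (- l) * T l = T l * (1 - ek c (- l))" by (simp add: algebra_simps)
    finally have "norm (T l) * norm (1 - ek c (- l)) \<le> V" by (simp add: norm_mult)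
    then show ?thesis using ne by (simp add: field_simps)
  qed
  have V0: "V \<ge> 0" using V(2) by (meson infsum_nonneg norm_ge_zero order_trans)
  have B: "norm (K l) \<le> B" for l
    unfolding K_def B_def by (rule kloosterman_phase_bound) (use c n in auto)
  have B0: "B \<ge> 0" using B[of 0] norm_ge_zero order_trans by blast
  let ?Z = "\<Sum>\<^sub>\<infinity>l\<in>{l::int. l > 0}. real_of_int l powr - (1 + e)"
  have "{0..<c} = insert 0 {0<..<c}" using c by auto
  then have "(\<Sum>l\<in>{0..<c}. norm (T l)) = norm (T 0) + (\<Sum>l\<in>{0<..<c}. norm (T l))" by simp
  also have "\<dots> \<le> G + (\<Sum>l\<in>{0<..<c}. V * (1 / norm (1 - ek c (- l))))"
    by (intro add_mono T0 sum_mono Tl)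
  also have "(\<Sum>l\<in>{0<..<c}. V * (1 / norm (1 - ek c (- l)))) = V * (\<Sum>l\<in>{0<..<c}. 1 / norm (1 - ek c (- l)))"
    by (simp add: sum_distrib_left)
  also have "\<dots> \<le> V * (c / 2 * (c powr e * (\<Sum>\<^sub>\<infinity>l\<in>{l::int. l > 0}. real_of_int l powr - (1 + e))))"
    by (intro mult_left_mono sum_inverse_one_minus_ek_bound V0 c e)
  finally have S: "(\<Sum>l\<in>{0..<c}. norm (T l)) \<le> G + V * (c / 2 * (c powr e * ?Z))" by simp
  have "norm (\<Sum>l\<in>{0..<c}. K l / of_int c * T l) \<le> (\<Sum>l\<in>{0..<c}. B / c * norm (T l))"
    using c by (intro sum_norm_le) (auto simp: norm_mult norm_divide intro!: mult_right_mono divide_right_mono B)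
  also have "\<dots> = B / c * (\<Sum>l\<in>{0..<c}. norm (T l))" by (simp add: sum_distrib_left)
  also have "\<dots> \<le> B / c * (G + V * (c / 2 * (c powr e * ?Z)))"
    using B0 c by (intro mult_left_mono S) auto
  also have "\<dots> = B * (G / c + V / 2 * c powr e * (\<Sum>\<^sub>\<infinity>l\<in>{l::int. l > 0}. real_of_int l powr - (1 + e)))"
    using c by (simp add: field_simps)
  finally show ?thesis unfolding eq B_def .
qed

section \<open>Lattice powers and the rows of the Kloosterman zeta function\<close>

text \<open>Up to a factor that depends only on \<open>\<tau>\<close>, \<open>Q\<close> and
  \<open>s\<close>, the \<open>s\<close>-th power of the imaginary part of the transformed point,
  see \<open>Im_row_point_powr\<close>.\<close>

definition latpow :: "complex \<Rightarrow> int \<Rightarrow> int \<Rightarrow> complex \<Rightarrow> complex" where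
  "latpow \<tau> c d s = of_real (norm (of_int c * \<tau> + of_int d)) powr (- 2 * s)"

lemma norm_latpow: "norm (latpow \<tau> c d s) = norm (of_int c * \<tau> + of_int d) powr (- 2 * Re s)"
  unfolding latpow_def by (subst norm_powr_real_powr) auto

lemma cball_halfplane:
  assumes "s \<in> cball z r"
  shows "Re z - r \<le> Re s" "Re s \<le> Re z + r" "norm s \<le> norm z + r"
proof -
  have "norm (s - z) \<le> r" using assms by (simp add: dist_norm norm_minus_commute)
  then show "Re z - r \<le> Re s" "Re s \<le> Re z + r" "norm s \<le> norm z + r"
    using abs_Re_le_cmod[of "s - z"] norm_triangle_ineq2[of s z] by auto
qed

text \<open>Uniform over exponents in \<open>{a0..a1}\<close>: the worst case is the largest
  exponent for the small number \<open>\<kappa>\<close> and the smallest one for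
  \<open>x \<ge> 1\<close>.\<close>

lemma powr_scaled_bound:
  fixes N \<kappa> x a a0 a1 :: real
  assumes "0 < \<kappa>" "\<kappa> \<le> 1" "x \<ge> 1" "\<kappa> * x \<le> N" "0 \<le> a0" "a0 \<le> a" "a \<le> a1"
  shows "N powr - a \<le> \<kappa> powr - a1 * x powr - a0"
proof -
  have "N powr - a \<le> (\<kappa> * x) powr - a"
    using assms by (intro powr_mono2') auto
  also have "\<dots> = \<kappa> powr - a * x powr - a" using assms by (simp add: powr_mult)
  also have "\<dots> \<le> \<kappa> powr - a1 * x powr - a0"
    using assms by (intro mult_mono powr_mono powr_mono') auto
  finally show ?thesis .
qed

text \<open>Mean value inequality on the ray of reals from \<open>m\<close> onwards, where the bound
  for the derivative is largest at \<open>m\<close>.\<close>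

lemma real_powr_diff_bound:
  fixes x y m :: real and s :: complex
  assumes "0 < m" "m \<le> x" "m \<le> y" "Re s \<ge> 0"
  shows "norm (of_real x powr (- 2 * s) - of_real y powr (- 2 * s)) \<le>
    2 * norm s * m powr (- 2 * Re s - 1) * \<bar>x - y\<bar>"
proof -
  let ?S = "complex_of_real ` {m..}"
  have "norm (of_real x powr (- 2 * s) - of_real y powr (- 2 * s)) \<le>
    2 * norm s * m powr (- 2 * Re s - 1) * norm (complex_of_real x - of_real y)"
  proof (rule field_differentiable_bound)
    show "convex ?S" by (intro convex_linear_image) (auto simp: linear_iff scaleR_conv_of_real)
    fix z assume "z \<in> ?S"
    then obtain t where t: "z = of_real t" "t \<ge> m" by auto
    then have "z \<notin> \<real>\<^sub>\<le>\<^sub>0" using assms by (auto simp: complex_nonpos_Reals_iff)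
    then show "((\<lambda>z. z powr (- 2 * s)) has_field_derivative (- 2 * s) * z powr (- 2 * s - 1)) (at z within ?S)"
      by (rule has_field_derivative_powr[THEN has_field_derivative_at_within])
    have "norm (z powr (- 2 * s - 1)) = t powr (- 2 * Re s - 1)"
      using t assms by (subst norm_powr_real_powr) auto
    also have "\<dots> \<le> m powr (- 2 * Re s - 1)" using t assms by (intro powr_mono2') auto
    finally show "norm (- 2 * s * z powr (- 2 * s - 1)) \<le> 2 * norm s * m powr (- 2 * Re s - 1)"
      by (simp add: norm_mult mult_left_mono)
  qed (use assms in auto)
  also have "norm (complex_of_real x - of_real y) = \<bar>x - y\<bar>"
    by (simp flip: of_real_diff)
  finally show ?thesis .
qed

lemma latpow_bound:
  assumes "Im \<tau> > 0" "\<sigma>\<^sub>0 \<ge> 0"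
  obtains K where "K > 0" "\<And>c d s. c > 0 \<Longrightarrow> \<sigma>\<^sub>0 \<le> Re s \<Longrightarrow> Re s \<le> \<sigma>\<^sub>1 \<Longrightarrow>
    norm (latpow \<tau> c d s) \<le> K * real_of_int (c + \<bar>d\<bar>) powr (- 2 * \<sigma>\<^sub>0)"
proof -
  obtain \<kappa> where \<kappa>: "\<kappa> > 0" "\<kappa> \<le> 1" "\<And>c d :: int. c > 0 \<Longrightarrow> \<kappa> * real_of_int (c + \<bar>d\<bar>) \<le> norm (of_int c * \<tau> + of_int d)"
    using lattice_lower_bound[OF assms(1)] by blast
  have "norm (latpow \<tau> c d s) \<le> \<kappa> powr (- 2 * \<sigma>\<^sub>1) * real_of_int (c + \<bar>d\<bar>) powr (- 2 * \<sigma>\<^sub>0)"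
    if "c > 0" "\<sigma>\<^sub>0 \<le> Re s" "Re s \<le> \<sigma>\<^sub>1" for c d :: int and s
    unfolding norm_latpow
    using powr_scaled_bound[OF \<kappa>(1,2) _ \<kappa>(3)[OF that(1)], of d "2 * \<sigma>\<^sub>0" "2 * Re s" "2 * \<sigma>\<^sub>1"] that assms
    by auto
  then show ?thesis using that[of "\<kappa> powr (- 2 * \<sigma>\<^sub>1)"] \<kappa>(1) by auto
qed

text \<open>Differencing in \<open>d\<close> gains one power of \<open>c + \<bar>d\<bar>\<close>;
  this is the variation that enters \<open>incomplete_phase_sum_bound\<close>.\<close>

lemma latpow_diff_bound:
  assumes "Im \<tau> > 0" "\<sigma>\<^sub>0 \<ge> 0" "R > 0"
  obtains K where "K > 0" "\<And>c d s. c > 0 \<Longrightarrow> \<sigma>\<^sub>0 \<le> Re s \<Longrightarrow> Re s \<le> \<sigma>\<^sub>1 \<Longrightarrow> norm s \<le> R \<Longrightarrow>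
    norm (latpow \<tau> c d s - latpow \<tau> c (d - 1) s) \<le> K * real_of_int (c + \<bar>d\<bar>) powr (- (2 * \<sigma>\<^sub>0 + 1))"
proof -
  obtain \<kappa> where \<kappa>: "\<kappa> > 0" "\<kappa> \<le> 1" "\<And>c d :: int. c > 0 \<Longrightarrow> \<kappa> * real_of_int (c + \<bar>d\<bar>) \<le> norm (of_int c * \<tau> + of_int d)"
    using lattice_lower_bound[OF assms(1)] by blast
  have "norm (latpow \<tau> c d s - latpow \<tau> c (d - 1) s) \<le>
     2 * R * (\<kappa> / 2) powr (- (2 * \<sigma>\<^sub>1 + 1)) * real_of_int (c + \<bar>d\<bar>) powr (- (2 * \<sigma>\<^sub>0 + 1))"
    if *: "c > 0" "\<sigma>\<^sub>0 \<le> Re s" "Re s \<le> \<sigma>\<^sub>1" "norm s \<le> R" for c d :: int and s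
  proof -
    \<comment> \<open>Since \<open>c + \<bar>d\<bar>\<close> is at most twice
      \<open>c + \<bar>d - 1\<bar>\<close>, half of \<open>\<kappa>\<close> gives a common lower
      bound for the two neighbouring norms.\<close>
    define m where "m = \<kappa> / 2 * real_of_int (c + \<bar>d\<bar>)"
    let ?N = "\<lambda>d. norm (of_int c * \<tau> + of_int d)"
    have "real_of_int (c + \<bar>d\<bar>) \<ge> 1" using * by simp
    then have m: "m > 0" using \<kappa> by (simp add: m_def)
    have m1: "m \<le> ?N d"
    proof -
      have "m \<le> \<kappa> * real_of_int (c + \<bar>d\<bar>)" using \<kappa> * by (simp add: m_def)
      then show ?thesis using \<kappa>(3)[OF *(1), of d] by linarith
    qed
    have m2: "m \<le> ?N (d - 1)"
    proof -
      have "c + \<bar>d\<bar> \<le> 2 * (c + \<bar>d - 1\<bar>)" using *(1) by arith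
      then have "real_of_int (c + \<bar>d\<bar>) \<le> 2 * real_of_int (c + \<bar>d - 1\<bar>)" by linarith
      then have "m \<le> \<kappa> / 2 * (2 * real_of_int (c + \<bar>d - 1\<bar>))" unfolding m_def using \<kappa> by (intro mult_left_mono) auto
      also have "\<dots> = \<kappa> * real_of_int (c + \<bar>d - 1\<bar>)" by simp
      also have "\<dots> \<le> ?N (d - 1)" by (rule \<kappa>(3)[OF *(1)])
      finally show ?thesis .
    qed
    have "\<bar>?N d - ?N (d - 1)\<bar> \<le> norm ((of_int c * \<tau> + of_int d) - (of_int c * \<tau> + of_int (d - 1)))"
      by (rule norm_triangle_ineq3)
    then have diff: "\<bar>?N d - ?N (d - 1)\<bar> \<le> 1" by simp
    have "norm (latpow \<tau> c d s - latpow \<tau> c (d - 1) s) \<le> 2 * norm s * m powr (- 2 * Re s - 1) * \<bar>?N d - ?N (d - 1)\<bar>"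
      unfolding latpow_def using m m1 m2 * assms by (intro real_powr_diff_bound) auto
    also have "\<dots> \<le> 2 * R * ((\<kappa> / 2) powr (- (2 * \<sigma>\<^sub>1 + 1)) * real_of_int (c + \<bar>d\<bar>) powr (- (2 * \<sigma>\<^sub>0 + 1))) * 1"
    proof (intro mult_mono diff)
      have eq: "- 2 * Re s - 1 = - (2 * Re s + 1)" by simp
      have "m powr - (2 * Re s + 1) \<le> (\<kappa> / 2) powr (- (2 * \<sigma>\<^sub>1 + 1)) * real_of_int (c + \<bar>d\<bar>) powr (- (2 * \<sigma>\<^sub>0 + 1))"
        using \<kappa> * assms by (intro powr_scaled_bound) (auto simp: m_def)
      then show "m powr (- 2 * Re s - 1) \<le> (\<kappa> / 2) powr (- (2 * \<sigma>\<^sub>1 + 1)) * real_of_int (c + \<bar>d\<bar>) powr (- (2 * \<sigma>\<^sub>0 + 1))"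
        unfolding eq .
    qed (use * assms in auto)
    finally show ?thesis by simp
  qed
  then show ?thesis using that[of "2 * R * (\<kappa> / 2) powr (- (2 * \<sigma>\<^sub>1 + 1))"] \<kappa>(1) assms by auto
qed

lemma summable_on_lattice_row:
  assumes "c > 0" "a \<ge> 0" "b > 1"
  shows "(\<lambda>d. real_of_int (c + \<bar>d\<bar>) powr - (a + b)) summable_on UNIV"
    "(\<Sum>\<^sub>\<infinity>d. real_of_int (c + \<bar>d\<bar>) powr - (a + b)) \<le>
       real_of_int c powr - a * (\<Sum>\<^sub>\<infinity>d::int. (1 + \<bar>real_of_int d\<bar>) powr - b)"
proof -
  have le: "real_of_int (c + \<bar>d\<bar>) powr - (a + b) \<le> real_of_int c powr - a * (1 + \<bar>real_of_int d\<bar>) powr - b" for d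
    using assms by (intro split_powr_bound) auto
  have s: "(\<lambda>d::int. real_of_int c powr - a * (1 + \<bar>real_of_int d\<bar>) powr - b) summable_on UNIV"
    by (intro summable_on_cmult_right summable_on_int_powr assms)
  show 1: "(\<lambda>d. real_of_int (c + \<bar>d\<bar>) powr - (a + b)) summable_on UNIV"
    by (rule summable_on_comparison_test[OF s le]) auto
  have "(\<Sum>\<^sub>\<infinity>d. real_of_int (c + \<bar>d\<bar>) powr - (a + b)) \<le> (\<Sum>\<^sub>\<infinity>d::int. real_of_int c powr - a * (1 + \<bar>real_of_int d\<bar>) powr - b)"
    by (rule infsum_mono[OF 1 s le])
  then show "(\<Sum>\<^sub>\<infinity>d. real_of_int (c + \<bar>d\<bar>) powr - (a + b)) \<le>
       real_of_int c powr - a * (\<Sum>\<^sub>\<infinity>d::int. (1 + \<bar>real_of_int d\<bar>) powr - b)"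
    by (simp add: infsum_cmult_right')
qed

text \<open>The inner sum of the Kloosterman zeta function at a fixed \<open>c\<close>.\<close>

definition kzeta_row :: "int \<Rightarrow> nat \<Rightarrow> complex \<Rightarrow> int \<Rightarrow> complex \<Rightarrow> complex" where
  "kzeta_row Q n \<tau> c s = (\<Sum>\<^sub>\<infinity>d\<in>{d. coprime c d}. phase Q n c d * latpow \<tau> c d s)"

lemma latpow_row_summable:
  assumes "Im \<tau> > 0" "c > 0" "Re s > 1 / 2"
  shows "(\<lambda>d. norm (latpow \<tau> c d s)) summable_on A"
proof -
  have "Re s \<ge> 0" using assms by simp
  then obtain K where "K > 0" and K': "\<And>c d s'. c > 0 \<Longrightarrow> Re s \<le> Re s' \<Longrightarrow> Re s' \<le> Re s \<Longrightarrow>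
    norm (latpow \<tau> c d s') \<le> K * real_of_int (c + \<bar>d\<bar>) powr (- 2 * Re s)"
    using latpow_bound[OF assms(1), of "Re s" "Re s"] by blast
  have K: "norm (latpow \<tau> c d s) \<le> K * real_of_int (c + \<bar>d\<bar>) powr (- 2 * Re s)" for d
    by (rule K') (use assms in auto)
  have "(\<lambda>d. real_of_int (c + \<bar>d\<bar>) powr - (0 + 2 * Re s)) summable_on UNIV"
    using assms by (intro summable_on_lattice_row) auto
  then have "(\<lambda>d. K * real_of_int (c + \<bar>d\<bar>) powr (- 2 * Re s)) summable_on UNIV"
    by (intro summable_on_cmult_right) simp
  then have "(\<lambda>d. norm (latpow \<tau> c d s)) summable_on UNIV"
    by (rule summable_on_comparison_test) (use K in auto)
  then show ?thesis by (rule summable_on_subset_banach) auto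
qed

text \<open>At \<open>Re s = 9/10\<close> the exponent \<open>9/5\<close> is split as
  \<open>79/100 + 101/100\<close>, the second part paying for the sum over \<open>d\<close>. So a
  row has total size \<open>c\<close> to \<open>- 79/100\<close> and variation \<open>c\<close> to
  \<open>- 179/100\<close>. With the factor \<open>3/4\<close> from the Kloosterman sums and
  \<open>e = 1/100\<close>, the two contributions have exponents \<open>- 104/100\<close> and
  \<open>- 103/100\<close>, both below \<open>- 1\<close>.\<close>

lemma kzeta_row_bound:
  assumes "Im \<tau> > 0" "n > 0" "R > 0"
  obtains K where "K > 0" "\<And>c s. c > 0 \<Longrightarrow> coprime c Q \<Longrightarrow> 9 / 10 \<le> Re s \<Longrightarrow> Re s \<le> \<sigma> \<Longrightarrow> norm s \<le> R \<Longrightarrow>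
    norm (kzeta_row Q n \<tau> c s) \<le> K * (real (card (divs c)) * real_of_int c powr - (103 / 100))"
proof -
  obtain K1 where K1: "K1 > 0" "\<And>c d s. c > 0 \<Longrightarrow> 9 / 10 \<le> Re s \<Longrightarrow> Re s \<le> \<sigma> \<Longrightarrow>
    norm (latpow \<tau> c d s) \<le> K1 * real_of_int (c + \<bar>d\<bar>) powr (- 2 * (9 / 10))"
    using latpow_bound[OF assms(1), of "9 / 10" \<sigma>] by auto
  obtain K2 where K2: "K2 > 0" "\<And>c d s. c > 0 \<Longrightarrow> 9 / 10 \<le> Re s \<Longrightarrow> Re s \<le> \<sigma> \<Longrightarrow> norm s \<le> R \<Longrightarrow>
    norm (latpow \<tau> c d s - latpow \<tau> c (d - 1) s) \<le> K2 * real_of_int (c + \<bar>d\<bar>) powr (- (2 * (9 / 10) + 1))"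
    using latpow_diff_bound[OF assms(1) _ assms(3), of "9 / 10" \<sigma>] by auto
  define Z1 where "Z1 = (\<Sum>\<^sub>\<infinity>d::int. (1 + \<bar>real_of_int d\<bar>) powr - (101 / 100))"
  define Z2 where "Z2 = (\<Sum>\<^sub>\<infinity>l\<in>{l::int. l > 0}. real_of_int l powr - (1 + 1 / 100))"
  have Z: "Z1 \<ge> 0" "Z2 \<ge> 0" unfolding Z1_def Z2_def by (auto intro!: infsum_nonneg)
  define K where "K = 2 * real n * (K1 * Z1 + K2 * Z1 / 2 * Z2) + 1"
  have bound: "norm (kzeta_row Q n \<tau> c s) \<le> K * (real (card (divs c)) * real_of_int c powr - (103 / 100))"
    if c: "c > 0" "coprime c Q" and s: "9 / 10 \<le> Re s" "Re s \<le> \<sigma>" "norm s \<le> R" for c s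
  proof -
    define x where "x = real_of_int c"
    have x: "x \<ge> 1" using c by (simp add: x_def)
    define G where "G = (\<Sum>\<^sub>\<infinity>d. norm (latpow \<tau> c d s))"
    have sG: "(\<lambda>d. norm (latpow \<tau> c d s)) summable_on UNIV"
      by (rule latpow_row_summable) (use assms c s in auto)
    have row1: "(\<lambda>d. real_of_int (c + \<bar>d\<bar>) powr - (79 / 100 + 101 / 100)) summable_on UNIV"
      "(\<Sum>\<^sub>\<infinity>d. real_of_int (c + \<bar>d\<bar>) powr - (79 / 100 + 101 / 100)) \<le> x powr - (79 / 100) * Z1"
      using summable_on_lattice_row[OF c(1), of "79 / 100" "101 / 100"] by (simp_all add: Z1_def x_def)
    have row2: "(\<lambda>d. real_of_int (c + \<bar>d\<bar>) powr - (179 / 100 + 101 / 100)) summable_on UNIV"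
      "(\<Sum>\<^sub>\<infinity>d. real_of_int (c + \<bar>d\<bar>) powr - (179 / 100 + 101 / 100)) \<le> x powr - (179 / 100) * Z1"
      using summable_on_lattice_row[OF c(1), of "179 / 100" "101 / 100"] by (simp_all add: Z1_def x_def)
    have "G \<le> (\<Sum>\<^sub>\<infinity>d. K1 * real_of_int (c + \<bar>d\<bar>) powr - (79 / 100 + 101 / 100))"
      unfolding G_def using K1(2)[OF c(1) s(1,2)] by (intro infsum_mono sG summable_on_cmult_right row1) auto
    also have "\<dots> \<le> K1 * (x powr - (79 / 100) * Z1)"
      unfolding infsum_cmult_right' using K1(1) row1(2) by (intro mult_left_mono) auto
    finally have G: "G \<le> K1 * (x powr - (79 / 100) * Z1)" .
    have d1: "norm (latpow \<tau> c d s - latpow \<tau> c (d - 1) s) \<le> K2 * real_of_int (c + \<bar>d\<bar>) powr - (179 / 100 + 101 / 100)" for d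
      using K2(2)[OF c(1) s] by simp
    have sV: "(\<lambda>d. norm (latpow \<tau> c d s - latpow \<tau> c (d - 1) s)) summable_on UNIV"
      by (rule summable_on_comparison_test[OF summable_on_cmult_right[OF row2(1)] d1]) auto
    have "(\<Sum>\<^sub>\<infinity>d. norm (latpow \<tau> c d s - latpow \<tau> c (d - 1) s)) \<le> (\<Sum>\<^sub>\<infinity>d. K2 * real_of_int (c + \<bar>d\<bar>) powr - (179 / 100 + 101 / 100))"
      by (rule infsum_mono[OF sV summable_on_cmult_right[OF row2(1)] d1])
    also have "\<dots> \<le> K2 * (x powr - (179 / 100) * Z1)"
      unfolding infsum_cmult_right' using K2(1) row2(2) by (intro mult_left_mono) auto
    finally have V: "(\<Sum>\<^sub>\<infinity>d. norm (latpow \<tau> c d s - latpow \<tau> c (d - 1) s)) \<le> K2 * (x powr - (179 / 100) * Z1)" .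
    have "norm (kzeta_row Q n \<tau> c s) \<le> 2 * real n * (x powr (3/4) * card (divs c)) * (G / x +
      (K2 * (x powr - (179 / 100) * Z1)) / 2 * x powr (1/100) * Z2)"
      unfolding kzeta_row_def Z2_def x_def
      by (rule incomplete_phase_sum_bound) (use c assms sG sV V in \<open>auto simp: G_def x_def\<close>)
    also have "\<dots> \<le> 2 * real n * (x powr (3/4) * card (divs c)) * (K1 * (x powr - (79 / 100) * Z1) / x +
      (K2 * (x powr - (179 / 100) * Z1)) / 2 * x powr (1/100) * Z2)"
      using x by (intro mult_left_mono add_right_mono divide_right_mono G) auto
    also have "\<dots> = 2 * real n * card (divs c) * (K1 * Z1 * (x powr (3/4) * x powr - (79 / 100) / x) +
      K2 * Z1 / 2 * Z2 * (x powr (3/4) * x powr - (179 / 100) * x powr (1/100)))"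
      by (simp add: algebra_simps)
    also have "x powr (3/4) * x powr - (79 / 100) / x = x powr - (104/100)"
    proof -
      have "x powr - 1 = 1 / x" using x by (simp add: powr_minus_divide)
      then have "x powr (3/4) * x powr - (79 / 100) / x = x powr (3/4) * x powr - (79 / 100) * x powr - 1" by simp
      also have "\<dots> = x powr (3/4 + - (79/100) + - 1)" by (simp only: powr_add)
      also have "\<dots> = x powr - (104/100)" by simp
      finally show ?thesis .
    qed
    also have "x powr (3/4) * x powr - (179 / 100) * x powr (1/100) = x powr - (103/100)"
      by (simp add: powr_add[symmetric])
    also have "2 * real n * card (divs c) * (K1 * Z1 * x powr - (104/100) + K2 * Z1 / 2 * Z2 * x powr - (103/100)) \<le>
      2 * real n * card (divs c) * (K1 * Z1 * x powr - (103/100) + K2 * Z1 / 2 * Z2 * x powr - (103/100))"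
      using x K1(1) Z by (intro mult_left_mono add_right_mono powr_mono) auto
    also have "\<dots> = 2 * real n * (K1 * Z1 + K2 * Z1 / 2 * Z2) * (real (card (divs c)) * x powr - (103/100))"
      by (simp add: algebra_simps)
    also have "\<dots> \<le> K * (real (card (divs c)) * x powr - (103/100))"
      unfolding K_def by (intro mult_right_mono) auto
    finally show ?thesis by (simp add: x_def)
  qed
  have "K > 0" unfolding K_def using Z K1(1) K2(1) by (intro add_nonneg_pos) auto
  with bound show ?thesis using that[of K] by blast
qed

lemma halfplane_nhd:
  fixes a :: real
  assumes "Re z > a"
  obtains r where "r > 0" "cball z r \<subseteq> {s. Re s > a}" "\<And>s. s \<in> cball z r \<Longrightarrow> Re z - r \<le> Re s" "a < Re z - r"
proof -
  let ?r = "(Re z - a) / 2"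
  have "cball z ?r \<subseteq> {s. Re s > a}"
  proof
    fix s assume "s \<in> cball z ?r"
    from cball_halfplane(1)[OF this] show "s \<in> {s. Re s > a}" using assms by (simp add: field_simps)
  qed
  moreover have "?r > 0" "a < Re z - ?r" using assms by (auto simp: field_simps)
  moreover have "Re z - ?r \<le> Re s" if "s \<in> cball z ?r" for s
    using cball_halfplane(1)[OF that] .
  ultimately show ?thesis using that by blast
qed

lemma latpow_holomorphic:
  assumes "Im \<tau> > 0" "c > 0"
  shows "latpow \<tau> c d holomorphic_on A"
proof -
  have "of_int c * \<tau> + of_int d \<noteq> 0" using assms by (auto simp: complex_eq_iff)
  then show ?thesis unfolding latpow_def by (auto intro!: holomorphic_intros)
qed

lemma kzeta_row_holomorphic:
  assumes "Im \<tau> > 0" "c > 0"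
  shows "kzeta_row Q n \<tau> c holomorphic_on {s. Re s > 1 / 2}"
  unfolding kzeta_row_def
proof (rule holomorphic_infsum)
  show "open {s. Re s > 1 / 2}" by (rule open_halfspace_Re_gt)
  show "(\<lambda>s. phase Q n c d * latpow \<tau> c d s) holomorphic_on {s. Re s > 1 / 2}" for d
    by (intro holomorphic_intros latpow_holomorphic assms)
  fix z assume "z \<in> {s. Re s > 1 / 2}"
  then have "Re z > 1 / 2" by simp
  then obtain r where r: "r > 0" "cball z r \<subseteq> {s. Re s > 1 / 2}" "\<And>s. s \<in> cball z r \<Longrightarrow> Re z - r \<le> Re s" "1 / 2 < Re z - r"
    using halfplane_nhd by blast
  have "Re z - r \<ge> 0" using r by simp
  then obtain K where "K > 0" and K: "\<And>c d s. c > 0 \<Longrightarrow> Re z - r \<le> Re s \<Longrightarrow> Re s \<le> Re z + r \<Longrightarrow>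
    norm (latpow \<tau> c d s) \<le> K * real_of_int (c + \<bar>d\<bar>) powr (- 2 * (Re z - r))"
    using latpow_bound[OF assms(1), of "Re z - r" "Re z + r"] by blast
  have "(\<lambda>d. real_of_int (c + \<bar>d\<bar>) powr - (0 + 2 * (Re z - r))) summable_on UNIV"
    using assms r by (intro summable_on_lattice_row) auto
  then have s: "(\<lambda>d. K * real_of_int (c + \<bar>d\<bar>) powr (- 2 * (Re z - r))) summable_on UNIV"
    by (intro summable_on_cmult_right) simp
  show "\<exists>r>0. \<exists>M. cball z r \<subseteq> {s. Re s > 1 / 2} \<and> M summable_on {d. coprime c d} \<and>
      (\<forall>d\<in>{d. coprime c d}. \<forall>s\<in>cball z r. norm (phase Q n c d * latpow \<tau> c d s) \<le> M d)"
  proof (intro exI[of _ r] exI[of _ "\<lambda>d. K * real_of_int (c + \<bar>d\<bar>) powr (- 2 * (Re z - r))"] conjI ballI r)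
    show "(\<lambda>d. K * real_of_int (c + \<bar>d\<bar>) powr (- 2 * (Re z - r))) summable_on {d. coprime c d}"
      by (rule summable_on_subset_banach[OF s]) simp
    fix d s assume "s \<in> cball z r"
    from cball_halfplane[OF this] show "norm (phase Q n c d * latpow \<tau> c d s) \<le> K * real_of_int (c + \<bar>d\<bar>) powr (- 2 * (Re z - r))"
      using K[OF assms(2)] by (simp add: norm_mult)
  qed
qed

text \<open>The sum over \<open>d\<close> is formed inside each row: only its cancellation makes the
  majorant of \<open>kzeta_row_bound\<close> summable over \<open>c\<close> to the left of
  \<open>1\<close>.\<close>

lemma kzeta_holomorphic:
  assumes "Im \<tau> > 0" "n > 0" "\<And>c. c \<in> C \<Longrightarrow> c > 0 \<and> coprime c Q"
  shows "(\<lambda>s. \<Sum>\<^sub>\<infinity>c\<in>C. kzeta_row Q n \<tau> c s) holomorphic_on {s. Re s > 9 / 10}" (is ?hol)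
    and "Re s > 9 / 10 \<Longrightarrow> (\<lambda>c. kzeta_row Q n \<tau> c s) summable_on C"
proof -
  have C: "C \<subseteq> {c. c > 0}" using assms by auto
  have sumM: "(\<lambda>c. K * (real (card (divs c)) * real_of_int c powr - (103 / 100))) summable_on C" for K
  proof (rule summable_on_cmult_right)
    have "(\<lambda>c. real (card (divs c)) * real_of_int c powr - (103 / 100)) summable_on {c. c > 0}"
      by (rule summable_on_divs_powr) simp
    then show "(\<lambda>c. real (card (divs c)) * real_of_int c powr - (103 / 100)) summable_on C"
      using C by (rule summable_on_subset_banach)
  qed
  have nhd: "\<exists>r>0. \<exists>M. cball z r \<subseteq> {s. Re s > 9 / 10} \<and> M summable_on C \<and>
      (\<forall>c\<in>C. \<forall>s\<in>cball z r. norm (kzeta_row Q n \<tau> c s) \<le> M c)" if z: "Re z > 9 / 10" for z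
  proof -
    obtain r where r: "r > 0" "cball z r \<subseteq> {s. Re s > 9 / 10}" "\<And>s. s \<in> cball z r \<Longrightarrow> Re z - r \<le> Re s" "9 / 10 < Re z - r"
      using halfplane_nhd[OF z] by blast
    have "norm z + r > 0" using r(1) by (simp add: add_nonneg_pos)
    then obtain K where "K > 0" and K: "\<And>c s. c > 0 \<Longrightarrow> coprime c Q \<Longrightarrow> 9 / 10 \<le> Re s \<Longrightarrow> Re s \<le> Re z + r \<Longrightarrow> norm s \<le> norm z + r \<Longrightarrow>
      norm (kzeta_row Q n \<tau> c s) \<le> K * (real (card (divs c)) * real_of_int c powr - (103 / 100))"
      using kzeta_row_bound[OF assms(1,2), where R = "norm z + r" and Q = Q and \<sigma> = "Re z + r"] by metis
    have "norm (kzeta_row Q n \<tau> c s) \<le> K * (real (card (divs c)) * real_of_int c powr - (103 / 100))"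
      if "c \<in> C" "s \<in> cball z r" for c s
    proof (rule K)
      show "9 / 10 \<le> Re s" using r(3)[OF that(2)] r(4) by simp
    qed (use assms(3) that cball_halfplane[of s z r] in auto)
    then show ?thesis
      by (intro exI[of _ r] exI[of _ "\<lambda>c. K * (real (card (divs c)) * real_of_int c powr - (103 / 100))"]
        conjI r(1,2) sumM) blast
  qed
  show ?hol
  proof (rule holomorphic_infsum)
    show "open {s. Re s > 9 / 10}" by (rule open_halfspace_Re_gt)
    show "kzeta_row Q n \<tau> c holomorphic_on {s. Re s > 9 / 10}" if "c \<in> C" for c
      using kzeta_row_holomorphic[of \<tau> c Q n] assms that by (auto intro: holomorphic_on_subset)
  qed (use nhd in auto)
  show "(\<lambda>c. kzeta_row Q n \<tau> c s) summable_on C" if s: "Re s > 9 / 10"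
  proof -
    obtain r M where r: "r > 0" "M summable_on C" "\<forall>c\<in>C. \<forall>s\<in>cball s r. norm (kzeta_row Q n \<tau> c s) \<le> M c"
      using nhd[OF s] by blast
    have "(\<lambda>c. norm (kzeta_row Q n \<tau> c s)) summable_on C"
      by (rule summable_on_comparison_test[OF r(2)]) (use r in auto)
    then show ?thesis by (rule abs_summable_summable)
  qed
qed

section \<open>Analytic continuation of the row series\<close>

text \<open>The power series factor of the Bessel function: \<open>I\<close> of order
  \<open>s - 1/2\<close> at \<open>2 x\<close> is \<open>x\<close> to the \<open>s - 1/2\<close>
  times this function at \<open>x^2\<close>.\<close>

definition bessel_E :: "complex \<Rightarrow> complex \<Rightarrow> complex" where
  "bessel_E s x = (\<Sum>k. rGamma (s + 1 / 2 + of_nat k) / fact k * x ^ k)"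

text \<open>Each step of \<open>rGamma z = z * rGamma (z + 1)\<close> divides by a number of norm at
  least 1.\<close>

lemma norm_rGamma_shift_le:
  assumes "Re z \<ge> 1"
  shows "norm (rGamma (z + of_nat k)) \<le> norm (rGamma z)"
proof (induction k)
  case (Suc k)
  let ?w = "z + of_nat k"
  have "1 \<le> Re ?w" using assms by simp
  also have "\<dots> \<le> norm ?w" by (rule complex_Re_le_cmod)
  finally have "1 * norm (rGamma (?w + 1)) \<le> norm ?w * norm (rGamma (?w + 1))"
    by (intro mult_right_mono) auto
  also have "\<dots> = norm (rGamma ?w)" by (metis norm_mult rGamma_plus1)
  finally show ?case using Suc by (simp add: add_ac)
qed simp

lemma bessel_E_term_bound:
  assumes "Re s \<ge> 1 / 2"
  shows "norm (rGamma (s + 1 / 2 + of_nat k) / fact k * x ^ k) \<le> norm (rGamma (s + 1 / 2)) * (norm x ^ k / fact k)"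
  using norm_rGamma_shift_le[of "s + 1 / 2" k] assms
  by (simp add: norm_mult norm_divide norm_power divide_right_mono mult_right_mono)

lemma summable_exp_norm: "summable (\<lambda>k. B * (norm (x::complex) ^ k / fact k))"
  using summable_exp[of "norm x"] by (intro summable_mult) (simp add: field_simps)

lemma suminf_exp_norm: "(\<Sum>k. norm (x::complex) ^ k / fact k) = exp (norm x)"
  by (simp add: exp_def field_simps)

lemma bessel_E_summable:
  assumes "Re s \<ge> 1 / 2"
  shows "summable (\<lambda>k. norm (rGamma (s + 1 / 2 + of_nat k) / fact k * x ^ k))"
  by (rule summable_comparison_test'[OF summable_exp_norm[of "norm (rGamma (s + 1 / 2))" x]])
     (use bessel_E_term_bound[OF assms] in auto)

lemma norm_bessel_E_le:
  assumes "Re s \<ge> 1 / 2"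
  shows "norm (bessel_E s x) \<le> norm (rGamma (s + 1 / 2)) * exp (norm x)"
proof -
  have "norm (bessel_E s x) \<le> (\<Sum>k. norm (rGamma (s + 1 / 2)) * (norm x ^ k / fact k))"
    unfolding bessel_E_def
    by (rule norm_suminf_le[OF bessel_E_term_bound[OF assms] summable_exp_norm])
  also have "\<dots> = norm (rGamma (s + 1 / 2)) * exp (norm x)"
    using summable_exp_norm[of 1 x] by (subst suminf_mult) (auto simp: suminf_exp_norm)
  finally show ?thesis .
qed

text \<open>The subtracted value is the constant term of the power series; every remaining term
  carries a factor \<open>x\<close>.\<close>

lemma norm_bessel_E_diff_le:
  assumes "Re s \<ge> 1 / 2"
  shows "norm (bessel_E s x - rGamma (s + 1 / 2)) \<le> norm (rGamma (s + 1 / 2)) * (norm x * exp (norm x))"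
proof -
  let ?t = "\<lambda>k. rGamma (s + 1 / 2 + of_nat k) / fact k * x ^ k"
  let ?G = "norm (rGamma (s + 1 / 2))"
  have st: "summable ?t" by (rule summable_norm_cancel[OF bessel_E_summable[OF assms]])
  have "bessel_E s x - rGamma (s + 1 / 2) = (\<Sum>k. ?t (Suc k))"
    using suminf_split_head[OF st] by (simp add: bessel_E_def)
  also have "norm \<dots> \<le> (\<Sum>k. ?G * norm x * (norm x ^ k / fact k))"
  proof (rule norm_suminf_le[OF _ summable_exp_norm])
    fix k
    have "norm (?t (Suc k)) \<le> ?G * (norm x ^ Suc k / fact (Suc k))"
      by (rule bessel_E_term_bound[OF assms])
    also have "\<dots> \<le> ?G * (norm x ^ Suc k / fact k)"
      by (intro mult_left_mono divide_left_mono fact_mono) auto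
    finally show "norm (?t (Suc k)) \<le> ?G * norm x * (norm x ^ k / fact k)" by (simp add: mult_ac)
  qed
  also have "\<dots> = ?G * norm x * exp (norm x)"
    using summable_exp_norm[of 1 x] by (subst suminf_mult) (auto simp: suminf_exp_norm)
  finally show ?thesis by (simp add: mult_ac)
qed

lemma bessel_E_holomorphic: "(\<lambda>s. bessel_E s x) holomorphic_on {s. Re s > 1 / 2}"
proof -
  let ?t = "\<lambda>k s. rGamma (s + 1 / 2 + of_nat k) / fact k * x ^ k"
  have "(\<lambda>s. \<Sum>\<^sub>\<infinity>k. ?t k s) holomorphic_on {s. Re s > 1 / 2}"
  proof (rule holomorphic_infsum)
    show "open {s. Re s > 1 / 2}" by (rule open_halfspace_Re_gt)
    show "?t k holomorphic_on {s. Re s > 1 / 2}" for k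
      by (intro holomorphic_intros) auto
    fix z assume "z \<in> {s. Re s > 1 / 2}"
    then obtain r where r: "r > 0" "cball z r \<subseteq> {s. Re s > 1 / 2}" "\<And>s. s \<in> cball z r \<Longrightarrow> Re z - r \<le> Re s" "1 / 2 < Re z - r"
      using halfplane_nhd[of "1 / 2" z] by blast
    have "compact ((\<lambda>s. rGamma (s + 1 / 2)) ` cball z r)"
      by (intro compact_continuous_image holomorphic_on_imp_continuous_on holomorphic_intros) auto
    then obtain B where B: "\<And>s. s \<in> cball z r \<Longrightarrow> norm (rGamma (s + 1 / 2)) \<le> B"
      by (metis bounded_iff compact_imp_bounded imageI)
    have "(\<lambda>k. B * (norm x ^ k / fact k)) summable_on UNIV"
      by (rule norm_summable_imp_summable_on) (use summable_exp_norm[of "\<bar>B\<bar>" x] in \<open>simp add: abs_mult\<close>)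
    moreover have "norm (?t k s) \<le> B * (norm x ^ k / fact k)" if s: "s \<in> cball z r" for k s
    proof -
      have "Re s \<ge> 1 / 2" using r(3)[OF s] r(4) by simp
      then have "norm (?t k s) \<le> norm (rGamma (s + 1 / 2)) * (norm x ^ k / fact k)"
        by (rule bessel_E_term_bound)
      also have "\<dots> \<le> B * (norm x ^ k / fact k)" by (intro mult_right_mono B s) auto
      finally show ?thesis .
    qed
    ultimately show "\<exists>r>0. \<exists>M. cball z r \<subseteq> {s. Re s > 1 / 2} \<and> M summable_on UNIV \<and>
        (\<forall>k\<in>UNIV. \<forall>s\<in>cball z r. norm (?t k s) \<le> M k)"
      using r(1,2) by blast
  qed
  moreover have "(\<Sum>\<^sub>\<infinity>k. ?t k s) = bessel_E s x" if "s \<in> {s. Re s > 1 / 2}" for s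
  proof -
    have *: "summable (\<lambda>k. norm (?t k s))" by (rule bessel_E_summable) (use that in auto)
    show ?thesis
      unfolding bessel_E_def
      by (rule infsumI, rule norm_summable_imp_has_sum[OF * summable_sums[OF summable_norm_cancel[OF *]]])
  qed
  ultimately show ?thesis by (rule holomorphic_transform)
qed

text \<open>What remains of \<open>sqrt (n y)\<close> times \<open>pi n y\<close> to the
  \<open>s - 1/2\<close> once the power \<open>y\<close> to the \<open>s\<close> has been taken
  out.\<close>

definition seed_coeff :: "nat \<Rightarrow> complex \<Rightarrow> complex" where
  "seed_coeff n s = of_real (sqrt n) * of_real (pi * n) powr (s - 1 / 2)"

lemma bessel_I_eq:
  assumes "x > 0" "Re s \<ge> 1 / 2"
  shows "bessel_I (s - 1 / 2) (of_real (2 * x)) = of_real x powr (s - 1 / 2) * bessel_E s (of_real (x ^ 2))"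
proof -
  have "rGamma (s - 1 / 2 + of_nat k + 1) / fact k * (of_real (2 * x) / 2) powr (s - 1 / 2 + 2 * of_nat k) =
    of_real x powr (s - 1 / 2) * (rGamma (s + 1 / 2 + of_nat k) / fact k * of_real (x ^ 2) ^ k)" for k
  proof -
    have "complex_of_real x powr (of_nat (2 * k)) = of_real x ^ (2 * k)"
      by (rule powr_nat') (use assms in auto)
    then have "complex_of_real x powr (s - 1 / 2 + 2 * of_nat k) = of_real x powr (s - 1 / 2) * of_real x ^ (2 * k)"
      by (simp add: powr_add)
    moreover have arg: "s - 1 / 2 + of_nat k + 1 = s + 1 / 2 + of_nat k" by simp
    ultimately show ?thesis unfolding arg by (simp add: power_mult)
  qed
  then have "bessel_I (s - 1 / 2) (of_real (2 * x)) =
    (\<Sum>k. of_real x powr (s - 1 / 2) * (rGamma (s + 1 / 2 + of_nat k) / fact k * of_real (x ^ 2) ^ k))"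
    unfolding bessel_I_def by presburger
  also have "\<dots> = of_real x powr (s - 1 / 2) * bessel_E s (of_real (x ^ 2))"
    unfolding bessel_E_def by (rule suminf_mult[OF summable_norm_cancel[OF bessel_E_summable[OF assms(2)]]])
  finally show ?thesis .
qed

lemma niebur_seed_eq:
  assumes "n > 0" "Im w > 0" "Re s \<ge> 1 / 2"
  shows "niebur_seed n s w = unit_exp (- of_nat n * of_real (Re w)) * of_real (Im w) powr s *
    (seed_coeff n s * bessel_E s (of_real ((pi * n * Im w) ^ 2)))"
proof -
  have "bessel_I (s - 1 / 2) (of_real (2 * pi * real n * Im w)) =
    of_real (pi * n * Im w) powr (s - 1 / 2) * bessel_E s (of_real ((pi * n * Im w) ^ 2))"
    using bessel_I_eq[of "pi * n * Im w" s] assms by (simp add: mult_ac)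
  moreover have "complex_of_real (pi * n * Im w) powr (s - 1 / 2) = of_real (pi * n) powr (s - 1 / 2) * of_real (Im w) powr (s - 1 / 2)"
    unfolding of_real_mult[of "pi * n"] by (rule powr_times_real) (use assms in auto)
  moreover have "complex_of_real (sqrt (real n * Im w)) = of_real (sqrt n) * of_real (sqrt (Im w))"
    by (simp add: real_sqrt_mult)
  moreover have "complex_of_real (Im w) powr s = of_real (sqrt (Im w)) * of_real (Im w) powr (s - 1 / 2)"
  proof -
    have "complex_of_real (sqrt (Im w)) = of_real (Im w) powr (1 / 2)"
      using assms by (simp add: powr_half_sqrt[symmetric] powr_of_real[symmetric])
    then show ?thesis by (simp add: powr_add[symmetric])
  qed
  ultimately show ?thesis by (simp add: niebur_seed_def seed_coeff_def mult_ac)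
qed

lemma norm_unit_exp_of_real_minus_1: "norm (unit_exp (of_real x) - 1) \<le> 2 * pi * \<bar>x\<bar>"
proof -
  have "norm (unit_exp (of_real x) - 1) = norm (exp (\<i> * of_real (2 * pi * x)) - 1)"
    by (simp add: unit_exp_def mult_ac)
  also have "\<dots> = 2 * \<bar>sin (pi * x)\<bar>" by (subst dist_exp_i_1) simp
  also have "\<dots> \<le> 2 * \<bar>pi * x\<bar>" using abs_sin_x_le_abs_x[of "pi * x"] by simp
  finally show ?thesis by (simp add: abs_mult)
qed

text \<open>Coefficient of the leading term of the seed as its argument tends to
  \<open>0\<close>.\<close>

definition seed_lead :: "nat \<Rightarrow> complex \<Rightarrow> complex" where
  "seed_lead n s = seed_coeff n s * rGamma (s + 1 / 2)"

lemma seed_coeff_holomorphic: "n > 0 \<Longrightarrow> seed_coeff n holomorphic_on A"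
  unfolding seed_coeff_def by (auto intro!: holomorphic_intros)

lemma seed_lead_holomorphic: "n > 0 \<Longrightarrow> seed_lead n holomorphic_on A"
  unfolding seed_lead_def by (auto intro!: holomorphic_intros seed_coeff_holomorphic)

text \<open>Both the phase and the Bessel factor differ from their values at \<open>0\<close> by a
  multiple of \<open>norm w\<close>. This additional factor is what makes the error series
  absolutely convergent around \<open>s = 1\<close>. Compactness of the disc and the height bound
  \<open>V\<close> make the constant uniform.\<close>

lemma seed_bounds:
  assumes "n > 0" "V > 0" "\<And>s. s \<in> cball z r \<Longrightarrow> Re s \<ge> 1 / 2"
  obtains K where "K > 0"
    "\<And>s w. s \<in> cball z r \<Longrightarrow> 0 < Im w \<Longrightarrow> Im w \<le> V \<Longrightarrow>
      norm (niebur_seed n s w - of_real (Im w) powr s * seed_lead n s) \<le> K * norm w * Im w powr Re s"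
proof -
  have "compact ((\<lambda>s. rGamma (s + 1 / 2)) ` cball z r)"
    by (intro compact_continuous_image holomorphic_on_imp_continuous_on holomorphic_intros) auto
  then obtain B1 where B1: "\<And>s. s \<in> cball z r \<Longrightarrow> norm (rGamma (s + 1 / 2)) \<le> B1"
    by (metis bounded_iff compact_imp_bounded imageI)
  have "compact (seed_coeff n ` cball z r)"
    by (intro compact_continuous_image holomorphic_on_imp_continuous_on seed_coeff_holomorphic assms) auto
  then obtain B2 where B2: "\<And>s. s \<in> cball z r \<Longrightarrow> norm (seed_coeff n s) \<le> B2"
    by (metis bounded_iff compact_imp_bounded imageI)
  define X where "X = (pi * n * V) ^ 2"
  define K where "K = \<bar>B2\<bar> * (2 * pi * n * (\<bar>B1\<bar> * exp X) + \<bar>B1\<bar> * ((pi * n) ^ 2 * V * exp X)) + 1"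
  have bound: "norm (niebur_seed n s w - of_real (Im w) powr s * seed_lead n s) \<le> K * norm w * Im w powr Re s"
    if s: "s \<in> cball z r" and w: "0 < Im w" "Im w \<le> V" for s w
  proof -
    have Re: "Re s \<ge> 1 / 2" using assms(3)[OF s] .
    define x where "x = (pi * n * Im w) ^ 2"
    define u where "u = unit_exp (- of_nat n * of_real (Re w))"
    define E where "E = bessel_E s (of_real x)"
    have x0: "x \<ge> 0" by (simp add: x_def)
    have xX: "x \<le> X" unfolding x_def X_def using w assms by (intro power_mono mult_left_mono) auto
    \<comment> \<open>The Bessel error is quadratic in \<open>Im w\<close>; one factor is bounded by
      \<open>V\<close> so that a single \<open>norm w\<close> remains.\<close>
    have xw: "x \<le> (pi * n) ^ 2 * V * norm w"
    proof -
      have "Im w \<le> norm w" using abs_Im_le_cmod[of w] by linarith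
      then have "Im w * Im w \<le> V * norm w" using w by (intro mult_mono) auto
      then have "(pi * n) ^ 2 * (Im w * Im w) \<le> (pi * n) ^ 2 * (V * norm w)" by (intro mult_left_mono) auto
      then show ?thesis by (simp add: x_def power_mult_distrib power2_eq_square mult_ac)
    qed
    have u: "norm (u - 1) \<le> 2 * pi * n * norm w"
    proof -
      have "u = unit_exp (of_real (- real n * Re w))" by (simp add: u_def)
      then have "norm (u - 1) \<le> 2 * pi * \<bar>- real n * Re w\<bar>" by (simp only: norm_unit_exp_of_real_minus_1)
      also have "\<dots> = 2 * pi * n * \<bar>Re w\<bar>" by (simp add: abs_mult)
      also have "\<dots> \<le> 2 * pi * n * norm w" by (intro mult_left_mono abs_Re_le_cmod) auto
      finally show ?thesis .
    qed
    have B1': "norm (rGamma (s + 1 / 2)) \<le> \<bar>B1\<bar>" using B1[OF s] by linarith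
    have E: "norm E \<le> \<bar>B1\<bar> * exp X"
    proof -
      have "norm E \<le> norm (rGamma (s + 1 / 2)) * exp (norm (complex_of_real x))"
        unfolding E_def by (rule norm_bessel_E_le[OF Re])
      also have "\<dots> \<le> \<bar>B1\<bar> * exp X" using xX x0 B1' by (intro mult_mono) auto
      finally show ?thesis .
    qed
    have E': "norm (E - rGamma (s + 1 / 2)) \<le> \<bar>B1\<bar> * (((pi * n) ^ 2 * V * norm w) * exp X)"
    proof -
      have "norm (E - rGamma (s + 1 / 2)) \<le> norm (rGamma (s + 1 / 2)) * (norm (complex_of_real x) * exp (norm (complex_of_real x)))"
        unfolding E_def by (rule norm_bessel_E_diff_le[OF Re])
      also have "\<dots> \<le> \<bar>B1\<bar> * (((pi * n) ^ 2 * V * norm w) * exp X)"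
        using xX x0 B1' xw by (intro mult_mono) auto
      finally show ?thesis .
    qed
    have nY: "norm (complex_of_real (Im w) powr s) = Im w powr Re s"
      using w by (subst norm_powr_real_powr) auto
    have "niebur_seed n s w - of_real (Im w) powr s * seed_lead n s =
      of_real (Im w) powr s * (seed_coeff n s * ((u - 1) * E + (E - rGamma (s + 1 / 2))))"
      unfolding niebur_seed_eq[OF assms(1) w(1) Re] u_def E_def x_def seed_lead_def by (simp add: algebra_simps)
    then have "norm (niebur_seed n s w - of_real (Im w) powr s * seed_lead n s) =
      Im w powr Re s * (norm (seed_coeff n s) * norm ((u - 1) * E + (E - rGamma (s + 1 / 2))))"
      by (simp add: norm_mult nY)
    also have "\<dots> \<le> Im w powr Re s * (\<bar>B2\<bar> * ((2 * pi * n * norm w) * (\<bar>B1\<bar> * exp X) + \<bar>B1\<bar> * (((pi * n) ^ 2 * V * norm w) * exp X)))"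
    proof (intro mult_left_mono mult_mono)
      show "norm (seed_coeff n s) \<le> \<bar>B2\<bar>" using B2[OF s] by linarith
      show "norm ((u - 1) * E + (E - rGamma (s + 1 / 2))) \<le>
        (2 * pi * n * norm w) * (\<bar>B1\<bar> * exp X) + \<bar>B1\<bar> * (((pi * n) ^ 2 * V * norm w) * exp X)"
        by (rule order_trans[OF norm_triangle_ineq], unfold norm_mult, intro add_mono mult_mono u E E') auto
    qed auto
    also have "\<dots> = (K - 1) * norm w * Im w powr Re s" by (simp add: K_def algebra_simps)
    also have "\<dots> \<le> K * norm w * Im w powr Re s" by (intro mult_right_mono) auto
    finally show ?thesis .
  qed
  show ?thesis
  proof (rule that[OF _ bound])
    show "K > 0" unfolding K_def
      using assms(2) by (intro add_nonneg_pos mult_nonneg_nonneg add_nonneg_nonneg) auto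
  qed
qed

lemma summable_on_lattice:
  fixes C :: "int set" and D :: "int \<Rightarrow> int set"
  assumes "a > 1" "C \<subseteq> {c. c > 0}"
  shows "(\<lambda>(c, d). real_of_int (c + \<bar>d\<bar>) powr - (2 * a)) summable_on Sigma C D"
proof (rule summable_on_subset_banach)
  show "(\<lambda>(c, d). real_of_int (c + \<bar>d\<bar>) powr - (2 * a)) summable_on {c. c > 0} \<times> UNIV"
  proof (rule summable_on_comparison_test)
    show "(\<lambda>(c, d). real_of_int c powr - a * (1 + \<bar>real_of_int d\<bar>) powr - a) summable_on {c. c > 0} \<times> UNIV"
      by (rule summable_on_product[OF summable_on_pos_int_powr[OF assms(1)] summable_on_int_powr[OF assms(1)]]) auto
    fix p :: "int \<times> int" assume "p \<in> {c. c > 0} \<times> UNIV"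
    then obtain c d where p: "p = (c, d)" "c > 0" by auto
    have "real_of_int (c + \<bar>d\<bar>) powr - (a + a) \<le> real_of_int c powr - a * (1 + \<bar>real_of_int d\<bar>) powr - a"
      using p assms by (intro split_powr_bound) auto
    then show "(case p of (c, d) \<Rightarrow> real_of_int (c + \<bar>d\<bar>) powr - (2 * a)) \<le>
      (case p of (c, d) \<Rightarrow> real_of_int c powr - a * (1 + \<bar>real_of_int d\<bar>) powr - a)"
      by (simp add: p)
  qed (auto split: prod.splits)
qed (use assms in auto)

definition row_point :: "int \<Rightarrow> complex \<Rightarrow> int \<Rightarrow> int \<Rightarrow> complex" where
  "row_point Q \<tau> c d = - 1 / (of_int Q * of_int c * (of_int c * \<tau> + of_int d))"

lemma lat_nonzero:
  assumes "Im \<tau> > 0" "c > 0"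
  shows "of_int c * \<tau> + of_int d \<noteq> 0"
  using assms by (auto simp: complex_eq_iff)

lemma Im_row_point:
  assumes "Im \<tau> > 0" "c > 0" "Q > 0"
  shows "Im (row_point Q \<tau> c d) = Im \<tau> / of_int Q * (1 / (norm (of_int c * \<tau> + of_int d)) ^ 2)"
proof -
  let ?z = "of_int c * \<tau> + of_int d"
  have "row_point Q \<tau> c d = of_real (- 1 / (of_int Q * of_int c)) * inverse ?z"
    by (simp add: row_point_def field_simps)
  then have "Im (row_point Q \<tau> c d) = - 1 / (of_int Q * of_int c) * Im (inverse ?z)"
    by (simp only: Im_complex_of_real Re_complex_of_real times_complex.sel)
  also have "Im (inverse ?z) = - (of_int c * Im \<tau>) / (norm ?z)\<^sup>2"
    by (simp add: cmod_power2)
  finally show ?thesis using assms by (simp add: field_simps)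
qed

lemma norm_row_point:
  assumes "c > 0" "Q > 0"
  shows "norm (row_point Q \<tau> c d) \<le> 1 / norm (of_int c * \<tau> + of_int d)"
proof -
  have Qc: "1 \<le> real_of_int Q * real_of_int c" using assms by (metis int_one_le_iff_zero_less of_int_1_le_iff of_int_mult zero_less_mult_iff)
  have "norm (row_point Q \<tau> c d) = 1 / (of_int Q * of_int c * norm (of_int c * \<tau> + of_int d))"
    using assms by (simp add: row_point_def norm_divide norm_mult)
  also have "\<dots> \<le> 1 / norm (of_int c * \<tau> + of_int d)"
  proof (cases "norm (of_int c * \<tau> + of_int d) = 0")
    case False
    then have "norm (of_int c * \<tau> + of_int d) > 0" by simp
    then show ?thesis using Qc assms
      by (intro divide_left_mono) (auto intro: mult_pos_pos simp: mult_le_cancel_right1)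
  qed auto
  finally show ?thesis .
qed

lemma Im_row_point_pos:
  assumes "Im \<tau> > 0" "c > 0" "Q > 0"
  shows "Im (row_point Q \<tau> c d) > 0"
  unfolding Im_row_point[OF assms] using assms lat_nonzero[OF assms(1,2), of d] by simp

lemma Im_row_point_le:
  assumes "Im \<tau> > 0" "c > 0" "Q > 0"
  shows "Im (row_point Q \<tau> c d) \<le> 1 / Im \<tau>"
proof -
  let ?N = "norm (of_int c * \<tau> + of_int d)"
  have "Im \<tau> * 1 \<le> Im \<tau> * of_int c" using assms by (intro mult_left_mono) auto
  also have "\<dots> = Im (of_int c * \<tau> + of_int d)" by simp
  also have "\<dots> \<le> ?N" using abs_Im_le_cmod[of "of_int c * \<tau> + of_int d"] by linarith
  finally have "(Im \<tau>)\<^sup>2 \<le> ?N\<^sup>2" using assms by (intro power_mono) auto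
  then have "1 / ?N\<^sup>2 \<le> 1 / (Im \<tau>)\<^sup>2"
    using assms lat_nonzero[OF assms(1,2), of d] by (intro divide_left_mono) auto
  moreover have "Im \<tau> / of_int Q \<le> Im \<tau> / 1" using assms by (intro divide_left_mono) auto
  ultimately have "Im \<tau> / of_int Q * (1 / ?N\<^sup>2) \<le> Im \<tau> / 1 * (1 / (Im \<tau>)\<^sup>2)"
    using assms by (intro mult_mono) auto
  then show ?thesis unfolding Im_row_point[OF assms] using assms by (simp add: power2_eq_square)
qed

lemma Im_row_point_powr:
  assumes "Im \<tau> > 0" "c > 0" "Q > 0"
  shows "of_real (Im (row_point Q \<tau> c d)) powr s = of_real (Im \<tau> / of_int Q) powr s * latpow \<tau> c d s"
proof -
  let ?N = "norm (of_int c * \<tau> + of_int d)"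
  have N: "?N > 0" using lat_nonzero[OF assms(1,2)] by simp
  have "of_real (Im (row_point Q \<tau> c d)) powr s = of_real (Im \<tau> / of_int Q) powr s * of_real (1 / ?N ^ 2) powr s"
    unfolding Im_row_point[OF assms] of_real_mult[of "Im \<tau> / of_int Q"]
    by (rule powr_times_real) (use assms in auto)
  also have "complex_of_real (1 / ?N ^ 2) powr s = latpow \<tau> c d s"
  proof -
    have "Ln (complex_of_real (1 / ?N ^ 2)) = of_real (ln (1 / ?N ^ 2))" by (rule Ln_of_real) (use N in auto)
    also have "ln (1 / ?N ^ 2) = - 2 * ln ?N" using N by (simp add: ln_div ln_realpow)
    also have "complex_of_real (- 2 * ln ?N) = - 2 * Ln (of_real ?N)" using N by (simp add: Ln_of_real)
    finally show ?thesis using N by (simp add: latpow_def powr_def mult_ac)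
  qed
  finally show ?thesis .
qed

text \<open>By \<open>seed_row_rep\<close> this is the seed at the image of \<open>\<tau>\<close>
  under a matrix with lower row \<open>sqrt Q * (c, d)\<close>.\<close>

definition row_term :: "int \<Rightarrow> nat \<Rightarrow> complex \<Rightarrow> complex \<Rightarrow> int \<Rightarrow> int \<Rightarrow> complex" where
  "row_term Q n \<tau> s c d = phase Q n c d * niebur_seed n s (row_point Q \<tau> c d)"

text \<open>The term with the seed replaced by its leading part; summed over \<open>d\<close> it is
  a multiple of \<open>kzeta_row\<close>.\<close>

definition row_main :: "int \<Rightarrow> nat \<Rightarrow> complex \<Rightarrow> complex \<Rightarrow> int \<Rightarrow> int \<Rightarrow> complex" where
  "row_main Q n \<tau> s c d = of_real (Im \<tau> / of_int Q) powr s * seed_lead n s * (phase Q n c d * latpow \<tau> c d s)"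

lemma niebur_seed_holomorphic:
  assumes "n > 0" "Im w > 0"
  shows "(\<lambda>s. niebur_seed n s w) holomorphic_on {s. Re s > 1 / 2}"
proof -
  have "(\<lambda>s. unit_exp (- of_nat n * of_real (Re w)) * of_real (Im w) powr s *
    (seed_coeff n s * bessel_E s (of_real ((pi * n * Im w) ^ 2)))) holomorphic_on {s. Re s > 1 / 2}"
    using assms by (intro holomorphic_intros seed_coeff_holomorphic bessel_E_holomorphic) auto
  then show ?thesis
    by (rule holomorphic_transform) (use niebur_seed_eq[OF assms] in auto)
qed

text \<open>The factor \<open>norm w\<close> of \<open>seed_bounds\<close> is at most the reciprocal
  of the norm of \<open>c \<tau> + d\<close>. It raises the decay from \<open>2 Re s\<close> to
  \<open>2 Re s + 1\<close>, which exceeds 2 as soon as \<open>Re s > 1/2\<close>.\<close>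

lemma row_error_bound:
  assumes "Im \<tau> > 0" "n > 0" "Q > 0" "Re z > 1 / 2"
  obtains r K a where "r > 0" "cball z r \<subseteq> {s. Re s > 1 / 2}" "a > 1"
    "\<And>s c d. s \<in> cball z r \<Longrightarrow> c > 0 \<Longrightarrow>
       norm (row_term Q n \<tau> s c d - row_main Q n \<tau> s c d) \<le> K * real_of_int (c + \<bar>d\<bar>) powr - (2 * a)"
proof -
  obtain r where r: "r > 0" "cball z r \<subseteq> {s. Re s > 1 / 2}" "\<And>s. s \<in> cball z r \<Longrightarrow> Re z - r \<le> Re s" "1 / 2 < Re z - r"
    using halfplane_nhd[OF assms(4)] by blast
  have half: "Re s \<ge> 1 / 2" if "s \<in> cball z r" for s
    using r(3)[OF that] r(4) by simp
  have V: "1 / Im \<tau> > 0" using assms by simp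
  obtain K1 where K1: "K1 > 0" "\<And>s w. s \<in> cball z r \<Longrightarrow> 0 < Im w \<Longrightarrow> Im w \<le> 1 / Im \<tau> \<Longrightarrow>
      norm (niebur_seed n s w - of_real (Im w) powr s * seed_lead n s) \<le> K1 * norm w * Im w powr Re s"
    using seed_bounds[OF assms(2) V half] by metis
  have "Re z - r + 1 / 2 \<ge> 0" using r by simp
  then obtain K2 where K2: "K2 > 0" "\<And>c d s. c > 0 \<Longrightarrow> Re z - r + 1 / 2 \<le> Re s \<Longrightarrow> Re s \<le> Re z + r + 1 / 2 \<Longrightarrow>
    norm (latpow \<tau> c d s) \<le> K2 * real_of_int (c + \<bar>d\<bar>) powr (- 2 * (Re z - r + 1 / 2))"
    using latpow_bound[OF assms(1), of "Re z - r + 1 / 2" "Re z + r + 1 / 2"] by metis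
  have "compact ((\<lambda>s. of_real (Im \<tau> / of_int Q) powr s) ` cball z r)"
    using assms by (intro compact_continuous_image holomorphic_on_imp_continuous_on holomorphic_intros) auto
  then obtain B where B: "\<And>s. s \<in> cball z r \<Longrightarrow> norm (complex_of_real (Im \<tau> / of_int Q) powr s) \<le> B"
    by (metis bounded_iff compact_imp_bounded imageI)
  have bound: "norm (row_term Q n \<tau> s c d - row_main Q n \<tau> s c d) \<le>
      K1 * \<bar>B\<bar> * K2 * real_of_int (c + \<bar>d\<bar>) powr - (2 * (Re z - r + 1 / 2))"
    if s: "s \<in> cball z r" and c: "c > 0" for s c d
  proof -
    define w where "w = row_point Q \<tau> c d"
    let ?N = "norm (of_int c * \<tau> + of_int d)"
    have N: "?N > 0" using lat_nonzero[OF assms(1) c] by simp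
    have w: "Im w > 0" "Im w \<le> 1 / Im \<tau>"
      unfolding w_def using Im_row_point_pos Im_row_point_le assms c by auto
    have "row_term Q n \<tau> s c d - row_main Q n \<tau> s c d =
      phase Q n c d * (niebur_seed n s w - of_real (Im w) powr s * seed_lead n s)"
      unfolding row_term_def row_main_def w_def Im_row_point_powr[OF assms(1) c assms(3)]
      by (simp add: algebra_simps)
    then have "norm (row_term Q n \<tau> s c d - row_main Q n \<tau> s c d) =
      norm (niebur_seed n s w - of_real (Im w) powr s * seed_lead n s)" by (simp add: norm_mult)
    also have "\<dots> \<le> K1 * norm w * Im w powr Re s" by (rule K1(2)[OF s w])
    also have "Im w powr Re s = norm (complex_of_real (Im w) powr s)"
      using w by (subst norm_powr_real_powr) auto
    also have "\<dots> = norm (complex_of_real (Im \<tau> / of_int Q) powr s) * norm (latpow \<tau> c d s)"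
      unfolding w_def Im_row_point_powr[OF assms(1) c assms(3)] by (simp add: norm_mult)
    also have "K1 * norm w * (norm (complex_of_real (Im \<tau> / of_int Q) powr s) * norm (latpow \<tau> c d s)) \<le>
      K1 * (1 / ?N) * (\<bar>B\<bar> * norm (latpow \<tau> c d s))"
    proof (intro mult_mono order_refl)
      show "norm w \<le> 1 / ?N" unfolding w_def by (rule norm_row_point[OF c assms(3)])
      show "norm (complex_of_real (Im \<tau> / of_int Q) powr s) \<le> \<bar>B\<bar>" using B[OF s] by linarith
    qed (use K1(1) in auto)
    also have "\<dots> = K1 * \<bar>B\<bar> * (1 / ?N * norm (latpow \<tau> c d s))" by simp
    \<comment> \<open>Gaining a reciprocal norm is the same as moving \<open>s\<close> to
      \<open>s + 1/2\<close>, so \<open>latpow_bound\<close> applies there.\<close>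
    also have "1 / ?N * norm (latpow \<tau> c d s) = norm (latpow \<tau> c d (s + 1 / 2))"
    proof -
      have "1 / ?N = ?N powr - 1" using N by (simp add: powr_minus_divide)
      then have "1 / ?N * norm (latpow \<tau> c d s) = ?N powr (- 1 + - 2 * Re s)"
        unfolding norm_latpow by (simp only: powr_add)
      also have "- 1 + - 2 * Re s = - 2 * Re (s + 1 / 2)" by simp
      finally show ?thesis unfolding norm_latpow .
    qed
    also have "\<dots> \<le> K2 * real_of_int (c + \<bar>d\<bar>) powr (- 2 * (Re z - r + 1 / 2))"
      by (rule K2(2)[OF c]) (use cball_halfplane[OF s] in auto)
    also have "- 2 * (Re z - r + 1 / 2) = - (2 * (Re z - r + 1 / 2))" by simp
    finally show ?thesis using K1(1) by (simp add: mult_left_mono mult.assoc)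
  qed
  show ?thesis by (rule that[OF r(1,2) _ bound]) (use r(4) in auto)
qed

text \<open>\<open>F\<close> is an error series over pairs, absolutely convergent for
  \<open>Re s > 1/2\<close>, plus a multiple of the Kloosterman zeta function, which is summed row
  by row. For \<open>Re s > 1\<close> it is a sum over pairs; at \<open>s = 1\<close> its value is
  available as an iterated sum, from which the Fourier expansion starts.\<close>

lemma row_series_continuation:
  assumes "Im \<tau> > 0" "n > 0" "Q > 0" "\<And>c. c \<in> C \<Longrightarrow> c > 0 \<and> coprime c Q"
  defines "prs \<equiv> Sigma C (\<lambda>c. {d. coprime c d})"
  obtains F where "F holomorphic_on {s. Re s > 9 / 10}"
    "\<And>s. Re s > 1 \<Longrightarrow> ((\<lambda>(c, d). row_term Q n \<tau> s c d) has_sum F s) prs"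
    "\<And>c. c \<in> C \<Longrightarrow> (\<lambda>d. row_term Q n \<tau> 1 c d) summable_on {d. coprime c d}"
    "((\<lambda>c. \<Sum>\<^sub>\<infinity>d\<in>{d. coprime c d}. row_term Q n \<tau> 1 c d) has_sum F 1) C"
proof -
  define err where "err = (\<lambda>(c, d) s. row_term Q n \<tau> s c d - row_main Q n \<tau> s c d)"
  define A where "A s = complex_of_real (Im \<tau> / of_int Q) powr s * seed_lead n s" for s
  define F where "F s = (\<Sum>\<^sub>\<infinity>p\<in>prs. err p s) + A s * (\<Sum>\<^sub>\<infinity>c\<in>C. kzeta_row Q n \<tau> c s)" for s
  have C: "C \<subseteq> {c. c > 0}" using assms(4) by auto
  have nhd: "\<exists>r>0. \<exists>M. cball z r \<subseteq> {s. Re s > 1 / 2} \<and> M summable_on prs \<and>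
      (\<forall>p\<in>prs. \<forall>s\<in>cball z r. norm (err p s) \<le> M p)" if z: "Re z > 1 / 2" for z
  proof -
    obtain r K a where r: "r > 0" "cball z r \<subseteq> {s. Re s > 1 / 2}" "a > 1"
      and K: "\<And>s c d. s \<in> cball z r \<Longrightarrow> c > 0 \<Longrightarrow>
       norm (row_term Q n \<tau> s c d - row_main Q n \<tau> s c d) \<le> K * real_of_int (c + \<bar>d\<bar>) powr - (2 * a)"
      by (rule row_error_bound[OF assms(1-3) z]) (rule that)
    let ?M = "\<lambda>p. K * (case p of (c, d) \<Rightarrow> real_of_int (c + \<bar>d\<bar>) powr - (2 * a))"
    have "?M summable_on prs" unfolding prs_def
      by (rule summable_on_cmult_right[OF summable_on_lattice[OF r(3) C]])
    moreover have "\<forall>p\<in>prs. \<forall>s\<in>cball z r. norm (err p s) \<le> ?M p"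
      using K C by (auto simp: prs_def err_def)
    ultimately show ?thesis by (intro exI[of _ r] exI[of _ ?M] conjI r(1,2))
  qed
  have err_summable: "(\<lambda>p. err p s) summable_on prs" if s: "Re s > 1 / 2" for s
  proof -
    obtain r M where r: "r > 0" "M summable_on prs" "\<forall>p\<in>prs. \<forall>s\<in>cball s r. norm (err p s) \<le> M p"
      using nhd[OF s] by metis
    have "(\<lambda>p. norm (err p s)) summable_on prs"
      by (rule summable_on_comparison_test[OF r(2)]) (use r in auto)
    then show ?thesis by (rule abs_summable_summable)
  qed
  have err_hol: "(\<lambda>s. \<Sum>\<^sub>\<infinity>p\<in>prs. err p s) holomorphic_on {s. Re s > 1 / 2}"
  proof (rule holomorphic_infsum)
    show "open {s. Re s > 1 / 2}" by (rule open_halfspace_Re_gt)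
    fix p assume "p \<in> prs"
    then obtain c d where p: "p = (c, d)" "c > 0" using C by (auto simp: prs_def)
    show "err p holomorphic_on {s. Re s > 1 / 2}"
      unfolding p err_def row_term_def row_main_def prod.case
      using assms p by (intro holomorphic_intros niebur_seed_holomorphic latpow_holomorphic seed_lead_holomorphic Im_row_point_pos) auto
  qed (use nhd in auto)
  have 1: "F holomorphic_on {s. Re s > 9 / 10}"
    unfolding F_def A_def
  proof (intro holomorphic_intros kzeta_holomorphic seed_lead_holomorphic assms)
    show "(\<lambda>s. \<Sum>\<^sub>\<infinity>p\<in>prs. err p s) holomorphic_on {s. Re s > 9 / 10}"
      by (rule holomorphic_on_subset[OF err_hol]) auto
  qed (use assms in auto)
  have main_eq: "row_main Q n \<tau> s c d = A s * (phase Q n c d * latpow \<tau> c d s)" for s c d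
    by (simp add: row_main_def A_def)
  have main_row: "((\<lambda>d. row_main Q n \<tau> s c d) has_sum A s * kzeta_row Q n \<tau> c s) {d. coprime c d}"
    if "c \<in> C" "Re s > 1 / 2" for c s
  proof -
    have "(\<lambda>d. norm (phase Q n c d * latpow \<tau> c d s)) summable_on {d. coprime c d}"
      using latpow_row_summable[OF assms(1), of c s] that C by (auto simp: norm_mult)
    then have "((\<lambda>d. phase Q n c d * latpow \<tau> c d s) has_sum kzeta_row Q n \<tau> c s) {d. coprime c d}"
      unfolding kzeta_row_def by (intro has_sum_infsum abs_summable_summable[where f = "\<lambda>d. phase Q n c d * latpow \<tau> c d s"])
    then show ?thesis unfolding main_eq by (rule has_sum_cmult_right)
  qed
  have main_sum: "((\<lambda>c. A s * kzeta_row Q n \<tau> c s) has_sum A s * (\<Sum>\<^sub>\<infinity>c\<in>C. kzeta_row Q n \<tau> c s)) C"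
    if s: "Re s > 9 / 10" for s
    by (intro has_sum_cmult_right has_sum_infsum kzeta_holomorphic(2)[OF assms(1,2,4) s])
  have 2: "((\<lambda>(c, d). row_term Q n \<tau> s c d) has_sum F s) prs" if s: "Re s > 1" for s
  proof -
    have "Re s \<ge> 0" using s by simp
    then obtain K where K: "K > 0" "\<And>c d s'. c > 0 \<Longrightarrow> Re s \<le> Re s' \<Longrightarrow> Re s' \<le> Re s \<Longrightarrow>
      norm (latpow \<tau> c d s') \<le> K * real_of_int (c + \<bar>d\<bar>) powr (- 2 * Re s)"
      using latpow_bound[OF assms(1), of "Re s" "Re s"] by metis
    \<comment> \<open>For \<open>Re s > 1\<close> the main part is absolutely summable over pairs,
      which identifies the iterated sum in \<open>F\<close> with the double series.\<close>
    have "(\<lambda>p. norm (case p of (c, d) \<Rightarrow> row_main Q n \<tau> s c d)) summable_on prs"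
    proof (rule summable_on_comparison_test)
      let ?M = "\<lambda>p. norm (A s) * (K * (case p of (c, d) \<Rightarrow> real_of_int (c + \<bar>d\<bar>) powr - (2 * Re s)))"
      show "?M summable_on prs"
        unfolding prs_def by (intro summable_on_cmult_right summable_on_lattice s C)
      fix p assume "p \<in> prs"
      then obtain c d where p: "p = (c, d)" "c > 0" using C by (auto simp: prs_def)
      show "norm (case p of (c, d) \<Rightarrow> row_main Q n \<tau> s c d) \<le> ?M p"
        using K(2)[OF p(2), of s d] by (simp add: p main_eq norm_mult mult_left_mono)
    qed auto
    then have "(\<lambda>p. case p of (c, d) \<Rightarrow> row_main Q n \<tau> s c d) summable_on prs"
      by (rule abs_summable_summable)
    then have "((\<lambda>p. case p of (c, d) \<Rightarrow> row_main Q n \<tau> s c d) has_sum A s * (\<Sum>\<^sub>\<infinity>c\<in>C. kzeta_row Q n \<tau> c s)) prs"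
      unfolding prs_def by (intro has_sum_SigmaI[OF _ main_sum]) (use main_row s in auto)
    from has_sum_add[OF has_sum_infsum[OF err_summable[of s]] this]
    show ?thesis using s unfolding F_def by (simp add: err_def case_prod_unfold)
  qed
  have re1: "Re (1::complex) > 1 / 2" "Re (1::complex) > 9 / 10" by auto
  have rows_err: "(\<lambda>d. err (c, d) 1) summable_on {d. coprime c d}" if "c \<in> C" for c
    using summable_on_SigmaD1[of "\<lambda>c d. err (c, d) 1" C "\<lambda>c. {d. coprime c d}" c] err_summable[OF re1(1)] that
    by (simp add: prs_def case_prod_unfold)
  have rows_term: "((\<lambda>d. row_term Q n \<tau> 1 c d) has_sum
      ((\<Sum>\<^sub>\<infinity>d\<in>{d. coprime c d}. err (c, d) 1) + A 1 * kzeta_row Q n \<tau> c 1)) {d. coprime c d}" if "c \<in> C" for c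
    using has_sum_add[OF has_sum_infsum[OF rows_err[OF that]] main_row[OF that re1(1)]]
    by (simp add: err_def)
  have 3: "(\<lambda>d. row_term Q n \<tau> 1 c d) summable_on {d. coprime c d}" if "c \<in> C" for c
    using rows_term[OF that] by (rule has_sum_imp_summable)
  have "((\<lambda>c. \<Sum>\<^sub>\<infinity>d\<in>{d. coprime c d}. err (c, d) 1) has_sum (\<Sum>\<^sub>\<infinity>p\<in>prs. err p 1)) C"
    using has_sum_SigmaD[OF has_sum_infsum[OF err_summable[OF re1(1)], unfolded prs_def] has_sum_infsum[OF rows_err]]
    by (simp add: prs_def)
  from has_sum_add[OF this main_sum[OF re1(2)]]
  have "((\<lambda>c. (\<Sum>\<^sub>\<infinity>d\<in>{d. coprime c d}. err (c, d) 1) + A 1 * kzeta_row Q n \<tau> c 1) has_sum F 1) C"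
    by (simp add: F_def)
  then have 4: "((\<lambda>c. \<Sum>\<^sub>\<infinity>d\<in>{d. coprime c d}. row_term Q n \<tau> 1 c d) has_sum F 1) C"
    by (rule has_sum_cong[THEN iffD1, rotated]) (use rows_term infsumI in fastforce)
  show ?thesis by (rule that[OF 1 2 3 4])
qed

section \<open>Fourier expansion at \<open>s = 1\<close>\<close>

text \<open>The duplication formula at half-integers, by induction. It is what makes the Bessel
  function of order \<open>1/2\<close> elementary.\<close>

lemma rGamma_three_halves_shift:
  "rGamma (3 / 2 + of_nat k :: complex) / fact k = 2 ^ (2 * k + 1) / (of_real (sqrt pi) * fact (2 * k + 1))"
proof (induction k)
  case 0
  have "(1 / 2 :: complex) * rGamma (1 / 2 + 1) = rGamma (1 / 2)" by (rule rGamma_plus1)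
  moreover have "rGamma (1 / 2 :: complex) = 1 / of_real (sqrt pi)"
    by (simp add: rGamma_inverse_Gamma Gamma_one_half_complex field_simps)
  ultimately show ?case by (simp add: field_simps)
next
  case (Suc k)
  let ?z = "3 / 2 + of_nat k :: complex"
  have nz: "?z \<noteq> 0" "(of_nat (Suc k) :: complex) \<noteq> 0" "(of_nat (2 * k + 3) :: complex) \<noteq> 0"
    by (auto simp: complex_eq_iff simp del: of_nat_Suc)
  have "rGamma (?z + 1) = rGamma ?z / ?z"
    using rGamma_plus1[of ?z] nz by (simp add: field_simps)
  then have "rGamma (3 / 2 + of_nat (Suc k) :: complex) / fact (Suc k) = (rGamma ?z / fact k) / (?z * of_nat (Suc k))"
    by (simp add: add_ac)
  also have "\<dots> = 2 ^ (2 * k + 1) / (of_real (sqrt pi) * fact (2 * k + 1)) / (?z * of_nat (Suc k))"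
    unfolding Suc ..
  also have "?z = of_nat (2 * k + 3) / 2" by (simp add: field_simps)
  also have "(2::complex) ^ (2 * k + 1) / (of_real (sqrt pi) * fact (2 * k + 1)) / (of_nat (2 * k + 3) / 2 * of_nat (Suc k)) =
    2 ^ (2 * k + 1) * 4 / (of_real (sqrt pi) * (of_nat (2 * k + 3) * (of_nat (2 * k + 2) * fact (2 * k + 1))))"
  proof -
    have "a / (s * F) / (m / 2 * j) = a * 4 / (s * (m * (2 * j * F)))" for a s F m j :: complex
      by (simp add: divide_simps)
    moreover have "(of_nat (2 * k + 2) :: complex) = 2 * of_nat (Suc k)" by simp
    ultimately show ?thesis by presburger
  qed
  also have "of_nat (2 * k + 3) * (of_nat (2 * k + 2) * fact (2 * k + 1)) = (fact (2 * Suc k + 1) :: complex)"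
    by (simp add: numeral_3_eq_3 algebra_simps)
  also have "(2::complex) ^ (2 * k + 1) * 4 = 2 ^ (2 * Suc k + 1)" by simp
  finally show ?case .
qed

lemma sinh_odd_sums: "(\<lambda>k. x ^ (2 * k + 1) / fact (2 * k + 1)) sums sinh (x :: real)"
proof -
  have "(\<lambda>n. (x ^ n / fact n - (- x) ^ n / fact n) / 2) sums ((exp x - exp (- x)) / 2)"
    using exp_converges[of x] exp_converges[of "- x"]
    by (intro sums_divide sums_diff) (simp_all add: field_simps)
  also have "(exp x - exp (- x)) / 2 = sinh x" by (simp add: sinh_def)
  finally have "(\<lambda>n. (x ^ n / fact n - (- x) ^ n / fact n) / 2) sums sinh x" .
  moreover have "strict_mono (\<lambda>k::nat. 2 * k + 1)" by (auto simp: strict_mono_def)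
  moreover have "(x ^ n / fact n - (- x) ^ n / fact n) / 2 = 0" if "n \<notin> range (\<lambda>k. 2 * k + 1)" for n
  proof -
    have "even n" using that by (metis oddE rangeI)
    then show ?thesis by simp
  qed
  ultimately have "(\<lambda>k. (x ^ (2 * k + 1) / fact (2 * k + 1) - (- x) ^ (2 * k + 1) / fact (2 * k + 1)) / 2) sums sinh x"
    by (subst sums_mono_reindex) auto
  then show ?thesis by (simp add: mult.commute)
qed

text \<open>At \<open>s = 1\<close> the Bessel function has order \<open>1/2\<close>; its
  coefficients become those of the odd part of the exponential series.\<close>

lemma bessel_E_one:
  "of_real x * bessel_E 1 (of_real (x ^ 2)) = of_real (sinh (2 * x) / sqrt pi)"
proof -
  have t: "complex_of_real x * (rGamma (1 + 1 / 2 + of_nat k) / fact k * of_real (x ^ 2) ^ k) =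
    of_real (1 / sqrt pi * ((2 * x) ^ (2 * k + 1) / fact (2 * k + 1)))" for k
  proof -
    have "1 + 1 / 2 = (3 / 2 :: complex)" by simp
    then have "complex_of_real x * (rGamma (1 + 1 / 2 + of_nat k) / fact k * of_real (x ^ 2) ^ k) =
      of_real x * (2 ^ (2 * k + 1) / (of_real (sqrt pi) * fact (2 * k + 1)) * of_real (x ^ 2) ^ k)"
      by (simp only: rGamma_three_halves_shift)
    also have "\<dots> = of_real (1 / sqrt pi * (2 ^ (2 * k + 1) * (x * (x ^ 2) ^ k) / fact (2 * k + 1)))"
      by (simp del: fact_Suc add_2_eq_Suc' power_Suc)
    also have "2 ^ (2 * k + 1) * (x * (x ^ 2) ^ k) = (2 * x) ^ (2 * k + 1)"
      by (simp add: power_mult_distrib power_mult)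
    finally show ?thesis .
  qed
  have "(\<lambda>k. 1 / sqrt pi * ((2 * x) ^ (2 * k + 1) / fact (2 * k + 1))) sums (1 / sqrt pi * sinh (2 * x))"
    by (intro sums_mult sinh_odd_sums)
  then have "(\<lambda>k. complex_of_real (1 / sqrt pi * ((2 * x) ^ (2 * k + 1) / fact (2 * k + 1)))) sums of_real (1 / sqrt pi * sinh (2 * x))"
    by (rule sums_of_real)
  then have "(\<lambda>k. complex_of_real x * (rGamma (1 + 1 / 2 + of_nat k) / fact k * of_real (x ^ 2) ^ k)) sums of_real (1 / sqrt pi * sinh (2 * x))"
    unfolding t .
  moreover have "summable (\<lambda>k. rGamma (1 + 1 / 2 + of_nat k) / fact k * complex_of_real (x ^ 2) ^ k)"
    by (rule summable_norm_cancel[OF bessel_E_summable]) simp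
  ultimately have "complex_of_real x * bessel_E 1 (of_real (x ^ 2)) = of_real (1 / sqrt pi * sinh (2 * x))"
    unfolding bessel_E_def by (subst suminf_mult[symmetric]) (auto simp: sums_iff)
  then show ?thesis by simp
qed

text \<open>The hyperbolic sine splits into a growing and a decaying exponential, which combine with
  the phase to a holomorphic and an antiholomorphic exponential.\<close>

lemma niebur_seed_one:
  assumes "n > 0" "Im w > 0"
  shows "2 * of_real pi * niebur_seed n 1 w = unit_exp (- (of_nat n * w)) - unit_exp (- (of_nat n * cnj w))"
proof -
  define x where "x = pi * n * Im w"
  have pn: "pi * n > 0" using assms by simp
  have "seed_coeff n 1 = of_real (sqrt n) * of_real (sqrt (pi * n))"
  proof -
    have "complex_of_real (pi * n) powr (1 / 2) = of_real (sqrt (pi * n))"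
      using pn by (subst powr_half_sqrt[symmetric]) (auto simp: powr_of_real[symmetric])
    then show ?thesis by (simp add: seed_coeff_def)
  qed
  then have "seed_coeff n 1 = of_real (sqrt pi * n)" by (simp add: real_sqrt_mult flip: of_real_mult)
  then have "of_real (Im w) * (seed_coeff n 1 * bessel_E 1 (of_real (x ^ 2))) =
    of_real (1 / sqrt pi) * (of_real x * bessel_E 1 (of_real (x ^ 2)))"
    by (simp add: x_def field_simps flip: of_real_mult)
  also have "\<dots> = of_real (1 / sqrt pi * (sinh (2 * x) / sqrt pi))" by (simp only: bessel_E_one of_real_mult)
  also have "1 / sqrt pi * (sinh (2 * x) / sqrt pi) = sinh (2 * x) / pi" by simp
  finally have "of_real (Im w) * (seed_coeff n 1 * bessel_E 1 (of_real (x ^ 2))) = complex_of_real (sinh (2 * x) / pi)" .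
  then have "niebur_seed n 1 w = unit_exp (- of_nat n * of_real (Re w)) * of_real (sinh (2 * x) / pi)"
    using assms by (subst niebur_seed_eq) (auto simp: x_def mult.assoc)
  then have "2 * of_real pi * niebur_seed n 1 w = unit_exp (- of_nat n * of_real (Re w)) * of_real (exp (2 * x) - exp (- 2 * x))"
    by (simp add: sinh_def field_simps)
  also have "\<dots> = unit_exp (- of_nat n * of_real (Re w)) * exp (of_real (2 * x)) - unit_exp (- of_nat n * of_real (Re w)) * exp (of_real (- 2 * x))"
    by (simp only: of_real_diff exp_of_real right_diff_distrib)
  also have "unit_exp (- of_nat n * of_real (Re w)) * exp (of_real (2 * x)) = unit_exp (- (of_nat n * w))"
    unfolding unit_exp_def exp_add[symmetric] by (rule arg_cong[of _ _ exp]) (simp add: complex_eq_iff x_def)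
  also have "unit_exp (- of_nat n * of_real (Re w)) * exp (of_real (- 2 * x)) = unit_exp (- (of_nat n * cnj w))"
    unfolding unit_exp_def exp_add[symmetric] by (rule arg_cong[of _ _ exp]) (simp add: complex_eq_iff x_def)
  finally show ?thesis .
qed

section \<open>The Lipschitz formula by way of polygamma functions\<close>

lemma not_int_if_Im: "Im z \<noteq> 0 \<Longrightarrow> z \<notin> \<int>" "Im z \<noteq> 0 \<Longrightarrow> z \<notin> \<int>\<^sub>\<le>\<^sub>0"
  by (auto elim!: Ints_cases nonpos_Ints_cases)

text \<open>Logarithmic derivative of the reflection formula for \<open>rGamma\<close>, multiplied
  out by the sine.\<close>

lemma Digamma_reflection:
  assumes "Im z \<noteq> 0"
  shows "sin (of_real pi * z) * (Digamma (1 - z) - Digamma z) = of_real pi * cos (of_real pi * z)"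
proof -
  have z: "z \<notin> \<int>\<^sub>\<le>\<^sub>0" "1 - z \<notin> \<int>\<^sub>\<le>\<^sub>0" using assms by (auto intro!: not_int_if_Im)
  have eq: "(\<lambda>z::complex. rGamma z * rGamma (1 - z)) = (\<lambda>z. sin (of_real pi * z) / of_real pi)"
    using rGamma_reflection_complex by auto
  have 1: "((\<lambda>z. rGamma z * rGamma (1 - z)) has_field_derivative
      rGamma z * rGamma (1 - z) * (Digamma (1 - z) - Digamma z)) (at z)"
    using z by (auto intro!: derivative_eq_intros simp: algebra_simps)
  have 2: "((\<lambda>z. sin (of_real pi * z) / of_real pi) has_field_derivative cos (of_real pi * z)) (at z)"
    by (auto intro!: derivative_eq_intros)
  have "rGamma z * rGamma (1 - z) * (Digamma (1 - z) - Digamma z) = cos (of_real pi * z)"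
    using 1 2 unfolding eq by (rule DERIV_unique)
  then show ?thesis by (simp add: rGamma_reflection_complex field_simps)
qed

text \<open>The case distinction suppresses \<open>0 ^ 0 = 1\<close> at \<open>k = 0\<close>, so
  that the series starts at \<open>l = 1\<close> for every \<open>k\<close>.\<close>

definition exp_sum_coeff :: "nat \<Rightarrow> nat \<Rightarrow> complex" where
  "exp_sum_coeff k l = (if l = 0 then 0 else of_nat l ^ k)"

lemma diffs_exp_sum_coeff: "diffs (exp_sum_coeff k) = (\<lambda>l. exp_sum_coeff (Suc k) (Suc l))"
  by (auto simp: diffs_def exp_sum_coeff_def fun_eq_iff)

lemma exp_sum_coeff_summable:
  assumes "norm x < 1"
  shows "summable (\<lambda>l. exp_sum_coeff k l * x ^ l)"
  using assms
proof (induction k arbitrary: x)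
  case 0
  have "summable (\<lambda>l. x ^ Suc l)" using 0 by (simp add: summable_geometric summable_mult)
  then have "summable (\<lambda>l. exp_sum_coeff 0 (Suc l) * x ^ Suc l)" by (simp add: exp_sum_coeff_def)
  then show ?case by (subst (asm) summable_Suc_iff)
next
  case (Suc k)
  have "summable (\<lambda>l. diffs (exp_sum_coeff k) l * x ^ l)"
    by (rule termdiff_converges[of x 1]) (use Suc in auto)
  then have "summable (\<lambda>l. x * (exp_sum_coeff (Suc k) (Suc l) * x ^ l))"
    unfolding diffs_exp_sum_coeff by (rule summable_mult)
  then have "summable (\<lambda>l. exp_sum_coeff (Suc k) (Suc l) * x ^ Suc l)" by (simp add: mult_ac)
  then show ?case by (subst (asm) summable_Suc_iff)
qed

text \<open>The Fourier side of the Lipschitz formula.\<close>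

definition exp_sum :: "nat \<Rightarrow> complex \<Rightarrow> complex" where
  "exp_sum k z = (\<Sum>l. exp_sum_coeff k l * unit_exp z ^ l)"

lemma norm_unit_exp_less_1: "Im z > 0 \<Longrightarrow> norm (unit_exp z) < 1"
  by (simp add: norm_unit_exp)

lemma exp_sum_derivative:
  assumes "Im z > 0"
  shows "(exp_sum k has_field_derivative 2 * of_real pi * \<i> * exp_sum (Suc k) z) (at z)"
proof -
  let ?q = "unit_exp z"
  obtain K where K: "norm ?q < K" "K < 1" using norm_unit_exp_less_1[OF assms] dense by blast
  have "summable (\<lambda>l. exp_sum_coeff k l * (of_real K) ^ l)"
  proof (rule exp_sum_coeff_summable)
    have "K \<ge> 0" using K(1) norm_ge_zero[of ?q] by linarith
    then show "norm (complex_of_real K) < 1" using K by simp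
  qed
  then have 1: "((\<lambda>x. \<Sum>l. exp_sum_coeff k l * x ^ l) has_field_derivative (\<Sum>l. diffs (exp_sum_coeff k) l * ?q ^ l)) (at ?q)"
    by (rule termdiffs_strong) (use K in auto)
  have 2: "(unit_exp has_field_derivative 2 * of_real pi * \<i> * ?q) (at z)"
    unfolding unit_exp_def by (auto intro!: derivative_eq_intros)
  have "(exp_sum k has_field_derivative (\<Sum>l. diffs (exp_sum_coeff k) l * ?q ^ l) * (2 * of_real pi * \<i> * ?q)) (at z)"
    unfolding exp_sum_def using DERIV_chain2[OF 1 2] .
  also have "(\<Sum>l. diffs (exp_sum_coeff k) l * ?q ^ l) * (2 * of_real pi * \<i> * ?q) =
    2 * of_real pi * \<i> * (?q * (\<Sum>l. exp_sum_coeff (Suc k) (Suc l) * ?q ^ l))"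
    by (simp add: diffs_exp_sum_coeff mult_ac)
  also have "?q * (\<Sum>l. exp_sum_coeff (Suc k) (Suc l) * ?q ^ l) = (\<Sum>l. exp_sum_coeff (Suc k) (Suc l) * ?q ^ Suc l)"
  proof -
    have "summable (\<lambda>l. diffs (exp_sum_coeff k) l * ?q ^ l)"
      using norm_unit_exp_less_1[OF assms] by (intro termdiff_converges[of _ 1] exp_sum_coeff_summable) auto
    then show ?thesis unfolding diffs_exp_sum_coeff by (subst suminf_mult[symmetric]) (auto simp: mult_ac)
  qed
  also have "\<dots> = exp_sum (Suc k) z"
    using suminf_split_head[OF exp_sum_coeff_summable[OF norm_unit_exp_less_1[OF assms]], of "Suc k"]
    by (simp add: exp_sum_def exp_sum_coeff_def)
  finally show ?thesis .
qed

lemma exp_sum_0: assumes "Im z > 0" shows "exp_sum 0 z = unit_exp z / (1 - unit_exp z)"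
proof -
  let ?q = "unit_exp z"
  have q: "norm ?q < 1" by (rule norm_unit_exp_less_1[OF assms])
  have "exp_sum 0 z = (\<Sum>l. exp_sum_coeff 0 (Suc l) * ?q ^ Suc l)"
    using suminf_split_head[OF exp_sum_coeff_summable[OF q], of 0] by (simp add: exp_sum_def exp_sum_coeff_def)
  also have "\<dots> = (\<Sum>l. ?q * ?q ^ l)" by (simp add: exp_sum_coeff_def)
  also have "\<dots> = ?q / (1 - ?q)" using q by (simp add: suminf_mult summable_geometric suminf_geometric)
  finally show ?thesis .
qed

text \<open>In disguise, the \<open>k\<close>-th derivative of \<open>pi cot (pi z)\<close>: see
  \<open>Digamma_reflection\<close> and \<open>polygamma_refl_derivative\<close>.\<close>

definition polygamma_refl :: "nat \<Rightarrow> complex \<Rightarrow> complex" where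
  "polygamma_refl k z = (-1) ^ k * Polygamma k (1 - z) - Polygamma k z"

lemma polygamma_refl_derivative:
  assumes "Im z \<noteq> 0"
  shows "(polygamma_refl k has_field_derivative polygamma_refl (Suc k) z) (at z)"
  unfolding polygamma_refl_def
  using not_int_if_Im(2)[OF assms] not_int_if_Im(2)[of "1 - z"] assms
  by (auto intro!: derivative_eq_intros)

lemma cot_unit_exp:
  "cos (of_real pi * z) * (1 - unit_exp z) = - \<i> * (1 + unit_exp z) * sin (of_real pi * z)"
proof -
  define e where "e = exp (\<i> * (of_real pi * z))"
  have e: "e \<noteq> 0" by (simp add: e_def)
  have q: "unit_exp z = e * e" by (simp add: unit_exp_def e_def exp_add[symmetric] algebra_simps)
  have c: "cos (of_real pi * z) = (e + inverse e) / 2" and s: "sin (of_real pi * z) = (e - inverse e) / (2 * \<i>)"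
    unfolding cos_exp_eq sin_exp_eq e_def exp_minus by (rule refl)+
  show ?thesis
    using e unfolding q c s by (simp add: field_simps power2_eq_square)
qed

lemma polygamma_refl_0:
  assumes "Im z > 0"
  shows "polygamma_refl 0 z = - of_real pi * \<i> - 2 * of_real pi * \<i> * exp_sum 0 z"
proof -
  let ?q = "unit_exp z" and ?s = "sin (of_real pi * z)" and ?c = "cos (of_real pi * z)"
  have q: "1 - ?q \<noteq> 0" using norm_unit_exp_less_1[OF assms] by auto
  \<comment> \<open>By the reflection formula a zero of the sine would also be a zero of the
    cosine.\<close>
  have s: "?s \<noteq> 0"
  proof
    assume s0: "?s = 0"
    then have "?c = 0" using Digamma_reflection[of z] assms by auto
    then show False using s0 sin_cos_squared_add[of "of_real pi * z"] by simp
  qed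
  have "polygamma_refl 0 z * (?s * (1 - ?q)) = (?s * (Digamma (1 - z) - Digamma z)) * (1 - ?q)"
    by (simp add: polygamma_refl_def)
  also have "\<dots> = of_real pi * (?c * (1 - ?q))" using assms by (simp add: Digamma_reflection)
  also have "\<dots> = (- of_real pi * \<i> - 2 * of_real pi * \<i> * (?q / (1 - ?q))) * (?s * (1 - ?q))"
    unfolding cot_unit_exp using q by (simp add: field_simps)
  finally show ?thesis using s q by (simp add: exp_sum_0[OF assms])
qed

text \<open>Repeated differentiation of \<open>polygamma_refl_0\<close>; the constant term
  disappears at the first derivative.\<close>

lemma polygamma_refl_Suc:
  assumes "Im z > 0"
  shows "polygamma_refl (Suc k) z = - ((2 * of_real pi * \<i>) ^ (k + 2)) * exp_sum (Suc k) z"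
  using assms
proof (induction k arbitrary: z)
  case 0
  have op: "open {z. Im z > 0}" by (rule open_halfspace_Im_gt)
  have "((\<lambda>z. - of_real pi * \<i> - 2 * of_real pi * \<i> * exp_sum 0 z) has_field_derivative
      - ((2 * of_real pi * \<i>) ^ 2) * exp_sum 1 z) (at z)"
    using exp_sum_derivative[OF 0, of 0]
    by (auto intro!: derivative_eq_intros simp: power2_eq_square)
  then have "(polygamma_refl 0 has_field_derivative - ((2 * of_real pi * \<i>) ^ 2) * exp_sum 1 z) (at z)"
    by (rule has_field_derivative_transform_within_open[OF _ op]) (use 0 polygamma_refl_0 in auto)
  moreover have "(polygamma_refl 0 has_field_derivative polygamma_refl 1 z) (at z)"
    using polygamma_refl_derivative[of z 0] 0 by simp
  ultimately have "polygamma_refl 1 z = - ((2 * of_real pi * \<i>) ^ 2) * exp_sum 1 z" using DERIV_unique by blast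
  then show ?case by (simp add: power2_eq_square)
next
  case (Suc k)
  have op: "open {z. Im z > 0}" by (rule open_halfspace_Im_gt)
  have "((\<lambda>z. - ((2 * of_real pi * \<i>) ^ (k + 2)) * exp_sum (Suc k) z) has_field_derivative
      - ((2 * of_real pi * \<i>) ^ (k + 2)) * (2 * of_real pi * \<i> * exp_sum (Suc (Suc k)) z)) (at z)"
    by (intro DERIV_cmult exp_sum_derivative Suc)
  then have "(polygamma_refl (Suc k) has_field_derivative
      - ((2 * of_real pi * \<i>) ^ (k + 2)) * (2 * of_real pi * \<i> * exp_sum (Suc (Suc k)) z)) (at z)"
    by (rule has_field_derivative_transform_within_open[OF _ op]) (use Suc in auto)
  moreover have "(polygamma_refl (Suc k) has_field_derivative polygamma_refl (Suc (Suc k)) z) (at z)"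
    using polygamma_refl_derivative[of z "Suc k"] Suc by simp
  ultimately have "polygamma_refl (Suc (Suc k)) z = - ((2 * of_real pi * \<i>) ^ (k + 2)) * (2 * of_real pi * \<i> * exp_sum (Suc (Suc k)) z)"
    using DERIV_unique by blast
  then show ?case by simp
qed

text \<open>Summability over all integers is a hypothesis; the ordinary series only supply the
  values of the two halves. The negative half starts at \<open>- 1\<close>.\<close>

lemma has_sum_int_from_sums:
  fixes f :: "int \<Rightarrow> complex"
  assumes "f summable_on UNIV" "(\<lambda>t. f (int t)) sums a" "(\<lambda>t. f (- int (Suc t))) sums b"
  shows "(f has_sum (a + b)) UNIV"
proof -
  have un: "range int \<union> range (\<lambda>n. - int (Suc n)) = UNIV"
  proof (rule UNIV_eq_I[symmetric])
    fix d :: int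
    show "d \<in> range int \<union> range (\<lambda>n. - int (Suc n))"
    proof (cases "d \<ge> 0")
      case True
      then have "d = int (nat d)" by simp
      then show ?thesis by blast
    next
      case False
      then have "d = - int (Suc (nat (- d - 1)))" by simp
      then show ?thesis by blast
    qed
  qed
  have *: "(f has_sum c) (range h)" if h: "inj h" "(\<lambda>t. f (h t)) sums c" for h :: "nat \<Rightarrow> int" and c
  proof -
    have "f summable_on range h" by (rule summable_on_subset_banach[OF assms(1)]) auto
    then have "(\<lambda>t. f (h t)) summable_on UNIV"
      using summable_on_reindex[OF h(1), of f] by (simp add: o_def)
    then have "((\<lambda>t. f (h t)) has_sum (\<Sum>\<^sub>\<infinity>t. f (h t))) UNIV" by (rule has_sum_infsum)
    moreover have "(\<Sum>\<^sub>\<infinity>t. f (h t)) = c"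
      using has_sum_imp_sums[OF calculation] h(2) sums_unique2 by blast
    ultimately show ?thesis using has_sum_reindex[OF h(1), of f c] by (simp add: o_def)
  qed
  have "(f has_sum (a + b)) (range int \<union> range (\<lambda>n. - int (Suc n)))"
    by (rule has_sum_Un_disjoint[OF *[OF _ assms(2)] *[OF _ assms(3)]]) (auto simp: inj_on_def)
  then show ?thesis unfolding un .
qed

text \<open>The Lipschitz expression for the sum of \<open>(u + t)\<close> to the
  \<open>- (k + 1)\<close> over all integers \<open>t\<close>; for \<open>k = 0\<close> a constant
  is missing.\<close>

definition lipschitz_rhs :: "nat \<Rightarrow> complex \<Rightarrow> complex" where
  "lipschitz_rhs k u = (- 2 * of_real pi * \<i>) ^ Suc k / fact k * exp_sum k u"

text \<open>Subtracting the conjugate makes the sum over integer translates absolutely convergent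
  for \<open>k = 0\<close> too, where the simple poles alone would not be. It is also the
  combination that occurs in \<open>recip_exp\<close>.\<close>

definition pole_diff :: "nat \<Rightarrow> complex \<Rightarrow> complex" where
  "pole_diff k u = inverse (u ^ Suc k) - cnj (inverse (u ^ Suc k))"

text \<open>For \<open>k = 0\<close> the numerator collapses to the imaginary part; for larger
  \<open>k\<close> the triangle inequality suffices. The bound has one shape for all
  \<open>k\<close>, so that it factors into a part depending on \<open>k\<close> and a part
  depending on the translate.\<close>

lemma pole_diff_bound:
  assumes "Im u > 0"
  shows "norm (pole_diff k u) \<le> 2 * Im u ^ 2 * inverse (Im u) ^ Suc k * (1 / norm u ^ 2)"
proof -
  let ?y = "Im u"
  have y: "?y \<le> norm u" using abs_Im_le_cmod[of u] by linarith
  have N: "norm u > 0" using assms by auto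
  show ?thesis
  proof (cases k)
    case 0
    have "pole_diff 0 u = (cnj u - u) / (u * cnj u)"
      using assms by (auto simp: pole_diff_def field_simps complex_eq_iff)
    also have "norm \<dots> = 2 * ?y / norm u ^ 2"
    proof -
      have "cnj u - u = - (2 * \<i> * of_real ?y)" by (simp add: complex_eq_iff)
      then have "norm (cnj u - u) = 2 * ?y" using assms by (simp add: norm_mult)
      then show ?thesis by (simp add: norm_divide norm_mult power2_eq_square)
    qed
    finally show ?thesis using 0 assms by (simp add: power2_eq_square field_simps)
  next
    case (Suc j)
    have "norm (pole_diff k u) \<le> norm (inverse (u ^ Suc k)) + norm (cnj (inverse (u ^ Suc k)))"
      unfolding pole_diff_def by (rule norm_triangle_ineq4)
    also have "\<dots> = 2 * (inverse (norm u) ^ j * (1 / norm u ^ 2))"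
      by (simp add: Suc norm_inverse norm_mult norm_power power2_eq_square divide_inverse power_inverse)
    also have "\<dots> \<le> 2 * (inverse ?y ^ j * (1 / norm u ^ 2))"
      using y assms N by (intro mult_left_mono mult_right_mono power_mono le_imp_inverse_le) auto
    also have "inverse ?y ^ j = ?y ^ 2 * inverse ?y ^ Suc k"
      using assms by (simp add: Suc power2_eq_square field_simps)
    finally show ?thesis by (simp add: mult_ac)
  qed
qed

lemma summable_on_shift_inverse_square:
  assumes "Im u > 0"
  shows "(\<lambda>t::int. 1 / norm (u + of_int t) ^ 2) summable_on UNIV"
proof -
  have "(\<lambda>t. norm (latpow u 1 t 1)) summable_on UNIV"
    by (rule latpow_row_summable) (use assms in auto)
  also have "(\<lambda>t. norm (latpow u 1 t 1)) = (\<lambda>t::int. 1 / norm (u + of_int t) ^ 2)"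
  proof
    fix t
    have "norm (u + of_int t) > 0" using lat_nonzero[OF assms, of 1 t] by simp
    then show "norm (latpow u 1 t 1) = 1 / norm (u + of_int t) ^ 2"
      by (simp add: norm_latpow powr_minus_divide)
  qed
  finally show ?thesis .
qed

text \<open>The expansion \<open>polygamma_refl_0\<close> covers the upper half-plane only; this
  symmetry, read off from the cotangent, handles the conjugate point.\<close>

lemma polygamma_refl_0_cnj:
  assumes "Im u > 0"
  shows "polygamma_refl 0 (cnj u) = cnj (polygamma_refl 0 u)"
proof -
  have s: "sin (of_real pi * u) \<noteq> 0"
  proof
    assume s0: "sin (of_real pi * u) = 0"
    then have "cos (of_real pi * u) = 0" using Digamma_reflection[of u] assms by auto
    then show False using s0 sin_cos_squared_add[of "of_real pi * u"] by simp
  qed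
  have c: "cnj (of_real pi * u) = of_real pi * cnj u" by simp
  have "sin (of_real pi * cnj u) * polygamma_refl 0 (cnj u) = of_real pi * cos (of_real pi * cnj u)"
    using Digamma_reflection[of "cnj u"] assms by (simp add: polygamma_refl_def)
  also have "\<dots> = cnj (of_real pi * cos (of_real pi * u))"
    by (simp add: cnj_cos)
  also have "of_real pi * cos (of_real pi * u) = sin (of_real pi * u) * polygamma_refl 0 u"
    using Digamma_reflection[of u] assms by (simp add: polygamma_refl_def)
  also have "cnj \<dots> = sin (of_real pi * cnj u) * cnj (polygamma_refl 0 u)"
    by (simp add: cnj_sin)
  finally show ?thesis using s by (metis c cnj_sin complex_cnj_zero_iff mult_left_cancel)
qed

text \<open>Nonnegative and negative translates give polygamma values at \<open>u\<close> and at
  \<open>1 - u\<close>, which combine to \<open>polygamma_refl\<close>. For \<open>k = 0\<close>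
  only differences of Digamma series converge; there the constant \<open>- pi i\<close> of the
  cotangent expansion minus its conjugate leaves \<open>- 2 pi i\<close>.\<close>

lemma lipschitz_sum:
  assumes "Im u > 0"
  shows "((\<lambda>t::int. pole_diff k (u + of_int t)) has_sum
    (lipschitz_rhs k u - cnj (lipschitz_rhs k u) - (if k = 0 then 2 * of_real pi * \<i> else 0))) UNIV"
proof -
  have nz: "u \<noteq> 0" "1 - u \<noteq> 0" "cnj u \<noteq> 0" "1 - cnj u \<noteq> 0" using assms by (auto simp: complex_eq_iff)
  have "(\<lambda>t::int. 2 * Im u ^ 2 * inverse (Im u) ^ Suc k * (1 / norm (u + of_int t) ^ 2)) summable_on UNIV"
    by (intro summable_on_cmult_right summable_on_shift_inverse_square assms)
  then have "(\<lambda>t::int. norm (pole_diff k (u + of_int t))) summable_on UNIV"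
    by (rule summable_on_comparison_test) (use pole_diff_bound[of "u + of_int _" k] assms in auto)
  then have sm: "(\<lambda>t::int. pole_diff k (u + of_int t)) summable_on UNIV"
    by (rule abs_summable_summable)
  show ?thesis
  proof (cases k)
    case 0
    have dig: "(\<lambda>t. inverse (a + of_nat t) - inverse (b + of_nat t)) sums (Digamma b - Digamma a)"
      if "a \<noteq> 0" "b \<noteq> 0" for a b :: complex
    proof -
      have "(\<lambda>t. (inverse (of_nat (Suc t)) - inverse (b + of_nat t)) - (inverse (of_nat (Suc t)) - inverse (a + of_nat t))) sums
        ((Digamma b + euler_mascheroni) - (Digamma a + euler_mascheroni))"
        using summable_sums[OF summable_Digamma[OF that(1)]] summable_sums[OF summable_Digamma[OF that(2)]]
        by (intro sums_diff) (simp_all add: Digamma_def)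
      then show ?thesis by simp
    qed
    have 1: "(\<lambda>t. pole_diff k (u + of_int (int t))) sums (Digamma (cnj u) - Digamma u)"
      using dig[OF nz(1,3)] by (simp add: pole_diff_def 0)
    have inv: "inverse (u + of_int (- int (Suc t))) = - inverse (1 - u + of_nat t)" for u :: complex and t
    proof -
      have "u + of_int (- int (Suc t)) = - (1 - u + of_nat t)" by simp
      then show ?thesis by (simp only: inverse_minus_eq)
    qed
    have "(\<lambda>t. inverse (1 - cnj u + of_nat t) - inverse (1 - u + of_nat t)) sums (Digamma (1 - u) - Digamma (1 - cnj u))"
      by (rule dig[OF nz(4,2)])
    also have "(\<lambda>t. inverse (1 - cnj u + of_nat t) - inverse (1 - u + of_nat t)) = (\<lambda>t. pole_diff k (u + of_int (- int (Suc t))))"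
      unfolding pole_diff_def 0 power_Suc0_right inv by (rule ext) simp
    finally have 2: "(\<lambda>t. pole_diff k (u + of_int (- int (Suc t)))) sums (Digamma (1 - u) - Digamma (1 - cnj u))" .
    have "Digamma (cnj u) - Digamma u + (Digamma (1 - u) - Digamma (1 - cnj u)) = polygamma_refl 0 u - cnj (polygamma_refl 0 u)"
      unfolding polygamma_refl_0_cnj[OF assms, symmetric] by (simp add: polygamma_refl_def)
    also have "\<dots> = lipschitz_rhs k u - cnj (lipschitz_rhs k u) - (if k = 0 then 2 * of_real pi * \<i> else 0)"
      unfolding polygamma_refl_0[OF assms] by (simp add: 0 lipschitz_rhs_def)
    finally show ?thesis using has_sum_int_from_sums[OF sm 1 2] by simp
  next
    case (Suc j)
    define A where "A = (-1) ^ Suc k * Polygamma k u / fact k"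
    define B where "B = Polygamma k (1 - u) / fact k"
    have "(\<lambda>t. inverse ((u + of_nat t) ^ Suc k)) sums A"
      unfolding A_def by (rule Polygamma_LIMSEQ) (use nz Suc in auto)
    then have 1: "(\<lambda>t. pole_diff k (u + of_int (int t))) sums (A - cnj A)"
      unfolding pole_diff_def by (intro sums_diff sums_cnj[THEN iffD2]) simp_all
    have "(\<lambda>t. (-1) ^ Suc k * inverse ((1 - u + of_nat t) ^ Suc k)) sums ((-1) ^ Suc k * ((-1) ^ Suc k * Polygamma k (1 - u) / fact k))"
      by (intro sums_mult Polygamma_LIMSEQ) (use nz Suc in auto)
    also have "(-1) ^ Suc k * ((-1) ^ Suc k * Polygamma k (1 - u) / fact k) = B"
      by (simp add: B_def mult.assoc[symmetric] power_mult_distrib[symmetric])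
    also have "(\<lambda>t. (-1) ^ Suc k * inverse ((1 - u + of_nat t) ^ Suc k)) = (\<lambda>t. inverse ((u + of_int (- int (Suc t))) ^ Suc k))"
    proof
      fix t
      have "u + of_int (- int (Suc t)) = - (1 - u + of_nat t)" by simp
      then have "(u + of_int (- int (Suc t))) ^ Suc k = (-1) ^ Suc k * (1 - u + of_nat t) ^ Suc k"
        by (simp only: power_minus[of "1 - u + of_nat t"])
      then show "(-1) ^ Suc k * inverse ((1 - u + of_nat t) ^ Suc k) = inverse ((u + of_int (- int (Suc t))) ^ Suc k)"
        by (simp only: inverse_mult_distrib power_inverse[symmetric]) simp
    qed
    finally have "(\<lambda>t. inverse ((u + of_int (- int (Suc t))) ^ Suc k)) sums B" .
    then have 2: "(\<lambda>t. pole_diff k (u + of_int (- int (Suc t)))) sums (B - cnj B)"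
      unfolding pole_diff_def by (intro sums_diff sums_cnj[THEN iffD2]) simp_all
    have m1: "((-1) ^ k * (-1) ^ k :: complex) = 1" by (simp flip: power_mult_distrib)
    have "A + B = (-1) ^ k * polygamma_refl k u / fact k"
      unfolding A_def B_def polygamma_refl_def by (simp add: right_diff_distrib mult.assoc[symmetric] m1 diff_divide_distrib)
    also have "\<dots> = lipschitz_rhs k u"
    proof -
      have "(- 2 * complex_of_real pi * \<i>) ^ Suc k = (- 1) ^ Suc k * (2 * complex_of_real pi * \<i>) ^ Suc k"
        by (subst power_mult_distrib[symmetric]) simp
      then show ?thesis unfolding Suc polygamma_refl_Suc[OF assms] lipschitz_rhs_def by simp
    qed
    finally have AB: "A + B = lipschitz_rhs k u" .
    have "(A - cnj A) + (B - cnj B) = (A + B) - cnj (A + B)" by simp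
    also have "\<dots> = lipschitz_rhs k u - cnj (lipschitz_rhs k u) - (if k = 0 then 2 * of_real pi * \<i> else 0)"
      unfolding AB using Suc by simp
    finally show ?thesis using has_sum_int_from_sums[OF sm 1 2] by simp
  qed
qed

lemma has_sum_interchange:
  fixes f :: "'a \<times> 'b \<Rightarrow> complex"
  assumes "f summable_on A \<times> B"
    and "\<And>x. x \<in> A \<Longrightarrow> ((\<lambda>y. f (x, y)) has_sum g x) B"
    and "\<And>y. y \<in> B \<Longrightarrow> ((\<lambda>x. f (x, y)) has_sum h y) A"
  obtains T where "(g has_sum T) A" "(h has_sum T) B"
proof -
  let ?T = "infsum f (A \<times> B)"
  have 1: "(f has_sum ?T) (A \<times> B)" using assms(1) by (rule has_sum_infsum)
  then have "(g has_sum ?T) A" by (rule has_sum_SigmaD) (use assms(2) in auto)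
  moreover have "((\<lambda>(y, x). f (x, y)) has_sum ?T) (B \<times> A)"
    using has_sum_reindex_bij_witness[of "B \<times> A" "\<lambda>(x, y). (y, x)" "\<lambda>(y, x). (x, y)" "A \<times> B" f "\<lambda>(y, x). f (x, y)" ?T ?T] 1
    by auto
  then have "(h has_sum ?T) B" by (rule has_sum_SigmaD) (use assms(3) in auto)
  ultimately show ?thesis by (rule that)
qed

section \<open>Summing a row over integer translates\<close>

text \<open>By \<open>row_term_one\<close>, \<open>2 pi\<close> times the seed of a row at
  \<open>s = 1\<close> without its phase, with \<open>u = \<tau> + d / c\<close> and
  \<open>\<nu> = n / (Q c^2)\<close>.\<close>

definition recip_exp :: "real \<Rightarrow> complex \<Rightarrow> complex" where
  "recip_exp \<nu> u = unit_exp (of_real \<nu> / u) - unit_exp (of_real \<nu> / cnj u)"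

definition exp_coeff :: "real \<Rightarrow> nat \<Rightarrow> complex" where
  "exp_coeff \<nu> k = (2 * of_real pi * \<i> * of_real \<nu>) ^ Suc k / fact (Suc k)"

lemma recip_exp_sums: "(\<lambda>k. exp_coeff \<nu> k * pole_diff k u) sums recip_exp \<nu> u"
proof -
  have e: "(\<lambda>k. (2 * of_real pi * \<i> * of_real \<nu>) ^ k / fact k * inverse (v ^ k)) sums unit_exp (of_real \<nu> / v)" for v
  proof -
    have "(\<lambda>k. (2 * of_real pi * \<i> * (of_real \<nu> / v)) ^ k /\<^sub>R fact k) sums exp (2 * of_real pi * \<i> * (of_real \<nu> / v))"
      by (rule exp_converges)
    moreover have "(2 * of_real pi * \<i> * (of_real \<nu> / v)) ^ k /\<^sub>R fact k = (2 * of_real pi * \<i> * of_real \<nu>) ^ k / fact k * inverse (v ^ k)" for k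
      by (simp add: scaleR_conv_of_real power_mult_distrib power_divide divide_simps)
    ultimately show ?thesis by (simp only: unit_exp_def)
  qed
  have "(\<lambda>k. (2 * of_real pi * \<i> * of_real \<nu>) ^ k / fact k * (inverse (u ^ k) - cnj (inverse (u ^ k)))) sums recip_exp \<nu> u"
    using sums_diff[OF e[of u] e[of "cnj u"]] by (simp add: recip_exp_def right_diff_distrib)
  \<comment> \<open>The terms with \<open>k = 0\<close> cancel in the difference; dropping them
    shifts the index to \<open>Suc k\<close>.\<close>
  from sums_split_initial_segment[OF this, of 1] show ?thesis
    by (simp add: exp_coeff_def pole_diff_def del: power_Suc fact_Suc)
qed

text \<open>With \<open>L = l + 1\<close> this is \<open>sqrt (X / L)\<close> times the Bessel
  function \<open>I\<close> of order 1 at \<open>2 sqrt (X L)\<close> for positive \<open>X\<close>;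
  for negative \<open>X\<close>, up to sign, \<open>J\<close> of order 1 takes its place.\<close>

definition bessel_sum :: "real \<Rightarrow> nat \<Rightarrow> complex" where
  "bessel_sum X l = (\<Sum>k. of_real X ^ Suc k * of_nat (Suc l) ^ k / (fact (Suc k) * fact k))"

text \<open>The estimate \<open>(\<epsilon> L)^k / k! \<le> exp (\<epsilon> L)\<close> trades powers
  of \<open>L = l + 1\<close> for an exponential of arbitrarily small rate, which the powers of
  \<open>q\<close> will beat, and leaves an exponential series in \<open>k\<close>.\<close>

lemma bessel_sum_term_bound:
  assumes "\<epsilon> > 0"
  shows "norm (of_real X ^ Suc k * of_nat (Suc l) ^ k / (fact (Suc k) * fact k) :: complex) \<le>
    \<bar>X\<bar> * ((\<bar>X\<bar> / \<epsilon>) ^ k / fact k) * exp (\<epsilon> * Suc l)"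
proof -
  have "(\<epsilon> * Suc l) ^ k / fact k \<le> exp (\<epsilon> * Suc l)"
  proof -
    let ?x = "\<epsilon> * Suc l"
    have "(\<Sum>i\<in>{k}. ?x ^ i / fact i) \<le> (\<Sum>i. ?x ^ i / fact i)"
      using summable_exp[of ?x] assms by (intro sum_le_suminf) (auto simp: field_simps)
    also have "\<dots> = exp ?x" by (simp add: exp_def field_simps)
    finally show ?thesis by simp
  qed
  then have 1: "real (Suc l) ^ k / fact k \<le> exp (\<epsilon> * Suc l) / \<epsilon> ^ k"
    using assms by (simp add: power_mult_distrib field_simps del: of_nat_Suc)
  have "norm (of_real X ^ Suc k * of_nat (Suc l) ^ k / (fact (Suc k) * fact k) :: complex) =
    \<bar>X\<bar> ^ Suc k / fact (Suc k) * (real (Suc l) ^ k / fact k)"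
    by (simp add: norm_mult norm_divide norm_power del: of_nat_Suc power_Suc fact_Suc)
  also have "\<dots> \<le> \<bar>X\<bar> ^ Suc k / fact k * (exp (\<epsilon> * Suc l) / \<epsilon> ^ k)"
  proof (rule mult_mono[OF _ 1])
    show "\<bar>X\<bar> ^ Suc k / fact (Suc k) \<le> \<bar>X\<bar> ^ Suc k / fact k"
      by (intro divide_left_mono fact_mono) auto
  qed auto
  also have "\<dots> = \<bar>X\<bar> * ((\<bar>X\<bar> / \<epsilon>) ^ k / fact k) * exp (\<epsilon> * Suc l)"
    by (simp add: power_divide)
  finally show ?thesis .
qed

lemma summable_exp_real: "summable (\<lambda>k. B * (x ^ k / fact k) * C)" for x :: real
  using summable_exp[of x] by (intro summable_mult summable_mult2) (simp add: field_simps)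

lemma bessel_sum_summable: "summable (\<lambda>k. norm (of_real X ^ Suc k * of_nat (Suc l) ^ k / (fact (Suc k) * fact k) :: complex))"
  by (rule summable_comparison_test'[OF summable_exp_real[of "\<bar>X\<bar>" "\<bar>X\<bar> / 1" "exp (1 * Suc l)"]])
     (use bessel_sum_term_bound[of 1 X _ l] in auto)

lemma norm_bessel_sum_le:
  assumes "\<epsilon> > 0"
  shows "norm (bessel_sum X l) \<le> \<bar>X\<bar> * exp (\<bar>X\<bar> / \<epsilon>) * exp (\<epsilon> * Suc l)"
proof -
  have "norm (bessel_sum X l) \<le> (\<Sum>k. \<bar>X\<bar> * ((\<bar>X\<bar> / \<epsilon>) ^ k / fact k) * exp (\<epsilon> * Suc l))"
    unfolding bessel_sum_def by (rule norm_suminf_le[OF bessel_sum_term_bound[OF assms] summable_exp_real])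
  also have "\<dots> = \<bar>X\<bar> * exp (\<bar>X\<bar> / \<epsilon>) * exp (\<epsilon> * Suc l)"
  proof -
    have "(\<lambda>k. (\<bar>X\<bar> / \<epsilon>) ^ k / fact k) sums exp (\<bar>X\<bar> / \<epsilon>)"
      using exp_converges[of "\<bar>X\<bar> / \<epsilon>"] by (simp add: divide_inverse mult.commute)
    then have "(\<lambda>k. \<bar>X\<bar> * ((\<bar>X\<bar> / \<epsilon>) ^ k / fact k) * exp (\<epsilon> * Suc l)) sums (\<bar>X\<bar> * exp (\<bar>X\<bar> / \<epsilon>) * exp (\<epsilon> * Suc l))"
      by (intro sums_mult sums_mult2)
    then show ?thesis by (rule sums_unique[symmetric])
  qed
  finally show ?thesis .
qed

lemma has_sum_UNIV_nat:
  fixes f :: "nat \<Rightarrow> complex"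
  assumes "summable (\<lambda>k. norm (f k))"
  shows "(f has_sum (\<Sum>k. f k)) UNIV"
  using norm_summable_imp_has_sum[OF assms summable_sums[OF summable_norm_cancel[OF assms]]] .

text \<open>Expand the exponentials in powers \<open>k\<close>, exchange with the sum over
  translates, apply the Lipschitz formula for each \<open>k\<close>, then exchange the sums over
  \<open>k\<close> and the frequency \<open>l\<close>. The constant \<open>X\<close> is the
  \<open>k = 0\<close> term times the exceptional \<open>- 2 pi i\<close> of
  \<open>lipschitz_sum\<close>.\<close>

lemma recip_exp_shift_sum:
  assumes u: "Im u > 0" and "\<nu> > 0"
  defines "X \<equiv> 4 * pi\<^sup>2 * \<nu>" and "q \<equiv> unit_exp u"
  obtains T where "((\<lambda>t::int. recip_exp \<nu> (u + of_int t)) has_sum (of_real X + T)) UNIV"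
    "((\<lambda>l. bessel_sum X l * q ^ Suc l - bessel_sum (- X) l * cnj q ^ Suc l) has_sum T) UNIV"
proof -
  define y where "y = Im u"
  have y: "y > 0" using u by (simp add: y_def)
  define L where "L k = lipschitz_rhs k u - cnj (lipschitz_rhs k u) - (if k = 0 then 2 * of_real pi * \<i> else 0)" for k
  have sk: "summable (\<lambda>k. norm (exp_coeff \<nu> k) * inverse y ^ Suc k)"
  proof -
    have "summable (\<lambda>k. (2 * pi * \<nu> * inverse y) ^ k / fact k)"
      using summable_exp[of "2 * pi * \<nu> * inverse y"] by (simp add: field_simps)
    then have "summable (\<lambda>k. (2 * pi * \<nu> * inverse y) ^ Suc k / fact (Suc k))"
      by (subst summable_Suc_iff)
    moreover have "norm (exp_coeff \<nu> k) * inverse y ^ Suc k = (2 * pi * \<nu> * inverse y) ^ Suc k / fact (Suc k)" for k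
      using assms by (simp add: exp_coeff_def norm_mult norm_divide norm_power power_mult_distrib del: fact_Suc power_Suc)
    ultimately show ?thesis by simp
  qed
  have "(\<lambda>(k, t::int). norm (exp_coeff \<nu> k) * inverse y ^ Suc k * (2 * y\<^sup>2 * (1 / norm (u + of_int t) ^ 2))) summable_on UNIV \<times> UNIV"
    using sk y by (intro summable_on_product summable_on_cmult_right summable_on_shift_inverse_square u norm_summable_imp_summable_on)
       (auto simp: norm_mult norm_inverse norm_power)
  then have "(\<lambda>p. norm (case p of (k, t::int) \<Rightarrow> exp_coeff \<nu> k * pole_diff k (u + of_int t))) summable_on UNIV \<times> UNIV"
  proof (rule summable_on_comparison_test)
    fix p :: "nat \<times> int"
    obtain k t where p: "p = (k, t)" by (cases p)
    have "norm (pole_diff k (u + of_int t)) \<le> 2 * y ^ 2 * inverse y ^ Suc k * (1 / norm (u + of_int t) ^ 2)"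
      using pole_diff_bound[of "u + of_int t" k] u by (simp add: y_def)
    from mult_left_mono[OF this, of "norm (exp_coeff \<nu> k)"]
    show "norm (case p of (k, t::int) \<Rightarrow> exp_coeff \<nu> k * pole_diff k (u + of_int t)) \<le>
      (case p of (k, t) \<Rightarrow> norm (exp_coeff \<nu> k) * inverse y ^ Suc k * (2 * y\<^sup>2 * (1 / norm (u + of_int t) ^ 2)))"
      by (simp add: p norm_mult mult_ac)
  qed auto
  then have sm1: "(\<lambda>p. case p of (k, t::int) \<Rightarrow> exp_coeff \<nu> k * pole_diff k (u + of_int t)) summable_on UNIV \<times> UNIV"
    by (rule abs_summable_summable)
  have col1: "((\<lambda>t::int. exp_coeff \<nu> k * pole_diff k (u + of_int t)) has_sum exp_coeff \<nu> k * L k) UNIV" for k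
    unfolding L_def by (intro has_sum_cmult_right lipschitz_sum u)
  have row1: "((\<lambda>k. exp_coeff \<nu> k * pole_diff k (u + of_int t)) has_sum recip_exp \<nu> (u + of_int t)) UNIV" for t
  proof (rule norm_summable_imp_has_sum[OF _ recip_exp_sums])
    let ?N = "2 * y ^ 2 * (1 / norm (u + of_int t) ^ 2)"
    have "summable (\<lambda>k. norm (exp_coeff \<nu> k) * inverse y ^ Suc k * ?N)"
      by (rule summable_mult2[OF sk])
    then show "summable (\<lambda>k. norm (exp_coeff \<nu> k * pole_diff k (u + of_int t)))"
    proof (rule summable_comparison_test')
      fix k :: nat assume "k \<ge> 0"
      have "norm (pole_diff k (u + of_int t)) \<le> 2 * y ^ 2 * inverse y ^ Suc k * (1 / norm (u + of_int t) ^ 2)"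
        using pole_diff_bound[of "u + of_int t" k] u by (simp add: y_def)
      from mult_left_mono[OF this, of "norm (exp_coeff \<nu> k)"]
      show "norm (norm (exp_coeff \<nu> k * pole_diff k (u + of_int t))) \<le> norm (exp_coeff \<nu> k) * inverse y ^ Suc k * ?N"
        by (simp add: norm_mult mult_ac)
    qed
  qed
  obtain S where S: "((\<lambda>k. exp_coeff \<nu> k * L k) has_sum S) UNIV" "((\<lambda>t. recip_exp \<nu> (u + of_int t)) has_sum S) UNIV"
    by (rule has_sum_interchange[of "\<lambda>p. case p of (k, t::int) \<Rightarrow> exp_coeff \<nu> k * pole_diff k (u + of_int t)" UNIV UNIV])
       (use sm1 col1 row1 in auto)
  define P where "P = (\<lambda>(k, l). of_real X ^ Suc k * of_nat (Suc l) ^ k / (fact (Suc k) * fact k) * q ^ Suc l -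
     of_real (- X) ^ Suc k * of_nat (Suc l) ^ k / (fact (Suc k) * fact k) * cnj q ^ Suc l)"
  define \<epsilon> where "\<epsilon> = pi * y"
  have \<epsilon>: "\<epsilon> > 0" using y by (simp add: \<epsilon>_def)
  have nq: "norm q = exp (- 2 * pi * y)" by (simp add: q_def norm_unit_exp y_def)
  have nq': "exp (\<epsilon> * Suc l) * norm q ^ Suc l = exp (- \<epsilon>) ^ Suc l" for l
    unfolding nq exp_of_nat_mult[symmetric] exp_add[symmetric]
    by (rule arg_cong[of _ _ exp]) (simp add: \<epsilon>_def algebra_simps)
  have q1: "norm q < 1" using y by (simp add: nq)
  have geo: "summable (\<lambda>l. exp (- \<epsilon>) ^ Suc l)" using \<epsilon> by (subst summable_Suc_iff) (simp add: summable_geometric)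
  have Pb: "norm (P (k, l)) \<le> 2 * \<bar>X\<bar> * ((\<bar>X\<bar> / \<epsilon>) ^ k / fact k) * exp (- \<epsilon>) ^ Suc l" for k l
  proof -
    have "norm (P (k, l)) \<le> norm (of_real X ^ Suc k * of_nat (Suc l) ^ k / (fact (Suc k) * fact k) * q ^ Suc l) +
      norm (of_real (- X) ^ Suc k * of_nat (Suc l) ^ k / (fact (Suc k) * fact k) * cnj q ^ Suc l)"
      unfolding P_def prod.case by (rule norm_triangle_ineq4)
    also have "\<dots> \<le> \<bar>X\<bar> * ((\<bar>X\<bar> / \<epsilon>) ^ k / fact k) * exp (\<epsilon> * Suc l) * norm q ^ Suc l +
      \<bar>- X\<bar> * ((\<bar>- X\<bar> / \<epsilon>) ^ k / fact k) * exp (\<epsilon> * Suc l) * norm q ^ Suc l"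
      unfolding norm_mult[of _ "q ^ Suc l"] norm_mult[of _ "cnj q ^ Suc l"] norm_power complex_mod_cnj
      by (intro add_mono mult_right_mono bessel_sum_term_bound \<epsilon>) auto
    also have "\<dots> = 2 * \<bar>X\<bar> * ((\<bar>X\<bar> / \<epsilon>) ^ k / fact k) * (exp (\<epsilon> * Suc l) * norm q ^ Suc l)" by simp
    finally show ?thesis unfolding nq' .
  qed
  have "(\<lambda>(k, l). 2 * \<bar>X\<bar> * ((\<bar>X\<bar> / \<epsilon>) ^ k / fact k) * exp (- \<epsilon>) ^ Suc l) summable_on UNIV \<times> UNIV"
    using geo summable_exp_real[of "2 * \<bar>X\<bar>" "\<bar>X\<bar> / \<epsilon>" 1] \<epsilon>
    by (intro summable_on_product norm_summable_imp_summable_on) (auto simp: abs_mult)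
  then have "(\<lambda>p. norm (P p)) summable_on UNIV \<times> UNIV"
    by (rule summable_on_comparison_test) (use Pb in auto)
  then have sm2: "P summable_on UNIV \<times> UNIV" by (rule abs_summable_summable)
  have kapsum: "((\<lambda>k. of_real Y ^ Suc k * of_nat (Suc l) ^ k / (fact (Suc k) * fact k) * z) has_sum bessel_sum Y l * z) UNIV" for Y l z
    unfolding bessel_sum_def by (intro has_sum_cmult_left has_sum_UNIV_nat bessel_sum_summable)
  have row2: "((\<lambda>k. P (k, l)) has_sum (bessel_sum X l * q ^ Suc l - bessel_sum (- X) l * cnj q ^ Suc l)) UNIV" for l
    unfolding P_def prod.case by (intro has_sum_diff kapsum)
  have lipsum: "((\<lambda>l. of_nat (Suc l) ^ k * q ^ Suc l) has_sum exp_sum k u) UNIV" for k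
  proof (rule norm_summable_imp_has_sum)
    have "summable (\<lambda>l. exp_sum_coeff k l * q ^ l)" using q1 by (rule exp_sum_coeff_summable)
    then have "(\<lambda>l. exp_sum_coeff k l * q ^ l) sums exp_sum k u" unfolding exp_sum_def q_def by (rule summable_sums)
    then have "(\<lambda>l. exp_sum_coeff k (Suc l) * q ^ Suc l) sums exp_sum k u"
      by (subst sums_Suc_iff) (simp add: exp_sum_coeff_def)
    then show "(\<lambda>l. of_nat (Suc l) ^ k * q ^ Suc l) sums exp_sum k u" by (simp add: exp_sum_coeff_def)
    have "summable (\<lambda>l. exp_sum_coeff k l * of_real (norm q) ^ l)" using q1 by (intro exp_sum_coeff_summable) simp
    then have "summable (\<lambda>l. exp_sum_coeff k (Suc l) * of_real (norm q) ^ Suc l)" by (subst summable_Suc_iff)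
    also have "(\<lambda>l. exp_sum_coeff k (Suc l) * of_real (norm q) ^ Suc l) = (\<lambda>l. of_real (norm (of_nat (Suc l) ^ k * q ^ Suc l)))"
      by (simp add: exp_sum_coeff_def norm_mult norm_power fun_eq_iff del: of_nat_Suc)
    finally show "summable (\<lambda>l. norm (of_nat (Suc l) ^ k * q ^ Suc l))" by (subst (asm) summable_of_real_iff)
  qed
  have lipsum': "((\<lambda>l. of_nat (Suc l) ^ k * cnj q ^ Suc l) has_sum cnj (exp_sum k u)) UNIV" for k
    using has_sum_cnj_iff[THEN iffD2, OF lipsum[of k]] by simp
  have col2: "((\<lambda>l. P (k, l)) has_sum (exp_coeff \<nu> k * L k - (if k = 0 then of_real X else 0))) UNIV" for k
  proof -
    \<comment> \<open>This is the origin of \<open>X\<close>: the coefficient of the exponential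
      series meets the one of the Lipschitz formula, with opposite signs for the two conjugate
      parts.\<close>
    have pi2: "2 * complex_of_real pi * \<i> * of_real \<nu> * (- 2 * of_real pi * \<i>) = of_real X"
      "2 * complex_of_real pi * \<i> * of_real \<nu> * (2 * of_real pi * \<i>) = of_real (- X)"
      by (simp_all add: X_def complex_eq_iff power2_eq_square)
    have a: "exp_coeff \<nu> k * lipschitz_rhs k u = of_real X ^ Suc k / (fact (Suc k) * fact k) * exp_sum k u"
      unfolding exp_coeff_def lipschitz_rhs_def pi2(1)[symmetric] power_mult_distrib[of _ "- 2 * of_real pi * \<i>"]
      by (simp del: fact_Suc power_Suc)
    have "cnj (lipschitz_rhs k u) = (2 * of_real pi * \<i>) ^ Suc k / fact k * cnj (exp_sum k u)"
      by (simp add: lipschitz_rhs_def)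
    then have b: "exp_coeff \<nu> k * cnj (lipschitz_rhs k u) = of_real (- X) ^ Suc k / (fact (Suc k) * fact k) * cnj (exp_sum k u)"
      unfolding exp_coeff_def pi2(2)[symmetric] power_mult_distrib[of _ "2 * of_real pi * \<i>"]
      by (simp del: fact_Suc power_Suc)
    have c: "exp_coeff \<nu> 0 * (2 * of_real pi * \<i>) = - of_real X"
      using pi2(2) by (simp add: exp_coeff_def)
    have "((\<lambda>l. of_real X ^ Suc k / (fact (Suc k) * fact k) * (of_nat (Suc l) ^ k * q ^ Suc l) -
        of_real (- X) ^ Suc k / (fact (Suc k) * fact k) * (of_nat (Suc l) ^ k * cnj q ^ Suc l)) has_sum
        (exp_coeff \<nu> k * lipschitz_rhs k u - exp_coeff \<nu> k * cnj (lipschitz_rhs k u))) UNIV"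
      unfolding a b by (intro has_sum_diff has_sum_cmult_right lipsum lipsum')
    also have "exp_coeff \<nu> k * lipschitz_rhs k u - exp_coeff \<nu> k * cnj (lipschitz_rhs k u) = exp_coeff \<nu> k * L k - (if k = 0 then of_real X else 0)"
      using c by (auto simp: L_def right_diff_distrib)
    finally have "((\<lambda>l. of_real X ^ Suc k / (fact (Suc k) * fact k) * (of_nat (Suc l) ^ k * q ^ Suc l) -
        of_real (- X) ^ Suc k / (fact (Suc k) * fact k) * (of_nat (Suc l) ^ k * cnj q ^ Suc l)) has_sum
        (exp_coeff \<nu> k * L k - (if k = 0 then of_real X else 0))) UNIV" .
    moreover have "P (k, l) = of_real X ^ Suc k / (fact (Suc k) * fact k) * (of_nat (Suc l) ^ k * q ^ Suc l) -
        of_real (- X) ^ Suc k / (fact (Suc k) * fact k) * (of_nat (Suc l) ^ k * cnj q ^ Suc l)" for l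
      by (simp add: P_def mult.assoc del: fact_Suc power_Suc of_nat_Suc)
    ultimately show ?thesis by presburger
  qed
  obtain T where T: "((\<lambda>k. exp_coeff \<nu> k * L k - (if k = 0 then of_real X else 0)) has_sum T) UNIV"
    "((\<lambda>l. bessel_sum X l * q ^ Suc l - bessel_sum (- X) l * cnj q ^ Suc l) has_sum T) UNIV"
    by (rule has_sum_interchange[OF sm2 col2 row2])
  have "((\<lambda>k. if k = 0 then complex_of_real X else 0) has_sum of_real X) {0::nat}"
    by (rule has_sum_finiteI) auto
  then have "((\<lambda>k. if k = 0 then complex_of_real X else 0) has_sum of_real X) (UNIV :: nat set)"
    by (rule has_sum_cong_neutral[THEN iffD1, rotated -1]) auto
  from has_sum_diff[OF S(1) this] T(1) have "S - of_real X = T" by (rule has_sum_unique)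
  then have "S = of_real X + T" by (simp add: diff_eq_eq add.commute)
  then show ?thesis using that S(2) T(2) by simp
qed

lemma bij_betw_residue_shift:
  assumes "c > 0"
  shows "bij_betw (\<lambda>(r, t). r + c * t) (units_mod c \<times> UNIV) {d. coprime c d}"
proof (rule bij_betw_byWitness[where f' = "\<lambda>d. (d mod c, d div c)"])
  show "\<forall>p\<in>units_mod c \<times> UNIV. (\<lambda>d. (d mod c, d div c)) (case p of (r, t) \<Rightarrow> r + c * t) = p"
    using assms by (auto simp: units_mod_def)
  show "(\<lambda>(r, t). r + c * t) ` (units_mod c \<times> UNIV) \<subseteq> {d. coprime c d}"
  proof safe
    fix r t assume "r \<in> units_mod c"
    then have "coprime r c" by (simp add: units_mod_def)
    then have "gcd c (t * c + r) = 1" by (simp only: gcd_add_mult coprime_iff_gcd_eq_1 gcd.commute)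
    then show "coprime c (r + c * t)" by (simp only: coprime_iff_gcd_eq_1 add.commute mult.commute)
  qed
  show "(\<lambda>d. (d mod c, d div c)) ` {d. coprime c d} \<subseteq> units_mod c \<times> UNIV"
    using assms by (auto simp: units_mod_def coprime_commute)
qed auto

lemma phase_cong:
  assumes "[d = d'] (mod c)" "c > 0" "coprime c Q" "coprime c d"
  shows "phase Q n c d = phase Q n c d'"
proof -
  have "[minv c (Q * d) = minv c (Q * d')] (mod c)"
    by (rule minv_cong_arg) (use assms in \<open>auto simp: coprime_commute cong_mult\<close>)
  then have "[- (int n * minv c (Q * d)) = - (int n * minv c (Q * d'))] (mod c)"
    by (simp add: cong_minus_minus_iff cong_mult)
  then show ?thesis unfolding phase_def by (rule ek_cong) (use assms in auto)
qed

definition kl_coeff :: "int \<Rightarrow> nat \<Rightarrow> int \<Rightarrow> int \<Rightarrow> complex" where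
  "kl_coeff Q n c l = kloosterman c (- (int n * minv c Q)) l"

lemma sum_phase_ek:
  assumes "c > 0" "coprime c Q"
  shows "(\<Sum>r\<in>units_mod c. phase Q n c r * ek c (l * r)) = kl_coeff Q n c l"
  unfolding kl_coeff_def kloosterman_def
proof (rule sum.cong[OF refl])
  fix r assume "r \<in> units_mod c"
  then have r: "coprime r c" by (simp add: units_mod_def)
  have "[minv c (Q * r) = minv c Q * minv c r] (mod c)"
    by (rule minv_mult_cong) (use assms r in \<open>auto simp: coprime_commute\<close>)
  then have "[- (int n * minv c (Q * r)) = - (int n * (minv c Q * minv c r))] (mod c)"
    by (simp add: cong_minus_minus_iff cong_mult)
  then have "phase Q n c r = ek c (- (int n * (minv c Q * minv c r)))"
    unfolding phase_def by (rule ek_cong) (use assms in auto)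
  then show "phase Q n c r * ek c (l * r) = ek c (- (int n * minv c Q) * minv c r + l * r)"
    by (simp add: ek_add[symmetric] mult.assoc)
qed

lemma row_term_one:
  assumes "Im \<tau> > 0" "n > 0" "c > 0" "Q > 0"
  shows "2 * of_real pi * row_term Q n \<tau> 1 c d =
    phase Q n c d * recip_exp (real n / (of_int Q * of_int c ^ 2)) (\<tau> + of_int d / of_int c)"
proof -
  define w where "w = row_point Q \<tau> c d"
  define \<nu> where "\<nu> = real n / (of_int Q * of_int c ^ 2)"
  define u where "u = \<tau> + of_int d / of_int c"
  have nz: "of_int c * \<tau> + of_int d \<noteq> 0" by (rule lat_nonzero) (use assms in auto)
  have u: "of_int c * \<tau> + of_int d = of_int c * u" using assms by (simp add: u_def field_simps)
  have "u \<noteq> 0" using nz unfolding u by auto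
  then have w: "- (of_nat n * w) = of_real \<nu> / u"
    using assms unfolding w_def row_point_def u \<nu>_def by (simp add: field_simps power2_eq_square)
  then have "cnj (- (of_nat n * w)) = cnj (of_real \<nu> / u)" by (rule arg_cong)
  then have w': "- (of_nat n * cnj w) = of_real \<nu> / cnj u" by simp
  have "2 * of_real pi * niebur_seed n 1 w = recip_exp \<nu> u"
    unfolding recip_exp_def w[symmetric] w'[symmetric] w_def
    by (rule niebur_seed_one) (use assms Im_row_point_pos in auto)
  then show ?thesis by (simp add: row_term_def w_def \<nu>_def u_def mult.left_commute)
qed

text \<open>Within a residue class of \<open>d\<close> modulo \<open>c\<close> the phase is constant
  and \<open>\<tau> + d / c\<close> runs through integer translates, so
  \<open>recip_exp_shift_sum\<close> applies. The \<open>l\<close>-th frequency acquires the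
  character value \<open>ek c (l r)\<close>, and summing over the units \<open>r\<close> gives
  Kloosterman sums.\<close>

lemma row_fourier:
  assumes "Im \<tau> > 0" "n > 0" "c > 0" "Q > 0" "coprime c Q"
    and sm: "(\<lambda>d. row_term Q n \<tau> 1 c d) summable_on {d. coprime c d}"
  defines "X \<equiv> 4 * pi\<^sup>2 * (real n / (of_int Q * of_int c ^ 2))" and "q \<equiv> unit_exp \<tau>"
  shows "((\<lambda>l. bessel_sum X l * kl_coeff Q n c (int (Suc l)) * q ^ Suc l - bessel_sum (- X) l * kl_coeff Q n c (- int (Suc l)) * cnj q ^ Suc l)
    has_sum (2 * of_real pi * (\<Sum>\<^sub>\<infinity>d\<in>{d. coprime c d}. row_term Q n \<tau> 1 c d) - of_real X * kl_coeff Q n c 0)) UNIV"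
proof -
  define \<nu> where "\<nu> = real n / (of_int Q * of_int c ^ 2)"
  have \<nu>: "\<nu> > 0" using assms by (simp add: \<nu>_def)
  have X: "X = 4 * pi\<^sup>2 * \<nu>" by (simp add: X_def \<nu>_def)
  define u where "u r = \<tau> + of_int r / of_int c" for r :: int
  have u: "Im (u r) > 0" for r
  proof -
    have "u r = \<tau> + of_real (of_int r / of_int c)" by (simp add: u_def)
    then show ?thesis using assms(1) by simp
  qed
  have qr: "unit_exp (u r) = q * ek c r" for r
    by (simp add: u_def unit_exp_add q_def ek_def)
  have ex: "\<exists>T. ((\<lambda>t::int. recip_exp \<nu> (u r + of_int t)) has_sum (of_real X + T)) UNIV \<and>
     ((\<lambda>l. bessel_sum X l * unit_exp (u r) ^ Suc l - bessel_sum (- X) l * cnj (unit_exp (u r)) ^ Suc l) has_sum T) UNIV" for r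
    unfolding X by (rule recip_exp_shift_sum[OF u \<nu>, of r]) blast
  from choice[OF allI[OF ex]] obtain T
    where T: "\<forall>r. ((\<lambda>t::int. recip_exp \<nu> (u r + of_int t)) has_sum (of_real X + T r)) UNIV \<and>
      ((\<lambda>l. bessel_sum X l * unit_exp (u r) ^ Suc l - bessel_sum (- X) l * cnj (unit_exp (u r)) ^ Suc l) has_sum T r) UNIV" ..
  have T1: "((\<lambda>t::int. recip_exp \<nu> (u r + of_int t)) has_sum (of_real X + T r)) UNIV"
    and T2: "((\<lambda>l. bessel_sum X l * unit_exp (u r) ^ Suc l - bessel_sum (- X) l * cnj (unit_exp (u r)) ^ Suc l) has_sum T r) UNIV" for r
    using T[rule_format, of r] by (rule conjunct1, rule conjunct2)
  let ?S = "\<Sum>\<^sub>\<infinity>d\<in>{d. coprime c d}. row_term Q n \<tau> 1 c d"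
  have "((\<lambda>d. 2 * of_real pi * row_term Q n \<tau> 1 c d) has_sum 2 * of_real pi * ?S) {d. coprime c d}"
    by (intro has_sum_cmult_right has_sum_infsum sm)
  then have "((\<lambda>p. 2 * of_real pi * row_term Q n \<tau> 1 c (case p of (r, t) \<Rightarrow> r + c * t)) has_sum 2 * of_real pi * ?S) (units_mod c \<times> UNIV)"
    using has_sum_reindex_bij_betw[OF bij_betw_residue_shift[OF assms(3)],
      of "\<lambda>d. 2 * of_real pi * row_term Q n \<tau> 1 c d" "2 * of_real pi * ?S"] by simp
  moreover have "((\<lambda>t. 2 * of_real pi * row_term Q n \<tau> 1 c (case (r, t) of (r, t) \<Rightarrow> r + c * t)) has_sum phase Q n c r * (of_real X + T r)) UNIV"
    if r: "r \<in> units_mod c" for r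
  proof -
    have "2 * of_real pi * row_term Q n \<tau> 1 c (r + c * t) = phase Q n c r * recip_exp \<nu> (u r + of_int t)" for t
    proof -
      have "phase Q n c (r + c * t) = phase Q n c r"
      proof (rule phase_cong)
        show "coprime c (r + c * t)"
          using bij_betw_apply[OF bij_betw_residue_shift[OF assms(3)], of "(r, t)"] r by simp
      qed (use assms in \<open>auto simp: cong_def\<close>)
      moreover have "\<tau> + of_int (r + c * t) / of_int c = u r + of_int t"
        using assms by (simp add: u_def field_simps)
      ultimately show ?thesis using row_term_one[OF assms(1-4), of "r + c * t"] by (simp add: \<nu>_def)
    qed
    then show ?thesis using has_sum_cmult_right[OF T1[of r], of "phase Q n c r"] by simp
  qed
  ultimately have "((\<lambda>r. phase Q n c r * (of_real X + T r)) has_sum 2 * of_real pi * ?S) (units_mod c)"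
    by (rule has_sum_SigmaD)
  then have S: "2 * of_real pi * ?S = (\<Sum>r\<in>units_mod c. phase Q n c r * (of_real X + T r))"
    using has_sum_finite_iff[OF finite_units_mod] by blast
  have k0: "(\<Sum>r\<in>units_mod c. phase Q n c r) = kl_coeff Q n c 0"
    using sum_phase_ek[OF assms(3,5), of n 0] by simp
  have "2 * of_real pi * ?S - of_real X * kl_coeff Q n c 0 = (\<Sum>r\<in>units_mod c. phase Q n c r * T r)"
    unfolding S k0[symmetric] by (simp add: sum_distrib_left sum_subtractf[symmetric] algebra_simps)
  moreover have "((\<lambda>l. \<Sum>r\<in>units_mod c. phase Q n c r * (bessel_sum X l * unit_exp (u r) ^ Suc l - bessel_sum (- X) l * cnj (unit_exp (u r)) ^ Suc l))
    has_sum (\<Sum>r\<in>units_mod c. phase Q n c r * T r)) UNIV"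
    by (intro has_sum_sum has_sum_cmult_right T2) simp
  moreover have "(\<Sum>r\<in>units_mod c. phase Q n c r * (bessel_sum X l * unit_exp (u r) ^ Suc l - bessel_sum (- X) l * cnj (unit_exp (u r)) ^ Suc l)) =
    bessel_sum X l * kl_coeff Q n c (int (Suc l)) * q ^ Suc l - bessel_sum (- X) l * kl_coeff Q n c (- int (Suc l)) * cnj q ^ Suc l" for l
  proof -
    have "phase Q n c r * (bessel_sum X l * unit_exp (u r) ^ Suc l - bessel_sum (- X) l * cnj (unit_exp (u r)) ^ Suc l) =
      (bessel_sum X l * q ^ Suc l) * (phase Q n c r * ek c (int (Suc l) * r)) -
      (bessel_sum (- X) l * cnj q ^ Suc l) * (phase Q n c r * ek c (- int (Suc l) * r))" for r
    proof -
      have 1: "unit_exp (u r) ^ Suc l = q ^ Suc l * ek c (int (Suc l) * r)"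
        unfolding qr ek_power by (rule power_mult_distrib)
      have "cnj (unit_exp (u r)) ^ Suc l = cnj q ^ Suc l * cnj (ek c (int (Suc l) * r))"
        unfolding complex_cnj_power[symmetric] 1 complex_cnj_mult ..
      also have "cnj (ek c (int (Suc l) * r)) = ek c (- int (Suc l) * r)"
        unfolding ek_minus[symmetric] mult_minus_left ..
      finally show ?thesis unfolding 1 by (simp only: right_diff_distrib mult_ac)
    qed
    then have "(\<Sum>r\<in>units_mod c. phase Q n c r * (bessel_sum X l * unit_exp (u r) ^ Suc l - bessel_sum (- X) l * cnj (unit_exp (u r)) ^ Suc l)) =
      (bessel_sum X l * q ^ Suc l) * kl_coeff Q n c (int (Suc l)) - (bessel_sum (- X) l * cnj q ^ Suc l) * kl_coeff Q n c (- int (Suc l))"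
      by (simp only: sum_subtractf sum_distrib_left[symmetric] sum_phase_ek[OF assms(3,5)])
    then show ?thesis by (simp only: mult_ac)
  qed
  ultimately show ?thesis by simp
qed

text \<open>One sequence \<open>b\<close> is chosen for all \<open>\<tau>\<close>, as the uniqueness
  of Fourier coefficients demands. Exchanging the sums over \<open>c\<close> and the frequency is
  justified by the decay of \<open>X c\<close>, quadratic in \<open>c\<close>, against the
  Kloosterman bound.\<close>

lemma series_fourier:
  assumes n: "n > 0" and Q: "Q > 0" and C: "\<And>c. c \<in> C \<Longrightarrow> c > 0 \<and> coprime c Q"
  obtains b where "\<And>\<tau>. Im \<tau> > 0 \<Longrightarrow>
    (\<lambda>l. b (int (Suc l)) * unit_exp \<tau> ^ Suc l + b (- int (Suc l)) * cnj (unit_exp \<tau>) ^ Suc l) sums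
      (2 * of_real pi * (\<Sum>\<^sub>\<infinity>c\<in>C. \<Sum>\<^sub>\<infinity>d\<in>{d. coprime c d}. row_term Q n \<tau> 1 c d) - b 0)"
proof -
  define X where "X c = 4 * pi\<^sup>2 * (real n / (of_int Q * of_int c ^ 2))" for c :: int
  define X1 where "X1 = 4 * pi\<^sup>2 * real n"
  \<comment> \<open>The exponent \<open>- 5/4\<close> is \<open>3/4\<close> from the Kloosterman sum
    minus \<open>2\<close> from \<open>X c\<close>.\<close>
  define M where "M c = 2 * real n * (X1 * (real (card (divs c)) * real_of_int c powr - (5 / 4)))" for c :: int
  have X1: "X1 > 0" using n by (simp add: X1_def)
  have Msum: "M summable_on C"
  proof -
    have "(\<lambda>c. real (card (divs c)) * real_of_int c powr - (5 / 4)) summable_on {c. c > 0}"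
      by (rule summable_on_divs_powr) simp
    then have "(\<lambda>c. real (card (divs c)) * real_of_int c powr - (5 / 4)) summable_on C"
      by (rule summable_on_subset_banach) (use C in auto)
    then show ?thesis unfolding M_def by (intro summable_on_cmult_right)
  qed
  have Xle: "0 \<le> X c" "X c \<le> X1 / real_of_int c ^ 2" "X c \<le> X1" if "c \<in> C" for c
  proof -
    have c: "real_of_int c \<ge> 1" using C[OF that] by simp
    have Q1: "real_of_int Q \<ge> 1" using Q by simp
    show "0 \<le> X c" using Q by (simp add: X_def)
    have "X1 / (of_int Q * of_int c ^ 2) \<le> X1 / (1 * of_int c ^ 2)"
      using X1 c Q1 by (intro divide_left_mono mult_right_mono) auto
    then show 1: "X c \<le> X1 / real_of_int c ^ 2" by (simp add: X_def X1_def)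
    have "X1 / real_of_int c ^ 2 \<le> X1 / 1" using X1 c by (intro divide_left_mono) auto
    with 1 show "X c \<le> X1" by simp
  qed
  have KM: "X1 / real_of_int c ^ 2 * norm (kl_coeff Q n c l) \<le> M c" if "c \<in> C" for c l
  proof -
    define x where "x = real_of_int c"
    have x: "x \<ge> 1" using C[OF that] by (simp add: x_def)
    have "X1 / x ^ 2 * norm (kl_coeff Q n c l) \<le> X1 / x ^ 2 * (2 * real n * (x powr (3 / 4) * real (card (divs c))))"
      unfolding kl_coeff_def x_def
      by (intro mult_left_mono kloosterman_phase_bound) (use C[OF that] n X1 in auto)
    also have "\<dots> = 2 * real n * (X1 * (real (card (divs c)) * (x powr (3 / 4) * x powr - 2)))"
      using x by (simp add: powr_minus_divide powr_numeral)
    also have "x powr (3 / 4) * x powr - 2 = x powr - (5 / 4)"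
      by (simp add: powr_add[symmetric])
    finally show ?thesis by (simp add: M_def x_def)
  qed
  \<comment> \<open>One factor \<open>X c\<close> is kept to pay for the Kloosterman sum; in the
    exponential it is replaced by its maximum \<open>X1\<close>.\<close>
  have kapb: "norm (bessel_sum Y l * kl_coeff Q n c k) \<le> exp (X1 / \<epsilon>) * exp (\<epsilon> * Suc l) * M c"
    if c: "c \<in> C" and Y: "\<bar>Y\<bar> = X c" and \<epsilon>: "\<epsilon> > 0" for Y l c k \<epsilon>
  proof -
    have "norm (bessel_sum Y l) \<le> \<bar>Y\<bar> * exp (\<bar>Y\<bar> / \<epsilon>) * exp (\<epsilon> * Suc l)" by (rule norm_bessel_sum_le[OF \<epsilon>])
    also have "\<dots> \<le> X1 / real_of_int c ^ 2 * exp (X1 / \<epsilon>) * exp (\<epsilon> * Suc l)"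
      unfolding Y using Xle[OF c] \<epsilon> X1 by (intro mult_mono) (auto simp: divide_right_mono)
    finally have "norm (bessel_sum Y l * kl_coeff Q n c k) \<le> X1 / real_of_int c ^ 2 * exp (X1 / \<epsilon>) * exp (\<epsilon> * Suc l) * norm (kl_coeff Q n c k)"
      unfolding norm_mult by (intro mult_right_mono) auto
    also have "\<dots> = exp (X1 / \<epsilon>) * exp (\<epsilon> * Suc l) * (X1 / real_of_int c ^ 2 * norm (kl_coeff Q n c k))" by simp
    also have "\<dots> \<le> exp (X1 / \<epsilon>) * exp (\<epsilon> * Suc l) * M c" by (intro mult_left_mono KM c) auto
    finally show ?thesis .
  qed
  have kaps: "(\<lambda>c. bessel_sum (g (X c)) l * kl_coeff Q n c k) summable_on C" if g: "\<And>x. x \<ge> 0 \<Longrightarrow> \<bar>g x\<bar> = x" for g l k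
  proof (rule abs_summable_summable, rule summable_on_comparison_test)
    show "(\<lambda>c. exp (X1 / 1) * exp (1 * real (Suc l)) * M c) summable_on C" by (intro summable_on_cmult_right Msum)
    show "norm (bessel_sum (g (X c)) l * kl_coeff Q n c k) \<le> exp (X1 / 1) * exp (1 * real (Suc l)) * M c" if "c \<in> C" for c
      by (rule kapb[OF that]) (use g Xle(1)[OF that] in auto)
  qed auto
  \<comment> \<open>\<open>bessel_sum\<close> with argument \<open>l\<close> belongs to the
    frequency \<open>l + 1\<close>, hence \<open>nat l - 1\<close>.\<close>
  define b where "b l = (if l = 0 then \<Sum>\<^sub>\<infinity>c\<in>C. of_real (X c) * kl_coeff Q n c 0
    else if l > 0 then \<Sum>\<^sub>\<infinity>c\<in>C. bessel_sum (X c) (nat l - 1) * kl_coeff Q n c l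
    else - (\<Sum>\<^sub>\<infinity>c\<in>C. bessel_sum (- X c) (nat (- l) - 1) * kl_coeff Q n c l))" for l
  have b0: "((\<lambda>c. of_real (X c) * kl_coeff Q n c 0) has_sum b 0) C"
  proof -
    have "(\<lambda>c. of_real (X c) * kl_coeff Q n c 0) summable_on C"
    proof (rule abs_summable_summable, rule summable_on_comparison_test[OF Msum])
      fix c assume c: "c \<in> C"
      have "norm (of_real (X c) * kl_coeff Q n c 0) = X c * norm (kl_coeff Q n c 0)"
        using Xle[OF c] by (simp add: norm_mult)
      also have "\<dots> \<le> X1 / real_of_int c ^ 2 * norm (kl_coeff Q n c 0)"
        by (intro mult_right_mono Xle(2)[OF c]) auto
      also have "\<dots> \<le> M c" by (rule KM[OF c])
      finally show "norm (of_real (X c) * kl_coeff Q n c 0) \<le> M c" .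
    qed auto
    then show ?thesis by (simp add: b_def)
  qed
  have bp: "((\<lambda>c. bessel_sum (X c) l * kl_coeff Q n c (int (Suc l))) has_sum b (int (Suc l))) C" for l
    using kaps[of "\<lambda>x. x" l "int (Suc l)"] by (simp add: b_def nat_add_distrib)
  have bm: "((\<lambda>c. bessel_sum (- X c) l * kl_coeff Q n c (- int (Suc l))) has_sum (- b (- int (Suc l)))) C" for l
  proof -
    have "b (- int (Suc l)) = - (\<Sum>\<^sub>\<infinity>c\<in>C. bessel_sum (- X c) l * kl_coeff Q n c (- int (Suc l)))"
      by (simp add: b_def nat_add_distrib)
    then show ?thesis using kaps[of "\<lambda>x. - x" l "- int (Suc l)"] by simp
  qed
  show ?thesis
  proof (rule that)
    fix \<tau> assume \<tau>: "Im \<tau> > 0"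
    define q where "q = unit_exp \<tau>"
    let ?S = "\<lambda>c. \<Sum>\<^sub>\<infinity>d\<in>{d. coprime c d}. row_term Q n \<tau> 1 c d"
    obtain F where F: "\<And>c. c \<in> C \<Longrightarrow> (\<lambda>d. row_term Q n \<tau> 1 c d) summable_on {d. coprime c d}" "(?S has_sum F (1::complex)) C"
      by (rule row_series_continuation[OF \<tau> n Q C]) (assumption, rule that)
    define f where "f = (\<lambda>(c, l). bessel_sum (X c) l * kl_coeff Q n c (int (Suc l)) * q ^ Suc l - bessel_sum (- X c) l * kl_coeff Q n c (- int (Suc l)) * cnj q ^ Suc l)"
    define \<epsilon> where "\<epsilon> = pi * Im \<tau>"
    have \<epsilon>: "\<epsilon> > 0" using \<tau> by (simp add: \<epsilon>_def)
    have nq: "exp (\<epsilon> * Suc l) * norm q ^ Suc l = exp (- \<epsilon>) ^ Suc l" for l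
      unfolding q_def norm_unit_exp exp_of_nat_mult[symmetric] exp_add[symmetric]
      by (rule arg_cong[of _ _ exp]) (simp add: \<epsilon>_def algebra_simps)
    have fb: "norm (f (c, l)) \<le> M c * (2 * exp (X1 / \<epsilon>) * exp (- \<epsilon>) ^ Suc l)" if c: "c \<in> C" for c l
    proof -
      have "norm (f (c, l)) \<le> norm (bessel_sum (X c) l * kl_coeff Q n c (int (Suc l)) * q ^ Suc l) +
        norm (bessel_sum (- X c) l * kl_coeff Q n c (- int (Suc l)) * cnj q ^ Suc l)"
        unfolding f_def prod.case by (rule norm_triangle_ineq4)
      also have "\<dots> \<le> exp (X1 / \<epsilon>) * exp (\<epsilon> * Suc l) * M c * norm q ^ Suc l + exp (X1 / \<epsilon>) * exp (\<epsilon> * Suc l) * M c * norm q ^ Suc l"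
        unfolding norm_mult[of _ "q ^ Suc l"] norm_mult[of _ "cnj q ^ Suc l"] norm_power complex_mod_cnj
        by (intro add_mono mult_right_mono kapb c \<epsilon>) (use Xle(1)[OF c] in auto)
      also have "\<dots> = M c * (2 * exp (X1 / \<epsilon>) * (exp (\<epsilon> * Suc l) * norm q ^ Suc l))" by simp
      finally show ?thesis unfolding nq .
    qed
    have M0: "M c \<ge> 0" if "c \<in> C" for c using X1 by (simp add: M_def)
    have "(\<lambda>(c, l). M c * (2 * exp (X1 / \<epsilon>) * exp (- \<epsilon>) ^ Suc l)) summable_on C \<times> UNIV"
    proof (intro summable_on_product Msum M0)
      have "summable (\<lambda>l. exp (- \<epsilon>) ^ Suc l)" using \<epsilon> by (subst summable_Suc_iff) (simp add: summable_geometric)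
      then show "(\<lambda>l. 2 * exp (X1 / \<epsilon>) * exp (- \<epsilon>) ^ Suc l) summable_on UNIV"
        by (intro summable_on_cmult_right norm_summable_imp_summable_on) simp
    qed auto
    then have "(\<lambda>p. norm (f p)) summable_on C \<times> UNIV"
      by (rule summable_on_comparison_test) (use fb in auto)
    then have sm: "f summable_on C \<times> UNIV" by (rule abs_summable_summable)
    have row: "((\<lambda>l. f (c, l)) has_sum (2 * of_real pi * ?S c - of_real (X c) * kl_coeff Q n c 0)) UNIV" if c: "c \<in> C" for c
      unfolding f_def prod.case X_def q_def
      by (rule row_fourier[OF \<tau> n _ Q _ F(1)[OF c]]) (use C[OF c] in auto)
    have col: "((\<lambda>c. f (c, l)) has_sum (b (int (Suc l)) * q ^ Suc l - (- b (- int (Suc l))) * cnj q ^ Suc l)) C" for l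
      unfolding f_def prod.case by (intro has_sum_diff has_sum_cmult_left bp bm)
    obtain T where T: "((\<lambda>c. 2 * of_real pi * ?S c - of_real (X c) * kl_coeff Q n c 0) has_sum T) C"
      "((\<lambda>l. b (int (Suc l)) * q ^ Suc l - (- b (- int (Suc l))) * cnj q ^ Suc l) has_sum T) UNIV"
      by (rule has_sum_interchange[OF sm row col])
    have "((\<lambda>c. 2 * of_real pi * ?S c - of_real (X c) * kl_coeff Q n c 0) has_sum (2 * of_real pi * F 1 - b 0)) C"
      by (intro has_sum_diff has_sum_cmult_right F(2) b0)
    with T(1) have "T = 2 * of_real pi * F 1 - b 0" by (rule has_sum_unique)
    moreover have "F 1 = (\<Sum>\<^sub>\<infinity>c\<in>C. ?S c)" using F(2) by (simp add: infsumI)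
    ultimately show "(\<lambda>l. b (int (Suc l)) * unit_exp \<tau> ^ Suc l + b (- int (Suc l)) * cnj (unit_exp \<tau>) ^ Suc l) sums
      (2 * of_real pi * (\<Sum>\<^sub>\<infinity>c\<in>C. ?S c) - b 0)"
      using has_sum_imp_sums[OF T(2)] by (simp add: q_def)
  qed
qed

section \<open>Atkin-Lehner cosets\<close>

lemma mat2_nth [simp]:
  "mat2 a b c d $ 1 $ 1 = a" "mat2 a b c d $ 1 $ 2 = b"
  "mat2 a b c d $ 2 $ 1 = c" "mat2 a b c d $ 2 $ 2 = d"
  by (simp_all add: mat2_def)

lemma mat2_eq_iff: "mat2 a b c d = mat2 a' b' c' d' \<longleftrightarrow> a = a' \<and> b = b' \<and> c = c' \<and> d = d'"
  by (metis mat2_nth)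

lemma mat2_eta: "(A :: real ^ 2 ^ 2) = mat2 (A $ 1 $ 1) (A $ 1 $ 2) (A $ 2 $ 1) (A $ 2 $ 2)"
  by (simp add: vec_eq_iff forall_2)

lemma mat2_mult: "mat2 a b c d ** mat2 a' b' c' d' =
    mat2 (a * a' + b * c') (a * b' + b * d') (c * a' + d * c') (c * b' + d * d')"
  by (simp add: vec_eq_iff forall_2 matrix_matrix_mult_def sum_2)

lemma mat2_one: "mat 1 = mat2 1 0 0 1"
  by (simp add: vec_eq_iff forall_2 mat_def)

lemma det_mat2 [simp]: "det (mat2 a b c d) = a * d - b * c"
  by (simp add: det_2)

definition mat2_adj :: "real ^ 2 ^ 2 \<Rightarrow> real ^ 2 ^ 2" where
  "mat2_adj A = mat2 (A $ 2 $ 2) (- (A $ 1 $ 2)) (- (A $ 2 $ 1)) (A $ 1 $ 1)"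

lemma mat2_adj_mat2 [simp]: "mat2_adj (mat2 a b c d) = mat2 d (- b) (- c) a"
  by (simp add: mat2_adj_def)

lemma mat2_adj_mult:
  assumes "det A = 1"
  shows "mat2_adj A ** A = mat 1" "A ** mat2_adj A = mat 1"
proof -
  obtain a b c d where A: "A = mat2 a b c d" using mat2_eta by blast
  show "mat2_adj A ** A = mat 1" "A ** mat2_adj A = mat 1"
    using assms unfolding A by (auto simp: mat2_mult mat2_one mat2_eq_iff algebra_simps)
qed

lemma det_mat2_adj: "det (mat2_adj A) = det A"
  by (simp add: mat2_adj_def det_2 mult.commute)

lemma SL2R_simps [simp]:
  "carrier SL2R = {A. det A = 1}" "mult SL2R = (**)" "one SL2R = mat 1"
  by (simp_all add: SL2R_def)

lemma group_SL2R: "group SL2R"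
proof (rule groupI)
  fix A assume "A \<in> carrier SL2R"
  then show "\<exists>B\<in>carrier SL2R. B \<otimes>\<^bsub>SL2R\<^esub> A = \<one>\<^bsub>SL2R\<^esub>"
    using mat2_adj_mult(1)[of A] by (intro bexI[of _ "mat2_adj A"]) (auto simp: det_mat2_adj)
qed (auto simp: det_mul matrix_mul_assoc)

lemma inv_SL2R: "det A = 1 \<Longrightarrow> inv\<^bsub>SL2R\<^esub> A = mat2_adj A"
  by (rule group.inv_equality[OF group_SL2R]) (auto simp: mat2_adj_mult det_mat2_adj)

text \<open>Two Atkin-Lehner matrices for \<open>Q\<close> and \<open>R\<close> multiply to one for \<open>Q R / gcd(Q, R)\<^sup>2\<close>.\<close>

definition al_star :: "nat \<Rightarrow> nat \<Rightarrow> nat" where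
  "al_star Q R = (Q div gcd Q R) * (R div gcd Q R)"

lemma al_star_commute: "al_star Q R = al_star R Q"
  by (simp add: al_star_def gcd.commute mult.commute)

lemma al_star_self [simp]: "Q > 0 \<Longrightarrow> al_star Q Q = 1"
  by (simp add: al_star_def)

lemma al_star_1 [simp]: "al_star (Suc 0) Q = Q" "al_star Q (Suc 0) = Q"
  by (simp_all add: al_star_def)

lemma exact_divisor_1 [simp]: "exact_divisor (Suc 0) N"
  by (simp add: exact_divisor_def)

lemma exact_divisor_pos: "exact_divisor Q N \<Longrightarrow> N > 0 \<Longrightarrow> Q > 0"
  by (auto simp: exact_divisor_def)

text \<open>The gcd \<open>g\<close>, the two remaining parts \<open>a\<close> and \<open>b\<close>,
  and the cofactor \<open>k\<close>: statements about two exact divisors become arithmetic with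
  pairwise coprime factors.\<close>

lemma exact_divisor_pair:
  assumes "exact_divisor Q N" "exact_divisor R N" "N > 0"
  obtains g a b k where "Q = g * a" "R = g * b" "N = g * a * b * k" "al_star Q R = a * b"
    "coprime g a" "coprime g b" "coprime a b" "coprime g k" "coprime a k" "coprime b k"
    "g > 0" "a > 0" "b > 0" "k > 0"
proof -
  define g where "g = gcd Q R"
  define a where "a = Q div g"
  define b where "b = R div g"
  have pos: "Q > 0" "R > 0" using assms exact_divisor_pos by auto
  have g: "g > 0" using pos by (simp add: g_def)
  have Q: "Q = g * a" and R: "R = g * b" by (simp_all add: a_def b_def g_def)
  have ab: "a > 0" "b > 0" using pos Q R by auto
  have cab: "coprime a b" unfolding a_def b_def g_def using pos by (intro div_gcd_coprime) auto
  obtain m where m: "N = Q * m" using assms by (auto simp: exact_divisor_def)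
  have cQm: "coprime Q m" using assms(1) pos m by (simp add: exact_divisor_def)
  have "R dvd Q * m" using assms(2) m by (simp add: exact_divisor_def)
  then have "b dvd a * m" using Q R g by (simp add: mult.assoc)
  then have "b dvd m" using cab by (simp add: coprime_dvd_mult_right_iff coprime_commute)
  then obtain k where k: "m = b * k" by auto
  have N: "N = g * a * b * k" using m Q k by (simp add: mult_ac)
  have k0: "k > 0" using assms(3) N by (cases k) auto
  have "N div R = a * k" using N R pos by (simp add: mult_ac)
  then have "coprime (g * b) (a * k)" using assms(2) R by (simp add: exact_divisor_def)
  moreover have "coprime (g * a) (b * k)" using cQm Q k by simp
  ultimately have c: "coprime g a" "coprime g b" "coprime g k" "coprime a k" "coprime b k"
    by (auto simp: coprime_commute)
  have "al_star Q R = a * b" by (simp add: al_star_def a_def b_def g_def)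
  then show ?thesis by (rule that[OF Q R N _ c(1,2) cab c(3-5) g ab k0])
qed

lemma exact_divisor_al_star:
  assumes "exact_divisor Q N" "exact_divisor R N" "N > 0"
  shows "exact_divisor (al_star Q R) N"
proof -
  obtain g a b k where *: "N = g * a * b * k" "al_star Q R = a * b"
    "coprime g a" "coprime g b" "coprime a k" "coprime b k" "a > 0" "b > 0"
    using exact_divisor_pair[OF assms] by metis
  have "N = (a * b) * (g * k)" using * by simp
  then have "N div (a * b) = g * k" using * by (metis mult_pos_pos nonzero_mult_div_cancel_left not_gr_zero)
  then show ?thesis unfolding exact_divisor_def
    using * by (auto simp: coprime_commute) 
qed

definition wmat :: "nat \<Rightarrow> nat \<Rightarrow> int \<Rightarrow> int \<Rightarrow> int \<Rightarrow> int \<Rightarrow> real ^ 2 ^ 2" where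
  "wmat Q N x y z w = mat2 (of_int (int Q * x) / sqrt Q) (of_int y / sqrt Q)
           (of_int (int N * z) / sqrt Q) (of_int (int Q * w) / sqrt Q)"

lemma atkin_lehner_iff:
  "A \<in> atkin_lehner Q N \<longleftrightarrow> (\<exists>x y z w. A = wmat Q N x y z w \<and> (int Q * x) * (int Q * w) - y * (int N * z) = int Q)"
  by (auto simp: atkin_lehner_def wmat_def)

lemma atkin_lehner_1: "atkin_lehner 1 N = Gamma0 N"
proof (intro subset_antisym subsetI)
  fix A assume "A \<in> atkin_lehner 1 N"
  then obtain x y z w where "A = wmat 1 N x y z w" "x * w - y * (int N * z) = 1"
    by (auto simp: atkin_lehner_iff)
  then have "A = mat2 (of_int x) (of_int y) (of_int (int N * z)) (of_int w) \<and>
      x * w - y * (int N * z) = 1 \<and> int N dvd int N * z"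
    by (simp add: wmat_def)
  then show "A \<in> Gamma0 N" unfolding Gamma0_def by blast
next
  fix A assume "A \<in> Gamma0 N"
  then obtain a b c d where *: "A = mat2 (of_int a) (of_int b) (of_int c) (of_int d)" "a * d - b * c = 1" "int N dvd c"
    unfolding Gamma0_def by blast
  obtain z where "c = int N * z" using *(3) by auto
  then have "A = wmat 1 N a b z d" "(int 1 * a) * (int 1 * d) - b * (int N * z) = int 1"
    using * by (simp_all add: wmat_def)
  then show "A \<in> atkin_lehner 1 N" unfolding atkin_lehner_iff by blast
qed

lemma det_wmat:
  assumes "Q > 0" "(int Q * x) * (int Q * w) - y * (int N * z) = int Q"
  shows "det (wmat Q N x y z w) = 1"
proof -
  have "det (wmat Q N x y z w) = of_int ((int Q * x) * (int Q * w) - y * (int N * z)) / (sqrt Q * sqrt Q)"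
    unfolding wmat_def det_mat2 of_int_diff of_int_mult by (simp add: diff_divide_distrib)
  also have "\<dots> = 1" unfolding assms(2) using assms(1) by simp
  finally show ?thesis .
qed

lemma atkin_lehner_det: "A \<in> atkin_lehner Q N \<Longrightarrow> Q > 0 \<Longrightarrow> det A = 1"
  unfolding atkin_lehner_iff using det_wmat by blast

lemma atkin_lehner_adj: "A \<in> atkin_lehner Q N \<Longrightarrow> mat2_adj A \<in> atkin_lehner Q N"
proof -
  assume "A \<in> atkin_lehner Q N"
  then obtain x y z w where A: "A = wmat Q N x y z w" "(int Q * x) * (int Q * w) - y * (int N * z) = int Q"
    by (auto simp: atkin_lehner_iff)
  have "mat2_adj A = wmat Q N w (- y) (- z) x" unfolding A(1) wmat_def by simp
  moreover have "(int Q * w) * (int Q * x) - (- y) * (int N * (- z)) = int Q" using A(2) by (simp add: mult_ac)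
  ultimately show ?thesis unfolding atkin_lehner_iff by blast
qed

lemma atkin_lehner_mult:
  assumes "exact_divisor Q N" "exact_divisor R N" "N > 0"
    and "A \<in> atkin_lehner Q N" "B \<in> atkin_lehner R N"
  shows "A ** B \<in> atkin_lehner (al_star Q R) N"
proof -
  obtain g a b k where *: "Q = g * a" "R = g * b" "N = g * a * b * k" "al_star Q R = a * b"
    and pos: "g > 0" "a > 0" "b > 0" "k > 0"
    using exact_divisor_pair[OF assms(1-3)] by metis
  obtain x1 y1 z1 w1 where A: "A = wmat Q N x1 y1 z1 w1" "(int Q * x1) * (int Q * w1) - y1 * (int N * z1) = int Q"
    using assms by (auto simp: atkin_lehner_iff)
  obtain x2 y2 z2 w2 where B: "B = wmat R N x2 y2 z2 w2" "(int R * x2) * (int R * w2) - y2 * (int N * z2) = int R"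
    using assms by (auto simp: atkin_lehner_iff)
  define G where "G = int g"
  define a' where "a' = int a"
  define b' where "b' = int b"
  define k' where "k' = int k"
  have pos': "G > 0" "a' > 0" "b' > 0" using pos by (auto simp: G_def a'_def b'_def)
  have d1: "G * a' * x1 * w1 - y1 * b' * k' * z1 = 1"
  proof -
    have "(G * a') * (G * a' * x1 * w1 - y1 * b' * k' * z1) = (G * a') * 1"
      using A(2) by (simp add: * G_def a'_def b'_def k'_def algebra_simps)
    then show ?thesis using pos' by (metis mult_cancel_left mult_pos_pos less_irrefl)
  qed
  have d2: "G * b' * x2 * w2 - y2 * a' * k' * z2 = 1"
  proof -
    have "(G * b') * (G * b' * x2 * w2 - y2 * a' * k' * z2) = (G * b') * 1"
      using B(2) by (simp add: * G_def a'_def b'_def k'_def algebra_simps)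
    then show ?thesis using pos' by (metis mult_cancel_left mult_pos_pos less_irrefl)
  qed
  \<comment> \<open>The integral entries of the product once the common factor \<open>g\<close> is
    removed; it is matched by \<open>sqrt Q * sqrt R = g * sqrt (a * b)\<close>.\<close>
  define X where "X = G * x1 * x2 + k' * y1 * z2"
  define Y where "Y = a' * x1 * y2 + b' * y1 * w2"
  define Z where "Z = b' * z1 * x2 + a' * w1 * z2"
  define W where "W = k' * z1 * y2 + G * w1 * w2"
  have "a' * b' * X * W - Y * (G * k') * Z = (G * a' * x1 * w1 - y1 * b' * k' * z1) * (G * b' * x2 * w2 - y2 * a' * k' * z2)"
    unfolding X_def Y_def Z_def W_def by algebra
  then have dd: "a' * b' * X * W - Y * (G * k') * Z = 1" unfolding d1 d2 by simp
  have det: "(int (a * b) * X) * (int (a * b) * W) - Y * (int N * Z) = int (a * b)"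
  proof -
    have "(int (a * b) * X) * (int (a * b) * W) - Y * (int N * Z) = (a' * b') * (a' * b' * X * W - Y * (G * k') * Z)"
      by (simp add: * G_def a'_def b'_def k'_def algebra_simps)
    then show ?thesis unfolding dd by (simp add: a'_def b'_def)
  qed
  have sq: "sqrt Q * sqrt R = real g * sqrt (a * b)"
    unfolding * by (simp add: real_sqrt_mult[symmetric] real_sqrt_abs2[symmetric] mult_ac power2_eq_square)
      (simp add: real_sqrt_mult)
  have frac: "u / sqrt Q * (v / sqrt R) + u' / sqrt Q * (v' / sqrt R) = t / sqrt (a * b)"
    if "u * v + u' * v' = real g * t" for u v u' v' t
  proof -
    have "u / sqrt Q * (v / sqrt R) + u' / sqrt Q * (v' / sqrt R) = (u * v + u' * v') / (sqrt Q * sqrt R)"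
      by (simp add: add_divide_distrib)
    also have "\<dots> = t / sqrt (a * b)" unfolding that sq using pos by simp
    finally show ?thesis .
  qed
  have "A ** B = wmat (a * b) N X Y Z W"
    unfolding A(1) B(1) wmat_def mat2_mult mat2_eq_iff
    by (intro conjI frac)
       (simp_all add: * X_def Y_def Z_def W_def G_def a'_def b'_def k'_def algebra_simps)
  then show ?thesis unfolding *(4) atkin_lehner_iff using det by blast
qed

lemma atkin_lehner_nonempty:
  assumes "exact_divisor Q N" "N > 0"
  obtains A where "A \<in> atkin_lehner Q N"
proof -
  obtain m where m: "N = Q * m" using assms by (auto simp: exact_divisor_def)
  have "Q > 0" using exact_divisor_pos assms by blast
  then have "coprime (int Q) (int m)" using assms m by (simp add: exact_divisor_def)
  then obtain x y where "int Q * x + int m * y = 1" by (metis bezout_int coprime_imp_gcd_eq_1 mult.commute)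
  then have "int Q * (int Q * x + int m * y) = int Q" by simp
  then have "(int Q * x) * (int Q * 1) - (- y) * (int N * 1) = int Q"
    using m by (simp add: algebra_simps)
  then have "wmat Q N x (- y) 1 1 \<in> atkin_lehner Q N" unfolding atkin_lehner_iff by blast
  then show ?thesis using that by blast
qed

text \<open>The consequence of admissibility with which the proof works, because it passes directly
  to plicates. Equal \<open>Q\<close> and \<open>R\<close> are excluded since their
  \<open>al_star\<close> is \<open>1\<close>, which is not an element of \<open>S\<close>.\<close>

definition al_closed :: "nat \<Rightarrow> nat set \<Rightarrow> bool" where
  "al_closed N S \<longleftrightarrow> N > 0 \<and> (\<forall>Q\<in>S. Q > 1 \<and> exact_divisor Q N) \<and>
     (\<forall>Q\<in>S. \<forall>R\<in>S. Q \<noteq> R \<longrightarrow> al_star Q R \<in> S)"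

lemma al_generators_carrier:
  assumes "\<And>Q. Q \<in> S \<Longrightarrow> Q > 0"
  shows "Gamma0 N \<union> (\<Union>Q\<in>S. atkin_lehner Q N) \<subseteq> carrier SL2R"
  using atkin_lehner_det[of _ 1 N] atkin_lehner_det assms unfolding atkin_lehner_1 by auto

text \<open>\<open>insert 1 S\<close> is closed under \<open>al_star\<close> and every element is
  its own inverse, so the union of cosets is already closed under products and inverses.\<close>

lemma al_group_eq:
  assumes "al_closed N S"
  shows "al_group (N, S) = (\<Union>Q\<in>insert 1 S. atkin_lehner Q N)"
proof (intro subset_antisym subsetI)
  have N: "N > 0" using assms by (simp add: al_closed_def)
  have ex: "exact_divisor Q N" if "Q \<in> insert 1 S" for Q
    using that assms by (cases "Q = 1") (auto simp: al_closed_def)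
  have pos: "Q > 0" if "Q \<in> insert 1 S" for Q
    using exact_divisor_pos[OF ex[OF that] N] .
  have star: "al_star Q R \<in> insert 1 S" if "Q \<in> insert 1 S" "R \<in> insert 1 S" for Q R
    using that assms pos[OF that(1)] unfolding al_closed_def by (cases "Q = R") auto
  fix A
  {
    assume "A \<in> al_group (N, S)"
    then have "A \<in> generate SL2R (Gamma0 N \<union> (\<Union>Q\<in>S. atkin_lehner Q N))" by simp
    then show "A \<in> (\<Union>Q\<in>insert 1 S. atkin_lehner Q N)"
    proof (induction rule: generate.induct)
      case one
      have "mat2 1 0 0 1 = mat2 (of_int 1) (of_int 0) (of_int 0) (of_int 1) \<and>
          (1::int) * 1 - 0 * 0 = 1 \<and> int N dvd 0" by simp
      then have "mat 1 \<in> Gamma0 N" unfolding Gamma0_def mat2_one by blast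
      then show ?case by (auto simp: atkin_lehner_1[unfolded One_nat_def])
    next
      case (incl h)
      then show ?case by (auto simp: atkin_lehner_1[unfolded One_nat_def])
    next
      case (inv h)
      then have "h \<in> (\<Union>Q\<in>insert 1 S. atkin_lehner Q N)"
        by (auto simp: atkin_lehner_1[unfolded One_nat_def])
      then obtain Q where Q: "Q \<in> insert 1 S" "h \<in> atkin_lehner Q N" by blast
      then show ?case using inv_SL2R[of h] atkin_lehner_det[OF Q(2) pos[OF Q(1)]] atkin_lehner_adj by auto
    next
      case (eng h1 h2)
      then obtain Q R where "Q \<in> insert 1 S" "h1 \<in> atkin_lehner Q N" "R \<in> insert 1 S" "h2 \<in> atkin_lehner R N" by blast
      then show ?case using atkin_lehner_mult[OF ex ex N] star by (metis SL2R_simps(2) UN_I)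
    qed
  }
  assume "A \<in> (\<Union>Q\<in>insert 1 S. atkin_lehner Q N)"
  then show "A \<in> al_group (N, S)" by (auto simp: atkin_lehner_1[unfolded One_nat_def] intro: generate.incl)
qed

text \<open>The whole coset of \<open>P = al_star Q R\<close> lies in the group already, so
  adjoining \<open>P\<close> leaves the group unchanged and maximality puts \<open>P\<close> into
  \<open>S\<close>. That \<open>P > 1\<close> holds because \<open>P = 1\<close> would force
  \<open>Q = R\<close>.\<close>

lemma al_closed_if_admissible:
  assumes "al_admissible (N, S)"
  shows "al_closed N S"
  unfolding al_closed_def
proof (intro conjI ballI impI)
  have N: "N > 0" and ex: "\<And>Q. Q \<in> S \<Longrightarrow> Q > 1 \<and> exact_divisor Q N"
    and max: "\<And>S'. (\<forall>Q\<in>S'. Q > 1 \<and> exact_divisor Q N) \<Longrightarrow> al_group (N, S') = al_group (N, S) \<Longrightarrow> S' \<subseteq> S"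
    using assms by auto
  show "N > 0" by (rule N)
  show "Q > 1" "exact_divisor Q N" if "Q \<in> S" for Q using ex[OF that] by auto
  fix Q R assume QR: "Q \<in> S" "R \<in> S" "Q \<noteq> R"
  define P where "P = al_star Q R"
  have exP: "exact_divisor P N" unfolding P_def by (rule exact_divisor_al_star) (use ex QR N in auto)
  have P1: "P > 1"
  proof -
    obtain g a b where "Q = g * a" "R = g * b" "P = a * b" "a > 0" "b > 0"
      unfolding P_def using exact_divisor_pair[of Q N R] ex QR N by metis
    moreover have "a * b \<noteq> 1" using calculation QR(3) by auto
    moreover have "a * b > 0" using calculation by simp
    ultimately show ?thesis by linarith
  qed
  interpret group SL2R by (rule group_SL2R)
  let ?H = "Gamma0 N \<union> (\<Union>Q\<in>S. atkin_lehner Q N)"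
  have pos: "\<And>Q. Q \<in> S \<Longrightarrow> Q > 0" using ex by fastforce
  have sub: "subgroup (al_group (N, S)) SL2R"
    unfolding al_group.simps by (rule generate_is_subgroup[OF al_generators_carrier[OF pos]])
  have W: "atkin_lehner P N \<subseteq> al_group (N, S)"
  proof
    fix V assume V: "V \<in> atkin_lehner P N"
    obtain A where A: "A \<in> atkin_lehner Q N" using atkin_lehner_nonempty[of Q N] ex QR N by metis
    obtain B where B: "B \<in> atkin_lehner R N" using atkin_lehner_nonempty[of R N] ex QR N by metis
    have dets: "det A = 1" "det B = 1" using atkin_lehner_det A B pos QR by auto
    have "mat2_adj B ** mat2_adj A \<in> atkin_lehner (al_star R Q) N"
      by (rule atkin_lehner_mult) (use ex QR N A B atkin_lehner_adj in auto)
    \<comment> \<open>\<open>V\<close> times the inverse of \<open>A ** B\<close> lies in the coset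
      of \<open>al_star P P = 1\<close>, that is, in \<open>Gamma0 N\<close>.\<close>
    then have "V ** (mat2_adj B ** mat2_adj A) \<in> atkin_lehner (al_star P P) N"
      unfolding P_def[unfolded al_star_commute[of Q R], symmetric]
      by (intro atkin_lehner_mult exP N V)
    then have G: "V ** (mat2_adj B ** mat2_adj A) \<in> Gamma0 N" using P1 by (simp add: atkin_lehner_1[unfolded One_nat_def])
    have "V ** (mat2_adj B ** mat2_adj A) ** (A ** B) = V ** (mat2_adj B ** (mat2_adj A ** A) ** B)"
      by (simp only: matrix_mul_assoc)
    also have "\<dots> = V" using dets by (simp add: mat2_adj_mult)
    finally have "V = V ** (mat2_adj B ** mat2_adj A) ** (A ** B)" ..
    moreover have "V ** (mat2_adj B ** mat2_adj A) \<in> al_group (N, S)" "A \<in> al_group (N, S)" "B \<in> al_group (N, S)"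
      using G A B QR by (auto intro: generate.incl)
    ultimately show "V \<in> al_group (N, S)"
      using subgroup.m_closed[OF sub] by (metis SL2R_simps(2))
  qed
  have "al_group (N, insert P S) = al_group (N, S)"
  proof
    have "Gamma0 N \<union> (\<Union>Q\<in>insert P S. atkin_lehner Q N) \<subseteq> al_group (N, S)"
      using W by (auto intro: generate.incl)
    then show "al_group (N, insert P S) \<subseteq> al_group (N, S)"
      using generate_subgroup_incl[OF _ sub] by simp
    show "al_group (N, S) \<subseteq> al_group (N, insert P S)"
      unfolding al_group.simps by (rule mono_generate) auto
  qed
  then have "insert P S \<subseteq> S" using ex exP P1 by (intro max) auto
  then show "al_star Q R \<in> S" by (simp add: P_def)
qed

lemma has_sum_Sigma_finite:
  fixes f :: "'a \<times> 'b \<Rightarrow> complex"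
  assumes "finite A" "\<And>x. x \<in> A \<Longrightarrow> ((\<lambda>y. f (x, y)) has_sum g x) (B x)"
  shows "(f has_sum (\<Sum>x\<in>A. g x)) (Sigma A B)"
  using assms
proof (induction A rule: finite_induct)
  case (insert a A)
  have "(f has_sum g a) (Pair a ` B a)"
    using insert.prems[of a] by (subst has_sum_reindex) (auto simp: inj_on_def o_def)
  then have "(f has_sum (g a + (\<Sum>x\<in>A. g x))) (Pair a ` B a \<union> Sigma A B)"
    using insert by (intro has_sum_Un_disjoint) auto
  moreover have "Pair a ` B a \<union> Sigma A B = Sigma (insert a A) B" by auto
  ultimately show ?case using insert by simp
qed simp

section \<open>Cosets of the stabiliser of infinity and their lower rows\<close>

definition tmat :: "real \<Rightarrow> int \<Rightarrow> real ^ 2 ^ 2" where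
  "tmat \<epsilon> t = mat2 \<epsilon> (\<epsilon> * of_int t) 0 \<epsilon>"

lemma Gamma_inf_iff: "h \<in> Gamma_inf \<longleftrightarrow> (\<exists>\<epsilon> t. h = tmat \<epsilon> t \<and> (\<epsilon> = 1 \<or> \<epsilon> = -1))"
  by (auto simp: Gamma_inf_def tmat_def)

lemma tmat_mult: "tmat \<epsilon> t ** tmat \<epsilon>' t' = tmat (\<epsilon> * \<epsilon>') (t + t')"
  by (simp add: tmat_def mat2_mult mat2_eq_iff algebra_simps)

lemma Gamma_inf_mult: "g \<in> Gamma_inf \<Longrightarrow> h \<in> Gamma_inf \<Longrightarrow> g ** h \<in> Gamma_inf"
proof -
  assume "g \<in> Gamma_inf" "h \<in> Gamma_inf"
  then obtain \<epsilon> t \<epsilon>' t' where "g = tmat \<epsilon> t" "h = tmat \<epsilon>' t'" and e: "\<epsilon> = 1 \<or> \<epsilon> = -1" "\<epsilon>' = 1 \<or> \<epsilon>' = -1"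
    unfolding Gamma_inf_iff by blast
  then have "g ** h = tmat (\<epsilon> * \<epsilon>') (t + t')" by (simp add: tmat_mult)
  moreover have "\<epsilon> * \<epsilon>' = 1 \<or> \<epsilon> * \<epsilon>' = -1" using e by auto
  ultimately show ?thesis unfolding Gamma_inf_iff by blast
qed

lemma tmat_one: "tmat 1 0 = mat 1"
  by (simp add: tmat_def mat2_one)

lemma mat_1_Gamma_inf: "mat 1 \<in> Gamma_inf"
  unfolding Gamma_inf_iff tmat_one[symmetric] by blast

lemma Gamma_inf_inverse:
  assumes "h \<in> Gamma_inf"
  obtains h' where "h' \<in> Gamma_inf" "h' ** h = mat 1"
proof -
  obtain \<epsilon> t where h: "h = tmat \<epsilon> t" "\<epsilon> = 1 \<or> \<epsilon> = -1" using assms by (auto simp: Gamma_inf_iff)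
  have "tmat \<epsilon> (- t) \<in> Gamma_inf" using h unfolding Gamma_inf_iff by blast
  moreover have "tmat \<epsilon> (- t) ** h = mat 1" using h by (auto simp: tmat_mult tmat_one)
  ultimately show ?thesis using that by blast
qed

definition coset_inf :: "real ^ 2 ^ 2 \<Rightarrow> (real ^ 2 ^ 2) set" where
  "coset_inf a = (\<lambda>h. h ** a) ` Gamma_inf"

lemma coset_inf_self: "a \<in> coset_inf a"
  unfolding coset_inf_def using mat_1_Gamma_inf by (intro image_eqI[of _ _ "mat 1"]) auto

lemma coset_inf_mult:
  assumes "h \<in> Gamma_inf"
  shows "coset_inf (h ** a) = coset_inf a"
proof -
  obtain h' where h': "h' \<in> Gamma_inf" "h' ** h = mat 1" using Gamma_inf_inverse[OF assms] by blast
  show ?thesis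
  proof (intro subset_antisym subsetI)
    fix x assume "x \<in> coset_inf (h ** a)"
    then obtain g where "g \<in> Gamma_inf" "x = g ** (h ** a)" by (auto simp: coset_inf_def)
    then show "x \<in> coset_inf a" unfolding coset_inf_def
      using Gamma_inf_mult[OF _ assms] by (intro image_eqI[of _ _ "g ** h"]) (auto simp: matrix_mul_assoc)
  next
    fix x assume "x \<in> coset_inf a"
    then obtain g where g: "g \<in> Gamma_inf" "x = g ** a" by (auto simp: coset_inf_def)
    have "(g ** h') ** (h ** a) = g ** ((h' ** h) ** a)" by (simp only: matrix_mul_assoc)
    also have "\<dots> = x" using g h' by simp
    finally show "x \<in> coset_inf (h ** a)" unfolding coset_inf_def
      using Gamma_inf_mult[OF g(1) h'(1)] by (intro image_eqI[of _ _ "g ** h'"]) auto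
  qed
qed

lemma rcosets_eq: "rcosets\<^bsub>SL2R\<lparr>carrier := G\<rparr>\<^esub> Gamma_inf = coset_inf ` G"
  by (auto simp: RCOSETS_def r_coset_def coset_inf_def SL2R_def)

lemma niebur_seed_shift: "niebur_seed n s (w + of_int t) = niebur_seed n s w"
proof -
  have "unit_exp (- of_nat n * of_real (Re (w + of_int t))) = unit_exp (- of_nat n * of_real (Re w) + of_int (- (int n * t)))"
    by (simp add: algebra_simps)
  also have "\<dots> = unit_exp (- of_nat n * of_real (Re w))" by (simp only: unit_exp_add unit_exp_of_int mult_1_right)
  finally show ?thesis by (simp add: niebur_seed_def)
qed

lemma moebius_tmat:
  assumes "det a = 1" "Im \<tau> > 0" "\<epsilon> = 1 \<or> \<epsilon> = -1"
  shows "moebius (tmat \<epsilon> t ** a) \<tau> = moebius a \<tau> + of_int t"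
proof -
  obtain p q r s where a: "a = mat2 p q r s" using mat2_eta by blast
  have nz: "of_real r * \<tau> + of_real s \<noteq> 0"
  proof
    assume z: "of_real r * \<tau> + of_real s = 0"
    then have "r * Im \<tau> = 0" by (auto simp: complex_eq_iff)
    then have "r = 0" using assms by simp
    with z have "s = 0" by simp
    with \<open>r = 0\<close> show False using assms(1) by (simp add: a)
  qed
  let ?D = "of_real r * \<tau> + of_real s"
  have "moebius (tmat \<epsilon> t ** a) \<tau> = (of_real \<epsilon> * ((of_real p * \<tau> + of_real q) + of_int t * ?D)) / (of_real \<epsilon> * ?D)"
    by (simp add: a tmat_def mat2_mult moebius_def algebra_simps)
  also have "\<dots> = ((of_real p * \<tau> + of_real q) + of_int t * ?D) / ?D" using assms(3) by auto
  also have "\<dots> = moebius a \<tau> + of_int t" using nz by (simp add: add_divide_distrib a moebius_def)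
  finally show ?thesis .
qed

text \<open>Another representative moves the image point by an integer, and the seed has period 1.
  This disposes of the choice operator in \<open>niebur_series\<close>.\<close>

lemma seed_some_coset:
  assumes "det a = 1" "Im \<tau> > 0"
  shows "niebur_seed n s (moebius (SOME \<gamma>. \<gamma> \<in> coset_inf a) \<tau>) = niebur_seed n s (moebius a \<tau>)"
proof -
  have "(SOME \<gamma>. \<gamma> \<in> coset_inf a) \<in> coset_inf a" by (rule someI[of "\<lambda>\<gamma>. \<gamma> \<in> coset_inf a" a, OF coset_inf_self])
  then obtain \<epsilon> t where "(SOME \<gamma>. \<gamma> \<in> coset_inf a) = tmat \<epsilon> t ** a" "\<epsilon> = 1 \<or> \<epsilon> = -1"
    by (auto simp: coset_inf_def Gamma_inf_iff)
  then show ?thesis using moebius_tmat[OF assms] niebur_seed_shift by simp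
qed

text \<open>A matrix of determinant 1 in the coset of \<open>Q\<close> has lower row
  \<open>sqrt Q * (c, d)\<close> with \<open>c\<close> a multiple of \<open>N div Q\<close>; its
  determinant forces \<open>c\<close> to be coprime to both \<open>Q\<close> and
  \<open>d\<close>.\<close>

definition crow :: "nat \<Rightarrow> nat \<Rightarrow> int set" where
  "crow N Q = {c. c > 0 \<and> int (N div Q) dvd c \<and> coprime c (int Q)}"

definition row_idx :: "nat \<Rightarrow> nat set \<Rightarrow> (nat \<times> int \<times> int) set" where
  "row_idx N S = (SIGMA Q:insert 1 S. SIGMA c:crow N Q. {d. coprime c d})"

text \<open>The upper row solves the determinant equation, with the inverse of \<open>Q d\<close>
  modulo \<open>c\<close> as its integral entry \<open>x\<close>. The case \<open>c = 0\<close>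
  serves the index \<open>(1, 0, 1)\<close> of the identity coset.\<close>

definition row_rep :: "nat \<times> int \<times> int \<Rightarrow> real ^ 2 ^ 2" where
  "row_rep = (\<lambda>(Q, c, d). if c = 0 then mat 1 else
     (let x = minv c (int Q * d) in
       mat2 (sqrt Q * of_int x) (of_int ((x * (int Q * d) - 1) div c) / sqrt Q) (sqrt Q * of_int c) (sqrt Q * of_int d)))"

lemma row_rep_bottom:
  assumes "i \<in> insert (1, 0, 1) (row_idx N S)" "i = (Q, c, d)"
  shows "row_rep i $ 2 $ 1 = sqrt Q * of_int c" "row_rep i $ 2 $ 2 = sqrt Q * of_int d"
  using assms by (auto simp: row_rep_def Let_def mat2_one row_idx_def crow_def)

lemma row_idx_inverse:
  assumes "c \<in> crow N Q" "coprime c d"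
  shows "(minv c (int Q * d) * (int Q * d) - 1) div c * c = minv c (int Q * d) * (int Q * d) - 1"
proof -
  have "coprime (int Q * d) c" using assms by (auto simp: crow_def coprime_commute)
  then have "[int Q * d * minv c (int Q * d) = 1] (mod c)" by (rule minv_cong)
  then have "c dvd minv c (int Q * d) * (int Q * d) - 1" by (simp add: cong_iff_dvd_diff mult.commute)
  then show ?thesis by simp
qed

lemma row_rep_al:
  assumes "al_closed N S" "i \<in> insert (1, 0, 1) (row_idx N S)"
  shows "row_rep i \<in> al_group (N, S)"
proof (cases "i = (1, 0, 1)")
  case True
  have "wmat 1 N 1 0 0 1 \<in> atkin_lehner 1 N" by (auto simp: atkin_lehner_iff intro!: exI)
  moreover have "wmat 1 N 1 0 0 1 = row_rep i" using True by (simp add: wmat_def row_rep_def mat2_one)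
  ultimately show ?thesis unfolding al_group_eq[OF assms(1)] by auto
next
  case False
  then obtain Q c d where i: "i = (Q, c, d)" "Q \<in> insert 1 S" "c \<in> crow N Q" "coprime c d"
    using assms by (auto simp: row_idx_def)
  have ex: "exact_divisor Q N" and N: "N > 0"
    using i(2) assms(1) by (cases "Q = 1"; auto simp: al_closed_def)+
  have Q: "Q > 0" using exact_divisor_pos[OF ex N] .
  define x where "x = minv c (int Q * d)"
  define y where "y = (x * (int Q * d) - 1) div c"
  have y: "y * c = x * (int Q * d) - 1" unfolding y_def x_def by (rule row_idx_inverse[OF i(3,4)])
  obtain z where z: "c = int (N div Q) * z" using i(3) by (auto simp: crow_def)
  have "Q dvd N" using ex by (simp add: exact_divisor_def)
  then have Nz: "int N * z = int Q * c" unfolding z by (metis dvd_mult_div_cancel mult.assoc of_nat_mult)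
  have sq: "real Q / sqrt Q = sqrt Q" by (simp add: real_div_sqrt)
  have sq': "real Q * r / sqrt Q = sqrt Q * r" for r using sq by (metis times_divide_eq_left)
  have "wmat Q N x y z d = row_rep i"
    unfolding wmat_def Nz using i(3) by (simp add: row_rep_def i(1) x_def y_def Let_def crow_def sq')
  moreover have "(int Q * x) * (int Q * d) - y * (int N * z) = int Q"
  proof -
    have "(int Q * x) * (int Q * d) - y * (int Q * c) = int Q * (x * (int Q * d) - y * c)" by (simp add: algebra_simps)
    then show ?thesis unfolding Nz y by simp
  qed
  ultimately have "row_rep i \<in> atkin_lehner Q N" unfolding atkin_lehner_iff by metis
  then show ?thesis unfolding al_group_eq[OF assms(1)] using i(2) by blast
qed

text \<open>After squaring, the gcd of \<open>Q c^2\<close> and \<open>Q d^2\<close> is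
  \<open>Q\<close>, so rows of different cosets never coincide, even up to sign.\<close>

lemma int_row_unique:
  fixes Q Q' :: nat and c d c' d' :: int
  assumes "coprime c d" "coprime c' d'"
    and "sqrt Q * of_int c = \<epsilon> * (sqrt Q' * of_int c')" "sqrt Q * of_int d = \<epsilon> * (sqrt Q' * of_int d')"
    and "\<epsilon> = 1 \<or> \<epsilon> = -1"
  shows "Q = Q'"
proof -
  have sqr: "int Q * u\<^sup>2 = int Q' * v\<^sup>2" if "sqrt Q * of_int u = \<epsilon> * (sqrt Q' * of_int v)" for u v
  proof -
    have "(sqrt Q * of_int u)\<^sup>2 = (\<epsilon> * (sqrt Q' * of_int v))\<^sup>2" using that by simp
    then have "real Q * (of_int u)\<^sup>2 = real Q' * (of_int v)\<^sup>2" using assms(5) by (auto simp: power_mult_distrib)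
    then have "real_of_int (int Q * u\<^sup>2) = real_of_int (int Q' * v\<^sup>2)" by simp
    then show ?thesis by (simp only: of_int_eq_iff)
  qed
  have g: "gcd (int Q * c\<^sup>2) (int Q * d\<^sup>2) = int Q" if "coprime c d" for c d and Q :: nat
    using that by (simp add: gcd_mult_distrib_int[symmetric] coprime_imp_gcd_eq_1)
  have "int Q = int Q'" using g[OF assms(1), of Q] g[OF assms(2), of Q'] sqr[OF assms(3)] sqr[OF assms(4)] by simp
  then show ?thesis by simp
qed

text \<open>Left multiplication by \<open>Gamma_inf\<close> changes a lower row only by a sign,
  which \<open>c > 0\<close>, or \<open>d = 1\<close> for \<open>c = 0\<close>, normalises.
  Conversely, matrices of determinant 1 in the group with the same lower row differ by an integer
  translation.\<close>

lemma coset_bij: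
  assumes cl: "al_closed N S"
  shows "bij_betw (\<lambda>i. coset_inf (row_rep i)) (insert (1, 0, 1) (row_idx N S)) (coset_inf ` al_group (N, S))"
  unfolding bij_betw_def
proof
  have N: "N > 0" and ex: "\<And>Q. Q \<in> insert 1 S \<Longrightarrow> exact_divisor Q N"
    using cl by (auto simp: al_closed_def)
  have pos: "Q > 0" if "Q \<in> insert 1 S" for Q using exact_divisor_pos[OF ex[OF that] N] .
  show "inj_on (\<lambda>i. coset_inf (row_rep i)) (insert (1, 0, 1) (row_idx N S))"
  proof (rule inj_onI)
    fix i i' assume ii: "i \<in> insert (1, 0, 1) (row_idx N S)" "i' \<in> insert (1, 0, 1) (row_idx N S)"
      and "coset_inf (row_rep i) = coset_inf (row_rep i')"
    then have "row_rep i \<in> coset_inf (row_rep i')" using coset_inf_self by blast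
    then obtain \<epsilon> t where h: "row_rep i = tmat \<epsilon> t ** row_rep i'" "\<epsilon> = 1 \<or> \<epsilon> = -1"
      by (auto simp: coset_inf_def Gamma_inf_iff)
    obtain Q c d where i: "i = (Q, c, d)" by (cases i)
    obtain Q' c' d' where i': "i' = (Q', c', d')" by (cases i')
    have "row_rep i $ 2 $ 1 = \<epsilon> * row_rep i' $ 2 $ 1" "row_rep i $ 2 $ 2 = \<epsilon> * row_rep i' $ 2 $ 2"
      unfolding h by (subst mat2_eta[of "row_rep i'"], simp add: tmat_def mat2_mult)+
    then have e: "sqrt Q * of_int c = \<epsilon> * (sqrt Q' * of_int c')" "sqrt Q * of_int d = \<epsilon> * (sqrt Q' * of_int d')"
      using row_rep_bottom[OF ii(1) i] row_rep_bottom[OF ii(2) i'] by auto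
    have c: "coprime c d" "c > 0 \<or> c = 0 \<and> d = 1" "Q \<in> insert 1 S" using ii(1) by (auto simp: i row_idx_def crow_def)
    have c': "coprime c' d'" "c' > 0 \<or> c' = 0 \<and> d' = 1" "Q' \<in> insert 1 S" using ii(2) by (auto simp: i' row_idx_def crow_def)
    have Q: "Q = Q'" by (rule int_row_unique[OF c(1) c'(1) e h(2)])
    have "real_of_int c = \<epsilon> * of_int c'" "real_of_int d = \<epsilon> * of_int d'"
      using e pos[OF c(3)] unfolding Q by (auto simp: mult.left_commute[of \<epsilon>])
    then have "(c = c' \<and> d = d') \<or> (c = - c' \<and> d = - d')" using h(2) by (auto simp flip: of_int_minus)
    then show "i = i'" using c(2) c'(2) Q by (auto simp: i i')
  qed
  show "(\<lambda>i. coset_inf (row_rep i)) ` insert (1, 0, 1) (row_idx N S) = coset_inf ` al_group (N, S)"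
  proof (intro subset_antisym subsetI)
    fix C assume "C \<in> (\<lambda>i. coset_inf (row_rep i)) ` insert (1, 0, 1) (row_idx N S)"
    then show "C \<in> coset_inf ` al_group (N, S)" using row_rep_al[OF cl] by blast
  next
    fix C assume "C \<in> coset_inf ` al_group (N, S)"
    then obtain a Q where a: "C = coset_inf a" "Q \<in> insert 1 S" "a \<in> atkin_lehner Q N"
      unfolding al_group_eq[OF cl] by blast
    have Q: "Q > 0" using pos a by blast
    obtain x0 y0 z0 w0 where a0: "a = wmat Q N x0 y0 z0 w0" "(int Q * x0) * (int Q * w0) - y0 * (int N * z0) = int Q"
      using a(3) unfolding atkin_lehner_iff by blast
    define c0 where "c0 = int (N div Q) * z0"
    have QN: "Q dvd N" using ex[OF a(2)] by (simp add: exact_divisor_def)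
    have Nz: "int N * z0 = int Q * c0" unfolding c0_def by (metis QN dvd_mult_div_cancel mult.assoc of_nat_mult)
    \<comment> \<open>The sign that makes the first nonzero entry of the lower row positive.\<close>
    define \<sigma> :: int where "\<sigma> = (if c0 > 0 \<or> c0 = 0 \<and> w0 > 0 then 1 else -1)"
    have \<sigma>: "\<sigma> * \<sigma> = 1" "\<sigma> = 1 \<or> \<sigma> = -1" by (auto simp: \<sigma>_def)
    define x y c d where "x = \<sigma> * x0" and "y = \<sigma> * y0" and "c = \<sigma> * c0" and "d = \<sigma> * w0"
    have "int Q * (int Q * x0 * w0 - y0 * c0) = int Q * 1" using a0(2) unfolding Nz by (simp add: algebra_simps)
    then have det0: "int Q * x0 * w0 - y0 * c0 = 1" using Q by simp
    have "int Q * x * d - y * c = (\<sigma> * \<sigma>) * (int Q * x0 * w0 - y0 * c0)"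
      by (simp add: x_def y_def c_def d_def algebra_simps)
    then have det: "int Q * x * d - y * c = 1" using \<sigma>(1) det0 by simp
    have sg: "c > 0 \<or> c = 0 \<and> d > 0"
    proof -
      have "c0 \<noteq> 0 \<or> w0 \<noteq> 0" using det0 by auto
      then show ?thesis by (auto simp: c_def d_def \<sigma>_def)
    qed
    have sq: "real Q / sqrt Q = sqrt Q" by (simp add: real_div_sqrt)
    have sq': "real Q * r / sqrt Q = sqrt Q * r" for r using sq by (metis times_divide_eq_left)
    define a' where "a' = mat2 (sqrt Q * of_int x) (of_int y / sqrt Q) (sqrt Q * of_int c) (sqrt Q * of_int d)"
    have aa': "a = tmat (of_int \<sigma>) 0 ** a'"
      unfolding a0(1) wmat_def Nz a'_def tmat_def mat2_mult mat2_eq_iff x_def y_def c_def d_def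
      using \<sigma>(2) by (auto simp: sq')
    have h: "tmat (of_int \<sigma>) 0 \<in> Gamma_inf" unfolding Gamma_inf_iff using \<sigma>(2) by auto
    have C: "C = coset_inf a'" unfolding a(1) aa' by (rule coset_inf_mult[OF h])
    have copcd: "coprime c d"
    proof (rule coprimeI)
      fix p assume "p dvd c" "p dvd d"
      then have "p dvd int Q * x * d - y * c" by simp
      then show "is_unit p" using det by simp
    qed
    have copcQ: "coprime c (int Q)"
    proof (rule coprimeI)
      fix p assume "p dvd c" "p dvd int Q"
      then have "p dvd int Q * x * d - y * c" by simp
      then show "is_unit p" using det by simp
    qed
    show "C \<in> (\<lambda>i. coset_inf (row_rep i)) ` insert (1, 0, 1) (row_idx N S)"
    proof (cases "c = 0")
      case True
      then have "d > 0" using sg by simp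
      \<comment> \<open>With \<open>c = 0\<close> the determinant leaves
        \<open>Q = d = x = 1\<close>, which is the identity coset.\<close>
      have 1: "int Q * x * d = 1" using det True by simp
      then have "int Q dvd 1" "d dvd 1" by (metis dvd_triv_left mult.assoc, metis dvd_triv_right)
      then have "Q = 1" "d = 1" using \<open>d > 0\<close> by (auto simp: zdvd1_eq)
      then have "x = 1" using 1 by simp
      have "a' = tmat 1 y ** row_rep (1, 0, 1)"
        using \<open>x = 1\<close> \<open>Q = 1\<close> \<open>d = 1\<close> True by (simp add: a'_def tmat_def row_rep_def)
      moreover have "tmat 1 y \<in> Gamma_inf" unfolding Gamma_inf_iff by blast
      ultimately have "C = coset_inf (row_rep (1, 0, 1))" unfolding C using coset_inf_mult by simp
      then show ?thesis by blast
    next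
      case False
      then have c0: "c > 0" using sg by simp
      have ccrow: "c \<in> crow N Q" using c0 copcQ by (simp add: crow_def c_def c0_def)
      define X where "X = minv c (int Q * d)"
      define Y where "Y = (X * (int Q * d) - 1) div c"
      have Y: "Y * c = X * (int Q * d) - 1" unfolding X_def Y_def by (rule row_idx_inverse[OF ccrow copcd])
      have "[int Q * d * x = 1] (mod c)"
      proof -
        have "int Q * d * x - 1 = c * y" using det by (simp add: algebra_simps)
        then show ?thesis by (simp add: cong_iff_dvd_diff)
      qed
      \<comment> \<open>Both top entries invert \<open>Q d\<close> modulo \<open>c\<close>; their
        difference \<open>c t\<close> gives the translation by \<open>t\<close>.\<close>
      then have "[X = x] (mod c)" unfolding X_def by (rule cong_minv_unique)
      then obtain t where t: "x = X + c * t" by (metis cong_iff_lin)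
      have "c * y = c * (Y + t * (int Q * d))"
        using det Y unfolding t by (simp add: algebra_simps)
      then have y: "y = Y + t * (int Q * d)" using c0 by simp
      have rp: "row_rep (Q, c, d) = mat2 (sqrt Q * of_int X) (of_int Y / sqrt Q) (sqrt Q * of_int c) (sqrt Q * of_int d)"
        using False by (simp add: row_rep_def Let_def X_def Y_def)
      have e1: "sqrt Q * of_int x = sqrt Q * of_int X + of_int t * (sqrt Q * of_int c)"
        by (simp add: t algebra_simps)
      have "of_int y / sqrt Q = of_int Y / sqrt Q + of_int t * (real Q * of_int d / sqrt Q)"
        by (simp add: y add_divide_distrib)
      then have e2: "of_int y / sqrt Q = of_int Y / sqrt Q + of_int t * (sqrt Q * of_int d)"
        unfolding sq' .
      have "a' = tmat 1 t ** row_rep (Q, c, d)"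
        unfolding rp a'_def tmat_def mat2_mult mat2_eq_iff using e1 e2 by simp
      moreover have "tmat 1 t \<in> Gamma_inf" unfolding Gamma_inf_iff by blast
      ultimately have "C = coset_inf (row_rep (Q, c, d))" unfolding C using coset_inf_mult by simp
      moreover have "(Q, c, d) \<in> row_idx N S" using a(2) ccrow copcd by (simp add: row_idx_def)
      ultimately show ?thesis by blast
    qed
  qed
qed

lemma seed_row_rep:
  assumes "c \<in> crow N Q" "coprime c d" "Q > 0" "Im \<tau> > 0"
  shows "niebur_seed n s (moebius (row_rep (Q, c, d)) \<tau>) = row_term (int Q) n \<tau> s c d"
proof -
  have c: "c > 0" using assms by (simp add: crow_def)
  define x where "x = minv c (int Q * d)"
  define y where "y = (x * (int Q * d) - 1) div c"
  have "y * c = x * (int Q * d) - 1" unfolding y_def x_def by (rule row_idx_inverse[OF assms(1,2)])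
  then have "of_int (y * c) = (of_int (x * (int Q * d) - 1) :: complex)" by simp
  then have y: "(of_int y :: complex) * of_int c = of_int x * (of_nat Q * of_int d) - 1" by simp
  let ?z = "of_int c * \<tau> + of_int d"
  have z: "?z \<noteq> 0" by (rule lat_nonzero[OF assms(4) c])
  have sq: "complex_of_real (sqrt Q) \<noteq> 0" "complex_of_real (sqrt Q) * of_real (sqrt Q) = of_nat Q"
    using assms(3) by (auto simp flip: of_real_mult)
  have "moebius (row_rep (Q, c, d)) \<tau> =
     (of_real (sqrt Q) * of_int x * \<tau> + of_int y / of_real (sqrt Q)) / (of_real (sqrt Q) * of_int c * \<tau> + of_real (sqrt Q) * of_int d)"
    using c by (simp add: moebius_def row_rep_def Let_def x_def y_def)
  also have "\<dots> = (of_real (sqrt Q) * (of_real (sqrt Q) * of_int x * \<tau> + of_int y / of_real (sqrt Q))) / (of_real (sqrt Q) * (of_real (sqrt Q) * of_int c * \<tau> + of_real (sqrt Q) * of_int d))"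
    using sq(1) by simp
  also have "of_real (sqrt Q) * (of_real (sqrt Q) * of_int x * \<tau> + of_int y / of_real (sqrt Q)) = of_nat Q * of_int x * \<tau> + of_int y"
    using sq(1) unfolding sq(2)[symmetric] by (simp add: field_simps)
  also have "of_real (sqrt Q) * (of_real (sqrt Q) * of_int c * \<tau> + of_real (sqrt Q) * of_int d) = of_nat Q * ?z"
    unfolding sq(2)[symmetric] by (simp add: algebra_simps)
  also have "(of_nat Q * of_int x * \<tau> + of_int y) / (of_nat Q * ?z) = of_int x / of_int c + row_point (int Q) \<tau> c d"
  proof -
    have "of_int c * (of_nat Q * of_int x * \<tau> + of_int y) = of_int x * (of_nat Q * ?z) - 1"
      using y by (simp add: algebra_simps)
    then have "(of_nat Q * of_int x * \<tau> + of_int y) = (of_int x * (of_nat Q * ?z) - 1) / of_int c"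
      using c by (simp add: field_simps)
    then have "(of_nat Q * of_int x * \<tau> + of_int y) / (of_nat Q * ?z) = (of_int x * (of_nat Q * ?z) - 1) / (of_int c * (of_nat Q * ?z))"
      by simp
    also have "\<dots> = of_int x / of_int c - 1 / (of_int c * (of_nat Q * ?z))"
      using z c assms(3) by (simp add: diff_divide_distrib)
    finally show ?thesis by (simp add: row_point_def mult_ac)
  qed
  finally have m: "moebius (row_rep (Q, c, d)) \<tau> = of_real (of_int x / of_int c) + row_point (int Q) \<tau> c d" by simp
  have "niebur_seed n s (of_real r + w) = unit_exp (- of_nat n * of_real r) * niebur_seed n s w" for r w
  proof -
    have "unit_exp (- of_nat n * of_real (Re (of_real r + w))) = unit_exp (- of_nat n * of_real r + - of_nat n * of_real (Re w))"
      by (simp add: algebra_simps)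
    then show ?thesis unfolding niebur_seed_def unit_exp_add by simp
  qed
  then have "niebur_seed n s (moebius (row_rep (Q, c, d)) \<tau>) = unit_exp (- of_nat n * of_real (of_int x / of_int c)) * niebur_seed n s (row_point (int Q) \<tau> c d)"
    unfolding m by blast
  also have "unit_exp (- of_nat n * of_real (of_int x / of_int c)) = phase (int Q) n c d"
    by (simp add: phase_def ek_def x_def)
  finally show ?thesis by (simp add: row_term_def)
qed

definition row_series :: "nat \<Rightarrow> nat \<Rightarrow> nat \<Rightarrow> complex \<Rightarrow> complex \<Rightarrow> complex" where
  "row_series N Q n \<tau> s = (\<Sum>\<^sub>\<infinity>(c, d)\<in>Sigma (crow N Q) (\<lambda>c. {d. coprime c d}). row_term (int Q) n \<tau> s c d)"

lemma row_series_has_sum: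
  assumes "Im \<tau> > 0" "n > 0" "Q > 0" "Re s > 1"
  shows "((\<lambda>(c, d). row_term (int Q) n \<tau> s c d) has_sum row_series N Q n \<tau> s) (Sigma (crow N Q) (\<lambda>c. {d. coprime c d}))"
proof -
  have Q: "int Q > 0" using assms by simp
  have C: "c > 0 \<and> coprime c (int Q)" if "c \<in> crow N Q" for c using that by (simp add: crow_def)
  obtain F where "\<And>s. Re s > 1 \<Longrightarrow> ((\<lambda>(c, d). row_term (int Q) n \<tau> s c d) has_sum F s) (Sigma (crow N Q) (\<lambda>c. {d. coprime c d}))"
    by (rule row_series_continuation[OF assms(1,2) Q C]) (assumption, rule that)
  from this[OF assms(4)] show ?thesis unfolding row_series_def by (simp add: infsumI)
qed

lemma al_closed_finite: "al_closed N S \<Longrightarrow> finite S"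
  by (rule finite_subset[of _ "{..N}"]) (auto simp: al_closed_def exact_divisor_def dest: dvd_imp_le)

lemma niebur_series_eq:
  assumes cl: "al_closed N S" and n: "n > 0" and \<tau>: "Im \<tau> > 0" and s: "Re s > 1"
  shows "niebur_series (N, S) n \<tau> s =
    2 * of_real pi * (niebur_seed n s \<tau> + (\<Sum>Q\<in>insert 1 S. row_series N Q n \<tau> s))"
proof -
  have pos: "Q > 0" if "Q \<in> insert 1 S" for Q
    using that cl by (auto simp: al_closed_def)
  have fin: "finite (insert 1 S)" using al_closed_finite[OF cl] by simp
  let ?f = "\<lambda>i. niebur_seed n s (moebius (row_rep i) \<tau>)"
  have det: "det (row_rep i) = 1" if i: "i \<in> insert (1, 0, 1) (row_idx N S)" for i
  proof -
    obtain Q where "Q \<in> insert 1 S" "row_rep i \<in> atkin_lehner Q N"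
      using row_rep_al[OF cl i] unfolding al_group_eq[OF cl] by (elim UN_E)
    then show ?thesis using atkin_lehner_det pos by metis
  qed
  have "(?f has_sum (\<Sum>Q\<in>insert 1 S. row_series N Q n \<tau> s)) (row_idx N S)"
    unfolding row_idx_def
  proof (rule has_sum_Sigma_finite[OF fin])
    fix Q assume Q: "Q \<in> insert 1 S"
    show "((\<lambda>y. ?f (Q, y)) has_sum row_series N Q n \<tau> s) (Sigma (crow N Q) (\<lambda>c. {d. coprime c d}))"
      by (rule has_sum_cong[THEN iffD2, OF _ row_series_has_sum[OF \<tau> n pos[OF Q] s]])
         (use seed_row_rep[OF _ _ pos[OF Q] \<tau>] in auto)
  qed
  moreover have "(?f has_sum niebur_seed n s \<tau>) {(1, 0, 1)}"
    by (rule has_sum_finiteI) (auto simp: row_rep_def moebius_def mat2_one)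
  ultimately have "(?f has_sum (niebur_seed n s \<tau> + (\<Sum>Q\<in>insert 1 S. row_series N Q n \<tau> s))) ({(1, 0, 1)} \<union> row_idx N S)"
    by (intro has_sum_Un_disjoint) (auto simp: row_idx_def crow_def)
  then have 1: "(\<Sum>\<^sub>\<infinity>i\<in>insert (1, 0, 1) (row_idx N S). ?f i) = niebur_seed n s \<tau> + (\<Sum>Q\<in>insert 1 S. row_series N Q n \<tau> s)"
    by (simp add: infsumI)
  have "(\<Sum>\<^sub>\<infinity>C\<in>rcosets\<^bsub>SL2R\<lparr>carrier := al_group (N, S)\<rparr>\<^esub> Gamma_inf. niebur_seed n s (moebius (SOME \<gamma>. \<gamma> \<in> C) \<tau>)) =
    (\<Sum>\<^sub>\<infinity>i\<in>insert (1, 0, 1) (row_idx N S). niebur_seed n s (moebius (SOME \<gamma>. \<gamma> \<in> coset_inf (row_rep i)) \<tau>))"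
    unfolding rcosets_eq by (rule infsum_reindex_bij_betw[OF coset_bij[OF cl], symmetric])
  also have "\<dots> = (\<Sum>\<^sub>\<infinity>i\<in>insert (1, 0, 1) (row_idx N S). ?f i)"
    by (rule infsum_cong) (rule seed_some_coset[OF det \<tau>])
  finally show ?thesis unfolding niebur_series_def 1 by simp
qed

section \<open>The functions \<open>j\<close> and \<open>J\<close>\<close>

text \<open>Convergence at real points near 1 gives convergence in the whole disc, and a power
  series is continuous at its centre.\<close>

lemma powser_real_limit:
  fixes a :: "nat \<Rightarrow> complex"
  assumes "\<And>r. 0 < r \<Longrightarrow> r < 1 \<Longrightarrow> (\<lambda>l. a l * of_real r ^ l) sums f r"
  shows "(f \<longlongrightarrow> a 0) (at_right 0)"
    and "norm z < 1 \<Longrightarrow> summable (\<lambda>l. a l * z ^ l)"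
proof -
  show sm: "summable (\<lambda>l. a l * z ^ l)" if z: "norm z < 1" for z
  proof -
    obtain r where r: "norm z < r" "r < 1" using z dense by blast
    have r0: "r > 0" using r(1) norm_ge_zero[of z] by linarith
    show ?thesis
      by (rule powser_inside[OF sums_summable[OF assms[OF r0 r(2)]]]) (use r r0 in auto)
  qed
  define g where "g z = (\<Sum>l. a l * z ^ l)" for z
  have "summable (\<lambda>l. a l * (1 / 2) ^ l)" by (rule sm) simp
  then have "isCont g 0" unfolding g_def by (rule isCont_powser) simp
  moreover have "g 0 = a 0" by (simp add: g_def)
  ultimately have "(g \<longlongrightarrow> a 0) (at 0)" by (simp add: isCont_def)
  moreover have "filterlim (\<lambda>r. complex_of_real r) (at 0) (at_right 0)"
    unfolding filterlim_at
    by (intro conjI tendsto_eq_intros) (auto simp: eventually_at_filter)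
  ultimately have "((\<lambda>r. g (of_real r)) \<longlongrightarrow> a 0) (at_right 0)" by (rule filterlim_compose)
  moreover have "eventually (\<lambda>r. g (of_real r) = f r) (at_right 0)"
  proof -
    have "eventually (\<lambda>r::real. r \<in> {0<..<1}) (at_right 0)" by (rule eventually_at_right_real) simp
    then show ?thesis
      by eventually_elim (use assms in \<open>auto simp: g_def sums_iff\<close>)
  qed
  ultimately show "(f \<longlongrightarrow> a 0) (at_right 0)" by (rule Lim_transform_eventually)
qed

text \<open>The zeros on the real segment accumulate at \<open>0\<close>, whereas a nonzero power
  series has isolated zeros.\<close>

lemma powser_real_zero:
  fixes a :: "nat \<Rightarrow> complex"
  assumes "\<And>r. 0 < r \<Longrightarrow> r < 1 \<Longrightarrow> (\<lambda>l. a l * of_real r ^ l) sums 0"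
  shows "a l = 0"
proof -
  have "((\<lambda>r. 0) \<longlongrightarrow> a 0) (at_right (0::real))" by (rule powser_real_limit(1)) (use assms in auto)
  then have a0: "a 0 = 0" by (simp add: tendsto_const_iff)
  define g where "g z = (\<Sum>l. a l * z ^ l)" for z
  have g: "(\<lambda>l. a l * (z - 0) ^ l) sums g z" if "norm (z - 0) < 1" for z
    using powser_real_limit(2)[OF assms, of z] that by (simp add: g_def summable_sums)
  show ?thesis
  proof (rule ccontr)
    assume al: "a l \<noteq> 0"
    then have "l > 0" using a0 by (cases l) auto
    have "g 0 = 0" using a0 by (simp add: g_def)
    obtain s where s: "s > 0" "\<And>z. z \<in> cball 0 s - {0} \<Longrightarrow> g z \<noteq> 0"
      using powser_0_nonzero[OF zero_less_one g \<open>g 0 = 0\<close> al \<open>l > 0\<close>] by blast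
    define r where "r = min s (1 / 2)"
    have r: "0 < r" "r < 1" "r \<le> s" using s(1) by (auto simp: r_def)
    have "g (of_real r) = 0" using assms[OF r(1,2)] by (simp add: g_def sums_iff)
    moreover have "g (of_real r) \<noteq> 0" by (rule s(2)) (use r in auto)
    ultimately show False by simp
  qed
qed

definition fourier_tail :: "(int \<Rightarrow> complex) \<Rightarrow> complex \<Rightarrow> nat \<Rightarrow> complex" where
  "fourier_tail c \<tau> l = c (int (Suc l)) * unit_exp \<tau> ^ Suc l + c (- int (Suc l)) * cnj (unit_exp \<tau>) ^ Suc l"

text \<open>On a vertical line the argument of \<open>unit_exp \<tau>\<close> is fixed, so the
  two-sided expansion becomes an ordinary power series in its modulus \<open>r\<close>.\<close>

lemma fourier_tail_radial:
  fixes x r :: real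
  assumes "0 < r" "r < 1"
  defines "\<tau> \<equiv> Complex x (- ln r / (2 * pi))"
  defines "E \<equiv> unit_exp (of_real x)"
  shows "Im \<tau> > 0" "fourier_tail c \<tau> l = (c (int (Suc l)) * E ^ Suc l + c (- int (Suc l)) * cnj E ^ Suc l) * of_real r ^ Suc l"
proof -
  show "Im \<tau> > 0" using assms by (simp add: \<tau>_def field_simps)
  have "unit_exp \<tau> = of_real r * E"
  proof -
    have "\<tau> = of_real x + of_real (- ln r / (2 * pi)) * \<i>" by (simp add: \<tau>_def complex_eq_iff)
    then have "unit_exp \<tau> = E * unit_exp (of_real (- ln r / (2 * pi)) * \<i>)" by (simp only: unit_exp_add E_def)
    also have "unit_exp (of_real (- ln r / (2 * pi)) * \<i>) = exp (of_real (ln r))"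
      unfolding unit_exp_def by (rule arg_cong[of _ _ exp]) (simp add: complex_eq_iff)
    also have "\<dots> = of_real r" using assms by (simp add: exp_of_real)
    finally show ?thesis by simp
  qed
  then show "fourier_tail c \<tau> l = (c (int (Suc l)) * E ^ Suc l + c (- int (Suc l)) * cnj E ^ Suc l) * of_real r ^ Suc l"
    by (simp add: fourier_tail_def power_mult_distrib algebra_simps del: power_Suc)
qed

text \<open>Large \<open>y\<close> corresponds to \<open>r\<close> tending to \<open>0\<close> from
  the right, and the power series of \<open>fourier_tail_radial\<close> has no constant
  term.\<close>

lemma fourier_tail_limit:
  assumes "\<And>\<tau>. Im \<tau> > 0 \<Longrightarrow> fourier_tail c \<tau> sums R \<tau>"
  shows "((\<lambda>y. R (Complex x y)) \<longlongrightarrow> 0) at_top"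
proof -
  define E where "E = unit_exp (of_real x)"
  define a where "a l = (if l = 0 then 0 else c (int l) * E ^ l + c (- int l) * cnj E ^ l)" for l
  have "(\<lambda>l. a l * of_real r ^ l) sums R (Complex x (- ln r / (2 * pi)))" if r: "0 < r" "r < 1" for r :: real
  proof -
    have "fourier_tail c (Complex x (- ln r / (2 * pi))) = (\<lambda>l. a (Suc l) * of_real r ^ Suc l)"
      by (rule ext) (simp only: fourier_tail_radial(2)[OF r] a_def E_def nat.simps if_False)
    with assms[OF fourier_tail_radial(1)[OF r, of x]]
    have "(\<lambda>l. a (Suc l) * of_real r ^ Suc l) sums R (Complex x (- ln r / (2 * pi)))" by simp
    then show ?thesis by (subst (asm) sums_Suc_iff) (simp add: a_def)
  qed
  then have "((\<lambda>r. R (Complex x (- ln r / (2 * pi)))) \<longlongrightarrow> a 0) (at_right 0)"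
    by (rule powser_real_limit(1))
  then have 1: "((\<lambda>r. R (Complex x (- ln r / (2 * pi)))) \<longlongrightarrow> 0) (at_right 0)" by (simp add: a_def)
  have "filterlim (\<lambda>y. exp (- (2 * pi) * y)) (at_right 0) at_top"
    by real_asymp
  from filterlim_compose[OF 1 this] show ?thesis by simp
qed

text \<open>Each vertical line only determines the combination of the coefficients at
  \<open>l\<close> and \<open>- l\<close> belonging to its real part; two suitable lines separate
  them.\<close>

lemma fourier_tail_unique:
  assumes "\<And>\<tau>. Im \<tau> > 0 \<Longrightarrow> fourier_tail c \<tau> sums (R \<tau> - c 0)"
    and "\<And>\<tau>. Im \<tau> > 0 \<Longrightarrow> fourier_tail c' \<tau> sums (R \<tau> - c' 0)"
  shows "c = c'"
proof -
  define e where "e l = c l - c' l" for l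
  define a where "a x l = (if l = 0 then e 0 else e (int l) * unit_exp (of_real x) ^ l + e (- int l) * cnj (unit_exp (of_real x)) ^ l)" for x :: real and l
  have z: "a x l = 0" for x l
  proof (rule powser_real_zero)
    fix r :: real assume r: "0 < r" "r < 1"
    let ?\<tau> = "Complex x (- ln r / (2 * pi))"
    have "(\<lambda>l. fourier_tail c ?\<tau> l - fourier_tail c' ?\<tau> l) sums ((R ?\<tau> - c 0) - (R ?\<tau> - c' 0))"
      by (intro sums_diff assms fourier_tail_radial(1) r)
    moreover have "fourier_tail c ?\<tau> l - fourier_tail c' ?\<tau> l = a x (Suc l) * of_real r ^ Suc l" for l
      unfolding fourier_tail_radial(2)[OF r] by (simp add: a_def e_def algebra_simps del: power_Suc of_nat_Suc)
    ultimately have "(\<lambda>l. a x (Suc l) * of_real r ^ Suc l) sums (- e 0)" by (simp add: e_def del: power_Suc)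
    then show "(\<lambda>l. a x l * of_real r ^ l) sums 0" by (subst (asm) sums_Suc_iff) (simp add: a_def)
  qed
  have e0: "e 0 = 0" using z[of 0 0] by (simp add: a_def)
  have e: "e (int l) = 0 \<and> e (- int l) = 0" if l: "l > 0" for l
  proof -
    have 1: "e (int l) + e (- int l) = 0" using z[of 0 l] l by (simp add: a_def)
    \<comment> \<open>On the line \<open>x = 1 / (4 l)\<close> the two coefficients are weighted by
      \<open>i\<close> and \<open>- i\<close>, which gives their difference; \<open>x = 0\<close>
      gives their sum.\<close>
    have E: "unit_exp (of_real (1 / (4 * real l))) ^ l = \<i>"
    proof -
      have "unit_exp (of_real (1 / (4 * real l))) ^ l = unit_exp (of_nat l * of_real (1 / (4 * real l)))"
        by (simp only: unit_exp_of_nat_mult)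
      also have "of_nat l * of_real (1 / (4 * real l)) = (1 / 4 :: complex)" using l by simp
      also have "unit_exp (1 / 4) = exp (\<i> * of_real (pi / 2))" by (simp add: unit_exp_def mult_ac)
      also have "\<dots> = cis (pi / 2)" by (rule cis_conv_exp[symmetric])
      also have "\<dots> = \<i>" by (rule cis_pi_half)
      finally show ?thesis .
    qed
    have "e (int l) * unit_exp (of_real (1 / (4 * real l))) ^ l + e (- int l) * cnj (unit_exp (of_real (1 / (4 * real l)))) ^ l = 0"
      using z[of "1 / (4 * real l)" l] l by (simp add: a_def)
    then have "e (int l) * \<i> + e (- int l) * cnj \<i> = 0"
      unfolding complex_cnj_power[symmetric] E .
    then have "\<i> * (e (int l) - e (- int l)) = 0" by (simp add: algebra_simps)
    then have "e (int l) = e (- int l)" by simp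
    then show ?thesis using 1 by simp
  qed
  show ?thesis
  proof
    fix l :: int
    have "e l = 0"
    proof (cases "l = 0")
      case False
      then show ?thesis using e[of "nat \<bar>l\<bar>"] by (cases "l > 0") auto
    qed (simp add: e0)
    then show "c l = c' l" by (simp add: e_def)
  qed
qed

text \<open>Two continuations may live on different half-planes; they agree on the smaller one by
  the identity theorem, so the definite description is met.\<close>

lemma niebur_j_eqI:
  assumes "\<sigma> < 1" "F holomorphic_on {s. Re s > \<sigma>}" "\<And>s. Re s > 1 \<Longrightarrow> F s = niebur_series G n \<tau> s"
  shows "niebur_j G n \<tau> = F 1"
  unfolding niebur_j_def
proof (rule the_equality)
  show "\<exists>\<sigma><1. \<exists>F'. F' holomorphic_on {s. Re s > \<sigma>} \<and> (\<forall>s. Re s > 1 \<longrightarrow> F' s = niebur_series G n \<tau> s) \<and> F 1 = F' 1"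
    using assms by blast
  fix v assume "\<exists>\<sigma><1. \<exists>F'. F' holomorphic_on {s. Re s > \<sigma>} \<and> (\<forall>s. Re s > 1 \<longrightarrow> F' s = niebur_series G n \<tau> s) \<and> v = F' 1"
  then obtain \<sigma>' F' where F': "\<sigma>' < 1" "F' holomorphic_on {s. Re s > \<sigma>'}" "\<forall>s. Re s > 1 \<longrightarrow> F' s = niebur_series G n \<tau> s" "v = F' 1"
    by blast
  let ?m = "max \<sigma> \<sigma>'"
  have "F' 1 = F 1"
  proof (rule analytic_continuation_open[of "{s. Re s > 1}" "{s. Re s > ?m}" F' F 1])
    show "{s. Re s > 1} \<noteq> {}" by (auto intro!: exI[of _ 2])
    show "open {s. Re s > ?m}" by (rule open_halfspace_Re_gt)
    show "connected {s. Re s > ?m}" by (intro convex_connected convex_halfspace_Re_gt)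
    show "F' holomorphic_on {s. Re s > ?m}" "F holomorphic_on {s. Re s > ?m}"
      using F'(2) assms(2) by (auto elim!: holomorphic_on_subset)
  qed (use assms F' in \<open>auto simp: open_halfspace_Re_gt\<close>)
  then show "v = F 1" using F'(4) by simp
qed

lemma niebur_seed_one_powi:
  assumes n: "n > 0" and \<tau>: "Im \<tau> > 0"
  shows "2 * of_real pi * niebur_seed n 1 \<tau> = unit_exp \<tau> powi (- int n) - cnj (unit_exp \<tau>) ^ n"
proof -
  have a: "unit_exp (- (of_nat n * \<tau>)) = unit_exp \<tau> powi (- int n)"
    by (simp add: unit_exp_minus unit_exp_of_nat_mult power_int_minus power_inverse)
  have "unit_exp (- (of_nat n * cnj \<tau>)) = cnj (unit_exp (of_nat n * \<tau>))" by (simp add: cnj_unit_exp)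
  then have b: "unit_exp (- (of_nat n * cnj \<tau>)) = cnj (unit_exp \<tau>) ^ n" by (simp add: unit_exp_of_nat_mult)
  show ?thesis unfolding niebur_seed_one[OF n \<tau>] a b ..
qed

text \<open>The continuation itself is exported along with its value, since the Hecke identity is
  first proved for \<open>Re s > 1\<close> and then transported along these functions.\<close>

lemma niebur_j_main:
  assumes cl: "al_closed N S" and n: "n > 0" and \<tau>: "Im \<tau> > 0"
  obtains F where "F holomorphic_on {s. Re s > 9 / 10}"
    "\<And>s. Re s > 1 \<Longrightarrow> F s = niebur_series (N, S) n \<tau> s"
    "niebur_j (N, S) n \<tau> = F 1"
    "F 1 = unit_exp \<tau> powi (- int n) - cnj (unit_exp \<tau>) ^ n +
      (\<Sum>Q\<in>insert 1 S. 2 * of_real pi * (\<Sum>\<^sub>\<infinity>c\<in>crow N Q. \<Sum>\<^sub>\<infinity>d\<in>{d. coprime c d}. row_term (int Q) n \<tau> 1 c d))"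
proof -
  have pos: "Q > 0" if "Q \<in> insert 1 S" for Q
    using that cl by (auto simp: al_closed_def)
  have "\<exists>F. F holomorphic_on {s. Re s > 9 / 10} \<and> (\<forall>s. Re s > 1 \<longrightarrow> F s = row_series N Q n \<tau> s) \<and>
      F 1 = (\<Sum>\<^sub>\<infinity>c\<in>crow N Q. \<Sum>\<^sub>\<infinity>d\<in>{d. coprime c d}. row_term (int Q) n \<tau> 1 c d)" if Q: "Q \<in> insert 1 S" for Q
  proof -
    have Q0: "int Q > 0" using pos[OF Q] by simp
    have C: "c > 0 \<and> coprime c (int Q)" if "c \<in> crow N Q" for c using that by (simp add: crow_def)
    obtain F where F: "F holomorphic_on {s. Re s > 9 / 10}"
      "\<And>s. Re s > 1 \<Longrightarrow> ((\<lambda>(c, d). row_term (int Q) n \<tau> s c d) has_sum F s) (Sigma (crow N Q) (\<lambda>c. {d. coprime c d}))"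
      "((\<lambda>c. \<Sum>\<^sub>\<infinity>d\<in>{d. coprime c d}. row_term (int Q) n \<tau> 1 c d) has_sum F 1) (crow N Q)"
      by (rule row_series_continuation[OF \<tau> n Q0 C]) (assumption, rule that)
    have "F s = row_series N Q n \<tau> s" if "Re s > 1" for s
      using has_sum_unique[OF F(2)[OF that] row_series_has_sum[OF \<tau> n pos[OF Q] that]] .
    moreover have "F 1 = (\<Sum>\<^sub>\<infinity>c\<in>crow N Q. \<Sum>\<^sub>\<infinity>d\<in>{d. coprime c d}. row_term (int Q) n \<tau> 1 c d)"
      using F(3) by (simp add: infsumI)
    ultimately show ?thesis using F(1) by (intro exI[of _ F]) simp
  qed
  then have "\<forall>Q\<in>insert 1 S. \<exists>F. F holomorphic_on {s. Re s > 9 / 10} \<and> (\<forall>s. Re s > 1 \<longrightarrow> F s = row_series N Q n \<tau> s) \<and>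
      F 1 = (\<Sum>\<^sub>\<infinity>c\<in>crow N Q. \<Sum>\<^sub>\<infinity>d\<in>{d. coprime c d}. row_term (int Q) n \<tau> 1 c d)" by (rule ballI)
  from bchoice[OF this] obtain f where f: "\<forall>Q\<in>insert 1 S. f Q holomorphic_on {s. Re s > 9 / 10} \<and> (\<forall>s. Re s > 1 \<longrightarrow> f Q s = row_series N Q n \<tau> s) \<and>
      f Q 1 = (\<Sum>\<^sub>\<infinity>c\<in>crow N Q. \<Sum>\<^sub>\<infinity>d\<in>{d. coprime c d}. row_term (int Q) n \<tau> 1 c d)" ..
  define F where "F s = 2 * of_real pi * (niebur_seed n s \<tau> + (\<Sum>Q\<in>insert 1 S. f Q s))" for s
  have "(\<lambda>s. niebur_seed n s \<tau>) holomorphic_on {s. Re s > 9 / 10}"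
    by (rule holomorphic_on_subset[OF niebur_seed_holomorphic[OF n \<tau>]]) auto
  then have 1: "F holomorphic_on {s. Re s > 9 / 10}"
    unfolding F_def using f by (intro holomorphic_intros) auto
  have 2: "F s = niebur_series (N, S) n \<tau> s" if "Re s > 1" for s
  proof -
    have "(\<Sum>Q\<in>insert 1 S. f Q s) = (\<Sum>Q\<in>insert 1 S. row_series N Q n \<tau> s)"
      by (rule sum.cong[OF refl]) (use f that in auto)
    then show ?thesis unfolding F_def niebur_series_eq[OF cl n \<tau> that] by simp
  qed
  have 3: "niebur_j (N, S) n \<tau> = F 1" by (rule niebur_j_eqI[OF _ 1 2]) simp
  have "F 1 = 2 * of_real pi * niebur_seed n 1 \<tau> + (\<Sum>Q\<in>insert 1 S. 2 * of_real pi * f Q 1)"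
    unfolding F_def distrib_left sum_distrib_left ..
  also have "2 * of_real pi * niebur_seed n 1 \<tau> = unit_exp \<tau> powi (- int n) - cnj (unit_exp \<tau>) ^ n"
    by (rule niebur_seed_one_powi[OF n \<tau>])
  also have "(\<Sum>Q\<in>insert 1 S. 2 * of_real pi * f Q 1) =
    (\<Sum>Q\<in>insert 1 S. 2 * of_real pi * (\<Sum>\<^sub>\<infinity>c\<in>crow N Q. \<Sum>\<^sub>\<infinity>d\<in>{d. coprime c d}. row_term (int Q) n \<tau> 1 c d))"
    by (rule sum.cong[OF refl]) (use f in auto)
  finally show ?thesis using that[OF 1 2 3] by blast
qed

text \<open>Existence of the coefficients comes from \<open>series_fourier\<close> for each coset,
  their uniqueness from \<open>fourier_tail_unique\<close>; together they resolve the definite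
  description in \<open>niebur_coeff\<close>.\<close>

lemma niebur_fourier:
  assumes cl: "al_closed N S" and n: "n > 0"
  shows "Im \<tau> > 0 \<Longrightarrow> fourier_tail (niebur_coeff (N, S) n) \<tau> sums
    (niebur_j (N, S) n \<tau> - (unit_exp \<tau> powi (- int n) - cnj (unit_exp \<tau>) ^ n) - niebur_coeff (N, S) n 0)"
proof -
  let ?R = "\<lambda>\<tau>. niebur_j (N, S) n \<tau> - (unit_exp \<tau> powi (- int n) - cnj (unit_exp \<tau>) ^ n)"
  have "\<exists>b. \<forall>\<tau>. Im \<tau> > 0 \<longrightarrow> fourier_tail b \<tau> sums
      (2 * of_real pi * (\<Sum>\<^sub>\<infinity>c\<in>crow N Q. \<Sum>\<^sub>\<infinity>d\<in>{d. coprime c d}. row_term (int Q) n \<tau> 1 c d) - b 0)" if Q: "Q \<in> insert 1 S" for Q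
  proof -
    have Q0: "int Q > 0" using Q cl by (auto simp: al_closed_def)
    have C: "c > 0 \<and> coprime c (int Q)" if "c \<in> crow N Q" for c using that by (simp add: crow_def)
    obtain b where "\<And>\<tau>. Im \<tau> > 0 \<Longrightarrow>
    (\<lambda>l. b (int (Suc l)) * unit_exp \<tau> ^ Suc l + b (- int (Suc l)) * cnj (unit_exp \<tau>) ^ Suc l) sums
      (2 * of_real pi * (\<Sum>\<^sub>\<infinity>c\<in>crow N Q. \<Sum>\<^sub>\<infinity>d\<in>{d. coprime c d}. row_term (int Q) n \<tau> 1 c d) - b 0)"
      by (rule series_fourier[OF n Q0 C]) (assumption, rule that)
    then show ?thesis unfolding fourier_tail_def by blast
  qed
  then have "\<forall>Q\<in>insert 1 S. \<exists>b. \<forall>\<tau>. Im \<tau> > 0 \<longrightarrow> fourier_tail b \<tau> sums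
      (2 * of_real pi * (\<Sum>\<^sub>\<infinity>c\<in>crow N Q. \<Sum>\<^sub>\<infinity>d\<in>{d. coprime c d}. row_term (int Q) n \<tau> 1 c d) - b 0)" by (rule ballI)
  from bchoice[OF this] obtain b where b: "\<forall>Q\<in>insert 1 S. \<forall>\<tau>. Im \<tau> > 0 \<longrightarrow> fourier_tail (b Q) \<tau> sums
      (2 * of_real pi * (\<Sum>\<^sub>\<infinity>c\<in>crow N Q. \<Sum>\<^sub>\<infinity>d\<in>{d. coprime c d}. row_term (int Q) n \<tau> 1 c d) - b Q 0)" ..
  define c where "c l = (\<Sum>Q\<in>insert 1 S. b Q l)" for l
  have ex: "fourier_tail c \<tau> sums (?R \<tau> - c 0)" if \<tau>: "Im \<tau> > 0" for \<tau>
  proof -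
    have "(\<lambda>l. \<Sum>Q\<in>insert 1 S. fourier_tail (b Q) \<tau> l) sums
      (\<Sum>Q\<in>insert 1 S. 2 * of_real pi * (\<Sum>\<^sub>\<infinity>c\<in>crow N Q. \<Sum>\<^sub>\<infinity>d\<in>{d. coprime c d}. row_term (int Q) n \<tau> 1 c d) - b Q 0)"
      by (rule sums_sum) (use b \<tau> in auto)
    also have "(\<lambda>l. \<Sum>Q\<in>insert 1 S. fourier_tail (b Q) \<tau> l) = fourier_tail c \<tau>"
      by (rule ext) (simp only: fourier_tail_def c_def sum.distrib sum_distrib_right)
    also have "(\<Sum>Q\<in>insert 1 S. 2 * of_real pi * (\<Sum>\<^sub>\<infinity>c\<in>crow N Q. \<Sum>\<^sub>\<infinity>d\<in>{d. coprime c d}. row_term (int Q) n \<tau> 1 c d) - b Q 0) = ?R \<tau> - c 0"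
    proof -
      have "?R \<tau> = (\<Sum>Q\<in>insert 1 S. 2 * of_real pi * (\<Sum>\<^sub>\<infinity>c\<in>crow N Q. \<Sum>\<^sub>\<infinity>d\<in>{d. coprime c d}. row_term (int Q) n \<tau> 1 c d))"
        by (rule niebur_j_main[OF cl n \<tau>]) simp
      then show ?thesis by (simp only: sum_subtractf c_def)
    qed
    finally show ?thesis .
  qed
  have P: "(\<forall>\<tau>. Im \<tau> > 0 \<longrightarrow>
        (let q = unit_exp \<tau> in
         (\<lambda>l. c (int (Suc l)) * q ^ Suc l + c (- int (Suc l)) * cnj q ^ Suc l) sums
           (niebur_j (N, S) n \<tau> - (q powi (- int n) - cnj q ^ n + c 0)))) \<longleftrightarrow>
      (\<forall>\<tau>. Im \<tau> > 0 \<longrightarrow> fourier_tail c \<tau> sums (?R \<tau> - c 0))" for c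
    unfolding Let_def fourier_tail_def diff_diff_eq ..
  have "niebur_coeff (N, S) n = c"
    unfolding niebur_coeff_def P
  proof (rule the_equality)
    show "\<forall>\<tau>. Im \<tau> > 0 \<longrightarrow> fourier_tail c \<tau> sums (?R \<tau> - c 0)" using ex by blast
    show "c' = c" if "\<forall>\<tau>. Im \<tau> > 0 \<longrightarrow> fourier_tail c' \<tau> sums (?R \<tau> - c' 0)" for c'
      by (rule fourier_tail_unique[of c' ?R c]) (use that ex in auto)
  qed
  then show "Im \<tau> > 0 \<Longrightarrow> fourier_tail (niebur_coeff (N, S) n) \<tau> sums (?R \<tau> - niebur_coeff (N, S) n 0)"
    using ex by simp
qed

text \<open>The normalisation removes the constant term, so what remains beside the seed part is a
  tail without constant term.\<close>

lemma niebur_J_limit: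
  assumes cl: "al_closed N S" and n: "n > 0"
  shows "((\<lambda>y. niebur_J (N, S) n (Complex x y) -
    (unit_exp (Complex x y) powi (- int n) - cnj (unit_exp (Complex x y)) ^ n)) \<longlongrightarrow> 0) at_top"
proof -
  have "fourier_tail (niebur_coeff (N, S) n) \<tau> sums
    (niebur_J (N, S) n \<tau> - (unit_exp \<tau> powi (- int n) - cnj (unit_exp \<tau>) ^ n))" if "Im \<tau> > 0" for \<tau>
    using niebur_fourier[OF cl n that] n by (simp add: niebur_J_def algebra_simps)
  from fourier_tail_limit[OF this] show ?thesis .
qed

section \<open>The Hecke identity\<close>

definition top_residues :: "int \<Rightarrow> int \<Rightarrow> int \<Rightarrow> int \<Rightarrow> int set" where
  "top_residues Q m C D = {A \<in> {0..<C}. C dvd Q * A * D - m}"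

text \<open>If \<open>C\<close> and \<open>D\<close> are coprime, the congruence has exactly one
  solution \<open>A\<close>. Otherwise a solution can exist only if \<open>gcd C D\<close> divides
  \<open>p^k\<close>, so \<open>p\<close> divides both; then shifting \<open>A\<close> by
  \<open>C / p\<close> permutes the solutions and multiplies the sum by \<open>e(- n / p)\<close>.
  This differs from 1 because \<open>p\<close> does not divide \<open>n\<close>.\<close>

lemma sum_top_residues:
  fixes p n k :: nat and Q C D :: int
  assumes p: "prime p" and n: "\<not> p dvd n" and C: "C > 0" and CQ: "coprime C Q"
  shows "(\<Sum>A\<in>top_residues Q (int (p ^ k)) C D. ek C (- (int n * A))) =
    (if coprime C D then phase Q (n * p ^ k) C D else 0)"
proof (cases "coprime C D")
  case True
  define x where "x = minv C (Q * D)"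
  have "coprime (Q * D) C" using True CQ by (simp add: coprime_commute)
  then have x: "[Q * D * x = 1] (mod C)" unfolding x_def by (rule minv_cong)
  define A0 where "A0 = (int (p ^ k) * x) mod C"
  have "top_residues Q (int (p ^ k)) C D = {A0}"
  proof (intro subset_antisym subsetI)
    fix A assume "A \<in> top_residues Q (int (p ^ k)) C D"
    then have A: "0 \<le> A" "A < C" "C dvd Q * A * D - int (p ^ k)" by (auto simp: top_residues_def)
    have "[Q * A * D = int (p ^ k)] (mod C)" using A(3) by (simp add: cong_iff_dvd_diff)
    then have "[x * (Q * A * D) = x * int (p ^ k)] (mod C)" by (rule cong_scalar_left)
    moreover have "[(Q * D * x) * A = 1 * A] (mod C)" by (rule cong_scalar_right[OF x])
    moreover have "x * (Q * A * D) = (Q * D * x) * A" by (simp add: mult_ac)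
    ultimately have "[A = x * int (p ^ k)] (mod C)" by (metis cong_sym cong_trans mult_1)
    then show "A \<in> {A0}" using A by (simp add: A0_def cong_def mult.commute)
  next
    fix A assume "A \<in> {A0}"
    then have A: "A = A0" by simp
    have "[A0 = int (p ^ k) * x] (mod C)" by (simp add: A0_def)
    then have "[Q * D * A0 = Q * D * (int (p ^ k) * x)] (mod C)" by (rule cong_scalar_left)
    moreover have "[(Q * D * x) * int (p ^ k) = 1 * int (p ^ k)] (mod C)" by (rule cong_scalar_right[OF x])
    moreover have "Q * D * (int (p ^ k) * x) = (Q * D * x) * int (p ^ k)" by (simp add: mult_ac)
    ultimately have "[Q * D * A0 = int (p ^ k)] (mod C)" by (metis cong_trans mult_1)
    then show "A \<in> top_residues Q (int (p ^ k)) C D"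
      using C by (simp add: top_residues_def A A0_def cong_iff_dvd_diff mult_ac)
  qed
  moreover have "ek C (- (int n * A0)) = phase Q (n * p ^ k) C D"
  proof -
    have "[A0 = int (p ^ k) * x] (mod C)" by (simp add: A0_def)
    then have "[- (int n * A0) = - (int n * (int (p ^ k) * x))] (mod C)"
      by (simp add: cong_minus_minus_iff cong_scalar_left)
    then have "ek C (- (int n * A0)) = ek C (- (int n * (int (p ^ k) * x)))"
      by (rule ek_cong) (use C in auto)
    then show ?thesis by (simp add: phase_def x_def mult.assoc)
  qed
  ultimately show ?thesis using True by simp
next
  case False
  let ?T = "top_residues Q (int (p ^ k)) C D"
  let ?S = "\<Sum>A\<in>?T. ek C (- (int n * A))"
  have "?S = 0"
  proof (cases "?T = {}")
    case False
    then obtain A1 where A1: "C dvd Q * A1 * D - int (p ^ k)" by (auto simp: top_residues_def)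
    define g where "g = gcd C D"
    have "g dvd Q * A1 * D - (Q * A1 * D - int (p ^ k))"
      by (intro dvd_diff dvd_trans[OF _ A1] dvd_mult) (auto simp: g_def)
    then have "g dvd int (p ^ k)" by simp
    then have "nat g dvd p ^ k" by (metis abs_of_nonneg g_def gcd_ge_0_int int_dvd_int_iff nat_0_le)
    then obtain j where j: "nat g = p ^ j" using p by (auto simp: divides_primepow_nat)
    have "g \<noteq> 1" using \<open>\<not> coprime C D\<close> by (simp add: g_def coprime_iff_gcd_eq_1)
    then have "j \<noteq> 0" using j by (intro notI) (simp add: g_def nat_eq_iff)
    then have "p dvd nat g" using j by simp
    then have pg: "int p dvd g" by (metis g_def gcd_ge_0_int int_dvd_int_iff nat_0_le)
    then have pC: "int p dvd C" and pD: "int p dvd D" by (auto simp: g_def)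
    obtain C1 where C1: "C = int p * C1" using pC by auto
    obtain D1 where D1: "D = int p * D1" using pD by auto
    define h where "h A = (A + C1) mod C" for A
    have "bij_betw h ?T ?T"
    proof -
      have "inj_on h ?T"
      proof (rule inj_onI)
        fix A B assume AB: "A \<in> ?T" "B \<in> ?T" "h A = h B"
        then have "[A + C1 = B + C1] (mod C)" by (simp add: h_def cong_def)
        then have "[A = B] (mod C)" by (simp only: cong_add_rcancel)
        then show "A = B" using AB by (simp add: top_residues_def cong_def)
      qed
      moreover have "h ` ?T \<subseteq> ?T"
      proof (rule image_subsetI)
        fix A assume A: "A \<in> ?T"
        have "[h A = A + C1] (mod C)" by (simp add: h_def)
        then have "[Q * h A * D = Q * (A + C1) * D] (mod C)" by (intro cong_mult cong_refl)
        then have "[Q * h A * D - int (p ^ k) = Q * (A + C1) * D - int (p ^ k)] (mod C)" by (rule cong_diff) simp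
        moreover have "Q * (A + C1) * D - int (p ^ k) = (Q * A * D - int (p ^ k)) + C * (Q * D1)"
          by (simp add: C1 D1 algebra_simps)
        moreover have "C dvd (Q * A * D - int (p ^ k)) + C * (Q * D1)" using A by (simp add: top_residues_def)
        ultimately have "C dvd Q * h A * D - int (p ^ k)" by (metis cong_dvd_iff)
        then show "h A \<in> ?T" using C by (simp add: top_residues_def h_def)
      qed
      moreover have "finite ?T" by (rule finite_subset[of _ "{0..<C}"]) (auto simp: top_residues_def)
      ultimately show ?thesis by (simp add: bij_betw_def endo_inj_surj)
    qed
    then have "?S = (\<Sum>A\<in>?T. ek C (- (int n * h A)))" by (rule sum.reindex_bij_betw[symmetric])
    also have "\<dots> = (\<Sum>A\<in>?T. ek C (- (int n * C1)) * ek C (- (int n * A)))"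
    proof (rule sum.cong[OF refl])
      fix A
      have "[h A = A + C1] (mod C)" by (simp add: h_def)
      then have "[- (int n * h A) = - (int n * (A + C1))] (mod C)"
        by (simp add: cong_minus_minus_iff cong_scalar_left)
      then have "ek C (- (int n * h A)) = ek C (- (int n * (A + C1)))" by (rule ek_cong) (use C in auto)
      also have "- (int n * (A + C1)) = - (int n * C1) + - (int n * A)" by (simp add: algebra_simps)
      finally show "ek C (- (int n * h A)) = ek C (- (int n * C1)) * ek C (- (int n * A))" by (simp only: ek_add)
    qed
    also have "\<dots> = ek C (- (int n * C1)) * ?S" by (simp add: sum_distrib_left)
    finally have "(1 - ek C (- (int n * C1))) * ?S = 0" by (simp add: algebra_simps)
    moreover have "ek C (- (int n * C1)) \<noteq> 1"
    proof
      assume "ek C (- (int n * C1)) = 1"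
      then have "C dvd - (int n * C1)" using C by (simp only: ek_eq_1_iff)
      then have "C1 * int p dvd C1 * int n" by (simp add: C1 mult.commute)
      moreover have "C1 \<noteq> 0" using C C1 by auto
      ultimately have "int p dvd int n" by (simp only: dvd_mult_cancel_left) simp
      then show False using n by simp
    qed
    ultimately show ?thesis by simp
  qed simp
  then show ?thesis using False by simp
qed

text \<open>The pairs \<open>(i, b)\<close> for which \<open>(C, D) = (p\<^sup>i c, c b + d p\<^bsup>k-i\<^esup>)\<close> with coprime integers \<open>c, d\<close>:
  the seed at the image of \<open>(p\<^sup>i \<tau> + b) / p\<^bsup>k-i\<^esup>\<close> under the row \<open>(c, d)\<close> then depends on \<open>(C, D)\<close> only,
  apart from its phase.\<close>

definition hecke_fiber :: "nat \<Rightarrow> nat \<Rightarrow> int \<Rightarrow> int \<Rightarrow> (nat \<times> nat) set" where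
  "hecke_fiber p k C D = {(i, b). i \<le> k \<and> b < p ^ (k - i) \<and> int (p ^ i) dvd C \<and>
     int (p ^ (k - i)) dvd D - C div int (p ^ i) * int b \<and>
     coprime (C div int (p ^ i)) ((D - C div int (p ^ i) * int b) div int (p ^ (k - i)))}"

lemma minv_range: "c > 0 \<Longrightarrow> 0 \<le> minv c a \<and> minv c a < c"
  by (simp add: modular_inverse_int_nonneg modular_inverse_int_less)

text \<open>From \<open>A = p^i x\<close>, the factor \<open>p^i\<close> is recovered as
  \<open>gcd A C\<close>; then \<open>x\<close>, the inverse of \<open>Q d\<close> modulo
  \<open>c\<close>, determines \<open>d\<close> modulo \<open>c\<close>. Changing \<open>d\<close>
  by \<open>c t\<close> changes \<open>b\<close> by a multiple of \<open>p^(k - i)\<close>, so the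
  range of \<open>b\<close> fixes it.\<close>

lemma hecke_fiber_bij:
  fixes p k :: nat and Q C D :: int
  assumes p: "prime p" and C: "C > 0" and CQ: "coprime C Q"
  defines "h \<equiv> \<lambda>(i, b). int (p ^ i) * minv (C div int (p ^ i))
     (Q * ((D - C div int (p ^ i) * int b) div int (p ^ (k - i))))"
  shows "bij_betw h (hecke_fiber p k C D) (top_residues Q (int (p ^ k)) C D)"
proof -
  have pp: "int (p ^ j) > 0" for j using p by (simp add: prime_gt_0_nat)
  have data: "\<exists>c d x y. C = int (p ^ i) * c \<and> c > 0 \<and> D = c * int b + d * int (p ^ (k - i)) \<and> coprime c d \<and>
      x = minv c (Q * d) \<and> Q * d * x = 1 + c * y \<and> 0 \<le> x \<and> x < c \<and> h (i, b) = int (p ^ i) * x"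
    if "(i, b) \<in> hecke_fiber p k C D" for i b
  proof -
    define c where "c = C div int (p ^ i)"
    define d where "d = (D - c * int b) div int (p ^ (k - i))"
    have *: "int (p ^ i) dvd C" "int (p ^ (k - i)) dvd D - c * int b" "coprime c d"
      using that by (auto simp: hecke_fiber_def c_def d_def)
    have c: "C = int (p ^ i) * c" using *(1) by (simp add: c_def)
    have c0: "c > 0" using C pp[of i] unfolding c by (simp add: zero_less_mult_iff)
    have d: "D = c * int b + d * int (p ^ (k - i))" using *(2) by (simp add: d_def)
    have "coprime c Q" using CQ c by simp
    then have "coprime (Q * d) c" using *(3) by (simp add: coprime_commute)
    then have "[Q * d * minv c (Q * d) = 1] (mod c)" by (rule minv_cong)
    then have "c dvd Q * d * minv c (Q * d) - 1" by (simp add: cong_iff_dvd_diff)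
    then obtain y where "Q * d * minv c (Q * d) - 1 = c * y" by auto
    then have y: "Q * d * minv c (Q * d) = 1 + c * y" by simp
    have "h (i, b) = int (p ^ i) * minv c (Q * d)" by (simp add: h_def c_def d_def)
    then show ?thesis using c c0 d *(3) y minv_range[OF c0, of "Q * d"] by blast
  qed
  have gcdA: "gcd (int (p ^ i) * x) (int (p ^ i) * c) = int (p ^ i)" if "Q * d * x = 1 + c * y" for i x c d y
  proof -
    have "coprime x c"
    proof (rule coprimeI)
      fix q assume "q dvd x" "q dvd c"
      then have "q dvd Q * d * x - c * y" by simp
      then show "is_unit q" using that by simp
    qed
    then show ?thesis by (simp add: gcd_mult_left)
  qed
  show ?thesis
    unfolding bij_betw_def
  proof
    show "inj_on h (hecke_fiber p k C D)"
    proof (rule inj_onI, clarify)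
      fix i b i' b' assume ib: "(i, b) \<in> hecke_fiber p k C D" "(i', b') \<in> hecke_fiber p k C D" and eq: "h (i, b) = h (i', b')"
      obtain c d x y where 1: "C = int (p ^ i) * c" "c > 0" "D = c * int b + d * int (p ^ (k - i))" "coprime c d"
        "x = minv c (Q * d)" "Q * d * x = 1 + c * y" "h (i, b) = int (p ^ i) * x" using data[OF ib(1)] by blast
      obtain c' d' x' y' where 2: "C = int (p ^ i') * c'" "c' > 0" "D = c' * int b' + d' * int (p ^ (k - i'))" "coprime c' d'"
        "x' = minv c' (Q * d')" "Q * d' * x' = 1 + c' * y'" "h (i', b') = int (p ^ i') * x'" using data[OF ib(2)] by blast
      have "int (p ^ i) = gcd (h (i, b)) C" unfolding 1(7) by (subst 1(1)) (rule gcdA[OF 1(6), symmetric])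
      also have "\<dots> = int (p ^ i')" unfolding eq 2(7) by (subst 2(1)) (rule gcdA[OF 2(6)])
      finally have "p ^ i = p ^ i'" by (simp only: of_nat_eq_iff)
      then have i: "i' = i" using power_inject_exp[OF prime_gt_1_nat[OF p]] by metis
      have c: "c' = c" using 1(1) 2(1) prime_gt_0_nat[OF p] unfolding i by simp
      have x: "x' = x" using eq 1(7) 2(7) prime_gt_0_nat[OF p] unfolding i by simp
      have "coprime c (Q * x)"
      proof (rule coprimeI)
        fix q assume "q dvd c" "q dvd Q * x"
        then have "q dvd d * (Q * x) - c * y" by simp
        then show "is_unit q" using 1(6) by (simp add: mult_ac)
      qed
      moreover have "c dvd (d - d') * (Q * x)"
      proof -
        have "(d - d') * (Q * x) = c * (y - y')" using 1(6) 2(6) unfolding c x by (simp add: algebra_simps)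
        then show ?thesis by simp
      qed
      ultimately have "c dvd d - d'" by (simp add: coprime_dvd_mult_left_iff)
      then obtain t where t: "d - d' = c * t" by auto
      let ?P = "int (p ^ (k - i))"
      have "c * (int b - int b') = - (d - d') * ?P" using 1(3) 2(3) unfolding c i by (simp add: algebra_simps)
      also have "\<dots> = c * (- t * ?P)" unfolding t by simp
      finally have "int b - int b' = - t * ?P" using 1(2) by (metis mult_cancel_left less_irrefl)
      then have "[int b = int b'] (mod ?P)" by (simp add: cong_iff_dvd_diff)
      moreover have "int b < ?P" "int b' < ?P"
        using ib unfolding i by (auto simp: hecke_fiber_def simp flip: of_nat_power)
      ultimately have "b = b'" by (simp add: cong_def)
      then show "i = i' \<and> b = b'" using i by simp
    qed
    show "h ` hecke_fiber p k C D = top_residues Q (int (p ^ k)) C D"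
    proof (intro subset_antisym subsetI)
      fix A assume "A \<in> h ` hecke_fiber p k C D"
      then obtain i b where ib: "(i, b) \<in> hecke_fiber p k C D" "A = h (i, b)" by auto
      obtain c d x y where 1: "C = int (p ^ i) * c" "c > 0" "D = c * int b + d * int (p ^ (k - i))"
        "Q * d * x = 1 + c * y" "0 \<le> x" "x < c" "h (i, b) = int (p ^ i) * x" using data[OF ib(1)] by blast
      have "i \<le> k" using ib(1) by (simp add: hecke_fiber_def)
      then have pk: "int (p ^ k) = int (p ^ i) * int (p ^ (k - i))" by (simp flip: power_add)
      have A: "A = int (p ^ i) * x" using ib 1 by simp
      have "Q * A * D - int (p ^ k) = C * (Q * x * int b) + int (p ^ i) * int (p ^ (k - i)) * (Q * d * x - 1)"
        unfolding A 1(3) pk by (subst 1(1)) (simp add: algebra_simps)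
      also have "\<dots> = C * (Q * x * int b) + C * (int (p ^ (k - i)) * y)"
        unfolding 1(4) by (subst (2) 1(1)) (simp add: algebra_simps)
      finally have "C dvd Q * A * D - int (p ^ k)" by simp
      moreover have "0 \<le> A" "A < C" unfolding A using 1(5,6) pp[of i] by (auto simp: 1(1))
      ultimately show "A \<in> top_residues Q (int (p ^ k)) C D" by (simp add: top_residues_def)
    next
      fix A assume "A \<in> top_residues Q (int (p ^ k)) C D"
      then have A: "0 \<le> A" "A < C" "C dvd Q * A * D - int (p ^ k)" by (auto simp: top_residues_def)
      define g where "g = gcd A C"
      have g0: "g > 0" using C by (simp add: g_def)
      have "g dvd Q * A * D - (Q * A * D - int (p ^ k))"
        by (intro dvd_diff dvd_trans[OF _ A(3)] dvd_mult dvd_mult2) (auto simp: g_def)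
      then have "g dvd int (p ^ k)" by simp
      then have "nat g dvd p ^ k" using g0 by (metis int_dvd_int_iff nat_0_le order_less_imp_le)
      then obtain i where i: "i \<le> k" "nat g = p ^ i" using p by (auto simp: divides_primepow_nat)
      then have g: "g = int (p ^ i)" using g0 by (metis nat_0_le order_less_imp_le)
      define x where "x = A div g"
      define c where "c = C div g"
      have Ax: "A = int (p ^ i) * x" and Cc: "C = int (p ^ i) * c" unfolding x_def c_def g[symmetric] by (auto simp: g_def)
      have cx: "coprime x c" unfolding x_def c_def g_def by (rule div_gcd_coprime) (use C in auto)
      have c0: "c > 0" using C pp[of i] unfolding Cc by (simp add: zero_less_mult_iff)
      have x0: "0 \<le> x" "x < c"
        using A(1,2) pp[of i] unfolding Ax Cc by (metis linorder_not_less mult_pos_neg, metis mult_less_cancel_left_pos)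
      let ?P = "int (p ^ (k - i))"
      have pk: "int (p ^ k) = int (p ^ i) * ?P" using i(1) by (simp flip: power_add)
      obtain B where B: "Q * A * D - int (p ^ k) = C * B" using A(3) by auto
      have "int (p ^ i) * (Q * x * D - ?P) = int (p ^ i) * (c * B)"
        using B unfolding Ax Cc pk by (simp add: algebra_simps)
      then have B': "Q * x * D - ?P = c * B" using pp[of i] by (metis mult_cancel_left less_irrefl)
      have "coprime c Q" using CQ Cc by simp
      then have Qxc: "coprime (Q * x) c" using cx by (simp add: coprime_commute)
      define d0 where "d0 = minv c (Q * x)"
      have "c dvd Q * x * d0 - 1" using minv_cong[OF Qxc] by (simp add: d0_def cong_iff_dvd_diff)
      then obtain y where y: "Q * x * d0 - 1 = c * y" by auto
      \<comment> \<open>Multiplying \<open>Q x D - p^(k - i) = c B\<close> by \<open>d0\<close> and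
        using \<open>Q x d0 = 1 + c y\<close> gives
        \<open>D - d0 p^(k - i) = c (d0 B - y D)\<close>.\<close>
      define b0 where "b0 = d0 * B - y * D"
      have b0: "c * b0 = D - d0 * ?P"
      proof -
        have "c * b0 = d0 * (c * B) - (c * y) * D" by (simp add: b0_def algebra_simps)
        also have "\<dots> = D - d0 * ?P" unfolding B'[symmetric] y[symmetric] by (simp add: algebra_simps)
        finally show ?thesis .
      qed
      define b where "b = nat (b0 mod ?P)"
      have bb: "int b = b0 mod ?P" using pp[of "k - i"] by (simp add: b_def)
      \<comment> \<open>Reducing \<open>b0\<close> to its residue moves the quotient into
        \<open>d\<close>: this preserves \<open>D\<close> and changes \<open>d\<close> only by a
        multiple of \<open>c\<close>.\<close>
      define d where "d = d0 + c * (b0 div ?P)"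
      have D: "D - c * int b = d * ?P"
      proof -
        have "b0 = ?P * (b0 div ?P) + int b" unfolding bb by simp
        then have "c * b0 = c * (?P * (b0 div ?P)) + c * int b" by (metis distrib_left)
        then show ?thesis using b0 by (simp add: d_def algebra_simps)
      qed
      have inv: "[Q * d * x = 1] (mod c)"
      proof -
        have "Q * d * x - 1 = c * (y + Q * x * (b0 div ?P))" using y by (simp add: d_def algebra_simps)
        then show ?thesis by (simp add: cong_iff_dvd_diff)
      qed
      have cd: "coprime c d"
      proof (rule coprimeI)
        fix q assume q: "q dvd c" "q dvd d"
        have 1: "q dvd Q * d * x - 1" using inv q(1) by (meson cong_iff_dvd_diff dvd_trans)
        have "q dvd Q * d * x - (Q * d * x - 1)" by (rule dvd_diff[OF _ 1]) (use q(2) in simp)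
        then show "is_unit q" by simp
      qed
      have "[minv c (Q * d) = x] (mod c)" by (rule cong_minv_unique[OF inv])
      then have mx: "minv c (Q * d) = x" using minv_range[OF c0, of "Q * d"] x0 by (simp add: cong_def)
      have cdiv: "C div int (p ^ i) = c" using pp[of i] by (metis Cc less_irrefl nonzero_mult_div_cancel_left)
      have ddiv: "(D - c * int b) div ?P = d" unfolding D using pp[of "k - i"] by (metis less_irrefl nonzero_mult_div_cancel_right)
      have "b < p ^ (k - i)"
      proof -
        have "int b < int (p ^ (k - i))" unfolding bb using pp[of "k - i"] by (rule pos_mod_bound)
        then show ?thesis by (simp only: of_nat_less_iff)
      qed
      then have "(i, b) \<in> hecke_fiber p k C D"
        unfolding hecke_fiber_def using i(1) D cd prime_gt_0_nat[OF p] cdiv ddiv by (auto simp: Cc)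
      moreover have "h (i, b) = A" unfolding h_def prod.case cdiv ddiv mx Ax ..
      ultimately show "A \<in> h ` hecke_fiber p k C D" by force
    qed
  qed
qed

text \<open>The phase of the row \<open>(c, d)\<close> is
  \<open>e(- n x / c) = e(- n p^i x / C)\<close>, so all phases of a fibre are values of one
  character modulo \<open>C\<close> and \<open>sum_top_residues\<close> applies.\<close>

lemma hecke_fiber_sum:
  fixes p n k :: nat and Q C D :: int
  assumes p: "prime p" and n: "\<not> p dvd n" and C: "C > 0" and CQ: "coprime C Q"
  shows "(\<Sum>(i, b)\<in>hecke_fiber p k C D. phase Q n (C div int (p ^ i)) ((D - C div int (p ^ i) * int b) div int (p ^ (k - i)))) =
    (if coprime C D then phase Q (n * p ^ k) C D else 0)"
proof -
  let ?h = "\<lambda>(i, b). int (p ^ i) * minv (C div int (p ^ i)) (Q * ((D - C div int (p ^ i) * int b) div int (p ^ (k - i))))"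
  have "(\<Sum>(i, b)\<in>hecke_fiber p k C D. phase Q n (C div int (p ^ i)) ((D - C div int (p ^ i) * int b) div int (p ^ (k - i)))) =
    (\<Sum>ib\<in>hecke_fiber p k C D. ek C (- (int n * ?h ib)))"
  proof (rule sum.cong[OF refl], clarify)
    fix i b assume "(i, b) \<in> hecke_fiber p k C D"
    then have d: "int (p ^ i) dvd C" by (simp add: hecke_fiber_def)
    define c where "c = C div int (p ^ i)"
    have c: "C = int (p ^ i) * c" using d by (simp add: c_def)
    have p0: "p \<noteq> 0" using prime_gt_0_nat[OF p] by simp
    have "phase Q n c e = ek C (- (int n * (int (p ^ i) * minv c (Q * e))))" for e
      unfolding phase_def ek_def using p0 by (subst c) (simp add: field_simps)
    then show "phase Q n (C div int (p ^ i)) ((D - C div int (p ^ i) * int b) div int (p ^ (k - i))) =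
      ek C (- (int n * (int (p ^ i) * minv (C div int (p ^ i)) (Q * ((D - C div int (p ^ i) * int b) div int (p ^ (k - i)))))))"
      by (simp add: c_def)
  qed
  also have "\<dots> = (\<Sum>A\<in>top_residues Q (int (p ^ k)) C D. ek C (- (int n * A)))"
    by (rule sum.reindex_bij_betw[OF hecke_fiber_bij[OF p C CQ]])
  also have "\<dots> = (if coprime C D then phase Q (n * p ^ k) C D else 0)"
    by (rule sum_top_residues[OF p n C CQ])
  finally show ?thesis .
qed

section \<open>Plicates for powers of a prime\<close>

text \<open>\<open>al_star Q R\<close> divides \<open>lcm Q R\<close>, hence every number that
  \<open>Q\<close> and \<open>R\<close> both divide; exactness is inherited because the cofactor
  only becomes smaller.\<close>

lemma al_closed_plicate_prime:
  assumes "al_closed N S" "prime p"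
  shows "al_closed (N div gcd p N) {Q \<in> S. Q dvd N div gcd p N}"
  unfolding al_closed_def
proof (intro conjI ballI impI)
  have N: "N > 0" and ex: "\<And>Q. Q \<in> S \<Longrightarrow> Q > 1 \<and> exact_divisor Q N"
    using assms by (auto simp: al_closed_def)
  define M where "M = N div gcd p N"
  have M: "N = M * gcd p N" by (simp add: M_def)
  have M0: "M > 0" using N M by (cases M) auto
  then show "N div gcd p N > 0" by (simp add: M_def)
  fix Q assume "Q \<in> {Q \<in> S. Q dvd N div gcd p N}"
  then have Q: "Q \<in> S" "Q dvd M" by (auto simp: M_def)
  show "Q > 1" using ex[OF Q(1)] by simp
  obtain m where m: "M = Q * m" using Q(2) by auto
  have Q0: "Q > 0" using ex[OF Q(1)] by simp
  have "N = Q * (m * gcd p N)" using M m by (simp add: mult_ac)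
  then have "N div Q = m * gcd p N" using Q0 by (metis nonzero_mult_div_cancel_left not_gr_zero)
  then have "coprime Q (m * gcd p N)" using ex[OF Q(1)] by (simp add: exact_divisor_def)
  then have "exact_divisor Q M" using m Q0 by (simp add: exact_divisor_def)
  then show "exact_divisor Q (N div gcd p N)" by (simp add: M_def)
  fix R assume "R \<in> {Q \<in> S. Q dvd N div gcd p N}" "Q \<noteq> R"
  then have R: "R \<in> S" "R dvd M" "Q \<noteq> R" by (auto simp: M_def)
  have "al_star Q R \<in> S" using assms(1) Q(1) R by (simp add: al_closed_def)
  have a: "al_star Q R dvd lcm Q R"
  proof -
    have "lcm Q R = Q * (R div gcd Q R)" by (simp add: lcm_nat_def div_mult_swap)
    moreover have "Q div gcd Q R dvd Q" by (metis dvd_div_mult_self dvd_triv_left gcd_dvd1)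
    ultimately show ?thesis unfolding al_star_def by (simp add: mult_dvd_mono)
  qed
  have "lcm Q R dvd M" using Q(2) R(2) by simp
  from dvd_trans[OF a this] \<open>al_star Q R \<in> S\<close> show "al_star Q R \<in> {Q \<in> S. Q dvd N div gcd p N}"
    by (simp add: M_def)
qed

lemma div_gcd_dvd_iff:
  fixes p M c :: nat
  assumes "M > 0"
  shows "M div gcd p M dvd c \<longleftrightarrow> M dvd p * c"
proof -
  define g where "g = gcd p M"
  have g: "g > 0" using assms by (simp add: g_def)
  obtain M' p' where *: "M = g * M'" "p = g * p'" "coprime p' M'"
    using gcd_coprime_exists[of p M] g by (metis g_def less_irrefl mult.commute)
  have "M dvd p * c \<longleftrightarrow> M' dvd p' * c" using g by (simp add: * mult.assoc)
  also have "\<dots> \<longleftrightarrow> M' dvd c" using *(3) by (simp add: coprime_dvd_mult_right_iff coprime_commute)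
  also have "M' = M div g" using g * by simp
  finally show ?thesis by (simp add: g_def)
qed

lemma plicate_prime_power: 
  assumes "prime p"
  shows "plicate (p ^ i) G = (plicate_prime p ^^ i) G"
proof -
  have "insort p (replicate j p) = p # replicate j p" for j
    by (cases j) auto
  then have 1: "sorted_list_of_multiset (replicate_mset i p) = replicate i p"
    by (induction i) auto
  have 2: "fold f (replicate i p) G = (f p ^^ i) G" for f :: "nat \<Rightarrow> al_symbol \<Rightarrow> al_symbol"
    by (induction i arbitrary: G) (auto simp: funpow_swap1)
  show ?thesis
    unfolding plicate_def using assms by (simp add: prime_factorization_prime_power 1 2)
qed

text \<open>The level \<open>M\<close> is characterised by its multiples, a form that iterates
  without a case distinction on the power of \<open>p\<close> in \<open>N\<close>.\<close>

lemma plicate_prime_power_props: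
  assumes "al_closed N S" "prime p"
  obtains M where "plicate (p ^ i) (N, S) = (M, {Q \<in> S. Q dvd M})" "al_closed M {Q \<in> S. Q dvd M}"
    "\<And>c. M dvd c \<longleftrightarrow> N dvd p ^ i * c"
proof -
  have "\<exists>M. (plicate_prime p ^^ i) (N, S) = (M, {Q \<in> S. Q dvd M}) \<and> al_closed M {Q \<in> S. Q dvd M} \<and>
    (\<forall>c. M dvd c \<longleftrightarrow> N dvd p ^ i * c)"
  proof (induction i)
    case 0
    have "{Q \<in> S. Q dvd N} = S" using assms by (auto simp: al_closed_def exact_divisor_def)
    then show ?case using assms by auto
  next
    case (Suc i)
    then obtain M where M: "(plicate_prime p ^^ i) (N, S) = (M, {Q \<in> S. Q dvd M})" "al_closed M {Q \<in> S. Q dvd M}"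
      "\<forall>c. M dvd c \<longleftrightarrow> N dvd p ^ i * c" by blast
    define M' where "M' = M div gcd p M"
    have "M > 0" using M(2) by (simp add: al_closed_def)
    have "M = M' * gcd p M" by (simp add: M'_def)
    then have "M' dvd M" by (metis dvd_triv_left)
    then have eq: "{Q \<in> {Q \<in> S. Q dvd M}. Q dvd M'} = {Q \<in> S. Q dvd M'}" by (auto intro: dvd_trans)
    have "(plicate_prime p ^^ Suc i) (N, S) = (M', {Q \<in> S. Q dvd M'})"
      using M(1) eq by (simp add: M'_def)
    moreover have "al_closed M' {Q \<in> S. Q dvd M'}"
      using al_closed_plicate_prime[OF M(2) assms(2)] eq by (simp add: M'_def)
    moreover have "M' dvd c \<longleftrightarrow> N dvd p ^ Suc i * c" for c
      unfolding M'_def div_gcd_dvd_iff[OF \<open>M > 0\<close>] using M(3) by (simp add: mult_ac)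
    ultimately show ?case by blast
  qed
  then show ?thesis using that unfolding plicate_prime_power[OF assms(2)] by blast
qed

text \<open>By \<open>hrow_eq\<close>, these are the rows of the coset of \<open>W\<^bsub>Q\<^esub>\<close> in the \<open>p\<^sup>i\<close>-plicate, and none if that coset is absent.\<close>

definition hrow :: "nat \<Rightarrow> nat \<Rightarrow> nat \<Rightarrow> nat \<Rightarrow> int set" where
  "hrow N p i Q = {c. int (p ^ i) * c \<in> crow N Q}"

text \<open>If \<open>Q\<close> divides \<open>M\<close> and \<open>i > 0\<close>, then exactness of
  \<open>Q\<close> in \<open>N\<close> excludes \<open>p dvd Q\<close>, so the two coprimality
  conditions agree. If \<open>Q\<close> does not divide \<open>M\<close>, a row would make
  \<open>Q\<close> coprime to \<open>p^i\<close>, and \<open>Q dvd p^i M\<close> would give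
  \<open>Q dvd M\<close> after all. Hence all plicates can be summed over the same set
  \<open>insert 1 S\<close>.\<close>

lemma hrow_eq:
  assumes cl: "al_closed N S" and p: "prime p" and Q: "Q \<in> insert 1 S"
    and M: "\<And>c. M dvd c \<longleftrightarrow> N dvd p ^ i * c" "M > 0"
  shows "hrow N p i Q = (if Q \<in> insert 1 {Q \<in> S. Q dvd M} then crow M Q else {})"
proof -
  have N: "N > 0" and ex: "exact_divisor Q N"
    using cl Q by (auto simp: al_closed_def)
  have Q0: "Q > 0" by (rule exact_divisor_pos[OF ex N])
  have QN: "Q dvd N" using ex by (simp add: exact_divisor_def)
  have pp: "p ^ i > 0" using p by (simp add: prime_gt_0_nat)
  have divs: "(N div Q) dvd p ^ i * c \<longleftrightarrow> M dvd Q * c" for c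
  proof -
    have "(N div Q) dvd p ^ i * c \<longleftrightarrow> Q * (N div Q) dvd Q * (p ^ i * c)" using Q0 by simp
    also have "\<dots> \<longleftrightarrow> N dvd p ^ i * (Q * c)" using QN by (simp add: mult_ac)
    also have "\<dots> \<longleftrightarrow> M dvd Q * c" by (rule M(1)[symmetric])
    finally show ?thesis .
  qed
  have cop: "coprime (p ^ i) Q" if QM: "Q dvd M"
  proof (cases "i = 0")
    case False
    have "\<not> p dvd Q"
    proof
      assume pQ: "p dvd Q"
      then obtain N1 where N1: "N = p * N1" using QN by (meson dvdE dvd_trans)
      have "N dvd p ^ i * N1" unfolding N1 using False by (intro mult_dvd_mono) (auto simp: dvd_power)
      then have "Q dvd N1" using M(1) QM dvd_trans by blast
      then obtain m where "N1 = Q * m" by auto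
      then have "N = Q * (p * m)" using N1 by (simp add: mult_ac)
      then have "N div Q = p * m" using Q0 by (metis nonzero_mult_div_cancel_left not_gr_zero)
      then have "coprime Q (p * m)" using ex by (simp add: exact_divisor_def)
      then have "coprime Q p" by simp
      then have "is_unit p" using pQ by (rule coprime_common_divisor) simp
      then show False using p by simp
    qed
    then have "coprime p Q" by (rule prime_imp_coprime[OF p])
    then show ?thesis by simp
  qed simp
  have imp: "Q dvd M" if "c > 0" "(N div Q) dvd p ^ i * c" "coprime (p ^ i * c) Q" for c
  proof -
    have "N dvd p ^ i * M" using M(1)[of M] by simp
    then have "Q dvd p ^ i * M" using QN dvd_trans by blast
    moreover have "coprime Q (p ^ i)" using that(3) by (simp add: coprime_commute)
    ultimately show ?thesis by (simp add: coprime_dvd_mult_right_iff)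
  qed
  have iff: "int c \<in> hrow N p i Q \<longleftrightarrow> c > 0 \<and> N div Q dvd p ^ i * c \<and> coprime (p ^ i * c) Q" for c
  proof -
    have "int c \<in> hrow N p i Q \<longleftrightarrow> int (p ^ i * c) > 0 \<and> int (N div Q) dvd int (p ^ i * c) \<and> coprime (int (p ^ i * c)) (int Q)"
      by (simp add: hrow_def crow_def)
    also have "\<dots> \<longleftrightarrow> p ^ i * c > 0 \<and> N div Q dvd p ^ i * c \<and> coprime (p ^ i * c) Q"
      by (simp only: int_dvd_int_iff coprime_int_iff of_nat_0_less_iff)
    finally show ?thesis using pp by simp
  qed
  have iff2: "int c \<in> crow M Q \<longleftrightarrow> c > 0 \<and> M div Q dvd c \<and> coprime c Q" for c
    by (simp add: crow_def)
  have pos: "c > 0" if "c \<in> hrow N p i Q" for c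
  proof -
    have "0 < int (p ^ i) * c" using that by (simp add: hrow_def crow_def)
    then show ?thesis using pp by (simp add: zero_less_mult_iff)
  qed
  show ?thesis
  proof (cases "Q dvd M")
    case True
    have mem: "Q \<in> insert 1 {Q \<in> S. Q dvd M}" using Q True by auto
    have "int c \<in> hrow N p i Q \<longleftrightarrow> int c \<in> crow M Q" for c
    proof -
      have "M dvd Q * c \<longleftrightarrow> M div Q dvd c"
      proof -
        obtain m where "M = Q * m" using True ..
        then show ?thesis using Q0 by simp
      qed
      then show ?thesis unfolding iff iff2 divs using cop[OF True] by auto
    qed
    then have "c \<in> hrow N p i Q \<longleftrightarrow> c \<in> crow M Q" for c
    proof (cases "c > 0")
      case True
      then have "c = int (nat c)" by simp
      then show ?thesis using \<open>\<And>c. (int c \<in> hrow N p i Q) = (int c \<in> crow M Q)\<close>[of "nat c"] by simp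
    next
      case False
      then show ?thesis using pos[of c] by (auto simp: crow_def)
    qed
    then have "hrow N p i Q = crow M Q" by blast
    then show ?thesis using mem by simp
  next
    case False
    then have "Q \<notin> insert 1 {Q \<in> S. Q dvd M}" by auto
    moreover have "hrow N p i Q = {}"
    proof (rule ccontr)
      assume "hrow N p i Q \<noteq> {}"
      then obtain c where c: "c \<in> hrow N p i Q" by blast
      then have "c = int (nat c)" using pos[OF c] by simp
      with c have "int (nat c) \<in> hrow N p i Q" by simp
      then show False using iff[of "nat c"] imp[of "nat c"] False by blast
    qed
    ultimately show ?thesis by (simp only: if_False)
  qed
qed

section \<open>The identity for the Niebur series\<close>

lemma niebur_seed_scale: "niebur_seed n s (of_nat m * w) = niebur_seed (n * m) s w"
  by (simp add: niebur_seed_def mult_ac)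

lemma niebur_seed_translate:
  "niebur_seed n s (of_real r + w) = unit_exp (- (of_nat n * of_real r)) * niebur_seed n s w"
proof -
  have "unit_exp (- of_nat n * of_real (Re (of_real r + w))) = unit_exp (- (of_nat n * of_real r) + - of_nat n * of_real (Re w))"
    by (simp add: algebra_simps)
  then show ?thesis unfolding niebur_seed_def unit_exp_add by simp
qed

text \<open>The points at which \<open>hecke_prime_power\<close> evaluates the plicates.\<close>

definition hpoint :: "nat \<Rightarrow> nat \<Rightarrow> nat \<Rightarrow> nat \<Rightarrow> complex \<Rightarrow> complex" where
  "hpoint p k i b \<tau> = (of_nat (p ^ i) * \<tau> + of_nat b) / of_nat (p ^ (k - i))"

lemma hpoint_Im: "prime p \<Longrightarrow> Im \<tau> > 0 \<Longrightarrow> Im (hpoint p k i b \<tau>) > 0"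
proof -
  assume p: "prime p" and "Im \<tau> > 0"
  have "hpoint p k i b \<tau> = of_real (real (p ^ i) / real (p ^ (k - i))) * \<tau> + of_real (real b / real (p ^ (k - i)))"
    by (simp add: hpoint_def add_divide_distrib)
  then have "Im (hpoint p k i b \<tau>) = real (p ^ i) / real (p ^ (k - i)) * Im \<tau>"
    by (simp only: plus_complex.sel Im_complex_of_real times_complex.sel Re_complex_of_real)
  then show ?thesis using p \<open>Im \<tau> > 0\<close> by (simp add: prime_gt_0_nat)
qed

text \<open>For \<open>i < k\<close> the sum over \<open>b\<close> is a complete character sum
  modulo \<open>p^(k - i)\<close> with \<open>p\<close> not dividing \<open>n\<close>, so it
  vanishes; only \<open>i = k\<close> remains. This settles the identity coset and, at
  \<open>s = 1\<close>, the singular parts.\<close>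

lemma seed_hecke_sum:
  assumes p: "prime p" and n: "\<not> p dvd n"
  shows "(\<Sum>i\<le>k. \<Sum>b<p ^ (k - i). niebur_seed n s (hpoint p k i b \<tau>)) = niebur_seed (n * p ^ k) s \<tau>"
proof -
  have zero: "(\<Sum>b<p ^ (k - i). niebur_seed n s (hpoint p k i b \<tau>)) = 0" if i: "i < k" for i
  proof -
    let ?P = "p ^ (k - i)"
    have P: "int ?P > 0" using p by (simp add: prime_gt_0_nat)
    let ?w = "of_nat (p ^ i) * \<tau> / of_nat ?P"
    have "niebur_seed n s (hpoint p k i b \<tau>) = ek (int ?P) (int b * (- int n)) * niebur_seed n s ?w" for b
    proof -
      have "hpoint p k i b \<tau> = of_real (real b / real ?P) + ?w"
        by (simp add: hpoint_def add_divide_distrib)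
      then have "niebur_seed n s (hpoint p k i b \<tau>) = unit_exp (- (of_nat n * of_real (real b / real ?P))) * niebur_seed n s ?w"
        by (simp only: niebur_seed_translate)
      moreover have "- (of_nat n * of_real (real b / real ?P)) = (of_int (int b * (- int n)) / of_int (int ?P) :: complex)"
        by (simp add: mult.commute)
      ultimately show ?thesis by (simp only: ek_def)
    qed
    then have "(\<Sum>b<?P. niebur_seed n s (hpoint p k i b \<tau>)) = (\<Sum>b<?P. ek (int ?P) (int b * (- int n))) * niebur_seed n s ?w"
      by (simp only: sum_distrib_right)
    also have "(\<Sum>b<?P. ek (int ?P) (int b * (- int n))) = (\<Sum>a\<in>{0..<int ?P}. ek (int ?P) (a * (- int n)))"
      by (rule sum_int_eq_sum_nat[symmetric])
    also have "\<dots> = 0"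
    proof -
      have "p dvd ?P" using i by (simp add: dvd_power)
      then have "\<not> int ?P dvd - int n" using n by (metis dvd_minus_iff dvd_trans int_dvd_int_iff)
      then show ?thesis by (simp only: sum_ek[OF P] if_False)
    qed
    finally show ?thesis by simp
  qed
  have "(\<Sum>i\<le>k. \<Sum>b<p ^ (k - i). niebur_seed n s (hpoint p k i b \<tau>)) =
    (\<Sum>i\<in>{k}. \<Sum>b<p ^ (k - i). niebur_seed n s (hpoint p k i b \<tau>))"
    by (rule sum.mono_neutral_right) (auto intro!: zero)
  also have "\<dots> = niebur_seed n s (of_nat (p ^ k) * \<tau>)" by (simp add: hpoint_def)
  also have "\<dots> = niebur_seed (n * p ^ k) s \<tau>" by (rule niebur_seed_scale)
  finally show ?thesis .
qed

lemma row_term_has_sum: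
  assumes "Im \<tau> > 0" "n > 0" "Q > 0" "Re s > 1" "\<And>c. c \<in> C \<Longrightarrow> c > 0 \<and> coprime c Q"
  shows "((\<lambda>(c, d). row_term Q n \<tau> s c d) has_sum (\<Sum>\<^sub>\<infinity>(c, d)\<in>Sigma C (\<lambda>c. {d. coprime c d}). row_term Q n \<tau> s c d))
    (Sigma C (\<lambda>c. {d. coprime c d}))"
proof -
  obtain F where "\<And>s. Re s > 1 \<Longrightarrow> ((\<lambda>(c, d). row_term Q n \<tau> s c d) has_sum F s) (Sigma C (\<lambda>c. {d. coprime c d}))"
    by (rule row_series_continuation[OF assms(1-3,5)]) (assumption, rule that)
  from has_sum_imp_summable[OF this[OF assms(4)]] show ?thesis by (rule has_sum_infsum)
qed

lemma hecke_fiber_finite: "finite (hecke_fiber p k C D)"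
  by (rule finite_subset[of _ "SIGMA i:{..k}. {..<p ^ (k - i)}"]) (auto simp: hecke_fiber_def)

text \<open>Absolute convergence for \<open>Re s > 1\<close> allows grouping all
  \<open>(i, b, c, d)\<close> by \<open>(C, D)\<close>. The seed is constant on a group, and
  \<open>hecke_fiber_sum\<close> adds up the phases.\<close>

lemma hecke_rows:
  assumes \<tau>: "Im \<tau> > 0" and n: "n > 0" and Q: "Q > 0" and s: "Re s > 1" and p: "prime p" and pn: "\<not> p dvd n"
  shows "(\<Sum>i\<le>k. \<Sum>b<p ^ (k - i). \<Sum>\<^sub>\<infinity>(c, d)\<in>Sigma (hrow N p i Q) (\<lambda>c. {d. coprime c d}). row_term (int Q) n (hpoint p k i b \<tau>) s c d)
    = row_series N Q (n * p ^ k) \<tau> s"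
proof -
  define W where "W i b = (\<Sum>\<^sub>\<infinity>(c, d)\<in>Sigma (hrow N p i Q) (\<lambda>c. {d. coprime c d}). row_term (int Q) n (hpoint p k i b \<tau>) s c d)" for i b
  define J where "J = (SIGMA i:{..k}. {..<p ^ (k - i)})"
  have finJ: "finite J" by (simp add: J_def)
  have pp: "int (p ^ j) > 0" for j using p by (simp add: prime_gt_0_nat)
  define B where "B C D = niebur_seed (n * p ^ k) s (row_point (int Q) \<tau> C D)" for C D
  define f where "f = (\<lambda>((i, b), (c, d)). phase (int Q) n c d * B (int (p ^ i) * c) (c * int b + d * int (p ^ (k - i))))"
  define rows where "rows = (\<lambda>(i, b :: nat). Sigma (hrow N p i Q) (\<lambda>c. {d. coprime c d}))"
  have hr: "c > 0 \<and> coprime c (int Q)" if "c \<in> hrow N p i Q" for c i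
  proof -
    have "0 < int (p ^ i) * c" "coprime (int (p ^ i) * c) (int Q)" using that by (simp_all add: hrow_def crow_def)
    then show ?thesis using pp[of i] by (simp only: zero_less_mult_iff coprime_mult_left_iff) linarith
  qed
  \<comment> \<open>The row point of \<open>hpoint\<close> is \<open>p^k\<close> times the row point
    of \<open>\<tau>\<close> for \<open>(C, D)\<close>; the scaling turns \<open>n\<close> into
    \<open>n p^k\<close>.\<close>
  have point: "B (int (p ^ i) * c) (c * int b + d * int (p ^ (k - i))) = niebur_seed n s (row_point (int Q) (hpoint p k i b \<tau>) c d)"
    if i: "i \<le> k" and c: "c > 0" for i b c d
  proof -
    let ?P = "of_nat (p ^ (k - i)) :: complex" and ?R = "of_nat (p ^ i) :: complex"
    have P: "?P \<noteq> 0" "?R \<noteq> 0" using p by (auto simp: prime_gt_0_nat)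
    have pk: "(of_nat (p ^ k) :: complex) = ?R * ?P" using i by (simp flip: of_nat_mult power_add)
    have e: "of_int c * hpoint p k i b \<tau> + of_int d = (?R * of_int c * \<tau> + (of_int c * of_nat b + of_int d * ?P)) / ?P"
      using P prime_gt_0_nat[OF p] by (simp add: hpoint_def field_simps)
    have "row_point (int Q) (hpoint p k i b \<tau>) c d =
      of_nat (p ^ k) * row_point (int Q) \<tau> (int (p ^ i) * c) (c * int b + d * int (p ^ (k - i)))"
      unfolding row_point_def e pk using prime_gt_0_nat[OF p] by (simp add: mult_ac)
    then show ?thesis unfolding B_def by (simp only: niebur_seed_scale)
  qed
  have W: "((\<lambda>y. f (ib, y)) has_sum (case ib of (i, b) \<Rightarrow> W i b)) (rows ib)" if ib: "ib \<in> J" for ib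
  proof -
    obtain i b where ib': "ib = (i, b)" "i \<le> k" using ib by (auto simp: J_def)
    have "((\<lambda>(c, d). row_term (int Q) n (hpoint p k i b \<tau>) s c d) has_sum W i b) (Sigma (hrow N p i Q) (\<lambda>c. {d. coprime c d}))"
      unfolding W_def by (rule row_term_has_sum[OF hpoint_Im[OF p \<tau>] n _ s hr]) (use Q in simp)
    also have "?this \<longleftrightarrow> ((\<lambda>y. f (ib, y)) has_sum W i b) (Sigma (hrow N p i Q) (\<lambda>c. {d. coprime c d}))"
    proof (rule has_sum_cong)
      fix cd assume "cd \<in> Sigma (hrow N p i Q) (\<lambda>c. {d. coprime c d})"
      then obtain c d where cd: "cd = (c, d)" "c > 0" using hr by auto
      show "(case cd of (c, d) \<Rightarrow> row_term (int Q) n (hpoint p k i b \<tau>) s c d) = f (ib, cd)"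
        unfolding cd ib'(1) f_def prod.case row_term_def point[OF ib'(2) cd(2)] ..
    qed
    finally show ?thesis by (simp add: ib' rows_def)
  qed
  have tot: "(f has_sum (\<Sum>ib\<in>J. case ib of (i, b) \<Rightarrow> W i b)) (Sigma J rows)"
    by (rule has_sum_Sigma_finite[OF finJ W])
  have JW: "(\<Sum>ib\<in>J. case ib of (i, b) \<Rightarrow> W i b) = (\<Sum>i\<le>k. \<Sum>b<p ^ (k - i). W i b)"
    unfolding J_def by (rule sum.Sigma[symmetric]) auto
  define X where "X = (SIGMA CD:crow N Q \<times> UNIV. case CD of (C, D) \<Rightarrow> hecke_fiber p k C D)"
  define g where "g = (\<lambda>((C, D), (i, b)). phase (int Q) n (C div int (p ^ i)) ((D - C div int (p ^ i) * int b) div int (p ^ (k - i))) * B C D)"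
  \<comment> \<open>\<open>fw\<close> and \<open>bw\<close> are inverse changes of variables between
    the grouping by \<open>(C, D)\<close> and the grouping by \<open>(i, b)\<close>.\<close>
  define fw where "fw = (\<lambda>((C :: int, D :: int), (i :: nat, b :: nat)). ((i, b), (C div int (p ^ i), (D - C div int (p ^ i) * int b) div int (p ^ (k - i)))))"
  define bw where "bw = (\<lambda>((i :: nat, b :: nat), (c :: int, d :: int)). ((int (p ^ i) * c, c * int b + d * int (p ^ (k - i))), (i, b)))"
  have "(g has_sum (\<Sum>ib\<in>J. case ib of (i, b) \<Rightarrow> W i b)) X \<longleftrightarrow> (f has_sum (\<Sum>ib\<in>J. case ib of (i, b) \<Rightarrow> W i b)) (Sigma J rows)"
  proof (rule has_sum_reindex_bij_witness[of X bw fw])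
    fix a assume "a \<in> X"
    then obtain C D i b where a: "a = ((C, D), (i, b))" "C \<in> crow N Q" "(i, b) \<in> hecke_fiber p k C D"
      by (auto simp: X_def)
    define c where "c = C div int (p ^ i)"
    define d where "d = (D - c * int b) div int (p ^ (k - i))"
    have ib: "i \<le> k" "b < p ^ (k - i)" "int (p ^ i) dvd C" "int (p ^ (k - i)) dvd D - c * int b" "coprime c d"
      using a(3) by (auto simp: hecke_fiber_def c_def d_def)
    have C: "int (p ^ i) * c = C" using ib(3) by (simp add: c_def)
    have D: "c * int b + d * int (p ^ (k - i)) = D" using ib(4) by (simp add: d_def)
    have fwa: "fw a = ((i, b), (c, d))" by (simp add: fw_def a c_def d_def)
    show "bw (fw a) = a" unfolding fwa using C D by (simp add: bw_def a)
    show "fw a \<in> Sigma J rows" unfolding fwa using ib a(2) C by (auto simp: J_def rows_def hrow_def)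
    show "f (fw a) = g a" 
      unfolding fwa unfolding a f_def g_def prod.case C D by (simp only: c_def d_def)
  next
    fix a assume "a \<in> Sigma J rows"
    then obtain i b c d where a: "a = ((i, b), (c, d))" "i \<le> k" "b < p ^ (k - i)" "c \<in> hrow N p i Q" "coprime c d"
      by (auto simp: J_def rows_def)
    define C where "C = int (p ^ i) * c"
    define D where "D = c * int b + d * int (p ^ (k - i))"
    have C: "C div int (p ^ i) = c" unfolding C_def using pp[of i] by (metis less_irrefl nonzero_mult_div_cancel_left)
    have D: "(D - c * int b) div int (p ^ (k - i)) = d"
      unfolding D_def using pp[of "k - i"] by (metis add_diff_cancel_left' less_irrefl nonzero_mult_div_cancel_right)
    have bwa: "bw a = ((C, D), (i, b))" by (simp add: bw_def a C_def D_def)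
    show "fw (bw a) = a" unfolding bwa by (simp only: fw_def prod.case C D a(1))
    have "int (p ^ (k - i)) dvd D - c * int b" by (simp add: D_def)
    moreover have "int (p ^ i) dvd C" by (simp add: C_def)
    ultimately have "(i, b) \<in> hecke_fiber p k C D"
      unfolding hecke_fiber_def using a C D by blast
    moreover have "C \<in> crow N Q" using a(4) by (simp add: hrow_def C_def)
    ultimately show "bw a \<in> X" unfolding bwa X_def by simp
  qed simp
  with tot have gX: "(g has_sum (\<Sum>ib\<in>J. case ib of (i, b) \<Rightarrow> W i b)) X" by simp
  have Qc: "C > 0 \<and> coprime C (int Q)" if "C \<in> crow N Q" for C using that by (simp add: crow_def)
  have "((\<lambda>(C, D). (if coprime C D then phase (int Q) (n * p ^ k) C D else 0) * B C D) has_sum (\<Sum>ib\<in>J. case ib of (i, b) \<Rightarrow> W i b)) (crow N Q \<times> UNIV)"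
  proof (rule has_sum_SigmaD[OF gX[unfolded X_def]])
    fix CD :: "int \<times> int" assume "CD \<in> crow N Q \<times> UNIV"
    then obtain C D where CD: "CD = (C, D)" "C \<in> crow N Q" by auto
    have "((\<lambda>y. g (CD, y)) has_sum (\<Sum>(i, b)\<in>hecke_fiber p k C D. g (CD, (i, b)))) (hecke_fiber p k C D)"
      by (rule has_sum_finiteI[OF hecke_fiber_finite]) (auto intro: sum.cong)
    also have "(\<Sum>(i, b)\<in>hecke_fiber p k C D. g (CD, (i, b))) =
      (\<Sum>(i, b)\<in>hecke_fiber p k C D. phase (int Q) n (C div int (p ^ i)) ((D - C div int (p ^ i) * int b) div int (p ^ (k - i)))) * B C D"
      unfolding sum_distrib_right by (rule sum.cong) (auto simp: g_def CD)
    also have "\<dots> = (if coprime C D then phase (int Q) (n * p ^ k) C D else 0) * B C D"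
      using hecke_fiber_sum[OF p pn, where C = C and Q = "int Q" and k = k and D = D] Qc[OF CD(2)] Q by simp
    finally show "((\<lambda>y. g (CD, y)) has_sum (case CD of (C, D) \<Rightarrow> (if coprime C D then phase (int Q) (n * p ^ k) C D else 0) * B C D))
      (case CD of (C, D) \<Rightarrow> hecke_fiber p k C D)" by (simp add: CD)
  qed
  also have "?this \<longleftrightarrow> ((\<lambda>(C, D). row_term (int Q) (n * p ^ k) \<tau> s C D) has_sum (\<Sum>ib\<in>J. case ib of (i, b) \<Rightarrow> W i b)) (Sigma (crow N Q) (\<lambda>C. {D. coprime C D}))"
    by (rule has_sum_cong_neutral) (auto simp: row_term_def B_def split: if_splits)
  finally have "((\<lambda>(C, D). row_term (int Q) (n * p ^ k) \<tau> s C D) has_sum (\<Sum>ib\<in>J. case ib of (i, b) \<Rightarrow> W i b)) (Sigma (crow N Q) (\<lambda>C. {D. coprime C D}))" .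
  then have "(\<Sum>ib\<in>J. case ib of (i, b) \<Rightarrow> W i b) = row_series N Q (n * p ^ k) \<tau> s"
    unfolding row_series_def by (rule infsumI[symmetric])
  with JW show ?thesis by (simp only: W_def)
qed

lemma niebur_series_plicate:
  assumes cl: "al_closed N S" and p: "prime p" and n: "n > 0" and \<tau>: "Im \<tau> > 0" and s: "Re s > 1"
  shows "niebur_series (plicate (p ^ i) (N, S)) n \<tau> s = 2 * of_real pi * (niebur_seed n s \<tau> +
    (\<Sum>Q\<in>insert 1 S. \<Sum>\<^sub>\<infinity>(c, d)\<in>Sigma (hrow N p i Q) (\<lambda>c. {d. coprime c d}). row_term (int Q) n \<tau> s c d))"
proof -
  obtain M where M: "plicate (p ^ i) (N, S) = (M, {Q \<in> S. Q dvd M})" "al_closed M {Q \<in> S. Q dvd M}"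
    "\<And>c. M dvd c \<longleftrightarrow> N dvd p ^ i * c"
    by (rule plicate_prime_power_props[OF cl p, of i]) (rule that)
  have M0: "M > 0" using M(2) by (simp add: al_closed_def)
  note h = hrow_eq[OF cl p _ M(3) M0]
  have "(\<Sum>Q\<in>insert 1 S. \<Sum>\<^sub>\<infinity>(c, d)\<in>Sigma (hrow N p i Q) (\<lambda>c. {d. coprime c d}). row_term (int Q) n \<tau> s c d) =
    (\<Sum>Q\<in>insert 1 {Q \<in> S. Q dvd M}. row_series M Q n \<tau> s)"
  proof (rule sum.mono_neutral_cong_right)
    show "finite (insert 1 S)" using al_closed_finite[OF cl] by simp
    show "insert 1 {Q \<in> S. Q dvd M} \<subseteq> insert 1 S" by auto
    show "\<forall>Q\<in>insert 1 S - insert 1 {Q \<in> S. Q dvd M}. (\<Sum>\<^sub>\<infinity>(c, d)\<in>Sigma (hrow N p i Q) (\<lambda>c. {d. coprime c d}). row_term (int Q) n \<tau> s c d) = 0"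
    proof
      fix Q assume Q: "Q \<in> insert 1 S - insert 1 {Q \<in> S. Q dvd M}"
      then have "Q \<in> insert 1 S" "Q \<notin> insert 1 {Q \<in> S. Q dvd M}" by blast+
      then have "hrow N p i Q = {}" by (simp only: h if_False)
      then show "(\<Sum>\<^sub>\<infinity>(c, d)\<in>Sigma (hrow N p i Q) (\<lambda>c. {d. coprime c d}). row_term (int Q) n \<tau> s c d) = 0" by simp
    qed
    fix Q assume Q: "Q \<in> insert 1 {Q \<in> S. Q dvd M}"
    then have "Q \<in> insert 1 S" by blast
    from h[OF this] Q have "hrow N p i Q = crow M Q" by (simp only: if_True)
    then show "(\<Sum>\<^sub>\<infinity>(c, d)\<in>Sigma (hrow N p i Q) (\<lambda>c. {d. coprime c d}). row_term (int Q) n \<tau> s c d) = row_series M Q n \<tau> s"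
      by (simp add: row_series_def)
  qed
  then show ?thesis unfolding M(1) niebur_series_eq[OF M(2) n \<tau> s] by simp
qed

text \<open>The identity coset is handled by \<open>seed_hecke_sum\<close>, every other coset by
  \<open>hecke_rows\<close>, separately for each \<open>Q\<close>.\<close>

lemma niebur_series_hecke:
  assumes cl: "al_closed N S" and p: "prime p" and pn: "\<not> p dvd n" and n: "n > 0" and \<tau>: "Im \<tau> > 0" and s: "Re s > 1"
  shows "niebur_series (N, S) (n * p ^ k) \<tau> s =
    (\<Sum>i\<le>k. \<Sum>b<p ^ (k - i). niebur_series (plicate (p ^ i) (N, S)) n (hpoint p k i b \<tau>) s)"
proof -
  have pos: "Q > 0" if "Q \<in> insert 1 S" for Q
    using that cl by (auto simp: al_closed_def)
  let ?r = "\<lambda>Q i b. \<Sum>\<^sub>\<infinity>(c, d)\<in>Sigma (hrow N p i Q) (\<lambda>c. {d. coprime c d}). row_term (int Q) n (hpoint p k i b \<tau>) s c d"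
  have "(\<Sum>i\<le>k. \<Sum>b<p ^ (k - i). \<Sum>Q\<in>insert 1 S. ?r Q i b) = (\<Sum>i\<le>k. \<Sum>Q\<in>insert 1 S. \<Sum>b<p ^ (k - i). ?r Q i b)"
    by (rule sum.cong[OF refl]) (rule sum.swap)
  also have "\<dots> = (\<Sum>Q\<in>insert 1 S. \<Sum>i\<le>k. \<Sum>b<p ^ (k - i). ?r Q i b)" by (rule sum.swap)
  also have "\<dots> = (\<Sum>Q\<in>insert 1 S. row_series N Q (n * p ^ k) \<tau> s)"
    by (rule sum.cong[OF refl], rule hecke_rows[OF \<tau> n pos s p pn])
  finally have rows: "(\<Sum>i\<le>k. \<Sum>b<p ^ (k - i). \<Sum>Q\<in>insert 1 S. ?r Q i b) = (\<Sum>Q\<in>insert 1 S. row_series N Q (n * p ^ k) \<tau> s)" .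
  have np: "n * p ^ k > 0" using n p by (simp add: prime_gt_0_nat)
  show ?thesis
    unfolding niebur_series_plicate[OF cl p n hpoint_Im[OF p \<tau>] s] niebur_series_eq[OF cl np \<tau> s]
      sum_distrib_left[symmetric] sum.distrib rows seed_hecke_sum[OF p pn] ..
qed

text \<open>The finite sum of the continuations for the plicates continues the left-hand series, so
  the values at \<open>1\<close> agree by \<open>niebur_j_eqI\<close>.\<close>

lemma niebur_j_hecke:
  assumes cl: "al_closed N S" and p: "prime p" and pn: "\<not> p dvd n" and n: "n > 0" and \<tau>: "Im \<tau> > 0"
  shows "niebur_j (N, S) (n * p ^ k) \<tau> =
    (\<Sum>i\<le>k. \<Sum>b<p ^ (k - i). niebur_j (plicate (p ^ i) (N, S)) n (hpoint p k i b \<tau>))"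
proof -
  have "\<exists>F. F holomorphic_on {s. Re s > 9 / 10} \<and>
      (\<forall>s. Re s > 1 \<longrightarrow> F s = niebur_series (plicate (p ^ i) (N, S)) n (hpoint p k i b \<tau>) s) \<and>
      niebur_j (plicate (p ^ i) (N, S)) n (hpoint p k i b \<tau>) = F 1" for i b
  proof -
    obtain M where M: "plicate (p ^ i) (N, S) = (M, {Q \<in> S. Q dvd M})" "al_closed M {Q \<in> S. Q dvd M}"
      by (rule plicate_prime_power_props[OF cl p, of i]) (rule that)
    obtain F where "F holomorphic_on {s. Re s > 9 / 10}"
      "\<And>s. Re s > 1 \<Longrightarrow> F s = niebur_series (M, {Q \<in> S. Q dvd M}) n (hpoint p k i b \<tau>) s"
      "niebur_j (M, {Q \<in> S. Q dvd M}) n (hpoint p k i b \<tau>) = F 1"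
      by (rule niebur_j_main[OF M(2) n hpoint_Im[OF p \<tau>, of k i b]]) (rule that)
    then show ?thesis unfolding M(1) by blast
  qed
  then obtain F where F: "\<And>i b. F i b holomorphic_on {s. Re s > 9 / 10}"
    "\<And>i b s. Re s > 1 \<Longrightarrow> F i b s = niebur_series (plicate (p ^ i) (N, S)) n (hpoint p k i b \<tau>) s"
    "\<And>i b. niebur_j (plicate (p ^ i) (N, S)) n (hpoint p k i b \<tau>) = F i b 1"
    by metis
  have "niebur_j (N, S) (n * p ^ k) \<tau> = (\<Sum>i\<le>k. \<Sum>b<p ^ (k - i). F i b 1)"
  proof (rule niebur_j_eqI[where \<sigma> = "9 / 10"])
    show "(\<lambda>s. \<Sum>i\<le>k. \<Sum>b<p ^ (k - i). F i b s) holomorphic_on {s. Re s > 9 / 10}"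
      by (intro holomorphic_on_sum F(1))
    fix s :: complex assume s: "Re s > 1"
    show "(\<Sum>i\<le>k. \<Sum>b<p ^ (k - i). F i b s) = niebur_series (N, S) (n * p ^ k) \<tau> s"
      unfolding niebur_series_hecke[OF cl p pn n \<tau> s] F(2)[OF s] ..
  qed simp
  then show ?thesis unfolding F(3) .
qed

lemma niebur_J_hecke:
  assumes cl: "al_closed N S" and p: "prime p" and pn: "\<not> p dvd n" and n: "n > 0" and \<tau>: "Im \<tau> > 0"
  shows "niebur_J (N, S) (n * p ^ k) \<tau> = hecke_prime_power p k (N, S) n \<tau>"
proof -
  define G where "G i = plicate (p ^ i) (N, S)" for i
  \<comment> \<open>All constant terms collected; by \<open>niebur_j_hecke\<close> the two sides for
    \<open>J\<close> differ by exactly \<open>K\<close> at every point.\<close>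
  define K where "K = (\<Sum>i\<le>k. \<Sum>b<p ^ (k - i). niebur_coeff (G i) n 0) - niebur_coeff (N, S) (n * p ^ k) 0"
  have np: "n * p ^ k > 0" using n p by (simp add: prime_gt_0_nat)
  have K: "niebur_J (N, S) (n * p ^ k) w - (\<Sum>i\<le>k. \<Sum>b<p ^ (k - i). niebur_J (G i) n (hpoint p k i b w)) = K"
    if w: "Im w > 0" for w
    using niebur_j_hecke[OF cl p pn n w, of k] n prime_gt_0_nat[OF p]
    by (simp add: niebur_J_def G_def K_def sum_subtractf)
  \<comment> \<open>The singular parts are written as seeds at \<open>s = 1\<close>, so that
    \<open>seed_hecke_sum\<close> cancels them in the difference below.\<close>
  let ?m = "\<lambda>n w. 2 * of_real pi * niebur_seed n 1 w"
  have L: "((\<lambda>y. niebur_J (N, S) (n * p ^ k) (Complex 0 y) - ?m (n * p ^ k) (Complex 0 y)) \<longlongrightarrow> 0) at_top"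
  proof (rule Lim_transform_eventually[OF niebur_J_limit[OF cl np]])
    show "\<forall>\<^sub>F y in at_top. niebur_J (N, S) (n * p ^ k) (Complex 0 y) -
      (unit_exp (Complex 0 y) powi (- int (n * p ^ k)) - cnj (unit_exp (Complex 0 y)) ^ (n * p ^ k)) =
      niebur_J (N, S) (n * p ^ k) (Complex 0 y) - ?m (n * p ^ k) (Complex 0 y)"
      using eventually_gt_at_top[of 0] by eventually_elim (simp only: niebur_seed_one_powi[OF np] complex.sel)
  qed
  have R: "((\<lambda>y. niebur_J (G i) n (hpoint p k i b (Complex 0 y)) - ?m n (hpoint p k i b (Complex 0 y))) \<longlongrightarrow> 0) at_top" for i b
  proof -
    obtain M where M: "G i = (M, {Q \<in> S. Q dvd M})" "al_closed M {Q \<in> S. Q dvd M}"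
      by (rule plicate_prime_power_props[OF cl p, of i]) (rule that[unfolded G_def])
    define x where "x = real b / real (p ^ (k - i))"
    define r where "r = real (p ^ i) / real (p ^ (k - i))"
    have r: "r > 0" using p by (simp add: r_def prime_gt_0_nat)
    \<comment> \<open>As \<open>y\<close> varies, each Hecke point moves up a vertical line, along
      which \<open>niebur_J_limit\<close> applies.\<close>
    have h: "hpoint p k i b (Complex 0 y) = Complex x (r * y)" for y
      by (simp add: hpoint_def x_def r_def complex_eq_iff Re_divide_of_nat Im_divide_of_nat flip: of_nat_power)
    have "((\<lambda>y. niebur_J (G i) n (Complex x y) - ?m n (Complex x y)) \<longlongrightarrow> 0) at_top"
    proof (rule Lim_transform_eventually[OF niebur_J_limit[OF M(2) n, of x, folded M(1)]])
      show "\<forall>\<^sub>F y in at_top. niebur_J (G i) n (Complex x y) -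
        (unit_exp (Complex x y) powi (- int n) - cnj (unit_exp (Complex x y)) ^ n) =
        niebur_J (G i) n (Complex x y) - ?m n (Complex x y)"
        using eventually_gt_at_top[of 0] by eventually_elim (simp only: niebur_seed_one_powi[OF n] complex.sel)
    qed
    moreover have "filterlim (\<lambda>y. r * y) at_top at_top"
      by (rule filterlim_tendsto_pos_mult_at_top[OF tendsto_const r filterlim_ident])
    ultimately show ?thesis unfolding h by (rule filterlim_compose)
  qed
  have "((\<lambda>y. (niebur_J (N, S) (n * p ^ k) (Complex 0 y) - ?m (n * p ^ k) (Complex 0 y)) -
    (\<Sum>i\<le>k. \<Sum>b<p ^ (k - i). niebur_J (G i) n (hpoint p k i b (Complex 0 y)) - ?m n (hpoint p k i b (Complex 0 y)))) \<longlongrightarrow>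
    0 - (\<Sum>i\<le>k. \<Sum>b<p ^ (k - i). 0)) at_top"
    by (intro tendsto_diff tendsto_sum L R)
  moreover have "\<forall>\<^sub>F y in at_top. (niebur_J (N, S) (n * p ^ k) (Complex 0 y) - ?m (n * p ^ k) (Complex 0 y)) -
    (\<Sum>i\<le>k. \<Sum>b<p ^ (k - i). niebur_J (G i) n (hpoint p k i b (Complex 0 y)) - ?m n (hpoint p k i b (Complex 0 y))) = K"
    using eventually_gt_at_top[of 0]
  proof eventually_elim
    case (elim y)
    show ?case unfolding sum_subtractf sum_distrib_left[symmetric] seed_hecke_sum[OF p pn]
      using K[of "Complex 0 y"] elim by simp
  qed
  ultimately have "((\<lambda>y :: real. K) \<longlongrightarrow> 0 - (\<Sum>i\<le>k. \<Sum>b<p ^ (k - i). 0)) at_top"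
    by (rule Lim_transform_eventually)
  then have "K = 0" by (simp add: tendsto_const_iff)
  with K[OF \<tau>] show ?thesis
    by (simp add: hecke_prime_power_def Ustar_def hpoint_def G_def)
qed

section \<open>Composing over the primes\<close>

text \<open>The induction is over lists for arbitrary \<open>m\<close>, because each operator but
  the last replaces \<open>m\<close> by \<open>p^k m\<close>; distinctness of the primes keeps the
  remaining ones prime to the new \<open>m\<close>.\<close>

lemma hecke_comp_eq:
  assumes "al_closed N S" "m > 0" "Im \<tau> > 0" "distinct (map fst ps)"
    "\<And>p k. (p, k) \<in> set ps \<Longrightarrow> prime p \<and> \<not> p dvd m"
  shows "hecke_comp ps (N, S) m \<tau> = niebur_J (N, S) (m * (\<Prod>(p, k)\<leftarrow>ps. p ^ k)) \<tau>"
  using assms(2,4,5)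
proof (induction ps arbitrary: m rule: induct_list012)
  case 1
  then show ?case by simp
next
  case (2 pk)
  then show ?case using niebur_J_hecke[OF assms(1) _ _ _ assms(3)] by (cases pk) auto
next
  case (3 pk x xs)
  obtain p k where pk: "pk = (p, k)" by force
  have p: "prime p" "\<not> p dvd m" using "3.prems" by (auto simp: pk)
  \<comment> \<open>As \<open>p\<close> does not divide \<open>m\<close>, the combination has the
    single term \<open>j = 0\<close>, which involves no plicate.\<close>
  have "{j. p ^ j dvd gcd m (p ^ k)} = {0}"
  proof -
    have "coprime p m" using p by (intro prime_imp_coprime)
    then have "coprime m (p ^ k)" by (simp add: coprime_commute)
    then have "gcd m (p ^ k) = 1" by simp
    then show ?thesis using p prime_gt_1_nat[of p] by auto
  qed
  then have "hecke_comp (pk # x # xs) (N, S) m \<tau> = hecke_comp (x # xs) (plicate 1 (N, S)) (p ^ k * m) \<tau>"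
    by (simp add: pk)
  also have "plicate 1 (N, S) = (N, S)" by (simp add: plicate_def)
  also have "hecke_comp (x # xs) (N, S) (p ^ k * m) \<tau> = niebur_J (N, S) (p ^ k * m * (\<Prod>(p, k)\<leftarrow>x # xs. p ^ k)) \<tau>"
  proof (rule "3.IH"(2))
    show "0 < p ^ k * m" using "3.prems" p by (simp add: prime_gt_0_nat)
    show "distinct (map fst (x # xs))" using "3.prems" by simp
    fix q l assume ql: "(q, l) \<in> set (x # xs)"
    then have q: "prime q" "\<not> q dvd m" using "3.prems"(3)[of q l] by auto
    have "q \<in> fst ` set (x # xs)" using ql by force
    then have "q \<noteq> p" using "3.prems"(2) by (auto simp: pk)
    then have "\<not> q dvd p ^ k" using p q by (metis prime_dvd_power primes_dvd_imp_eq)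
    then show "prime q \<and> \<not> q dvd p ^ k * m" using q by (simp add: prime_dvd_mult_iff)
  qed
  finally show ?case by (simp add: pk mult_ac)
qed

theorem corollary1p4:
  fixes N n :: nat and S :: "nat set" and \<tau> :: complex
  assumes "al_admissible (N, S)"
    and "n > 0"
    and "Im \<tau> > 0"
  shows "niebur_J (N, S) n \<tau> = hecke_T n (N, S) 1 \<tau>"
proof -
  let ?ps = "sorted_list_of_set (prime_factors n)"
  have "hecke_T n (N, S) 1 \<tau> = niebur_J (N, S) (1 * (\<Prod>(p, k)\<leftarrow>map (\<lambda>p. (p, multiplicity p n)) ?ps. p ^ k)) \<tau>"
    unfolding hecke_T_def
    by (rule hecke_comp_eq[OF al_closed_if_admissible[OF assms(1)] _ assms(3)])
      (auto simp: comp_def in_prime_factors_iff)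
  also have "(\<Prod>(p, k)\<leftarrow>map (\<lambda>p. (p, multiplicity p n)) ?ps. p ^ k) = (\<Prod>p\<in>prime_factors n. p ^ multiplicity p n)"
    by (simp add: comp_def prod.distinct_set_conv_list[symmetric])
  also have "\<dots> = n" using assms(2) prod_prime_factors[of n] by simp
  finally show ?thesis by simp
qed

end
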